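(* Let $1<p\le 2$ and let $g$ be an analytic function in the unit disc $\mathbb{D}$. Then the generalized Hilbert operator $\mathcal{H}_g$ is bounded from $H^p$ to $H^p$ if and only if $g\in\Lambda\left(p,\frac1p\right)$.
   Context: $\mathbb{D}$ is the open unit disc and $\mathcal{H}ol(\mathbb{D})$ the space of analytic functions in $\mathbb{D}$. For $f\in\mathcal{H}ol(\mathbb{D})$, $0<r<1$, $0<p<\infty$, $M_p(r,f)=\left(\frac1{2\pi}\int_0^{2\pi}|f(re^{it})|^p\,dt\right)^{1/p}$, and $H^p$ is the Hardy space of $f\in\mathcal{H}ol(\mathbb{D})$ with $\|f\|_{H^p}=\sup_{0<r<1}M_p(r,f)<\infty$. Given $g\in\mathcal{H}ol(\mathbb{D})$, the generalized Hilbert operator is $\mathcal{H}_g(f)(z)=\int_0^1 f(t)g'(tz)\,dt$, $z\in\mathbb{D}$, defined for $f\in \mathcal{H}ol(\mathbb{D})$ with $\int_0^1|f(t)|\,dt<\infty$ (in particular for every $f\in H^1$); then $\mathcal{H}_g(f)\in\mathcal{H}ol(\mathbb{D})$. Mean Lipschitz spaces: for $1\le p<\infty$ and $0<\alpha\le1$, $\Lambda(p,\alpha)$ is the set of $g\in H^p$ whose boundary function satisfies $\omega_p(g,t)=O(t^\alpha)$ as $t\to0$, where $\omega_p(g,t)=\sup_{0<h\le t}\left(\int_0^{2\pi}|g(e^{i(\theta+h)})-g(e^{i\theta})|^p\frac{d\theta}{2\pi}\right)^{1/p}$. Equivalently (Hardy–Littlewood), $\Lambda(p,\alpha)=\{g\in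 H^p: M_p(r,g')=O((1-r)^{\alpha-1}),\ r\to1^-\}$. *)

theory Defs
  imports "HOL-Complex_Analysis.Complex_Analysis"
begin

text \<open>
  Functions on the open unit disc are total functions of type \<open>complex \<Rightarrow> complex\<close>; every notion
  below depends only on their values on \<open>ball 0 1\<close>.
\<close>

definition integral_mean :: "real \<Rightarrow> real \<Rightarrow> (complex \<Rightarrow> complex) \<Rightarrow> real" where
  "integral_mean p r f =
     (1 / (2 * pi) * (LINT t:{0..2 * pi}|lebesgue. norm (f (of_real r * cis t)) powr p)) powr (1 / p)"

definition hardy_space :: "real \<Rightarrow> (complex \<Rightarrow> complex) set" where
  "hardy_space p =
     {f. f holomorphic_on ball 0 1 \<and> bdd_above ((\<lambda>r. integral_mean p r f) ` {0<..<1})}"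

text \<open>As a real supremum, this is meaningful only for members of \<open>hardy_space p\<close>.\<close>

definition hardy_norm :: "real \<Rightarrow> (complex \<Rightarrow> complex) \<Rightarrow> real" where
  "hardy_norm p f = (SUP r\<in>{0<..<1}. integral_mean p r f)"

text \<open>
  Radial limit at a point of the unit circle. For \<open>g\<close> in a Hardy space it exists at almost every
  point; elsewhere the value is unspecified.
\<close>

definition boundary_function :: "(complex \<Rightarrow> complex) \<Rightarrow> complex \<Rightarrow> complex" where
  "boundary_function g \<zeta> = Lim (at_left (1::real)) (\<lambda>r. g (of_real r * \<zeta>))"

text \<open>
  The integrals and the supremum are finite for \<open>g\<close> in \<open>hardy_space p\<close> with \<open>1 \<le> p\<close>, because the
  boundary function is then p-integrable; \<open>mean_Lipschitz\<close> only uses this case.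
\<close>

definition integral_modulus_of_continuity :: "real \<Rightarrow> (complex \<Rightarrow> complex) \<Rightarrow> real \<Rightarrow> real" where
  "integral_modulus_of_continuity p g t =
     (SUP h\<in>{0<..t}.
        (1 / (2 * pi) * (LINT \<theta>:{0..2 * pi}|lebesgue.
           norm (boundary_function g (cis (\<theta> + h)) - boundary_function g (cis \<theta>)) powr p))
        powr (1 / p))"

definition mean_Lipschitz :: "real \<Rightarrow> real \<Rightarrow> (complex \<Rightarrow> complex) set" where
  "mean_Lipschitz p \<alpha> =
     {g \<in> hardy_space p.
        (\<lambda>t. integral_modulus_of_continuity p g t) \<in> O[at_right 0](\<lambda>t. t powr \<alpha>)}"

text \<open>
  The integral converges absolutely for \<open>z\<close> in the disc whenever \<open>f\<close> is integrable on \<open>{0..<1}\<close>, in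
  particular for \<open>f\<close> in \<open>hardy_space p\<close> with \<open>1 \<le> p\<close>. The endpoint 1, where \<open>f\<close> is not specified,
  is left out.
\<close>

definition generalized_Hilbert ::
    "(complex \<Rightarrow> complex) \<Rightarrow> (complex \<Rightarrow> complex) \<Rightarrow> complex \<Rightarrow> complex" where
  "generalized_Hilbert g f z =
     (LINT t:{0..<1}|lebesgue. f (of_real t) * deriv g (of_real t * z))"

definition bounded_on_hardy_space ::
    "real \<Rightarrow> ((complex \<Rightarrow> complex) \<Rightarrow> complex \<Rightarrow> complex) \<Rightarrow> bool" where
  "bounded_on_hardy_space p T \<longleftrightarrow>
     (\<exists>C. \<forall>f\<in>hardy_space p. T f \<in> hardy_space p \<and> hardy_norm p (T f) \<le> C * hardy_norm p f)"

end

theory Submission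
  imports Defs
begin

text \<open>
  Both conditions are equivalent to \<open>M\<^sub>p(r, g') = O((1 - r)\<^bsup>1/p - 1\<^esup>)\<close>.

  Boundedness implies this growth: integrating by parts gives
  \<open>f(1) g' = (z H\<^sub>g f)' + H\<^sub>g (z f')\<close>, and one takes \<open>f(z) = (1 - a z)\<^bsup>-2\<^esup>\<close> at radius \<open>r = a\<close>.

  The growth implies the Lipschitz condition by going radially from the circle down to radius
  \<open>1 - h\<close>, along the arc, and back. For the converse one writes \<open>g'\<close> as a Cauchy integral of
  \<open>g(z e) - g(z)\<close>; this needs that a Hardy function is dominated in mean by its radial boundary
  values. They exist by the weak-type bound for the radial maximal function, since the dilates are Cauchy
  in the mean by uniform convexity.

  The growth implies boundedness by duality. Pairing \<open>H\<^sub>g f\<close> on a circle with \<open>h\<close> gives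
  \<open>\<integral> f(t) G(t) dt\<close> over the unit interval, where \<open>G(t)\<close> is the pairing of \<open>g'(t z)\<close> with \<open>h\<close>.
  By the Fejer--Riesz inequality it suffices to bound \<open>G\<close> in \<open>L\<^sup>q\<close>, which by Hardy's inequality
  follows from a bound of \<open>(1 - t) G'(t)\<close>. This is the growth of \<open>g'\<close> together with the
  Littlewood--Paley inequality for \<open>h\<close>, which is where \<open>q \<ge> 2\<close>, that is \<open>p \<le> 2\<close>, enters.
\<close>

section \<open>Integral inequalities\<close>

text \<open>Means are kept as p-th powers in the extended nonnegative reals (\<open>Lpow\<close>),
  so that bounds can be proved before finiteness is known. Minkowski's integral inequality takes the
  form of Jensen's inequality with a weight equal to the known growth of the means; dilation,
  differentiation and the difference estimate become convolutions on the circle with kernels of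
  known mass. The Fejer--Riesz and the Littlewood--Paley inequality come from one real interpolation
  lemma, \<open>Marcinkiewicz\<close>. Its endpoints are a weak-type bound in the first power and
  the supremum for the former, exponent 2 and the supremum for the latter; exponent 2 is the lower
  endpoint there because it rests on orthogonality of powers. Uniform convexity stands in for a
  representation of a Hardy function by its boundary values: mean convergence of the dilates gives
  the comparison with the boundary up to a factor \<open>2 powr p\<close>, which the O-constants
  absorb. In the duality step a single test function, extremal for the image itself on a circle of
  radius below 1, replaces the supremum over a dual ball; the means there are finite, so they can be
  cancelled.\<close>

lemma nn_integral_Holder:
  fixes u v :: "'a \<Rightarrow> real"
  assumes pq: "p > 1" "q > 1" "1/p + 1/q = 1"
    and [measurable]: "u \<in> borel_measurable M" "v \<in> borel_measurable M"
    and nn: "\<And>x. x \<in> space M \<Longrightarrow> 0 \<le> u x" "\<And>x. x \<in> space M \<Longrightarrow> 0 \<le> v x"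
    and U: "(\<integral>\<^sup>+x. ennreal (u x powr p) \<partial>M) \<le> ennreal U" "0 \<le> U"
    and V: "(\<integral>\<^sup>+x. ennreal (v x powr q) \<partial>M) \<le> ennreal V" "0 \<le> V"
  shows "(\<integral>\<^sup>+x. ennreal (u x * v x) \<partial>M) \<le> ennreal (U powr (1/p) * V powr (1/q))"
proof (cases "U = 0 \<or> V = 0")
  case True
  have "(AE x in M. u x = 0) \<or> (AE x in M. v x = 0)"
  proof (cases "U = 0")
    case True
    then have "(\<integral>\<^sup>+x. ennreal (u x powr p) \<partial>M) = 0" using U by simp
    then have "AE x in M. ennreal (u x powr p) = 0" by (subst (asm) nn_integral_0_iff_AE) auto
    then show ?thesis by (auto simp: ennreal_eq_0_iff powr_gt_zero[symmetric] elim!: eventually_mono)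
  next
    case False
    then have "(\<integral>\<^sup>+x. ennreal (v x powr q) \<partial>M) = 0" using V True by simp
    then have "AE x in M. ennreal (v x powr q) = 0" by (subst (asm) nn_integral_0_iff_AE) auto
    then show ?thesis by (auto simp: ennreal_eq_0_iff powr_gt_zero[symmetric] elim!: eventually_mono)
  qed
  then have "AE x in M. ennreal (u x * v x) = 0" by auto
  then have "(\<integral>\<^sup>+x. ennreal (u x * v x) \<partial>M) = 0" by (subst nn_integral_0_iff_AE) auto
  then show ?thesis by simp
next
  case False
  then have UV: "U > 0" "V > 0" using U V by auto
  \<comment> \<open>Normalising by \<open>U powr (1/p)\<close> and \<open>V powr (1/q)\<close> makes
    the two sides of Young's inequality integrate to \<open>1/p + 1/q = 1\<close>; the case split
    has removed the zero denominators.\<close>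
  define c where "c = U powr (1/p) * V powr (1/q)"
  have c: "c > 0" using UV by (simp add: c_def)
  have pw: "ennreal (u x * v x) \<le> ennreal (c / (p * U)) * ennreal (u x powr p) + ennreal (c / (q * V)) * ennreal (v x powr q)"
    if "x \<in> space M" for x
  proof -
    have "(u x / U powr (1/p)) * (v x / V powr (1/q)) \<le>
      (u x / U powr (1/p)) powr p / p + (v x / V powr (1/q)) powr q / q"
      using pq nn[OF that] by (intro Youngs_inequality) auto
    also have "(u x / U powr (1/p)) powr p = u x powr p / U"
      using UV nn[OF that] pq by (simp add: powr_divide powr_powr)
    also have "(v x / V powr (1/q)) powr q = v x powr q / V"
      using UV nn[OF that] pq by (simp add: powr_divide powr_powr)
    finally have "u x * v x \<le> c * (u x powr p / U / p + v x powr q / V / q)"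
      using UV by (simp add: c_def field_simps)
    also have "\<dots> = c / (p * U) * u x powr p + c / (q * V) * v x powr q"
      using UV pq by (simp add: field_simps)
    finally show ?thesis
      using c UV pq by (simp add: ennreal_mult[symmetric] ennreal_plus[symmetric] del: ennreal_plus)
  qed
  have "(\<integral>\<^sup>+x. ennreal (u x * v x) \<partial>M) \<le>
    (\<integral>\<^sup>+x. ennreal (c / (p * U)) * ennreal (u x powr p) + ennreal (c / (q * V)) * ennreal (v x powr q) \<partial>M)"
    by (intro nn_integral_mono pw)
  also have "\<dots> = ennreal (c / (p * U)) * (\<integral>\<^sup>+x. ennreal (u x powr p) \<partial>M) + ennreal (c / (q * V)) * (\<integral>\<^sup>+x. ennreal (v x powr q) \<partial>M)"
    by (simp add: nn_integral_add nn_integral_cmult)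
  also have "\<dots> \<le> ennreal (c / (p * U)) * ennreal U + ennreal (c / (q * V)) * ennreal V"
    by (intro add_mono mult_left_mono U V) auto
  also have "\<dots> = ennreal (c / (p * U) * U + c / (q * V) * V)"
    using c UV pq by (simp add: ennreal_mult[symmetric] ennreal_plus[symmetric] del: ennreal_plus)
  also have "c / (p * U) * U + c / (q * V) * V = c * (1/p + 1/q)"
    using UV pq by (simp add: field_simps)
  finally show ?thesis using pq by (simp add: c_def)
qed

text \<open>Hoelder's inequality for the splitting
  \<open>u = (u * w powr (- 1/q)) * w powr (1/q)\<close> with \<open>q\<close> conjugate to
  \<open>p\<close>. With \<open>w\<close> of the order of \<open>u\<close> the two factors are
  balanced, so no order of growth is lost for integrands far from constant.\<close>

lemma nn_integral_Jensen_weight: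
  fixes u w :: "'a \<Rightarrow> real"
  assumes p: "p > 1"
    and [measurable]: "u \<in> borel_measurable M" "w \<in> borel_measurable M"
    and nn: "\<And>x. x \<in> space M \<Longrightarrow> 0 \<le> u x" "\<And>x. x \<in> space M \<Longrightarrow> 0 < w x"
    and A: "(\<integral>\<^sup>+x. ennreal (w x) \<partial>M) \<le> ennreal A" "0 \<le> A"
    and I: "(\<integral>\<^sup>+x. ennreal (u x powr p * w x powr (1 - p)) \<partial>M) \<le> ennreal I" "0 \<le> I"
  shows "(\<integral>\<^sup>+x. ennreal (u x) \<partial>M) \<le> ennreal (A powr (1 - 1/p) * I powr (1/p))"
proof -
  define q where "q = p / (p - 1)"
  have q: "q > 1" "1/p + 1/q = 1" using p by (auto simp: q_def field_simps)
  have q': "1/q = 1 - 1/p" using q by simp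
  have "(\<integral>\<^sup>+x. ennreal (u x) \<partial>M) = (\<integral>\<^sup>+x. ennreal ((u x * w x powr (- 1/q)) * (w x powr (1/q))) \<partial>M)"
    using nn(2) by (intro nn_integral_cong) (simp add: mult.assoc powr_add[symmetric] less_imp_neq[THEN not_sym])
  also have "\<dots> \<le> ennreal (I powr (1/p) * A powr (1/q))"
  proof (rule nn_integral_Holder[OF p q])
    have "(\<integral>\<^sup>+x. ennreal ((u x * w x powr (- 1/q)) powr p) \<partial>M) = (\<integral>\<^sup>+x. ennreal (u x powr p * w x powr (1 - p)) \<partial>M)"
    proof (intro nn_integral_cong)
      fix x assume x: "x \<in> space M"
      have "- 1/q * p = 1 - p" using p by (simp add: q_def field_simps)
      then show "ennreal ((u x * w x powr (- 1/q)) powr p) = ennreal (u x powr p * w x powr (1 - p))"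
        using nn[OF x] by (simp add: powr_mult powr_powr)
    qed
    then show "(\<integral>\<^sup>+x. ennreal ((u x * w x powr (- 1/q)) powr p) \<partial>M) \<le> ennreal I" using I by simp
    have "(\<integral>\<^sup>+x. ennreal ((w x powr (1/q)) powr q) \<partial>M) = (\<integral>\<^sup>+x. ennreal (w x) \<partial>M)"
      using nn(2) q by (intro nn_integral_cong) (simp add: powr_powr less_imp_le)
    then show "(\<integral>\<^sup>+x. ennreal ((w x powr (1/q)) powr q) \<partial>M) \<le> ennreal A" using A by simp
  qed (use nn A I in \<open>auto intro!: mult_nonneg_nonneg\<close>)
  finally show ?thesis using q' by (simp add: mult.commute)
qed

text \<open>The form that can be integrated in a further variable: the right-hand side is linear in
  the weighted integral and may be infinite.\<close>

lemma nn_integral_Jensen_powr: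
  fixes u w :: "'a \<Rightarrow> real"
  assumes p: "p > 1"
    and [measurable]: "u \<in> borel_measurable M" "w \<in> borel_measurable M"
    and nn: "\<And>x. x \<in> space M \<Longrightarrow> 0 \<le> u x" "\<And>x. x \<in> space M \<Longrightarrow> 0 < w x"
    and A: "(\<integral>\<^sup>+x. ennreal (w x) \<partial>M) \<le> ennreal A" "0 < A"
    and v: "0 \<le> v" "ennreal v \<le> (\<integral>\<^sup>+x. ennreal (u x) \<partial>M)"
  shows "ennreal (v powr p) \<le> ennreal (A powr (p - 1)) * (\<integral>\<^sup>+x. ennreal (u x powr p * w x powr (1 - p)) \<partial>M)"
proof (cases "(\<integral>\<^sup>+x. ennreal (u x powr p * w x powr (1 - p)) \<partial>M) = \<infinity>")
  case True
  then show ?thesis using A by (simp add: ennreal_mult_top)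
next
  case False
  then obtain I where I: "0 \<le> I" "(\<integral>\<^sup>+x. ennreal (u x powr p * w x powr (1 - p)) \<partial>M) = ennreal I"
    by (auto simp: less_top[symmetric] elim!: ennreal_cases[of "\<integral>\<^sup>+x. ennreal (u x powr p * w x powr (1 - p)) \<partial>M"])
  have "ennreal v \<le> ennreal (A powr (1 - 1/p) * I powr (1/p))"
    by (rule order.trans[OF v(2)], rule nn_integral_Jensen_weight[OF p, where w = w]) (use nn A I in auto)
  then have "v \<le> A powr (1 - 1/p) * I powr (1/p)" by (simp add: ennreal_le_iff)
  then have "v powr p \<le> (A powr (1 - 1/p) * I powr (1/p)) powr p"
    using v(1) p by (intro powr_mono2) auto
  also have "\<dots> = A powr (p - 1) * I"
    using p I A by (simp add: powr_mult powr_powr algebra_simps)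
  finally show ?thesis using I by (simp add: ennreal_mult[symmetric])
qed

text \<open>Tonelli's theorem together with \<open>w y powr p * w y powr (1 - p) = w y\<close>; the
  hypothesis \<open>B\<close> lets the weight follow the mean of each slice.\<close>

lemma Minkowski_weight_aux:
  fixes u :: "'a \<Rightarrow> 'b \<Rightarrow> real" and w :: "'b \<Rightarrow> real"
  assumes "sigma_finite_measure M" "sigma_finite_measure N" and p: "p > 1"
    and [measurable]: "(\<lambda>(x, y). u x y) \<in> borel_measurable (M \<Otimes>\<^sub>M N)" "w \<in> borel_measurable N"
    and nn: "\<And>x y. 0 \<le> u x y" "\<And>y. y \<in> space N \<Longrightarrow> 0 < w y"
    and B: "\<And>y. y \<in> space N \<Longrightarrow> (\<integral>\<^sup>+x. ennreal (u x y powr p) \<partial>M) \<le> ennreal (B * w y powr p)" "0 \<le> B"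
    and A: "(\<integral>\<^sup>+y. ennreal (w y) \<partial>N) \<le> ennreal A" "0 < A"
  shows "(\<integral>\<^sup>+x. \<integral>\<^sup>+y. ennreal (u x y powr p * w y powr (1 - p)) \<partial>N \<partial>M) \<le> ennreal (B * A)"
proof -
  interpret M: sigma_finite_measure M by fact
  interpret N: sigma_finite_measure N by fact
  interpret pair_sigma_finite M N ..
  have "(\<integral>\<^sup>+x. \<integral>\<^sup>+y. ennreal (u x y powr p * w y powr (1 - p)) \<partial>N \<partial>M)
    = (\<integral>\<^sup>+y. \<integral>\<^sup>+x. ennreal (u x y powr p * w y powr (1 - p)) \<partial>M \<partial>N)"
    by (rule Fubini'[symmetric]) measurable
  also have "\<dots> \<le> (\<integral>\<^sup>+y. ennreal B * ennreal (w y) \<partial>N)"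
  proof (intro nn_integral_mono)
    fix y assume y[measurable]: "y \<in> space N"
    have "(\<integral>\<^sup>+x. ennreal (u x y powr p * w y powr (1 - p)) \<partial>M)
      = ennreal (w y powr (1 - p)) * (\<integral>\<^sup>+x. ennreal (u x y powr p) \<partial>M)"
      by (subst nn_integral_cmult[symmetric]) (auto simp: ennreal_mult mult.commute)
    also have "\<dots> \<le> ennreal (w y powr (1 - p)) * ennreal (B * w y powr p)"
      by (intro mult_left_mono B y) auto
    also have "\<dots> = ennreal B * ennreal (w y)"
      using nn(2)[OF y] B(2) by (simp add: ennreal_mult[symmetric] mult.left_commute powr_add[symmetric])
    finally show "(\<integral>\<^sup>+x. ennreal (u x y powr p * w y powr (1 - p)) \<partial>M) \<le> ennreal B * ennreal (w y)" .
  qed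
  also have "\<dots> = ennreal B * (\<integral>\<^sup>+y. ennreal (w y) \<partial>N)" by (rule nn_integral_cmult) auto
  also have "\<dots> \<le> ennreal B * ennreal A" by (intro mult_left_mono A) auto
  finally show ?thesis using B A by (simp add: ennreal_mult[symmetric])
qed

text \<open>A finite double integral makes the weighted inner integrals finite almost everywhere,
  and Jensen's inequality then removes the weight. This later yields radial limits.\<close>

lemma Minkowski_weight_AE_finite:
  fixes u :: "'a \<Rightarrow> 'b \<Rightarrow> real" and w :: "'b \<Rightarrow> real"
  assumes "sigma_finite_measure M" "sigma_finite_measure N" and p: "p > 1"
    and [measurable]: "(\<lambda>(x, y). u x y) \<in> borel_measurable (M \<Otimes>\<^sub>M N)" "w \<in> borel_measurable N"
    and nn: "\<And>x y. 0 \<le> u x y" "\<And>y. y \<in> space N \<Longrightarrow> 0 < w y"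
    and B: "\<And>y. y \<in> space N \<Longrightarrow> (\<integral>\<^sup>+x. ennreal (u x y powr p) \<partial>M) \<le> ennreal (B * w y powr p)" "0 \<le> B"
    and A: "(\<integral>\<^sup>+y. ennreal (w y) \<partial>N) \<le> ennreal A" "0 < A"
  shows "AE x in M. (\<integral>\<^sup>+y. ennreal (u x y) \<partial>N) < \<infinity>"
proof -
  interpret N: sigma_finite_measure N by fact
  have "AE x in M. (\<integral>\<^sup>+y. ennreal (u x y powr p * w y powr (1 - p)) \<partial>N) \<noteq> \<infinity>"
  proof (rule nn_integral_PInf_AE)
    show "(\<integral>\<^sup>+x. \<integral>\<^sup>+y. ennreal (u x y powr p * w y powr (1 - p)) \<partial>N \<partial>M) \<noteq> \<infinity>"
      using Minkowski_weight_aux[OF assms] by (auto simp: top_unique)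
  qed measurable
  then show ?thesis
  proof (rule AE_mp, intro AE_I2 impI)
    fix x assume x[measurable]: "x \<in> space M" and "(\<integral>\<^sup>+y. ennreal (u x y powr p * w y powr (1 - p)) \<partial>N) \<noteq> \<infinity>"
    then obtain I where I: "0 \<le> I" "(\<integral>\<^sup>+y. ennreal (u x y powr p * w y powr (1 - p)) \<partial>N) = ennreal I"
      by (auto simp: less_top[symmetric] elim!: ennreal_cases[of "\<integral>\<^sup>+y. ennreal (u x y powr p * w y powr (1 - p)) \<partial>N"])
    have "(\<integral>\<^sup>+y. ennreal (u x y) \<partial>N) \<le> ennreal (A powr (1 - 1/p) * I powr (1/p))"
      by (rule nn_integral_Jensen_weight[OF p, where w = w]) (use nn A I in auto)
    then show "(\<integral>\<^sup>+y. ennreal (u x y) \<partial>N) < \<infinity>" using le_less_trans by fastforce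
  qed
qed

text \<open>Stands in for Minkowski's integral inequality: slices of \<open>L\<^sup>p\<close> norm
  at most \<open>B powr (1/p) * w y\<close> superpose to norm at most
  \<open>B powr (1/p) * A\<close>. In the applications \<open>w\<close> is the known growth rate of
  the slices.\<close>

lemma Minkowski_weight:
  fixes u :: "'a \<Rightarrow> 'b \<Rightarrow> real" and w :: "'b \<Rightarrow> real" and v :: "'a \<Rightarrow> real"
  assumes "sigma_finite_measure M" "sigma_finite_measure N" and p: "p > 1"
    and [measurable]: "(\<lambda>(x, y). u x y) \<in> borel_measurable (M \<Otimes>\<^sub>M N)" "w \<in> borel_measurable N"
    and nn: "\<And>x y. 0 \<le> u x y" "\<And>y. y \<in> space N \<Longrightarrow> 0 < w y"
    and B: "\<And>y. y \<in> space N \<Longrightarrow> (\<integral>\<^sup>+x. ennreal (u x y powr p) \<partial>M) \<le> ennreal (B * w y powr p)" "0 \<le> B"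
    and A: "(\<integral>\<^sup>+y. ennreal (w y) \<partial>N) \<le> ennreal A" "0 < A"
    and v: "\<And>x. x \<in> space M \<Longrightarrow> 0 \<le> v x" "AE x in M. ennreal (v x) \<le> (\<integral>\<^sup>+y. ennreal (u x y) \<partial>N)"
  shows "(\<integral>\<^sup>+x. ennreal (v x powr p) \<partial>M) \<le> ennreal (B * A powr p)"
proof -
  interpret N: sigma_finite_measure N by fact
  let ?J = "\<lambda>x. \<integral>\<^sup>+y. ennreal (u x y powr p * w y powr (1 - p)) \<partial>N"
  have "(\<integral>\<^sup>+x. ennreal (v x powr p) \<partial>M) \<le> (\<integral>\<^sup>+x. ennreal (A powr (p - 1)) * ?J x \<partial>M)"
  proof (rule nn_integral_mono_AE, use v(2) in \<open>rule AE_mp\<close>, intro AE_I2 impI)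
    fix x assume x[measurable]: "x \<in> space M" and vx: "ennreal (v x) \<le> (\<integral>\<^sup>+y. ennreal (u x y) \<partial>N)"
    show "ennreal (v x powr p) \<le> ennreal (A powr (p - 1)) * ?J x"
      by (rule nn_integral_Jensen_powr[OF p _ _ _ _ A v(1)[OF x] vx]) (use nn in auto)
  qed
  also have "\<dots> = ennreal (A powr (p - 1)) * (\<integral>\<^sup>+x. ?J x \<partial>M)"
    by (rule nn_integral_cmult) measurable
  also have "\<dots> \<le> ennreal (A powr (p - 1)) * ennreal (B * A)"
    by (intro mult_left_mono Minkowski_weight_aux[OF assms(1-11)]) auto
  also have "\<dots> = ennreal (A powr (p - 1) * (B * A))" using A B by (simp add: ennreal_mult[symmetric])
  also have "A powr (p - 1) * (B * A) = B * A powr p" using A by (simp add: powr_diff field_simps)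
  finally show ?thesis .
qed

section \<open>Power integrals and real interpolation\<close>

lemma nn_integral_powr_0:
  fixes a b :: real
  assumes "a > 0" "b \<ge> 0"
  shows "(\<integral>\<^sup>+x. ennreal (x powr (a - 1)) * indicator {0<..<b} x \<partial>lborel) = ennreal (b powr a / a)"
proof -
  have "((\<lambda>x. x powr (a - 1)) has_integral (b powr (a - 1 + 1) / (a - 1 + 1))) {0..b}"
    using assms by (intro has_integral_powr_from_0) auto
  then have "((\<lambda>x. if x \<in> {0..b} then x powr (a - 1) else 0) has_integral (b powr a / a)) UNIV"
    by (subst has_integral_restrict_UNIV) simp
  moreover have "(\<lambda>x. if x \<in> {0..b} then x powr (a - 1) else 0) = (\<lambda>x. x powr (a - 1) * indicator {0..b} x)"
    by (auto simp: fun_eq_iff indicator_def)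
  ultimately have "((\<lambda>x. x powr (a - 1) * indicator {0..b} x) has_integral (b powr a / a)) UNIV" by simp
  then have "(\<integral>\<^sup>+x. ennreal (x powr (a - 1) * indicator {0..b} x) \<partial>lborel) = ennreal (b powr a / a)"
    by (intro nn_integral_has_integral_lborel) (auto simp: indicator_def)
  moreover have "(\<integral>\<^sup>+x. ennreal (x powr (a - 1)) * indicator {0<..<b} x \<partial>lborel) =
     (\<integral>\<^sup>+x. ennreal (x powr (a - 1) * indicator {0..b} x) \<partial>lborel)"
  proof (rule nn_integral_cong_AE)
    have "AE x in lborel. x \<noteq> 0 \<and> x \<noteq> b"
      using AE_lborel_singleton[of 0] AE_lborel_singleton[of b] by eventually_elim auto
    then show "AE x in lborel. ennreal (x powr (a - 1)) * indicator {0<..<b} x = ennreal (x powr (a - 1) * indicator {0..b} x)"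
      by eventually_elim (auto simp: indicator_def)
  qed
  ultimately show ?thesis by simp
qed

text \<open>The layer cake formula, with the truncation of \<open>h\<close> at height \<open>l / c\<close> already built into the weak-type hypothesis.\<close>

lemma Marcinkiewicz:
  fixes T :: "'a \<Rightarrow> real" and h :: "'b \<Rightarrow> real"
  assumes "sigma_finite_measure M" "sigma_finite_measure N"
    and [measurable]: "T \<in> borel_measurable M" "h \<in> borel_measurable N"
    and nn: "\<And>x. 0 \<le> T x" "\<And>y. 0 \<le> h y"
    and weak: "\<And>l. 0 < l \<Longrightarrow> emeasure M {x\<in>space M. l < T x}
        \<le> ennreal (C * l powr (- r)) * (\<integral>\<^sup>+y. ennreal (h y powr r) * indicator {y. l < c * h y} y \<partial>N)"
    and C: "0 \<le> C" "0 < c" "0 < r" "r < q"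
  shows "(\<integral>\<^sup>+x. ennreal (T x powr q) \<partial>M) \<le> ennreal (C * q * c powr (q - r) / (q - r)) * (\<integral>\<^sup>+y. ennreal (h y powr q) \<partial>N)"
proof -
  interpret M: sigma_finite_measure M by fact
  interpret N: sigma_finite_measure N by fact
  interpret MB: pair_sigma_finite M lborel by standard
  interpret NB: pair_sigma_finite N lborel by standard
  have "(\<integral>\<^sup>+x. ennreal (T x powr q) \<partial>M) =
     (\<integral>\<^sup>+x. \<integral>\<^sup>+l. ennreal (q * l powr (q - 1)) * indicator {0<..<T x} l \<partial>lborel \<partial>M)"
  proof (intro nn_integral_cong)
    fix x assume "x \<in> space M"
    have "(\<integral>\<^sup>+l. ennreal (q * l powr (q - 1)) * indicator {0<..<T x} l \<partial>lborel)
      = ennreal q * (\<integral>\<^sup>+l. ennreal (l powr (q - 1)) * indicator {0<..<T x} l \<partial>lborel)"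
      using C by (subst nn_integral_cmult[symmetric]) (auto simp: ennreal_mult mult.assoc)
    also have "\<dots> = ennreal (T x powr q)"
      using C nn by (subst nn_integral_powr_0) (auto simp: ennreal_mult[symmetric])
    finally show "ennreal (T x powr q) = (\<integral>\<^sup>+l. ennreal (q * l powr (q - 1)) * indicator {0<..<T x} l \<partial>lborel)" ..
  qed
  also have "\<dots> = (\<integral>\<^sup>+l. \<integral>\<^sup>+x. ennreal (q * l powr (q - 1)) * indicator {0<..<T x} l \<partial>M \<partial>lborel)"
    by (rule MB.Fubini'[symmetric]) (simp add: indicator_def if_distrib cong: if_cong)
  also have "\<dots> \<le> (\<integral>\<^sup>+l. \<integral>\<^sup>+y. ennreal (q * C * l powr (q - r - 1)) * ennreal (h y powr r) * indicator {0<..<c * h y} l \<partial>N \<partial>lborel)"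
  proof (intro nn_integral_mono)
    fix l :: real
    show "(\<integral>\<^sup>+x. ennreal (q * l powr (q - 1)) * indicator {0<..<T x} l \<partial>M) \<le>
      (\<integral>\<^sup>+y. ennreal (q * C * l powr (q - r - 1)) * ennreal (h y powr r) * indicator {0<..<c * h y} l \<partial>N)"
    proof (cases "l > 0")
      case True
      have "(\<integral>\<^sup>+x. ennreal (q * l powr (q - 1)) * indicator {0<..<T x} l \<partial>M)
         = (\<integral>\<^sup>+x. ennreal (q * l powr (q - 1)) * indicator {x\<in>space M. l < T x} x \<partial>M)"
        using True by (intro nn_integral_cong) (auto simp: indicator_def)
      also have "\<dots> = ennreal (q * l powr (q - 1)) * emeasure M {x\<in>space M. l < T x}"
        by (subst nn_integral_cmult_indicator) auto
      also have "\<dots> \<le> ennreal (q * l powr (q - 1)) * (ennreal (C * l powr (- r)) * (\<integral>\<^sup>+y. ennreal (h y powr r) * indicator {y. l < c * h y} y \<partial>N))"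
        by (intro mult_left_mono weak True) auto
      also have "\<dots> = ennreal (q * C * l powr (q - r - 1)) * (\<integral>\<^sup>+y. ennreal (h y powr r) * indicator {y. l < c * h y} y \<partial>N)"
      proof -
        have "l powr (q - 1) * l powr (- r) = l powr (q - r - 1)"
          by (simp add: powr_add[symmetric] algebra_simps)
        then have "ennreal (q * C * l powr (q - r - 1)) = ennreal (q * l powr (q - 1)) * ennreal (C * l powr (- r))"
          using C by (subst ennreal_mult[symmetric]) (auto simp: ac_simps intro!: arg_cong[where f = ennreal])
        then show ?thesis by (simp add: mult.assoc)
      qed
      also have "\<dots> = (\<integral>\<^sup>+y. ennreal (q * C * l powr (q - r - 1)) * (ennreal (h y powr r) * indicator {y. l < c * h y} y) \<partial>N)"
        by (rule nn_integral_cmult[symmetric]) (simp add: indicator_def if_distrib cong: if_cong)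
      also have "\<dots> = (\<integral>\<^sup>+y. ennreal (q * C * l powr (q - r - 1)) * ennreal (h y powr r) * indicator {0<..<c * h y} l \<partial>N)"
        using True by (intro nn_integral_cong) (auto simp: indicator_def)
      finally show ?thesis .
    qed (auto simp: indicator_def)
  qed
  also have "\<dots> = (\<integral>\<^sup>+y. \<integral>\<^sup>+l. ennreal (q * C * l powr (q - r - 1)) * ennreal (h y powr r) * indicator {0<..<c * h y} l \<partial>lborel \<partial>N)"
    by (rule NB.Fubini') (simp add: indicator_def if_distrib cong: if_cong)
  also have "\<dots> = (\<integral>\<^sup>+y. ennreal (C * q * c powr (q - r) / (q - r)) * ennreal (h y powr q) \<partial>N)"
  proof (intro nn_integral_cong)
    fix y assume "y \<in> space N"
    have "(\<integral>\<^sup>+l. ennreal (q * C * l powr (q - r - 1)) * ennreal (h y powr r) * indicator {0<..<c * h y} l \<partial>lborel)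
      = (\<integral>\<^sup>+l. ennreal (q * C * h y powr r) * (ennreal (l powr (q - r - 1)) * indicator {0<..<c * h y} l) \<partial>lborel)"
      using C by (intro nn_integral_cong) (auto simp: ennreal_mult ac_simps)
    \<comment> \<open>The exponent \<open>q - r - 1\<close> exceeds -1, so the layers are integrable
      down to height 0; this is where \<open>r < q\<close> enters.\<close>
    also have "\<dots> = ennreal (q * C * h y powr r) * ennreal ((c * h y) powr (q - r) / (q - r))"
      using C nn by (subst nn_integral_cmult) (auto simp: nn_integral_powr_0)
    also have "\<dots> = ennreal (C * q * c powr (q - r) / (q - r)) * ennreal (h y powr q)"
    proof -
      have "h y powr r * h y powr (q - r) = h y powr q" by (simp add: powr_add[symmetric])
      then have "q * C * h y powr r * ((c * h y) powr (q - r) / (q - r)) = C * q * c powr (q - r) / (q - r) * h y powr q"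
        using C nn by (simp add: powr_mult field_simps)
      then show ?thesis using C by (simp add: ennreal_mult[symmetric])
    qed
    finally show "(\<integral>\<^sup>+l. ennreal (q * C * l powr (q - r - 1)) * ennreal (h y powr r) * indicator {0<..<c * h y} l \<partial>lborel)
      = ennreal (C * q * c powr (q - r) / (q - r)) * ennreal (h y powr q)" .
  qed
  also have "\<dots> = ennreal (C * q * c powr (q - r) / (q - r)) * (\<integral>\<^sup>+y. ennreal (h y powr q) \<partial>N)"
    by (rule nn_integral_cmult) measurable
  finally show ?thesis .
qed

section \<open>Means over the unit circle\<close>

text \<open>Normalised arc length, as a measure on the whole plane: its measurable sets are the
  Borel sets of \<open>complex\<close>, so integrands need no restriction to the circle. That it
  lives on the circle is \<open>AE_circ\<close>.\<close>

definition circ :: "complex measure" where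
  "circ = distr (uniform_measure lborel {0..2 * pi}) borel cis"

lemma cis_borel_measurable [measurable]: "cis \<in> borel_measurable borel"
  by (intro borel_measurable_continuous_onI continuous_intros)

lemma cnj_borel_measurable [measurable]: "cnj \<in> borel_measurable borel"
  by (intro borel_measurable_continuous_onI continuous_intros)

lemma cis_uniform_measurable: "cis \<in> measurable (uniform_measure lborel A) borel"
proof -
  have "measurable (uniform_measure lborel A) borel = (borel_measurable borel :: (real \<Rightarrow> complex) set)"
    by (rule measurable_cong_sets) auto
  then show ?thesis using cis_borel_measurable by blast
qed

lemma sets_circ [simp, measurable_cong]: "sets circ = sets borel"
  by (simp add: circ_def)

lemma space_circ [simp]: "space circ = UNIV"
  by (simp add: circ_def)

lemma nn_integral_circ_angle:
  assumes [measurable]: "f \<in> borel_measurable borel"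
  shows "(\<integral>\<^sup>+z. f z \<partial>circ) = (\<integral>\<^sup>+t. f (cis t) * indicator {0..2 * pi} t \<partial>lborel) / ennreal (2 * pi)"
  unfolding circ_def
  by (subst nn_integral_distr[OF cis_uniform_measurable]) (auto simp: nn_integral_uniform_measure)

lemma prob_space_circ: "emeasure circ UNIV = 1"
proof -
  have "emeasure circ UNIV = emeasure (uniform_measure lborel {0..2 * pi}) (cis -` UNIV \<inter> space lborel)"
    unfolding circ_def by (subst emeasure_distr[OF cis_uniform_measurable]) auto
  also have "\<dots> = 1" using pi_gt_zero by (simp add: ennreal_divide_self)
  finally show ?thesis .
qed

lemma finite_measure_circ: "finite_measure circ"
  by (rule finite_measureI) (simp add: prob_space_circ)

lemma sigma_finite_circ: "sigma_finite_measure circ"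
proof -
  interpret finite_measure circ by (rule finite_measure_circ)
  show ?thesis by unfold_locales
qed

lemma AE_circ: "AE z in circ. norm z = 1"
  unfolding circ_def
  by (subst AE_distr_iff[OF cis_uniform_measurable]) auto

lemma nn_integral_circ_cong:
  assumes "\<And>z. norm z = 1 \<Longrightarrow> f z = g z"
  shows "(\<integral>\<^sup>+z. f z \<partial>circ) = (\<integral>\<^sup>+z. g z \<partial>circ)"
  by (rule nn_integral_cong_AE, rule AE_mp[OF AE_circ]) (use assms in auto)

lemma nn_integral_circ_mono:
  assumes "\<And>z. norm z = 1 \<Longrightarrow> f z \<le> g z"
  shows "(\<integral>\<^sup>+z. f z \<partial>circ) \<le> (\<integral>\<^sup>+z. g z \<partial>circ)"
  by (rule nn_integral_mono_AE, rule AE_mp[OF AE_circ]) (use assms in auto)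

lemma integral_circ_cong:
  fixes f :: "complex \<Rightarrow> 'b::{banach, second_countable_topology}"
  assumes "\<And>z. norm z = 1 \<Longrightarrow> f z = g z" "f \<in> borel_measurable borel" "g \<in> borel_measurable borel"
  shows "(LINT z|circ. f z) = (LINT z|circ. g z)"
  by (rule integral_cong_AE) (use assms AE_circ in \<open>auto elim: eventually_mono\<close>)

text \<open>The shifted window \<open>{b..<b + T}\<close> is cut at \<open>T\<close> and the
  overhang is moved back by one period; half-open intervals keep the pieces disjoint.\<close>

lemma nn_integral_periodic_shift:
  fixes g :: "real \<Rightarrow> ennreal"
  assumes [measurable]: "g \<in> borel_measurable borel" and per: "\<And>t. g (t + T) = g t" and b: "0 \<le> b" "b \<le> T"
  shows "(\<integral>\<^sup>+t. g (t + b) * indicator {0..<T} t \<partial>lborel) = (\<integral>\<^sup>+t. g t * indicator {0..<T} t \<partial>lborel)"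
proof -
  have "(\<integral>\<^sup>+t. g t * indicator {b..<b + T} t \<partial>lborel) = (\<integral>\<^sup>+t. g (b + 1 * t) * indicator {b..<b + T} (b + 1 * t) \<partial>lborel)"
    by (subst nn_integral_real_affine[where c = 1 and t = b]) auto
  also have "\<dots> = (\<integral>\<^sup>+t. g (t + b) * indicator {0..<T} t \<partial>lborel)"
    by (intro nn_integral_cong) (auto simp: indicator_def add.commute)
  finally have "(\<integral>\<^sup>+t. g (t + b) * indicator {0..<T} t \<partial>lborel) = (\<integral>\<^sup>+t. g t * indicator {b..<b + T} t \<partial>lborel)" ..
  also have "\<dots> = (\<integral>\<^sup>+t. g t * indicator {b..<T} t + g t * indicator {T..<b + T} t \<partial>lborel)"
    using b by (intro nn_integral_cong) (auto simp: indicator_def)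
  also have "\<dots> = (\<integral>\<^sup>+t. g t * indicator {b..<T} t \<partial>lborel) + (\<integral>\<^sup>+t. g t * indicator {T..<b + T} t \<partial>lborel)"
    by (rule nn_integral_add) auto
  also have "(\<integral>\<^sup>+t. g t * indicator {T..<b + T} t \<partial>lborel) = (\<integral>\<^sup>+t. g (T + 1 * t) * indicator {T..<b + T} (T + 1 * t) \<partial>lborel)"
    by (subst nn_integral_real_affine[where c = 1 and t = T]) auto
  also have "\<dots> = (\<integral>\<^sup>+t. g t * indicator {0..<b} t \<partial>lborel)"
    using per by (intro nn_integral_cong) (auto simp: indicator_def add.commute)
  also have "(\<integral>\<^sup>+t. g t * indicator {b..<T} t \<partial>lborel) + (\<integral>\<^sup>+t. g t * indicator {0..<b} t \<partial>lborel)
      = (\<integral>\<^sup>+t. g t * indicator {b..<T} t + g t * indicator {0..<b} t \<partial>lborel)"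
    by (rule nn_integral_add[symmetric]) auto
  also have "\<dots> = (\<integral>\<^sup>+t. g t * indicator {0..<T} t \<partial>lborel)"
    using b by (intro nn_integral_cong) (auto simp: indicator_def)
  finally show ?thesis .
qed

lemma nn_integral_Icc_Ico:
  fixes g :: "real \<Rightarrow> ennreal"
  shows "(\<integral>\<^sup>+t. g t * indicator {a..b} t \<partial>lborel) = (\<integral>\<^sup>+t. g t * indicator {a..<b} t \<partial>lborel)"
  by (rule nn_integral_cong_AE, rule AE_mp[OF AE_lborel_singleton[of b]]) (auto simp: indicator_def)

lemma nn_integral_circ_rotate:
  assumes [measurable]: "f \<in> borel_measurable borel" and a: "norm a = 1"
  shows "(\<integral>\<^sup>+z. f (a * z) \<partial>circ) = (\<integral>\<^sup>+z. f z \<partial>circ)"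
proof -
  define b where "b = Arg2pi a"
  have b: "0 \<le> b" "b \<le> 2 * pi" using Arg2pi[of a] by (auto simp: b_def)
  have ab: "a = cis b" using Arg2pi[of a] a by (simp add: b_def cis_conv_exp is_Arg_def)
  have "(\<integral>\<^sup>+t. f (cis (t + b)) * indicator {0..<2*pi} t \<partial>lborel) = (\<integral>\<^sup>+t. f (cis t) * indicator {0..<2*pi} t \<partial>lborel)"
    by (rule nn_integral_periodic_shift[OF _ _ b]) (auto simp: cis_mult[symmetric])
  then show ?thesis
    by (simp add: nn_integral_circ_angle nn_integral_Icc_Ico ab cis_mult add.commute)
qed

text \<open>Rotation invariance as an equation of measures is the form that carries
  almost-everywhere statements along a rotation.\<close>

lemma distr_circ_rotate:
  assumes a: "norm a = 1"
  shows "distr circ borel ((*) a) = circ"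
proof (rule measure_eqI)
  fix A assume "A \<in> sets (distr circ borel ((*) a))"
  then have [measurable]: "A \<in> sets borel" by simp
  have "emeasure (distr circ borel ((*) a)) A = (\<integral>\<^sup>+z. indicator A z \<partial>distr circ borel ((*) a))"
    by (simp add: nn_integral_indicator)
  also have "\<dots> = (\<integral>\<^sup>+z. indicator A (a * z) \<partial>circ)" by (subst nn_integral_distr) auto
  also have "\<dots> = (\<integral>\<^sup>+z. indicator A z \<partial>circ)" by (rule nn_integral_circ_rotate[OF _ a]) auto
  finally show "emeasure (distr circ borel ((*) a)) A = emeasure circ A" by (simp add: nn_integral_indicator)
qed auto

section \<open>Integration on the circle and the formulas of Cauchy and Poisson\<close>

lemma integrable_circ_bounded:
  fixes f :: "complex \<Rightarrow> 'b::{banach, second_countable_topology}"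
  assumes [measurable]: "f \<in> borel_measurable borel" and B: "\<And>z. norm z = 1 \<Longrightarrow> norm (f z) \<le> B"
  shows "integrable circ f"
proof (rule finite_measure.integrable_const_bound[OF finite_measure_circ])
  show "AE z in circ. norm (f z) \<le> B" by (rule AE_mp[OF AE_circ]) (use B in auto)
qed simp

lemma integrable_circ_continuous:
  fixes f :: "complex \<Rightarrow> 'b::{banach, second_countable_topology}"
  assumes [measurable]: "f \<in> borel_measurable borel" and c: "continuous_on (sphere 0 1) f"
  shows "integrable circ f"
proof -
  have "compact (f ` sphere 0 1)" by (intro compact_continuous_image c compact_sphere)
  then obtain B where "\<forall>x\<in>f ` sphere 0 1. norm x \<le> B" using compact_imp_bounded bounded_iff by blast
  then show ?thesis by (intro integrable_circ_bounded[where B = B]) auto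
qed

text \<open>The link to integrals over the angle, on which contour integration and the Leibniz rule
  act.\<close>

lemma has_integral_circ:
  fixes f :: "complex \<Rightarrow> complex"
  assumes [measurable]: "f \<in> borel_measurable borel" and c: "continuous_on (sphere 0 1) f"
  shows "((\<lambda>t. f (cis t)) has_integral (of_real (2 * pi) * (LINT z|circ. f z))) {0..2*pi}"
proof -
  have cc: "continuous_on {0..2*pi} (\<lambda>t. f (cis t))"
    by (rule continuous_on_compose2[OF c]) (auto intro!: continuous_intros)
  have si: "set_integrable lborel {0..2*pi} (\<lambda>t. f (cis t))"
    by (rule borel_integrable_atLeastAtMost'[OF cc])
  have "(LINT z|circ. f z) = (LINT t|uniform_measure lborel {0..2*pi}. f (cis t))"
    unfolding circ_def by (rule integral_distr[OF cis_uniform_measurable]) simp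
  also have "\<dots> = (LINT t|density lborel (\<lambda>t. ennreal (indicator {0..2*pi} t / (2*pi))). f (cis t))"
    unfolding uniform_measure_def
    by (intro arg_cong2[where f = lebesgue_integral] density_cong) (auto simp: indicator_def divide_ennreal[symmetric])
  also have "\<dots> = (LINT t|lborel. (indicator {0..2*pi} t / (2*pi)) *\<^sub>R f (cis t))"
    by (rule integral_density) auto
  also have "\<dots> = (LINT t|lborel. (1/(2*pi)) *\<^sub>R (indicator {0..2*pi} t *\<^sub>R f (cis t)))"
    by simp
  also have "\<dots> = (1/(2*pi)) *\<^sub>R (LINT t:{0..2*pi}|lborel. f (cis t))"
    unfolding set_lebesgue_integral_def by (rule integral_scaleR_right)
  also have "(LINT t:{0..2*pi}|lborel. f (cis t)) = integral {0..2*pi} (\<lambda>t. f (cis t))"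
    by (rule set_borel_integral_eq_integral(2)[OF si])
  finally have "of_real (2 * pi) * (LINT z|circ. f z) = integral {0..2*pi} (\<lambda>t. f (cis t))"
    by (simp add: scaleR_conv_of_real)
  then show ?thesis
    using set_borel_integral_eq_integral(1)[OF si] by (simp add: integrable_integral)
qed

text \<open>On the unit circle \<open>dz = \<i> * z * dt\<close>, whence the factor \<open>z\<close>
  in \<open>fh\<close>.\<close>

lemma circ_contour_integral:
  assumes f: "f \<in> borel_measurable borel" and c: "continuous_on (sphere 0 1) f"
    and h: "(h has_contour_integral I) (circlepath 0 1)" and fh: "\<And>z. norm z = 1 \<Longrightarrow> f z = h z * z"
  shows "(LINT z|circ. f z) = I / (2 * of_real pi * \<i>)"
proof -
  have "((\<lambda>t. h (0 + of_real 1 * cis t) * of_real 1 * \<i> * cis t) has_integral I) {0..2*pi}"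
    using h unfolding circlepath_def by (subst (asm) has_contour_integral_part_circlepath_iff) auto
  then have "((\<lambda>t. \<i> * f (cis t)) has_integral I) {0..2*pi}"
    by (simp add: fh mult_ac)
  moreover have "((\<lambda>t. \<i> * f (cis t)) has_integral (\<i> * (of_real (2 * pi) * (LINT z|circ. f z)))) {0..2*pi}"
    by (intro has_integral_mult_right has_integral_circ f c)
  ultimately have "I = \<i> * (of_real (2 * pi) * (LINT z|circ. f z))" by (rule has_integral_unique)
  then show ?thesis by (simp add: field_simps)
qed

text \<open>Since \<open>cnj e = 1 / e\<close> on the circle, the kernel
  \<open>1 / (1 - z * cnj e)\<close> is \<open>e / (e - z)\<close>, and the extra \<open>e\<close>
  is absorbed by \<open>dz\<close>.\<close>

lemma Cauchy_circ:
  assumes [measurable]: "F \<in> borel_measurable borel" and hol: "F holomorphic_on ball 0 R" and R: "R > 1" and z: "norm z < 1"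
  shows "(LINT e|circ. F e / (1 - z * cnj e)) = F z"
proof -
  have hol': "F holomorphic_on cball 0 1" by (rule holomorphic_on_subset[OF hol]) (use R in auto)
  have nz: "1 - z * cnj e \<noteq> 0" if "norm e = 1" for e
  proof
    assume "1 - z * cnj e = 0"
    then have "norm (z * cnj e) = 1" by simp
    then show False using z that by (simp add: norm_mult)
  qed
  have "(LINT e|circ. F e / (1 - z * cnj e)) = (2 * of_real pi * \<i> * F z) / (2 * of_real pi * \<i>)"
  proof (rule circ_contour_integral)
    show "((\<lambda>u. F u / (u - z)) has_contour_integral 2 * of_real pi * \<i> * F z) (circlepath 0 1)"
      by (rule Cauchy_integral_circlepath_simple[OF hol']) (use z in auto)
    show "continuous_on (sphere 0 1) (\<lambda>e. F e / (1 - z * cnj e))"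
      using nz by (intro continuous_intros holomorphic_on_imp_continuous_on[OF holomorphic_on_subset[OF hol']]) auto
    fix e :: complex assume e: "norm e = 1"
    have "cnj e * e = 1" using e by (simp add: complex_norm_square[symmetric] mult.commute)
    then have "(1 - z * cnj e) * e = e - z" by (simp add: algebra_simps)
    then show "F e / (1 - z * cnj e) = F e / (e - z) * e"
      using nz[OF e] e by (metis (no_types, lifting) mult_divide_mult_cancel_right norm_zero times_divide_eq_left zero_neq_one)
  qed simp
  then show ?thesis by simp
qed

text \<open>As before, \<open>cnj e / (1 - z * cnj e)^2\<close> equals \<open>e / (e - z)^2\<close>
  on the circle, which is Cauchy's formula for the derivative.\<close>

lemma Cauchy_deriv_circ:
  assumes [measurable]: "F \<in> borel_measurable borel" and hol: "F holomorphic_on ball 0 R" and R: "R > 1" and z: "norm z < 1"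
  shows "(LINT e|circ. F e * cnj e / (1 - z * cnj e)^2) = deriv F z"
proof -
  have hol': "F holomorphic_on cball 0 1" by (rule holomorphic_on_subset[OF hol]) (use R in auto)
  have nz: "1 - z * cnj e \<noteq> 0" if "norm e = 1" for e
  proof
    assume "1 - z * cnj e = 0"
    then have "norm (z * cnj e) = 1" by simp
    then show False using z that by (simp add: norm_mult)
  qed
  let ?I = "contour_integral (circlepath 0 1) (\<lambda>u. F u / (u - z)^2)"
  have C: "continuous_on (cball 0 1) F" "F holomorphic_on ball 0 1" "z \<in> ball 0 1"
    using hol' z by (auto intro: holomorphic_on_imp_continuous_on holomorphic_on_subset)
  have "(LINT e|circ. F e * cnj e / (1 - z * cnj e)^2) = ?I / (2 * of_real pi * \<i>)"
  proof (rule circ_contour_integral)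
    show "((\<lambda>u. F u / (u - z)^2) has_contour_integral ?I) (circlepath 0 1)"
      using Cauchy_derivative_integral_circlepath(1)[OF C] by (rule has_contour_integral_integral)
    show "continuous_on (sphere 0 1) (\<lambda>e. F e * cnj e / (1 - z * cnj e)^2)"
      using nz by (intro continuous_intros holomorphic_on_imp_continuous_on[OF holomorphic_on_subset[OF hol']]) auto
    fix e :: complex assume e: "norm e = 1"
    have ee: "cnj e * e = 1" using e by (simp add: complex_norm_square[symmetric] mult.commute)
    then have e1: "e - z = (1 - z * cnj e) * e" by (simp add: algebra_simps)
    have "e \<noteq> 0" using e by auto
    have "F e / (e - z)^2 * e = F e / ((1 - z * cnj e)^2 * e^2) * e" by (simp only: e1 power_mult_distrib)
    also have "\<dots> = F e * (1/e) / (1 - z * cnj e)^2" using \<open>e \<noteq> 0\<close> by (simp add: power2_eq_square)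
    also have "1/e = cnj e" using ee \<open>e \<noteq> 0\<close> by (simp add: field_simps)
    finally show "F e * cnj e / (1 - z * cnj e)^2 = F e / (e - z)^2 * e" ..
  qed simp
  also have "\<dots> = deriv F z"
    using DERIV_imp_deriv[OF Cauchy_derivative_integral_circlepath(2)[OF C]] by simp
  finally show ?thesis .
qed

lemma norm_one_minus_cnj:
  assumes "norm (e::complex) = 1"
  shows "norm (1 - z * cnj e) = norm (e - z)"
proof -
  have ee: "e * cnj e = 1" using assms by (simp add: complex_norm_square[symmetric])
  have "norm (1 - z * cnj e) = norm ((e - z) * cnj e)" using ee by (simp add: algebra_simps)
  also have "\<dots> = norm (e - z)" using assms by (simp add: norm_mult)
  finally show ?thesis .
qed

text \<open>Cauchy's formula for \<open>G\<close>: it agrees with \<open>F\<close> at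
  \<open>z\<close>, and on the circle its factor \<open>1 / (1 - cnj z * w)\<close> is conjugate to
  the Cauchy kernel, so that the product is the Poisson kernel.\<close>

lemma Poisson_circ:
  assumes [measurable]: "F \<in> borel_measurable borel" and hol: "F holomorphic_on ball 0 R" and R: "R > 1" and z: "norm z < 1"
  shows "(LINT e|circ. F e * of_real ((1 - (norm z)\<^sup>2) / (norm (e - z))\<^sup>2)) = F z"
proof -
  \<comment> \<open>The added factor has its pole at \<open>1 / cnj z\<close>, outside the closed
    unit disc; the radius \<open>R'\<close> stays below it.\<close>
  define R' where "R' = (if z = 0 then R else min R (1 / norm z))"
  have R': "R' > 1" using R z by (auto simp: R'_def field_simps)
  define G where "G = (\<lambda>w. F w * of_real (1 - (norm z)\<^sup>2) / (1 - cnj z * w))"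
  have nz: "1 - cnj z * w \<noteq> 0" if "norm w < R'" for w
  proof
    assume "1 - cnj z * w = 0"
    then have "norm (cnj z * w) = 1" by simp
    then have "norm z * norm w = 1" by (simp add: norm_mult)
    then show False using that z by (auto simp: R'_def field_simps split: if_splits)
  qed
  have "(LINT e|circ. G e / (1 - z * cnj e)) = G z"
  proof (rule Cauchy_circ[OF _ _ R' z])
    show "G holomorphic_on ball 0 R'" unfolding G_def using nz
      by (intro holomorphic_intros holomorphic_on_subset[OF hol]) (auto simp: R'_def)
  qed (simp add: G_def)
  moreover have "G z = F z"
  proof -
    have "1 - cnj z * z = of_real (1 - (norm z)\<^sup>2)" by (simp add: complex_norm_square mult.commute del: of_real_power)
    moreover have "(norm z)\<^sup>2 < 1" using z by (simp add: power_less_one_iff)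
    ultimately show ?thesis by (simp add: G_def del: of_real_diff)
  qed
  moreover have "(LINT e|circ. G e / (1 - z * cnj e)) = (LINT e|circ. F e * of_real ((1 - (norm z)\<^sup>2) / (norm (e - z))\<^sup>2))"
  proof (rule integral_circ_cong)
    fix e :: complex assume e: "norm e = 1"
    have "(1 - cnj z * e) * (1 - z * cnj e) = of_real ((norm (1 - z * cnj e))\<^sup>2)"
      by (subst complex_norm_square) (simp add: mult.commute)
    also have "\<dots> = of_real ((norm (e - z))\<^sup>2)" by (simp only: norm_one_minus_cnj[OF e])
    finally show "G e / (1 - z * cnj e) = F e * of_real ((1 - (norm z)\<^sup>2) / (norm (e - z))\<^sup>2)"
      by (simp add: G_def)
  qed (auto simp: G_def)
  ultimately show ?thesis by simp
qed

lemma nn_integral_Poisson_kernel: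
  assumes z: "norm z < 1"
  shows "(\<integral>\<^sup>+e. ennreal ((1 - (norm z)\<^sup>2) / (norm (e - z))\<^sup>2) \<partial>circ) = 1"
proof -
  let ?P = "\<lambda>e. (1 - (norm z)\<^sup>2) / (norm (e - z))\<^sup>2"
  have z2: "(norm z)\<^sup>2 < 1" using z by (simp add: power_less_one_iff)
  have int: "integrable circ ?P"
    by (rule integrable_circ_continuous) (use z in \<open>auto intro!: continuous_intros\<close>)
  have "complex_of_real (LINT e|circ. ?P e) = (LINT e|circ. 1 * of_real (?P e))"
    by (simp only: mult_1 integral_complex_of_real)
  also have "\<dots> = 1" by (rule Poisson_circ[where R = 2]) (use z in auto)
  finally have "(LINT e|circ. ?P e) = 1" by (simp only: of_real_eq_1_iff)
  then show ?thesis
    using z2 by (subst nn_integral_eq_integral[OF int]) auto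
qed

text \<open>Young's inequality for convolution on the circle. All rotations of \<open>u\<close> have
  the same mean, so in \<open>Minkowski_weight\<close> the kernel itself can serve as the
  weight.\<close>

lemma circ_convolution:
  fixes k u v :: "complex \<Rightarrow> real"
  assumes p: "p > 1" and [measurable]: "k \<in> borel_measurable borel" "u \<in> borel_measurable borel"
    and nn: "\<And>z. 0 \<le> u z" "\<And>z. 0 \<le> v z" and k: "\<And>z. norm z = 1 \<Longrightarrow> 0 < k z"
    and A: "(\<integral>\<^sup>+e. ennreal (k e) \<partial>circ) \<le> ennreal A" "0 < A"
    and B: "(\<integral>\<^sup>+z. ennreal (u z powr p) \<partial>circ) \<le> ennreal B" "0 \<le> B"
    and v: "\<And>z. norm z = 1 \<Longrightarrow> ennreal (v z) \<le> (\<integral>\<^sup>+e. ennreal (u (z * e) * k e) \<partial>circ)"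
  shows "(\<integral>\<^sup>+z. ennreal (v z powr p) \<partial>circ) \<le> ennreal (B * A powr p)"
proof -
  \<comment> \<open>The weight must be positive on the whole space of \<open>circ\<close>, which is
    the plane; off the circle the value 1 is as good as any.\<close>
  define k' where "k' = (\<lambda>e::complex. if norm e = 1 then k e else 1)"
  have [measurable]: "k' \<in> borel_measurable borel" unfolding k'_def by measurable
  have k'pos: "0 < k' e" for e using k by (auto simp: k'_def)
  define u' where "u' = (\<lambda>z e. if norm e = 1 then u (z * e) * k' e else 0)"
  have [measurable]: "(\<lambda>(z, e). u' z e) \<in> borel_measurable (circ \<Otimes>\<^sub>M circ)"
    unfolding u'_def by measurable
  show ?thesis
  proof (rule Minkowski_weight[OF sigma_finite_circ sigma_finite_circ p, where w = k' and u = u'])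
    show "(\<lambda>(z, e). u' z e) \<in> borel_measurable (circ \<Otimes>\<^sub>M circ)" by measurable
    show "k' \<in> borel_measurable circ" by measurable
    show "0 \<le> u' z e" for z e using nn k'pos by (auto simp: u'_def less_imp_le)
    show "(\<integral>\<^sup>+e. ennreal (k' e) \<partial>circ) \<le> ennreal A"
      using A(1) by (subst nn_integral_circ_cong[where g = "\<lambda>e. ennreal (k e)"]) (auto simp: k'_def)
    show "AE z in circ. ennreal (v z) \<le> (\<integral>\<^sup>+e. ennreal (u' z e) \<partial>circ)"
    proof (rule AE_mp[OF AE_circ], intro AE_I2 impI)
      fix z :: complex assume "norm z = 1"
      then have "ennreal (v z) \<le> (\<integral>\<^sup>+e. ennreal (u (z * e) * k e) \<partial>circ)" by (rule v)
      also have "\<dots> = (\<integral>\<^sup>+e. ennreal (u' z e) \<partial>circ)"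
        by (rule nn_integral_circ_cong) (auto simp: u'_def k'_def)
      finally show "ennreal (v z) \<le> (\<integral>\<^sup>+e. ennreal (u' z e) \<partial>circ)" .
    qed
    show "(\<integral>\<^sup>+z. ennreal (u' z e powr p) \<partial>circ) \<le> ennreal (B * k' e powr p)" for e
    proof (cases "norm e = 1")
      case True
      have "(\<integral>\<^sup>+z. ennreal (u' z e powr p) \<partial>circ) = (\<integral>\<^sup>+z. ennreal (k' e powr p) * ennreal (u (e * z) powr p) \<partial>circ)"
        using True nn k'pos by (intro nn_integral_cong) (auto simp: u'_def powr_mult less_imp_le ennreal_mult ac_simps)
      also have "\<dots> = ennreal (k' e powr p) * (\<integral>\<^sup>+z. ennreal (u (e * z) powr p) \<partial>circ)"
        by (rule nn_integral_cmult) measurable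
      also have "(\<integral>\<^sup>+z. ennreal (u (e * z) powr p) \<partial>circ) = (\<integral>\<^sup>+z. ennreal (u z powr p) \<partial>circ)"
        by (rule nn_integral_circ_rotate[OF _ True]) measurable
      also have "ennreal (k' e powr p) * \<dots> \<le> ennreal (k' e powr p) * ennreal B"
        by (intro mult_left_mono B) auto
      finally show ?thesis using B by (simp add: ennreal_mult[symmetric] mult.commute)
    qed (use B in \<open>auto simp: u'_def\<close>)
  qed (use nn k'pos A B in auto)
qed

text \<open>Outside the disc a holomorphic function is an arbitrary total function, possibly not
  measurable. Cutting it off to 0 makes it Borel, as integrals over \<open>circ\<close> and over
  radii require.\<close>

definition disc_ext :: "(complex \<Rightarrow> complex) \<Rightarrow> complex \<Rightarrow> complex" where
  "disc_ext f z = (if z \<in> ball 0 1 then f z else 0)"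

text \<open>The p-th power of the mean, without the root and with infinity allowed, so that
  estimates can precede finiteness.\<close>

definition Lpow :: "real \<Rightarrow> (complex \<Rightarrow> complex) \<Rightarrow> ennreal" where
  "Lpow p u = (\<integral>\<^sup>+z. ennreal (norm (u z) powr p) \<partial>circ)"

lemma disc_ext_eq: "norm z < 1 \<Longrightarrow> disc_ext f z = f z"
  by (simp add: disc_ext_def)

lemma disc_ext_measurable:
  assumes "f holomorphic_on ball 0 1"
  shows "disc_ext f \<in> borel_measurable borel"
  unfolding disc_ext_def
  by (rule borel_measurable_continuous_on_if) (auto intro: holomorphic_on_imp_continuous_on[OF assms])

lemma disc_ext_holomorphic:
  assumes "f holomorphic_on ball 0 1"
  shows "disc_ext f holomorphic_on ball 0 1"
  using assms by (rule holomorphic_transform) (auto simp: disc_ext_def)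

lemma Lpow_cong:
  assumes "\<And>z. norm z = 1 \<Longrightarrow> u z = v z"
  shows "Lpow p u = Lpow p v"
  unfolding Lpow_def by (rule nn_integral_circ_cong) (use assms in auto)

lemma Lpow_mono:
  assumes "\<And>z. norm z = 1 \<Longrightarrow> norm (u z) \<le> norm (v z)" "p > 0"
  shows "Lpow p u \<le> Lpow p v"
  unfolding Lpow_def by (rule nn_integral_circ_mono) (use assms in \<open>auto intro!: powr_mono2\<close>)

lemma Lpow_rotate:
  assumes "u \<in> borel_measurable borel" "norm a = 1"
  shows "Lpow p (\<lambda>z. u (a * z)) = Lpow p u"
  unfolding Lpow_def by (rule nn_integral_circ_rotate) (use assms in measurable)

lemma Lpow_cmult:
  assumes "u \<in> borel_measurable borel"
  shows "Lpow p (\<lambda>z. c * u z) = ennreal (norm c powr p) * Lpow p u"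
proof -
  note assms [measurable]
  have "Lpow p (\<lambda>z. c * u z) = (\<integral>\<^sup>+z. ennreal (norm c powr p) * ennreal (norm (u z) powr p) \<partial>circ)"
    unfolding Lpow_def by (intro nn_integral_cong) (simp add: norm_mult powr_mult ennreal_mult)
  also have "\<dots> = ennreal (norm c powr p) * Lpow p u"
    unfolding Lpow_def by (rule nn_integral_cmult) measurable
  finally show ?thesis .
qed

lemma powr_add_le:
  fixes a b :: real
  assumes "0 \<le> a" "0 \<le> b" "0 < p"
  shows "(a + b) powr p \<le> 2 powr p * (a powr p + b powr p)"
proof -
  have "(a + b) powr p \<le> (2 * max a b) powr p" using assms by (intro powr_mono2) auto
  also have "\<dots> = 2 powr p * (max a b) powr p" using assms by (simp add: powr_mult)
  also have "\<dots> \<le> 2 powr p * (a powr p + b powr p)" by (intro mult_left_mono) (auto simp: max_def)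
  finally show ?thesis .
qed

lemma Lpow_add_le:
  assumes [measurable]: "u \<in> borel_measurable borel" "v \<in> borel_measurable borel" and p: "p > 0"
  shows "Lpow p (\<lambda>z. u z + v z) \<le> ennreal (2 powr p) * (Lpow p u + Lpow p v)"
proof -
  have "Lpow p (\<lambda>z. u z + v z) \<le> (\<integral>\<^sup>+z. ennreal (2 powr p) * (ennreal (norm (u z) powr p) + ennreal (norm (v z) powr p)) \<partial>circ)"
    unfolding Lpow_def
  proof (intro nn_integral_mono)
    fix z
    have "norm (u z + v z) powr p \<le> (norm (u z) + norm (v z)) powr p"
      using p by (intro powr_mono2 norm_triangle_ineq) auto
    also have "\<dots> \<le> 2 powr p * (norm (u z) powr p + norm (v z) powr p)"
      using p by (intro powr_add_le) auto
    finally show "ennreal (norm (u z + v z) powr p) \<le> ennreal (2 powr p) * (ennreal (norm (u z) powr p) + ennreal (norm (v z) powr p))"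
      by (simp add: ennreal_mult[symmetric] ennreal_plus[symmetric] del: ennreal_plus)
  qed
  also have "\<dots> = ennreal (2 powr p) * (Lpow p u + Lpow p v)"
    unfolding Lpow_def by (simp add: nn_integral_cmult nn_integral_add)
  finally show ?thesis .
qed

text \<open>The hypothesis \<open>si\<close> matters: for a non-integrable function the right-hand
  side would be the default value 0 of the Lebesgue integral.\<close>

lemma nn_integral_circ_eq_LINT:
  assumes si: "set_integrable lborel {0..2*pi} (\<lambda>t. \<phi> (cis t))" and [measurable]: "\<phi> \<in> borel_measurable borel" and nn: "\<And>z. 0 \<le> \<phi> z"
  shows "(\<integral>\<^sup>+z. ennreal (\<phi> z) \<partial>circ) = ennreal (1 / (2 * pi) * (LINT t:{0..2 * pi}|lebesgue. \<phi> (cis t)))"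
proof -
  have "(LINT t:{0..2 * pi}|lebesgue. \<phi> (cis t)) = (LINT t:{0..2 * pi}|lborel. \<phi> (cis t))"
    unfolding set_lebesgue_integral_def by (rule integral_completion) measurable
  moreover have "(\<integral>\<^sup>+t. ennreal (\<phi> (cis t)) * indicator {0..2 * pi} t \<partial>lborel) = ennreal (LINT t:{0..2 * pi}|lborel. \<phi> (cis t))"
  proof -
    have "(\<integral>\<^sup>+t. ennreal (\<phi> (cis t)) * indicator {0..2 * pi} t \<partial>lborel) = (\<integral>\<^sup>+t. ennreal (indicator {0..2 * pi} t *\<^sub>R \<phi> (cis t)) \<partial>lborel)"
      by (intro nn_integral_cong) (auto simp: indicator_def)
    also have "\<dots> = ennreal (LINT t:{0..2 * pi}|lborel. \<phi> (cis t))"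
      unfolding set_lebesgue_integral_def
      by (rule nn_integral_eq_integral) (use si nn in \<open>auto simp: set_integrable_def\<close>)
    finally show ?thesis .
  qed
  moreover have "0 \<le> (LINT t:{0..2 * pi}|lborel. \<phi> (cis t))"
    unfolding set_lebesgue_integral_def using nn by (intro Bochner_Integration.integral_nonneg) auto
  ultimately show ?thesis
    by (subst nn_integral_circ_angle) (auto simp: divide_ennreal)
qed

section \<open>Power means and the Hardy norm\<close>

lemma Lpow_integral_mean:
  assumes f: "f holomorphic_on ball 0 1" and r: "0 \<le> r" "r < 1" and p: "p > 0"
  shows "Lpow p (\<lambda>z. f (of_real r * z)) = ennreal (integral_mean p r f powr p)"
proof -
  have [measurable]: "disc_ext f \<in> borel_measurable borel" by (rule disc_ext_measurable[OF f])
  have eq: "disc_ext f (of_real r * cis t) = f (of_real r * cis t)" for t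
    using r by (intro disc_ext_eq) (simp add: norm_mult)
  have "Lpow p (\<lambda>z. f (of_real r * z)) = Lpow p (\<lambda>z. disc_ext f (of_real r * z))"
    using r by (intro Lpow_cong) (simp add: disc_ext_eq norm_mult)
  also have "\<dots> = ennreal (1 / (2 * pi) * (LINT t:{0..2 * pi}|lebesgue. norm (disc_ext f (of_real r * cis t)) powr p))"
    unfolding Lpow_def
  proof (rule nn_integral_circ_eq_LINT)
    have "continuous_on UNIV (\<lambda>t. f (of_real r * cis t))"
      by (rule continuous_on_compose2[OF holomorphic_on_imp_continuous_on[OF f]])
         (use r in \<open>auto intro!: continuous_intros simp: norm_mult\<close>)
    then have "continuous_on UNIV (\<lambda>t. norm (disc_ext f (of_real r * cis t)) powr p)"
      using p by (intro continuous_on_powr' continuous_intros) (auto simp: eq)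
    then show "set_integrable lborel {0..2*pi} (\<lambda>t. norm (disc_ext f (of_real r * cis t)) powr p)"
      by (intro borel_integrable_atLeastAtMost') (rule continuous_on_subset, auto)
  qed auto
  also have "\<dots> = ennreal (integral_mean p r f powr p)"
    unfolding integral_mean_def using p
    by (subst powr_powr) (auto simp: eq set_lebesgue_integral_def intro!: Bochner_Integration.integral_nonneg)
  finally show ?thesis .
qed

lemma integral_mean_nonneg: "0 \<le> integral_mean p r f"
  by (simp add: integral_mean_def)

lemma Lpow_hardy:
  assumes f: "f \<in> hardy_space p" and r: "0 < r" "r < 1" and p: "p > 0"
  shows "Lpow p (\<lambda>z. f (of_real r * z)) \<le> ennreal (hardy_norm p f powr p)"
proof -
  have hol: "f holomorphic_on ball 0 1" and bdd: "bdd_above ((\<lambda>r. integral_mean p r f) ` {0<..<1})"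
    using f by (auto simp: hardy_space_def)
  have "integral_mean p r f \<le> hardy_norm p f"
    unfolding hardy_norm_def using r bdd by (intro cSUP_upper) auto
  then show ?thesis
    using r p integral_mean_nonneg[of p r f] by (subst Lpow_integral_mean[OF hol]) (auto intro!: ennreal_leI powr_mono2)
qed

lemma hardy_norm_nonneg:
  assumes f: "f \<in> hardy_space p" shows "0 \<le> hardy_norm p f"
proof -
  have "integral_mean p (1/2) f \<le> hardy_norm p f"
    unfolding hardy_norm_def using f by (intro cSUP_upper) (auto simp: hardy_space_def)
  then show ?thesis using integral_mean_nonneg[of p "1/2" f] by linarith
qed

lemma hardyI:
  assumes f: "f holomorphic_on ball 0 1" and p: "p > 0" and B: "0 \<le> B"
    and le: "\<And>r. 0 < r \<Longrightarrow> r < 1 \<Longrightarrow> Lpow p (\<lambda>z. f (of_real r * z)) \<le> ennreal (B powr p)"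
  shows "f \<in> hardy_space p" "hardy_norm p f \<le> B"
proof -
  have m: "integral_mean p r f \<le> B" if "0 < r" "r < 1" for r
  proof -
    have "ennreal (integral_mean p r f powr p) \<le> ennreal (B powr p)"
      using le[OF that] Lpow_integral_mean[OF f _ _ p, of r] that by simp
    then have "integral_mean p r f powr p \<le> B powr p" by (simp add: ennreal_le_iff)
    then show ?thesis using powr_less_mono2[of p B "integral_mean p r f"] p B by force
  qed
  then show "f \<in> hardy_space p" using f by (auto simp: hardy_space_def intro!: bdd_aboveI[where M = B])
  show "hardy_norm p f \<le> B" unfolding hardy_norm_def by (rule cSUP_least) (use m in auto)
qed

section \<open>Dilation and differentiation as convolutions\<close>

lemma norm_rotate_diff:
  assumes "norm (z::complex) = 1"
  shows "norm (z * e - of_real t * z) = norm (e - of_real t)"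
proof -
  have "z * e - of_real t * z = z * (e - of_real t)" by (simp add: algebra_simps)
  then show ?thesis using assms by (simp add: norm_mult)
qed

lemma norm_rotate_kernel:
  assumes "norm (z::complex) = 1" "norm e = 1"
  shows "norm (1 - of_real t * z * cnj (z * e)) = norm (e - of_real t)"
  using norm_one_minus_cnj[of "z * e" "of_real t * z"] norm_rotate_diff[of z e t] assms by (simp add: norm_mult)

text \<open>Rotating the integration variable by \<open>z\<close> frees the kernel from
  \<open>z\<close>, which gives the shape that \<open>circ_convolution\<close> takes.\<close>

lemma Poisson_norm_bound:
  assumes [measurable]: "F \<in> borel_measurable borel" and hol: "F holomorphic_on ball 0 R" and R: "R > 1"
    and r: "0 \<le> r" "r < 1" and z: "norm z = 1"
  shows "ennreal (norm (F (of_real r * z))) \<le> (\<integral>\<^sup>+e. ennreal (norm (F (z * e)) * ((1 - r\<^sup>2) / (norm (e - of_real r))\<^sup>2)) \<partial>circ)"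
proof -
  have r2: "r\<^sup>2 < 1" using r by (simp add: power_less_one_iff)
  let ?P = "\<lambda>e. F e * of_real ((1 - (norm (of_real r * z))\<^sup>2) / (norm (e - of_real r * z))\<^sup>2)"
  have tz: "norm (of_real r * z) < 1" using r z by (simp add: norm_mult)
  have "F (of_real r * z) = (LINT e|circ. ?P e)"
    using Poisson_circ[OF _ hol R tz] by simp
  then have "ennreal (norm (F (of_real r * z))) = ennreal (norm (LINT e|circ. ?P e))" by simp
  also have "\<dots> \<le> (\<integral>\<^sup>+e. norm (?P e) \<partial>circ)"
  proof (rule integral_norm_bound_ennreal, rule integrable_circ_continuous)
    have "continuous_on (sphere 0 1) F"
      by (rule holomorphic_on_imp_continuous_on[OF holomorphic_on_subset[OF hol]]) (use R in auto)
    then show "continuous_on (sphere 0 1) ?P" using tz by (auto intro!: continuous_intros)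
  qed measurable
  also have "\<dots> = (\<integral>\<^sup>+e. norm (?P (z * e)) \<partial>circ)"
    by (rule nn_integral_circ_rotate[symmetric, OF _ z]) measurable
  also have "\<dots> = (\<integral>\<^sup>+e. ennreal (norm (F (z * e)) * ((1 - r\<^sup>2) / (norm (e - of_real r))\<^sup>2)) \<partial>circ)"
    using r2 z r by (intro nn_integral_cong) (simp only: norm_rotate_diff norm_mult norm_of_real, auto)
  finally show ?thesis .
qed

lemma Cauchy_deriv_norm_bound:
  assumes [measurable]: "F \<in> borel_measurable borel" and hol: "F holomorphic_on ball 0 R" and R: "R > 1"
    and t: "0 \<le> t" "t < 1" and z: "norm z = 1"
  shows "ennreal (norm (deriv F (of_real t * z))) \<le> (\<integral>\<^sup>+e. ennreal (norm (F (z * e)) * (1 / (norm (e - of_real t))\<^sup>2)) \<partial>circ)"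
proof -
  let ?P = "\<lambda>e. F e * cnj e / (1 - of_real t * z * cnj e)\<^sup>2"
  have tz: "norm (of_real t * z) < 1" using t z by (simp add: norm_mult)
  have "deriv F (of_real t * z) = (LINT e|circ. ?P e)"
    using Cauchy_deriv_circ[OF _ hol R tz] by simp
  then have "ennreal (norm (deriv F (of_real t * z))) = ennreal (norm (LINT e|circ. ?P e))" by simp
  also have "\<dots> \<le> (\<integral>\<^sup>+e. norm (?P e) \<partial>circ)"
  proof (rule integral_norm_bound_ennreal, rule integrable_circ_continuous)
    have c: "continuous_on (sphere 0 1) F"
      by (rule holomorphic_on_imp_continuous_on[OF holomorphic_on_subset[OF hol]]) (use R in auto)
    show "continuous_on (sphere 0 1) ?P"
    proof (intro continuous_intros c)
      show "\<forall>e\<in>sphere 0 1. (1 - of_real t * z * cnj e)\<^sup>2 \<noteq> 0"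
      proof
        fix e :: complex assume e: "e \<in> sphere 0 1"
        have "norm (1 - of_real t * z * cnj e) = norm (e - of_real t * z)"
          by (rule norm_one_minus_cnj) (use e in simp)
        moreover have "e \<noteq> of_real t * z" using e tz by auto
        ultimately show "(1 - of_real t * z * cnj e)\<^sup>2 \<noteq> 0" by auto
      qed
    qed
  qed measurable
  also have "\<dots> = (\<integral>\<^sup>+e. norm (?P (z * e)) \<partial>circ)"
    by (rule nn_integral_circ_rotate[symmetric, OF _ z]) measurable
  also have "\<dots> = (\<integral>\<^sup>+e. ennreal (norm (F (z * e)) * (1 / (norm (e - of_real t))\<^sup>2)) \<partial>circ)"
  proof (rule nn_integral_circ_cong)
    fix e :: complex assume e: "norm e = 1"
    have "norm (?P (z * e)) = norm (F (z * e)) / (norm (1 - of_real t * z * cnj (z * e)))\<^sup>2"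
      using z e by (simp add: norm_mult norm_divide norm_power)
    then show "ennreal (norm (?P (z * e))) = ennreal (norm (F (z * e)) * (1 / (norm (e - of_real t))\<^sup>2))"
      by (simp only: norm_rotate_kernel[OF z e]) simp
  qed
  finally show ?thesis .
qed

text \<open>The kernel is the Poisson kernel divided by \<open>1 - t\<^sup>2\<close>, and the latter
  is at least \<open>1 - t\<close>.\<close>

lemma circ_kernel_mass:
  assumes t: "0 \<le> t" "t < 1"
  shows "(\<integral>\<^sup>+e. ennreal (1 / (norm (e - of_real t))\<^sup>2) \<partial>circ) \<le> ennreal (1 / (1 - t))"
proof -
  have t2: "t\<^sup>2 < 1" using t by (simp add: power_less_one_iff)
  have "(\<integral>\<^sup>+e. ennreal (1 / (norm (e - complex_of_real t))\<^sup>2) \<partial>circ) = (\<integral>\<^sup>+e. ennreal (1 / (1 - t\<^sup>2)) * ennreal ((1 - (norm (complex_of_real t))\<^sup>2) / (norm (e - complex_of_real t))\<^sup>2) \<partial>circ)"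
    using t2 by (intro nn_integral_cong) (simp add: ennreal_mult[symmetric])
  also have "\<dots> = ennreal (1 / (1 - t\<^sup>2))"
    using t nn_integral_Poisson_kernel[of "of_real t"] by (subst nn_integral_cmult) auto
  also have "\<dots> \<le> ennreal (1 / (1 - t))"
    using t t2 by (intro ennreal_leI divide_left_mono mult_pos_pos) (auto simp: power2_eq_square mult_left_le_one_le)
  finally show ?thesis .
qed

text \<open>Dilation is dominated by convolution with a Poisson kernel, whose mass is 1.\<close>

lemma Lpow_dilate_le:
  assumes [measurable]: "F \<in> borel_measurable borel" and hol: "F holomorphic_on ball 0 R" and R: "R > 1"
    and t: "0 \<le> t" "t < 1" and p: "p > 1"
  shows "Lpow p (\<lambda>z. F (of_real t * z)) \<le> Lpow p F"
proof (cases "Lpow p F = \<infinity>")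
  case False
  then obtain B where B: "0 \<le> B" "Lpow p F = ennreal B" by (cases "Lpow p F") auto
  have t2: "t\<^sup>2 < 1" using t by (simp add: power_less_one_iff)
  define k where "k = (\<lambda>e::complex. (1 - t\<^sup>2) / (norm (e - of_real t))\<^sup>2)"
  have [measurable]: "k \<in> borel_measurable borel" unfolding k_def by measurable
  have "(\<integral>\<^sup>+z. ennreal (norm (F (of_real t * z)) powr p) \<partial>circ) \<le> ennreal (B * 1 powr p)"
  proof (rule circ_convolution[OF p, where k = k and u = "\<lambda>z. norm (F z)"])
    show "0 < k z" if "norm z = 1" for z
      using t t2 that by (auto simp: k_def intro!: divide_pos_pos)
    show "(\<integral>\<^sup>+e. ennreal (k e) \<partial>circ) \<le> ennreal 1"
      using nn_integral_Poisson_kernel[of "of_real t"] t by (simp add: k_def)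
    show "(\<integral>\<^sup>+z. ennreal (norm (F z) powr p) \<partial>circ) \<le> ennreal B" using B by (simp add: Lpow_def)
    show "ennreal (norm (F (of_real t * z))) \<le> (\<integral>\<^sup>+e. ennreal (norm (F (z * e)) * k e) \<partial>circ)" if "norm z = 1" for z
      unfolding k_def by (rule Poisson_norm_bound[OF _ hol R t that]) measurable
  qed (use B in auto)
  then show ?thesis using B by (simp add: Lpow_def)
qed auto

text \<open>Cauchy's formula for the derivative is a convolution with a kernel of mass at most
  \<open>1 / (1 - t)\<close>.\<close>

lemma Lpow_deriv_le:
  assumes [measurable]: "F \<in> borel_measurable borel" and hol: "F holomorphic_on ball 0 R" and R: "R > 1"
    and t: "0 \<le> t" "t < 1" and p: "p > 1" and B: "Lpow p F \<le> ennreal B" "0 \<le> B"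
  shows "Lpow p (\<lambda>z. deriv F (of_real t * z)) \<le> ennreal (B * (1 / (1 - t)) powr p)"
proof -
  define k where "k = (\<lambda>e::complex. 1 / (norm (e - of_real t))\<^sup>2)"
  have [measurable]: "k \<in> borel_measurable borel" unfolding k_def by measurable
  show ?thesis unfolding Lpow_def
  proof (rule circ_convolution[OF p, where k = k and u = "\<lambda>z. norm (F z)"])
    show "0 < k z" if "norm z = 1" for z
      using t that by (auto simp: k_def intro!: divide_pos_pos)
    show "(\<integral>\<^sup>+e. ennreal (k e) \<partial>circ) \<le> ennreal (1 / (1 - t))"
      unfolding k_def by (rule circ_kernel_mass[OF t])
    show "(\<integral>\<^sup>+z. ennreal (norm (F z) powr p) \<partial>circ) \<le> ennreal B" using B by (simp add: Lpow_def)
    show "ennreal (norm (deriv F (of_real t * z))) \<le> (\<integral>\<^sup>+e. ennreal (norm (F (z * e)) * k e) \<partial>circ)" if "norm z = 1" for z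
      unfolding k_def by (rule Cauchy_deriv_norm_bound[OF _ hol R t that]) measurable
  qed (use B t in auto)
qed

lemma dilate_holomorphic:
  assumes "F holomorphic_on ball 0 1" and "0 < s"
  shows "(\<lambda>z. F (of_real s * z)) holomorphic_on ball 0 (1 / s)"
proof -
  have "(F \<circ> (\<lambda>z. of_real s * z)) holomorphic_on ball 0 (1 / s)"
    by (rule holomorphic_on_compose_gen[OF _ assms(1)])
       (use assms in \<open>auto intro!: holomorphic_intros simp: norm_mult field_simps\<close>)
  then show ?thesis by (simp add: o_def)
qed

lemma deriv_dilate:
  assumes F: "F holomorphic_on ball 0 1" and w: "norm (of_real s * w) < 1"
  shows "deriv (\<lambda>z. disc_ext F (of_real s * z)) w = of_real s * deriv F (of_real s * w)"
proof -
  have "(F has_field_derivative deriv F (of_real s * w)) (at (of_real s * w))"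
    by (intro holomorphic_derivI[OF F]) (use w in auto)
  then have "(disc_ext F has_field_derivative deriv F (of_real s * w)) (at (of_real s * w))"
    by (rule has_field_derivative_transform_within_open[where S = "ball 0 1"]) (use w in \<open>auto simp: disc_ext_def\<close>)
  moreover have "((\<lambda>w. of_real s * w) has_field_derivative of_real s) (at w)"
    by (auto intro!: derivative_eq_intros)
  ultimately have "((\<lambda>w. disc_ext F (of_real s * w)) has_field_derivative deriv F (of_real s * w) * of_real s) (at w)"
    by (rule DERIV_chain2)
  then have "deriv (\<lambda>z. disc_ext F (of_real s * z)) w = deriv F (of_real s * w) * of_real s"
    by (rule DERIV_imp_deriv)
  then show ?thesis by (simp only: mult.commute)
qed

lemma Lpow_mono_radius:
  assumes F: "F holomorphic_on ball 0 1" and r: "0 \<le> r" "r \<le> s" "s < 1" and p: "p > 1"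
  shows "Lpow p (\<lambda>z. F (of_real r * z)) \<le> Lpow p (\<lambda>z. F (of_real s * z))"
proof (cases "r = s")
  case False
  then have s: "0 < s" using r by auto
  have [measurable]: "disc_ext F \<in> borel_measurable borel" by (rule disc_ext_measurable[OF F])
  have "Lpow p (\<lambda>z. F (of_real r * z)) = Lpow p (\<lambda>z. disc_ext F (of_real s * (of_real (r / s) * z)))"
    using r s by (intro Lpow_cong) (simp add: disc_ext_eq norm_mult)
  also have "\<dots> \<le> Lpow p (\<lambda>z. disc_ext F (of_real s * z))"
    by (rule Lpow_dilate_le[OF _ dilate_holomorphic[OF disc_ext_holomorphic[OF F] s]]) (use r s p False in auto)
  also have "\<dots> = Lpow p (\<lambda>z. F (of_real s * z))"
    using r s by (intro Lpow_cong) (simp add: disc_ext_eq norm_mult)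
  finally show ?thesis .
qed simp

text \<open>Cauchy's formula on the circle of radius \<open>s\<close> halfway between
  \<open>r\<close> and 1: since \<open>s - r = (1 - r) / 2\<close>, one derivative costs a factor
  \<open>2 / (1 - r)\<close> in the mean.\<close>

lemma Lpow_deriv_growth:
  assumes F: "F holomorphic_on ball 0 1" and p: "p > 1" and B: "0 \<le> B"
    and le: "\<And>s. 0 < s \<Longrightarrow> s < 1 \<Longrightarrow> Lpow p (\<lambda>z. F (of_real s * z)) \<le> ennreal B" and r: "0 \<le> r" "r < 1"
  shows "Lpow p (\<lambda>z. deriv F (of_real r * z)) \<le> ennreal (B * (2 / (1 - r)) powr p)"
proof -
  define s where "s = (1 + r) / 2"
  have s: "0 < s" "r < s" "s < 1" using r by (auto simp: s_def)
  define G where "G = (\<lambda>z. disc_ext F (of_real s * z))"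
  have [measurable]: "disc_ext F \<in> borel_measurable borel" by (rule disc_ext_measurable[OF F])
  have [measurable]: "G \<in> borel_measurable borel" unfolding G_def by measurable
  have G: "G holomorphic_on ball 0 (1 / s)"
    unfolding G_def by (rule dilate_holomorphic[OF disc_ext_holomorphic[OF F] s(1)])
  have dG: "deriv G (of_real (r / s) * z) = of_real s * deriv F (of_real r * z)" if "norm z = 1" for z
    unfolding G_def using deriv_dilate[OF F, of s "of_real (r / s) * z"] that r s by (simp add: norm_mult)
  have Bs: "Lpow p G \<le> ennreal B"
  proof -
    have "Lpow p G = Lpow p (\<lambda>z. F (of_real s * z))"
      using s by (intro Lpow_cong) (simp add: G_def disc_ext_eq norm_mult)
    then show ?thesis using le[OF s(1,3)] by simp
  qed
  have "ennreal (s powr p) * Lpow p (\<lambda>z. deriv F (of_real r * z)) \<le> ennreal (B * (1 / (1 - r / s)) powr p)"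
  proof -
    have "disc_ext (deriv F) \<in> borel_measurable borel" by (intro disc_ext_measurable holomorphic_deriv F) auto
    then have [measurable]: "(\<lambda>z. disc_ext (deriv F) (of_real r * z)) \<in> borel_measurable borel" by measurable
    have "ennreal (s powr p) * Lpow p (\<lambda>z. deriv F (of_real r * z)) = ennreal (norm (complex_of_real s) powr p) * Lpow p (\<lambda>z. disc_ext (deriv F) (of_real r * z))"
    proof -
      have "Lpow p (\<lambda>z. deriv F (of_real r * z)) = Lpow p (\<lambda>z. disc_ext (deriv F) (of_real r * z))"
        using r by (intro Lpow_cong) (simp add: disc_ext_eq norm_mult)
      then show ?thesis using s by simp
    qed
    also have "\<dots> = Lpow p (\<lambda>z. of_real s * disc_ext (deriv F) (of_real r * z))"
      by (rule Lpow_cmult[symmetric]) measurable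
    also have "\<dots> = Lpow p (\<lambda>z. deriv G (of_real (r / s) * z))"
      using r by (intro Lpow_cong, subst dG) (auto simp: disc_ext_eq norm_mult)
    also have "\<dots> \<le> ennreal (B * (1 / (1 - r / s)) powr p)"
      by (rule Lpow_deriv_le[OF _ G _ _ _ p Bs B]) (use r s in auto)
    finally show ?thesis .
  qed
  then have "ennreal (s powr (- p)) * (ennreal (s powr p) * Lpow p (\<lambda>z. deriv F (of_real r * z))) \<le> ennreal (s powr (- p)) * ennreal (B * (1 / (1 - r / s)) powr p)"
    by (intro mult_left_mono) auto
  moreover have "ennreal (s powr (- p)) * (ennreal (s powr p) * Lpow p (\<lambda>z. deriv F (of_real r * z))) = Lpow p (\<lambda>z. deriv F (of_real r * z))"
    using s by (subst mult.assoc[symmetric]) (simp add: ennreal_mult[symmetric] powr_add[symmetric])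
  moreover have "ennreal (s powr (- p)) * ennreal (B * (1 / (1 - r / s)) powr p) = ennreal (B * (2 / (1 - r)) powr p)"
  proof -
    have "s powr (- p) * (1 / (1 - r / s)) powr p = (1/s) powr p * (1 / (1 - r / s)) powr p"
      using s by (simp add: powr_minus powr_divide field_simps)
    also have "\<dots> = ((1/s) * (1 / (1 - r / s))) powr p" by (rule powr_mult[symmetric])
    also have "(1/s) * (1 / (1 - r / s)) = 1 / (s - r)" using s by (simp add: field_simps)
    also have "s - r = (1 - r) / 2" by (simp add: s_def)
    finally show ?thesis using B by (simp add: ennreal_mult[symmetric] mult.left_commute)
  qed
  ultimately show ?thesis by simp
qed

section \<open>Necessity: test functions\<close>

text \<open>The growth \<open>(1 - r) powr (1/p - 1)\<close> of the mean of \<open>deriv g\<close>,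
  raised to the power \<open>p\<close>.\<close>

definition derivative_growth :: "real \<Rightarrow> (complex \<Rightarrow> complex) \<Rightarrow> bool" where
  "derivative_growth p g \<longleftrightarrow>
     (\<exists>K\<ge>0. \<forall>r. 0 \<le> r \<longrightarrow> r < 1 \<longrightarrow> Lpow p (\<lambda>z. deriv g (of_real r * z)) \<le> ennreal (K * (1 - r) powr (1 - p)))"

lemma norm_one_minus_ge:
  assumes "0 \<le> a" "a < 1" "norm z \<le> 1"
  shows "1 - a \<le> norm (1 - of_real a * z :: complex)"
proof -
  have "norm (of_real a * z) \<le> a" using assms by (simp add: norm_mult mult_left_le)
  then show ?thesis using norm_triangle_ineq2[of 1 "of_real a * z"] by simp
qed

lemma norm_of_real_mult_less:
  assumes "0 \<le> t" "t \<le> 1" "norm w < 1"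
  shows "norm (of_real t * w :: complex) < 1"
  using assms mult_left_le_one_le[of "norm w" t] by (simp add: norm_mult)

text \<open>Of the exponent \<open>real m * p\<close> of the denominator, 2 is kept for a kernel of
  mass at most \<open>1 / (1 - a)\<close>; the nonnegative rest is estimated pointwise, the
  denominator being at least \<open>1 - a\<close>.\<close>

lemma Lpow_test_function:
  assumes a: "0 \<le> a" "a < 1" and r: "0 \<le> r" "r < 1" and m: "2 \<le> real m * p" and p: "p > 0"
  shows "Lpow p (\<lambda>z. 1 / (1 - of_real a * (of_real r * z)) ^ m) \<le> ennreal ((1 - a) powr (1 - real m * p))"
proof -
  let ?b = "a * r"
  have b: "0 \<le> ?b" "?b < 1" "?b \<le> a" using a r
    by (auto simp: mult_left_le intro: le_less_trans[OF mult_left_le])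
  have "Lpow p (\<lambda>z. 1 / (1 - of_real a * (of_real r * z)) ^ m)
    \<le> (\<integral>\<^sup>+e. ennreal ((1 - a) powr (2 - real m * p)) * ennreal (1 / (norm (e - of_real ?b))\<^sup>2) \<partial>circ)"
    unfolding Lpow_def
  proof (rule nn_integral_circ_mono)
    fix z :: complex assume z: "norm z = 1"
    define x where "x = norm (1 - of_real ?b * z)"
    have xa: "1 - a \<le> x" unfolding x_def using norm_one_minus_ge[of ?b z] b z by simp
    then have x: "x > 0" using a by simp
    have "x = norm (z - of_real ?b)"
      using norm_one_minus_cnj[of "cnj z" "of_real ?b"] z
      by (metis complex_cnj_cnj complex_cnj_complex_of_real complex_cnj_diff complex_mod_cnj x_def)
    moreover have "norm (1 / (1 - of_real a * (of_real r * z)) ^ m) powr p = x powr (- (real m * p))"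
    proof -
      have "norm (1 / (1 - of_real a * (of_real r * z)) ^ m) = 1 / x ^ m"
        by (simp add: x_def norm_divide norm_power mult.assoc)
      also have "\<dots> = x powr (- real m)" using x by (simp add: powr_minus powr_realpow divide_inverse)
      finally show ?thesis by (simp add: powr_powr)
    qed
    moreover have "x powr (- (real m * p)) = x powr (2 - real m * p) * x powr (- 2)" by (simp add: powr_add[symmetric])
    moreover have "x powr (2 - real m * p) \<le> (1 - a) powr (2 - real m * p)"
      using xa a m by (intro powr_mono2') auto
    moreover have "x powr (-2) = 1 / x\<^sup>2" using x by (simp add: powr_minus powr_numeral divide_inverse)
    ultimately show "ennreal (norm (1 / (1 - of_real a * (of_real r * z)) ^ m) powr p)
      \<le> ennreal ((1 - a) powr (2 - real m * p)) * ennreal (1 / (norm (z - of_real ?b))\<^sup>2)"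
      by (simp add: ennreal_mult[symmetric] ennreal_leI divide_right_mono)
  qed
  also have "\<dots> = ennreal ((1 - a) powr (2 - real m * p)) * (\<integral>\<^sup>+e. ennreal (1 / (norm (e - complex_of_real ?b))\<^sup>2) \<partial>circ)"
    by (rule nn_integral_cmult) measurable
  also have "\<dots> \<le> ennreal ((1 - a) powr (2 - real m * p)) * ennreal (1 / (1 - ?b))"
    by (intro mult_left_mono circ_kernel_mass b) auto
  also have "\<dots> \<le> ennreal ((1 - a) powr (2 - real m * p)) * ennreal (1 / (1 - a))"
    using a b by (intro mult_left_mono ennreal_leI divide_left_mono) auto
  also have "\<dots> = ennreal ((1 - a) powr (1 - real m * p))"
  proof -
    have "(1 - a) powr (2 - real m * p) * (1 / (1 - a)) = (1 - a) powr (1 - real m * p)"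
      using a powr_diff[of "1 - a" "2 - real m * p" 1] by simp
    then show ?thesis using a by (simp add: ennreal_mult[symmetric])
  qed
  finally show ?thesis .
qed

lemma generalized_Hilbert_eq_integral:
  assumes f: "f holomorphic_on ball 0 R" "R > 1" and g: "g holomorphic_on ball 0 1" and w: "norm w < 1"
  shows "generalized_Hilbert g f w = integral {0..1} (\<lambda>t. f (of_real t) * deriv g (of_real t * w))"
proof -
  have "deriv g holomorphic_on ball 0 1" by (intro holomorphic_deriv g) auto
  then have c: "continuous_on (ball 0 1) (deriv g)" by (rule holomorphic_on_imp_continuous_on)
  have "continuous_on {0..1} (\<lambda>t. f (complex_of_real t) * deriv g (of_real t * w))"
  proof (intro continuous_on_mult continuous_on_compose2[OF c] continuous_on_compose2[OF holomorphic_on_imp_continuous_on[OF f(1)]] continuous_intros)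
    show "(\<lambda>x. complex_of_real x * w) ` {0..1} \<subseteq> ball 0 1"
      using w by (auto intro!: norm_of_real_mult_less)
  qed (use f(2) in auto)
  then have "(\<lambda>t. f (complex_of_real t) * deriv g (of_real t * w)) absolutely_integrable_on {0..1}"
    by (rule absolutely_integrable_continuous_real)
  then have "set_integrable lebesgue {0..<1} (\<lambda>t. f (complex_of_real t) * deriv g (of_real t * w))"
    by (rule set_integrable_subset) auto
  then have "generalized_Hilbert g f w = integral {0..<1} (\<lambda>t. f (of_real t) * deriv g (of_real t * w))"
    unfolding generalized_Hilbert_def by (rule set_lebesgue_integral_eq_integral)
  also have "\<dots> = integral {0..1} (\<lambda>t. f (of_real t) * deriv g (of_real t * w))"
  proof (rule integral_spike_set)
    have *: "{0..<1} - {0..1::real} = {}" "{0..1::real} - {0..<1} = {1}" by auto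
    show "negligible {x \<in> {0..<1} - {0..1}. f (complex_of_real x) * deriv g (of_real x * w) \<noteq> 0}" by (simp add: *)
    show "negligible {x \<in> {0..1} - {0..<1}. f (complex_of_real x) * deriv g (of_real x * w) \<noteq> 0}"
      by (rule negligible_subset[of "{1}"]) (auto simp: *)
  qed
  finally show ?thesis .
qed

text \<open>Integration by parts of the \<open>t\<close>-derivative of \<open>t * f t * deriv g (t * w)\<close>; it isolates \<open>deriv g w\<close>.\<close>

lemma generalized_Hilbert_by_parts:
  assumes f: "f holomorphic_on ball 0 R" "R > 1" and g: "g holomorphic_on ball 0 1" and w: "norm w < 1"
  shows "f 1 * deriv g w = generalized_Hilbert g f w + w * deriv (generalized_Hilbert g f) w
     + generalized_Hilbert g (\<lambda>z. z * deriv f z) w"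
proof -
  let ?g1 = "deriv g" and ?g2 = "deriv (deriv g)"
  have h1: "?g1 holomorphic_on ball 0 1" by (intro holomorphic_deriv g) auto
  have h2: "?g2 holomorphic_on ball 0 1" by (intro holomorphic_deriv h1) auto
  have hf: "deriv f holomorphic_on ball 0 R" by (intro holomorphic_deriv f) auto
  note c = holomorphic_on_imp_continuous_on[OF h1] holomorphic_on_imp_continuous_on[OF h2]
    holomorphic_on_imp_continuous_on[OF f(1)] holomorphic_on_imp_continuous_on[OF hf]
  have tx: "norm (of_real t * x) < 1" if "t \<in> {0..1}" "norm x < 1" for t :: real and x :: complex
    using that by (auto intro!: norm_of_real_mult_less)
  have w': "w \<in> ball 0 1" using w by simp
  have Heq: "integral {0..1} (\<lambda>t. f (of_real t) * ?g1 (of_real t * x)) = generalized_Hilbert g f x" if "x \<in> ball 0 1" for x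
    by (rule generalized_Hilbert_eq_integral[OF f g, symmetric]) (use that in simp)
  have cf: "continuous_on {0..1} (\<lambda>t. f (of_real t))" "continuous_on {0..1} (\<lambda>t. deriv f (of_real t))"
    using f(2) by (auto intro!: continuous_on_compose2[OF c(3)] continuous_on_compose2[OF c(4)] continuous_intros)
  have cg: "continuous_on {0..1} (\<lambda>t. ?g1 (of_real t * x))" "continuous_on {0..1} (\<lambda>t. ?g2 (of_real t * x))" if "norm x < 1" for x
    using tx[OF _ that] by (auto intro!: continuous_on_compose2[OF c(1)] continuous_on_compose2[OF c(2)] continuous_intros)
  have "((\<lambda>x. integral (cbox 0 1) (\<lambda>t. f (of_real t) * ?g1 (of_real t * x))) has_field_derivative
      integral (cbox 0 1) (\<lambda>t. f (of_real t) * (of_real t * ?g2 (of_real t * w)))) (at w within ball 0 1)"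
  proof (rule leibniz_rule_field_derivative)
    fix x :: complex and t :: real assume x: "x \<in> ball 0 1" and t: "t \<in> cbox 0 1"
    have "(?g1 has_field_derivative ?g2 (of_real t * x)) (at (of_real t * x))"
      using tx[of t x] x t by (intro holomorphic_derivI[OF h1]) auto
    moreover have "((\<lambda>x. of_real t * x) has_field_derivative of_real t) (at x within ball 0 1)"
      by (auto intro!: derivative_eq_intros)
    ultimately have "((\<lambda>x. ?g1 (of_real t * x)) has_field_derivative ?g2 (of_real t * x) * of_real t) (at x within ball 0 1)"
      by (rule DERIV_chain2)
    from DERIV_cmult[OF this, of "f (of_real t)"]
    show "((\<lambda>x. f (of_real t) * ?g1 (of_real t * x)) has_field_derivative f (of_real t) * (of_real t * ?g2 (of_real t * x))) (at x within ball 0 1)"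
      by (simp add: mult_ac)
  next
    fix x :: complex assume "x \<in> ball 0 1"
    then show "(\<lambda>t. f (of_real t) * ?g1 (of_real t * x)) integrable_on cbox 0 1"
      by (auto intro!: integrable_continuous_real continuous_intros cf cg)
  next
    show "continuous_on (ball 0 1 \<times> cbox 0 1) (\<lambda>(x, t). f (of_real t) * (of_real t * ?g2 (of_real t * x)))"
      unfolding split_beta using tx f(2)
      by (intro continuous_on_mult continuous_on_compose2[OF c(2)] continuous_on_compose2[OF c(3)] continuous_intros) auto
  qed (use w in auto)
  then have "((\<lambda>x. integral {0..1} (\<lambda>t. f (of_real t) * ?g1 (of_real t * x))) has_field_derivative
      integral {0..1} (\<lambda>t. f (of_real t) * (of_real t * ?g2 (of_real t * w)))) (at w)"
    by (simp only: at_within_open[OF w' open_ball] box_real)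
  then have "(generalized_Hilbert g f has_field_derivative
      integral {0..1} (\<lambda>t. f (of_real t) * (of_real t * ?g2 (of_real t * w)))) (at w)"
    by (rule has_field_derivative_transform_within_open[where S = "ball 0 1"
          and f = "\<lambda>x. integral {0..1} (\<lambda>t. f (of_real t) * ?g1 (of_real t * x))", OF _ open_ball w' Heq])
  then have d: "deriv (generalized_Hilbert g f) w = integral {0..1} (\<lambda>t. f (of_real t) * (of_real t * ?g2 (of_real t * w)))"
    by (rule DERIV_imp_deriv)
  \<comment> \<open>The product rule for \<open>t * f t * deriv g (t * w)\<close>: \<open>?a\<close>
    comes from the factor \<open>t\<close>, \<open>?b\<close> from \<open>deriv g\<close> and
    \<open>?c\<close> from \<open>f\<close>. The factor \<open>t\<close> removes the boundary term
    at 0.\<close>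
  let ?a = "\<lambda>t::real. f (of_real t) * ?g1 (of_real t * w)"
  let ?b = "\<lambda>t::real. w * (f (of_real t) * (of_real t * ?g2 (of_real t * w)))"
  let ?c = "\<lambda>t::real. of_real t * deriv f (of_real t) * ?g1 (of_real t * w)"
  have i: "?a integrable_on {0..1}" "?b integrable_on {0..1}" "?c integrable_on {0..1}"
    by (intro integrable_continuous_real continuous_intros cf cg w)+
  have "((\<lambda>t. ?a t + ?b t + ?c t) has_integral (of_real 1 * f (of_real 1) * ?g1 (of_real 1 * w) - of_real 0 * f (of_real 0) * ?g1 (of_real 0 * w))) {0..1}"
  proof (rule fundamental_theorem_of_calculus)
    fix t :: real assume t: "t \<in> {0..1}"
    have 1: "(f has_field_derivative deriv f (of_real t)) (at (of_real t))"
      using t f(2) by (intro holomorphic_derivI[OF f(1)]) auto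
    have "(?g1 has_field_derivative ?g2 (of_real t * w)) (at (of_real t * w))"
      using tx[OF t w] by (intro holomorphic_derivI[OF h1]) auto
    moreover have "((\<lambda>x. x * w) has_field_derivative w) (at (of_real t))" by (auto intro!: derivative_eq_intros)
    ultimately have 2: "((\<lambda>x. ?g1 (x * w)) has_field_derivative ?g2 (of_real t * w) * w) (at (of_real t))"
      by (rule DERIV_chain2)
    have "((\<lambda>x. x * f x * ?g1 (x * w)) has_field_derivative ?a t + ?b t + ?c t) (at (of_real t))"
      by (rule DERIV_cong[OF DERIV_mult[OF DERIV_mult[OF DERIV_ident 1] 2]]) (simp add: algebra_simps)
    then show "((\<lambda>t. of_real t * f (of_real t) * ?g1 (of_real t * w)) has_vector_derivative ?a t + ?b t + ?c t) (at t within {0..1})"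
      by (rule has_vector_derivative_real_field[THEN has_vector_derivative_at_within])
  qed simp
  then have "f 1 * ?g1 w = integral {0..1} (\<lambda>t. ?a t + ?b t + ?c t)" by (simp add: integral_unique)
  also have "\<dots> = integral {0..1} ?a + integral {0..1} ?b + integral {0..1} ?c"
    using i by (simp add: integral_add integrable_add)
  also have "integral {0..1} ?b = w * deriv (generalized_Hilbert g f) w" by (simp add: d)
  also have "integral {0..1} ?a = generalized_Hilbert g f w"
    by (rule generalized_Hilbert_eq_integral[OF f g w, symmetric])
  also have "integral {0..1} ?c = generalized_Hilbert g (\<lambda>z. z * deriv f z) w"
    by (rule generalized_Hilbert_eq_integral[OF _ f(2) g w, symmetric]) (intro holomorphic_intros hf)
  finally show ?thesis .
qed

text \<open>Put \<open>d = 1 - a\<close>. For the test function all three terms of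
  \<open>generalized_Hilbert_by_parts\<close> have p-th power mean of order at most
  \<open>d powr (1 - 3 * p)\<close>: a derivative, whether taken of the test function or of its
  image, costs \<open>d powr (- p)\<close>. Division by the value \<open>1 / d\<^sup>2\<close> at 1
  brings in \<open>d powr (2 * p)\<close>, which leaves \<open>d powr (1 - p)\<close>.\<close>

lemma derivative_growth_if_bounded:
  assumes p: "1 < p" and g: "g holomorphic_on ball 0 1"
    and bd: "bounded_on_hardy_space p (generalized_Hilbert g)"
  shows "derivative_growth p g"
proof -
  from bd obtain C0 where C0: "\<And>f. f \<in> hardy_space p \<Longrightarrow> generalized_Hilbert g f \<in> hardy_space p \<and>
      hardy_norm p (generalized_Hilbert g f) \<le> C0 * hardy_norm p f"
    unfolding bounded_on_hardy_space_def by blast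
  \<comment> \<open>The bound in \<open>bounded_on_hardy_space\<close> may a priori be
    negative.\<close>
  define C where "C = max C0 0"
  have C: "0 \<le> C" by (simp add: C_def)
  have H: "Lpow p (\<lambda>z. generalized_Hilbert g f (of_real r * z)) \<le> ennreal (C powr p * B)"
    "generalized_Hilbert g f holomorphic_on ball 0 1"
    if f: "f holomorphic_on ball 0 1" and B: "0 \<le> B"
      and le: "\<And>r. 0 < r \<Longrightarrow> r < 1 \<Longrightarrow> Lpow p (\<lambda>z. f (of_real r * z)) \<le> ennreal B" and r: "0 < r" "r < 1" for f B r
  proof -
    have le': "Lpow p (\<lambda>z. f (of_real r * z)) \<le> ennreal ((B powr (1/p)) powr p)" if "0 < r" "r < 1" for r
      using le[OF that] p B by (simp add: powr_powr)
    have f': "f \<in> hardy_space p" and n: "hardy_norm p f \<le> B powr (1/p)"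
      using hardyI[OF f _ _ le'] p by auto
    show "generalized_Hilbert g f holomorphic_on ball 0 1" using C0[OF f'] by (simp add: hardy_space_def)
    have "hardy_norm p (generalized_Hilbert g f) \<le> C0 * hardy_norm p f" using C0[OF f'] by simp
    also have "\<dots> \<le> C * hardy_norm p f" by (intro mult_right_mono hardy_norm_nonneg f') (simp add: C_def)
    also have "\<dots> \<le> C * B powr (1/p)" using C n by (intro mult_left_mono)
    finally have "hardy_norm p (generalized_Hilbert g f) powr p \<le> (C * B powr (1/p)) powr p"
      using C0[OF f'] p by (intro powr_mono2 hardy_norm_nonneg) auto
    also have "\<dots> = C powr p * B" using B p by (simp add: powr_mult powr_powr)
    finally show "Lpow p (\<lambda>z. generalized_Hilbert g f (of_real r * z)) \<le> ennreal (C powr p * B)"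
      using Lpow_hardy[of "generalized_Hilbert g f" p r] C0[OF f'] r p by (auto intro: order.trans ennreal_leI)
  qed
  \<comment> \<open>\<open>K\<close> collects the three terms under two applications of
    \<open>Lpow_add_le\<close>, the first two terms being grouped together.\<close>
  define K where "K = 2 powr p * (2 powr p * (C powr p + C powr p * 2 powr p) + C powr p * 2 powr p)"
  have K: "0 \<le> K" by (simp add: K_def)
  have "Lpow p (\<lambda>z. deriv g (of_real a * z)) \<le> ennreal (K * (1 - a) powr (1 - p))" if a: "0 < a" "a < 1" for a
  proof -
    define d where "d = 1 - a"
    have d: "0 < d" "d < 1" using a by (auto simp: d_def)
    define f where "f = (\<lambda>z::complex. 1 / (1 - of_real a * z)^2)"
    define f2 where "f2 = (\<lambda>z. z * deriv f z)"
    have R: "1 / a > 1" using a by simp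
    have nz: "1 - of_real a * z \<noteq> 0" if "norm z < 1 / a" for z :: complex
    proof
      assume "1 - of_real a * z = 0"
      then have "norm (of_real a * z) = 1" by simp
      then show False using that a by (simp add: norm_mult field_simps)
    qed
    have hf: "f holomorphic_on ball 0 (1 / a)"
      unfolding f_def using nz by (intro holomorphic_intros) auto
    have df: "deriv f z = 2 * of_real a / (1 - of_real a * z)^3" if "norm z < 1 / a" for z
    proof (rule DERIV_imp_deriv)
      define y where "y = 1 - of_real a * z"
      have y: "y \<noteq> 0" using nz[OF that] by (simp add: y_def)
      have d1: "((\<lambda>z. 1 - of_real a * z) has_field_derivative - of_real a) (at z)" by (auto intro!: derivative_eq_intros)
      have f_alt: "f = (\<lambda>z. inverse ((1 - of_real a * z)\<^sup>2))" by (simp add: f_def divide_inverse)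
      have nz': "(1 - of_real a * z)\<^sup>2 \<noteq> 0" using y by (simp add: y_def)
      show "(f has_field_derivative 2 * of_real a / (1 - of_real a * z)^3) (at z)"
        unfolding f_alt
        by (rule DERIV_cong[OF DERIV_inverse_fun[OF DERIV_power[OF d1, of 2] nz']])
           (use y in \<open>simp add: y_def[symmetric] power2_eq_square power3_eq_cube divide_inverse\<close>)
    qed
    have sub: "ball 0 1 \<subseteq> ball (0::complex) (1 / a)" using R by auto
    have hf1: "f holomorphic_on ball 0 1" by (rule holomorphic_on_subset[OF hf sub])
    have hf2: "f2 holomorphic_on ball 0 1" unfolding f2_def
      by (intro holomorphic_intros holomorphic_on_subset[OF _ sub] holomorphic_deriv hf) auto
    have Lf: "Lpow p (\<lambda>z. f (of_real r * z)) \<le> ennreal (d powr (1 - 2 * p))" if "0 < r" "r < 1" for r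
      using Lpow_test_function[of a r 2 p] a p that by (simp add: f_def d_def)
    have Lf2: "Lpow p (\<lambda>z. f2 (of_real r * z)) \<le> ennreal (2 powr p * d powr (1 - 3 * p))" if r: "0 < r" "r < 1" for r
    proof -
      have "Lpow p (\<lambda>z. f2 (of_real r * z)) \<le> Lpow p (\<lambda>z. 2 * (1 / (1 - of_real a * (of_real r * z)) ^ 3))"
      proof (rule Lpow_mono)
        fix z :: complex assume z: "norm z = 1"
        have "norm (of_real r * z) < 1 / a" using z r R by (simp add: norm_mult)
        then have "norm (f2 (of_real r * z)) = (r * a) * norm (2 * (1 / (1 - of_real a * (of_real r * z)) ^ 3))"
          using r a z by (simp add: f2_def df norm_mult norm_divide)
        also have "\<dots> \<le> 1 * norm (2 * (1 / (1 - of_real a * (of_real r * z)) ^ 3))"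
          using r a by (intro mult_right_mono) (auto simp: mult_le_one)
        finally show "norm (f2 (of_real r * z)) \<le> norm (2 * (1 / (1 - of_real a * (of_real r * z)) ^ 3))" by simp
      qed (use p in simp)
      also have "\<dots> = ennreal (norm (2::complex) powr p) * Lpow p (\<lambda>z. 1 / (1 - of_real a * (of_real r * z)) ^ 3)"
        by (rule Lpow_cmult) measurable
      also have "\<dots> \<le> ennreal (2 powr p) * ennreal (d powr (1 - 3 * p))"
        using Lpow_test_function[of a r 3 p] a p r by (intro mult_mono) (auto simp: d_def)
      finally show ?thesis by (simp add: ennreal_mult)
    qed
    let ?F = "generalized_Hilbert g f" and ?F2 = "generalized_Hilbert g f2"
    have Hf: "Lpow p (\<lambda>z. ?F (of_real r * z)) \<le> ennreal (C powr p * d powr (1 - 2 * p))" if "0 < r" "r < 1" for r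
      by (rule H(1)[OF hf1 _ Lf]) (use that in auto)
    have Hf2: "Lpow p (\<lambda>z. ?F2 (of_real r * z)) \<le> ennreal (C powr p * (2 powr p * d powr (1 - 3 * p)))" if "0 < r" "r < 1" for r
      by (rule H(1)[OF hf2 _ Lf2]) (use that in auto)
    have holF: "?F holomorphic_on ball 0 1" by (rule H(2)[OF hf1 _ Lf a]) auto
    have holF2: "?F2 holomorphic_on ball 0 1" by (rule H(2)[OF hf2 _ Lf2 a]) auto
    have [measurable]: "disc_ext ?F \<in> borel_measurable borel" "disc_ext ?F2 \<in> borel_measurable borel" "disc_ext (deriv ?F) \<in> borel_measurable borel"
      by (intro disc_ext_measurable holF holF2 holomorphic_deriv open_ball)+
    have az: "norm (of_real a * z) < 1" if "norm z = 1" for z :: complex using that a by (simp add: norm_mult)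
    define u1 where "u1 = (\<lambda>z. disc_ext ?F (of_real a * z))"
    define u2 where "u2 = (\<lambda>z. of_real a * z * disc_ext (deriv ?F) (of_real a * z))"
    define u3 where "u3 = (\<lambda>z. disc_ext ?F2 (of_real a * z))"
    have [measurable]: "u1 \<in> borel_measurable borel" "u2 \<in> borel_measurable borel" "u3 \<in> borel_measurable borel"
      unfolding u1_def u2_def u3_def by measurable
    \<comment> \<open>The image of the test function itself obeys a better bound; it is weakened to
      the exponent of the other two terms.\<close>
    have dle: "d powr (1 - 2 * p) \<le> d powr (1 - 3 * p)" using d p by (intro powr_mono') auto
    have L1: "Lpow p u1 \<le> ennreal (C powr p * d powr (1 - 3 * p))"
    proof -
      have "Lpow p u1 = Lpow p (\<lambda>z. ?F (of_real a * z))" using az by (intro Lpow_cong) (simp add: u1_def disc_ext_eq)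
      also have "\<dots> \<le> ennreal (C powr p * d powr (1 - 2 * p))" by (rule Hf[OF a])
      also have "\<dots> \<le> ennreal (C powr p * d powr (1 - 3 * p))" using dle by (intro ennreal_leI mult_left_mono) auto
      finally show ?thesis .
    qed
    have L2: "Lpow p u2 \<le> ennreal (C powr p * 2 powr p * d powr (1 - 3 * p))"
    proof -
      have "Lpow p u2 \<le> Lpow p (\<lambda>z. deriv ?F (of_real a * z))"
        using az a p by (intro Lpow_mono) (auto simp: u2_def disc_ext_eq norm_mult mult_left_le_one_le)
      also have "\<dots> \<le> ennreal ((C powr p * d powr (1 - 2 * p)) * (2 / d) powr p)"
        using Lpow_deriv_growth[OF holF p _ Hf, of a] a by (simp add: d_def)
      also have "(C powr p * d powr (1 - 2 * p)) * (2 / d) powr p = C powr p * 2 powr p * d powr (1 - 3 * p)"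
      proof -
        have "d powr (1 - 2 * p) * (2 / d) powr p = 2 powr p * (d powr (1 - 2 * p) * d powr (- p))"
          by (simp add: powr_divide powr_minus_divide)
        also have "d powr (1 - 2 * p) * d powr (- p) = d powr (1 - 3 * p)" by (simp add: powr_add[symmetric])
        finally show ?thesis by (simp add: mult_ac)
      qed
      finally show ?thesis .
    qed
    have L3: "Lpow p u3 \<le> ennreal (C powr p * 2 powr p * d powr (1 - 3 * p))"
    proof -
      have "Lpow p u3 = Lpow p (\<lambda>z. ?F2 (of_real a * z))" using az by (intro Lpow_cong) (simp add: u3_def disc_ext_eq)
      also have "\<dots> \<le> ennreal (C powr p * (2 powr p * d powr (1 - 3 * p)))" by (rule Hf2[OF a])
      finally show ?thesis by (simp add: mult_ac)
    qed
    have "Lpow p (\<lambda>z. u1 z + u2 z + u3 z) \<le> ennreal (2 powr p) * (Lpow p (\<lambda>z. u1 z + u2 z) + Lpow p u3)"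
      using p by (intro Lpow_add_le) auto
    also have "\<dots> \<le> ennreal (2 powr p) * (ennreal (2 powr p) * (Lpow p u1 + Lpow p u2) + Lpow p u3)"
      using p by (intro mult_left_mono add_mono Lpow_add_le) auto
    also have "\<dots> \<le> ennreal (2 powr p) * (ennreal (2 powr p) * (ennreal (C powr p * d powr (1 - 3 * p)) + ennreal (C powr p * 2 powr p * d powr (1 - 3 * p)))
        + ennreal (C powr p * 2 powr p * d powr (1 - 3 * p)))"
      by (intro mult_left_mono add_mono L1 L2 L3) auto
    also have "\<dots> = ennreal (K * d powr (1 - 3 * p))"
      by (simp add: K_def ennreal_mult[symmetric] ennreal_plus[symmetric] algebra_simps del: ennreal_plus)
    finally have L: "Lpow p (\<lambda>z. u1 z + u2 z + u3 z) \<le> ennreal (K * d powr (1 - 3 * p))" .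
    have "Lpow p (\<lambda>z. deriv g (of_real a * z)) = Lpow p (\<lambda>z. of_real (d\<^sup>2) * (u1 z + u2 z + u3 z))"
    proof (rule Lpow_cong)
      fix z :: complex assume z: "norm z = 1"
      have "f 1 * deriv g (of_real a * z) = u1 z + u2 z + u3 z"
        using generalized_Hilbert_by_parts[OF hf R g az[OF z]] az[OF z] by (simp add: u1_def u2_def u3_def disc_ext_eq f2_def)
      moreover have "f 1 = 1 / of_real (d\<^sup>2)" by (simp add: f_def d_def)
      ultimately show "deriv g (of_real a * z) = of_real (d\<^sup>2) * (u1 z + u2 z + u3 z)"
        using d by (simp add: field_simps)
    qed
    also have "\<dots> = ennreal (norm (complex_of_real (d\<^sup>2)) powr p) * Lpow p (\<lambda>z. u1 z + u2 z + u3 z)"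
      by (rule Lpow_cmult) measurable
    also have "norm (complex_of_real (d\<^sup>2)) powr p = d powr (2 * p)"
      using d by (simp add: norm_power powr_powr flip: powr_numeral)
    also have "ennreal (d powr (2 * p)) * Lpow p (\<lambda>z. u1 z + u2 z + u3 z) \<le> ennreal (d powr (2 * p)) * ennreal (K * d powr (1 - 3 * p))"
      by (intro mult_left_mono L) auto
    also have "\<dots> = ennreal (K * d powr (1 - p))"
    proof -
      have "d powr (2 * p) * d powr (1 - 3 * p) = d powr (1 - p)" by (simp add: powr_add[symmetric])
      then show ?thesis using K by (simp add: ennreal_mult[symmetric] mult.left_commute)
    qed
    finally show ?thesis by (simp add: d_def)
  qed
  note pos = this
  \<comment> \<open>So far only positive radii are covered. At radius 0 the mean is at most that at
    radius 1/2, which accounts for \<open>2 powr (p - 1)\<close>.\<close>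
  have "Lpow p (\<lambda>z. deriv g (of_real r * z)) \<le> ennreal (K * 2 powr (p - 1) * (1 - r) powr (1 - p))" if r: "0 \<le> r" "r < 1" for r
  proof (cases "r = 0")
    case True
    have "Lpow p (\<lambda>z. deriv g (of_real 0 * z)) \<le> Lpow p (\<lambda>z. deriv g (of_real (1/2) * z))"
      by (rule Lpow_mono_radius) (use p g in \<open>auto intro: holomorphic_deriv\<close>)
    also have "\<dots> \<le> ennreal (K * (1 - 1/2) powr (1 - p))" by (rule pos) auto
    also have "(1 - 1/2) powr (1 - p) = 2 powr (p - 1)" by (simp add: powr_divide powr_diff)
    finally show ?thesis using True by simp
  next
    case False
    have "1 \<le> 2 powr (p - 1)" using p by (intro ge_one_powr_ge_zero) auto
    then have "K * (1 - r) powr (1 - p) * 1 \<le> K * (1 - r) powr (1 - p) * 2 powr (p - 1)"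
      using K by (intro mult_left_mono) auto
    then have "ennreal (K * (1 - r) powr (1 - p)) \<le> ennreal (K * 2 powr (p - 1) * (1 - r) powr (1 - p))"
      by (intro ennreal_leI) (simp add: mult_ac)
    then show ?thesis using pos[of r] r False by (auto intro: order.trans)
  qed
  then show ?thesis unfolding derivative_growth_def using K by (intro exI[of _ "K * 2 powr (p - 1)"]) auto
qed

section \<open>From derivative growth to the Lipschitz condition\<close>

lemma measurable_pair_restrict:
  assumes "f \<in> measurable (M \<Otimes>\<^sub>M lborel) L"
  shows "f \<in> measurable (M \<Otimes>\<^sub>M restrict_space lborel S) L"
proof -
  have "(\<lambda>x. (fst x, snd x)) \<in> measurable (M \<Otimes>\<^sub>M restrict_space lborel S) (M \<Otimes>\<^sub>M lborel)"
  proof (rule measurable_Pair)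
    have "(\<lambda>x. x) \<in> measurable (restrict_space lborel S) lborel"
      by (rule measurable_restrict_space1) simp
    then show "snd \<in> measurable (M \<Otimes>\<^sub>M restrict_space lborel S) lborel"
      using measurable_compose[OF measurable_snd] by blast
  qed simp
  from measurable_compose[OF this assms] show ?thesis by simp
qed

lemma sigma_finite_restrict_lborel:
  "S \<in> sets borel \<Longrightarrow> sigma_finite_measure (restrict_space lborel S)"
  by (rule sigma_finite_measure_restrict_space) (auto intro: lborel.sigma_finite_measure_axioms)

lemma nn_integral_one_minus_powr:
  fixes a b :: real
  assumes "b > 0" "a \<le> 1"
  shows "(\<integral>\<^sup>+x. ennreal ((1 - x) powr (b - 1)) * indicator {a<..<1} x \<partial>lborel) = ennreal ((1 - a) powr b / b)"
proof -
  have "(\<integral>\<^sup>+x. ennreal ((1 - x) powr (b - 1)) * indicator {a<..<1} x \<partial>lborel)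
     = (\<integral>\<^sup>+x. ennreal ((1 - (1 + (-1) * x)) powr (b - 1)) * indicator {a<..<1} (1 + (-1) * x) \<partial>lborel)"
    by (subst nn_integral_real_affine[where c = "-1" and t = 1]) auto
  also have "\<dots> = (\<integral>\<^sup>+x. ennreal (x powr (b - 1)) * indicator {0<..<1 - a} x \<partial>lborel)"
    by (intro nn_integral_cong) (auto simp: indicator_def)
  also have "\<dots> = ennreal ((1 - a) powr b / b)" by (rule nn_integral_powr_0) (use assms in auto)
  finally show ?thesis .
qed

lemma norm_diff_le_nn_integral:
  fixes F :: "real \<Rightarrow> complex"
  assumes ab: "a \<le> b" and d: "\<And>t. t \<in> {a..b} \<Longrightarrow> (F has_vector_derivative F' t) (at t within {a..b})"
    and c: "continuous_on {a..b} F'"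
  shows "ennreal (norm (F b - F a)) \<le> (\<integral>\<^sup>+t. ennreal (norm (F' t)) * indicator {a..b} t \<partial>lborel)"
proof -
  have "(F' has_integral (F b - F a)) {a..b}" by (rule fundamental_theorem_of_calculus[OF ab d])
  moreover have si: "set_integrable lborel {a..b} F'" by (rule borel_integrable_atLeastAtMost'[OF c])
  ultimately have "F b - F a = (LINT t:{a..b}|lborel. F' t)"
    using set_borel_integral_eq_integral(2)[OF si] by (simp add: integral_unique)
  then have "ennreal (norm (F b - F a)) \<le> (\<integral>\<^sup>+t. norm (indicator {a..b} t *\<^sub>R F' t) \<partial>lborel)"
    using integral_norm_bound_ennreal[OF si[unfolded set_integrable_def]] by (simp only: set_lebesgue_integral_def)
  also have "\<dots> = (\<integral>\<^sup>+t. ennreal (norm (F' t)) * indicator {a..b} t \<partial>lborel)"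
    by (intro nn_integral_cong) (auto simp: indicator_def)
  finally show ?thesis .
qed

lemma nn_integral_tail_small:
  fixes u :: "real \<Rightarrow> ennreal"
  assumes [measurable]: "u \<in> borel_measurable borel" and fin: "(\<integral>\<^sup>+x. u x * indicator {0<..<1} x \<partial>lborel) < \<infinity>" and e: "0 < e"
  obtains a where "0 < a" "a < (1::real)" "(\<integral>\<^sup>+x. u x * indicator {a<..<1} x \<partial>lborel) < e"
proof -
  define A where "A = (\<lambda>n::nat. 1 - 1 / (real n + 2))"
  have "(\<lambda>n. \<integral>\<^sup>+x. u x * indicator {A n<..<1} x \<partial>lborel) \<longlonglongrightarrow> (\<integral>\<^sup>+x. 0 \<partial>(lborel :: real measure))"
  proof (rule nn_integral_dominated_convergence[where w = "\<lambda>x. u x * indicator {0<..<1} x"])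
    have lim: "A \<longlonglongrightarrow> 1" unfolding A_def by real_asymp
    show "AE x in lborel. (\<lambda>n. u x * indicator {A n<..<1} x) \<longlonglongrightarrow> 0"
    proof (intro AE_I2)
      fix x :: real
      show "(\<lambda>n. u x * indicator {A n<..<1} x) \<longlonglongrightarrow> 0"
      proof (cases "x < 1")
        case True
        then have "eventually (\<lambda>n. x < A n) sequentially" using lim by (rule order_tendstoD(1)[rotated])
        then have "eventually (\<lambda>n. u x * indicator {A n<..<1} x = 0) sequentially"
          by eventually_elim (auto simp: indicator_def)
        then show ?thesis by (rule tendsto_eventually)
      qed (simp add: indicator_def)
    qed
    show "AE x in lborel. u x * indicator {A n<..<1} x \<le> u x * indicator {0<..<1} x" for n
    proof -
      have "0 < A n" by (auto simp: A_def field_simps)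
      then show ?thesis by (intro AE_I2) (auto simp: indicator_def)
    qed
  qed (use fin in auto)
  then have "eventually (\<lambda>n. (\<integral>\<^sup>+x. u x * indicator {A n<..<1} x \<partial>lborel) < e) sequentially"
    using e by (intro order_tendstoD(2)) auto
  then obtain n where "(\<integral>\<^sup>+x. u x * indicator {A n<..<1} x \<partial>lborel) < e"
    by (auto simp: eventually_sequentially)
  moreover have "0 < A n" "A n < 1" by (auto simp: A_def field_simps)
  ultimately show ?thesis using that by blast
qed

text \<open>For \<open>d = deriv g\<close> and \<open>norm z = 1\<close> this is the length of the
  image under \<open>g\<close> of the radius from \<open>\<rho> * z\<close> to
  \<open>z\<close>.\<close>

definition radial_tail :: "(complex \<Rightarrow> complex) \<Rightarrow> real \<Rightarrow> complex \<Rightarrow> ennreal" where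
  "radial_tail d \<rho> z = (\<integral>\<^sup>+r. ennreal (norm (d (of_real r * z))) * indicator {\<rho><..<1} r \<partial>lborel)"

lemma radial_tail_measurable [measurable]:
  assumes [measurable]: "d \<in> borel_measurable borel"
  shows "radial_tail d \<rho> \<in> borel_measurable borel"
  unfolding radial_tail_def by measurable

lemma radial_tail_antimono:
  assumes "\<rho> \<le> \<sigma>" shows "radial_tail d \<sigma> z \<le> radial_tail d \<rho> z"
  unfolding radial_tail_def using assms by (intro nn_integral_mono) (auto simp: indicator_def)

lemma radial_diff_le:
  assumes g: "g holomorphic_on ball 0 1" and z: "norm z = 1" and r: "0 \<le> \<rho>" "\<rho> \<le> \<sigma>" "\<sigma> < 1"
  shows "ennreal (norm (g (of_real \<sigma> * z) - g (of_real \<rho> * z))) \<le> radial_tail (disc_ext (deriv g)) \<rho> z"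
proof -
  have hd: "deriv g holomorphic_on ball 0 1" by (intro holomorphic_deriv g) auto
  have "ennreal (norm (g (of_real \<sigma> * z) - g (of_real \<rho> * z)))
      \<le> (\<integral>\<^sup>+t. ennreal (norm (deriv g (of_real t * z) * z)) * indicator {\<rho>..\<sigma>} t \<partial>lborel)"
  proof (rule norm_diff_le_nn_integral[OF r(2)])
    fix t assume t: "t \<in> {\<rho>..\<sigma>}"
    have "(g has_field_derivative deriv g (of_real t * z)) (at (of_real t * z))"
      by (rule holomorphic_derivI[OF g]) (use t r z in \<open>auto simp: norm_mult\<close>)
    moreover have "((\<lambda>x. x * z) has_field_derivative z) (at (of_real t))" by (auto intro!: derivative_eq_intros)
    ultimately have "((\<lambda>x. g (x * z)) has_field_derivative deriv g (of_real t * z) * z) (at (of_real t))"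
      by (rule DERIV_chain2)
    then show "((\<lambda>t. g (of_real t * z)) has_vector_derivative deriv g (of_real t * z) * z) (at t within {\<rho>..\<sigma>})"
      by (rule has_vector_derivative_real_field[THEN has_vector_derivative_at_within])
  next
    show "continuous_on {\<rho>..\<sigma>} (\<lambda>t. deriv g (of_real t * z) * z)"
      by (intro continuous_intros continuous_on_compose2[OF holomorphic_on_imp_continuous_on[OF hd]])
         (use r z in \<open>auto simp: norm_mult\<close>)
  qed
  also have "\<dots> \<le> radial_tail (disc_ext (deriv g)) \<rho> z"
    unfolding radial_tail_def
  proof (rule nn_integral_mono_AE, rule AE_mp[OF AE_lborel_singleton[of \<rho>]], intro AE_I2 impI)
    fix t assume "t \<noteq> \<rho>"
    then show "ennreal (norm (deriv g (of_real t * z) * z)) * indicator {\<rho>..\<sigma>} t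
        \<le> ennreal (norm (disc_ext (deriv g) (of_real t * z))) * indicator {\<rho><..<1} t"
      using r z by (auto simp: indicator_def norm_mult disc_ext_eq)
  qed
  finally show ?thesis .
qed

lemma boundary_functionI:
  assumes "((\<lambda>r. g (of_real r * z)) \<longlongrightarrow> L) (at_left 1)"
  shows "boundary_function g z = L"
  unfolding boundary_function_def by (rule tendsto_Lim) (use assms in auto)

text \<open>A radial image of finite length satisfies the Cauchy criterion, and the remaining length
  bounds the distance to the limit.\<close>

lemma radial_limit_of_tail:
  assumes g: "g holomorphic_on ball 0 1" and z: "norm z = 1"
    and fin: "radial_tail (disc_ext (deriv g)) 0 z < \<infinity>"
  shows "((\<lambda>r. g (of_real r * z)) \<longlongrightarrow> boundary_function g z) (at_left 1)"
    and "\<And>\<rho>. 0 \<le> \<rho> \<Longrightarrow> \<rho> < 1 \<Longrightarrow> ennreal (norm (boundary_function g z - g (of_real \<rho> * z))) \<le> radial_tail (disc_ext (deriv g)) \<rho> z"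
proof -
  let ?T = "\<lambda>\<rho>. radial_tail (disc_ext (deriv g)) \<rho> z"
  have [measurable]: "disc_ext (deriv g) \<in> borel_measurable borel"
    by (intro disc_ext_measurable holomorphic_deriv g) auto
  have small: "\<exists>a. 0 < a \<and> a < 1 \<and> ?T a < ennreal e" if e: "e > 0" for e :: real
  proof -
    obtain a where "0 < a" "a < 1" "(\<integral>\<^sup>+x. ennreal (norm (disc_ext (deriv g) (of_real x * z))) * indicator {a<..<1} x \<partial>lborel) < ennreal e"
      by (rule nn_integral_tail_small[where e = "ennreal e" and u = "\<lambda>x. ennreal (norm (disc_ext (deriv g) (of_real x * z)))"])
         (use fin e in \<open>auto simp: radial_tail_def\<close>)
    then show ?thesis by (auto simp: radial_tail_def)
  qed
  define A where "A = (\<lambda>n::nat. 1 - 1 / (real n + 2))"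
  have A: "0 < A n" "A n < 1" for n by (auto simp: A_def field_simps)
  have limA: "A \<longlonglongrightarrow> 1" unfolding A_def by real_asymp
  have mA: "A m \<le> A n" if "m \<le> n" for m n using that by (auto simp: A_def field_simps)
  have "Cauchy (\<lambda>n. g (of_real (A n) * z))"
  proof (rule metric_CauchyI)
    fix e :: real assume e: "0 < e"
    then obtain a where a: "0 < a" "a < 1" "?T a < ennreal e" using small by blast
    have "eventually (\<lambda>n. a < A n) sequentially" using limA a(2) by (rule order_tendstoD(1))
    then obtain N where N: "\<And>n. n \<ge> N \<Longrightarrow> a < A n" by (auto simp: eventually_sequentially)
    have *: "dist (g (of_real (A m) * z)) (g (of_real (A n) * z)) < e" if "N \<le> n" "n \<le> m" for m n
    proof -
      have "ennreal (norm (g (of_real (A m) * z) - g (of_real (A n) * z))) \<le> ?T (A n)"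
        by (rule radial_diff_le[OF g z]) (use A mA[OF that(2)] in \<open>auto simp: less_imp_le\<close>)
      also have "\<dots> \<le> ?T a" using N[OF that(1)] by (intro radial_tail_antimono) auto
      also have "\<dots> < ennreal e" by fact
      finally show ?thesis by (simp add: dist_norm ennreal_less_iff)
    qed
    show "\<exists>M. \<forall>m\<ge>M. \<forall>n\<ge>M. dist (g (of_real (A m) * z)) (g (of_real (A n) * z)) < e"
      using * by (intro exI[of _ N]) (metis dist_commute nle_le)
  qed
  then obtain L where L: "(\<lambda>n. g (of_real (A n) * z)) \<longlonglongrightarrow> L" using Cauchy_convergent convergent_def by blast
  have b: "ennreal (norm (L - g (of_real \<rho> * z))) \<le> ?T \<rho>" if "0 \<le> \<rho>" "\<rho> < 1" for \<rho>
  proof (rule tendsto_upperbound)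
    show "(\<lambda>n. ennreal (norm (g (of_real (A n) * z) - g (of_real \<rho> * z)))) \<longlonglongrightarrow> ennreal (norm (L - g (of_real \<rho> * z)))"
      by (intro tendsto_intros L tendsto_ennrealI)
    have "eventually (\<lambda>n. \<rho> < A n) sequentially" using limA that(2) by (rule order_tendstoD(1))
    then show "eventually (\<lambda>n. ennreal (norm (g (of_real (A n) * z) - g (of_real \<rho> * z))) \<le> ?T \<rho>) sequentially"
      by eventually_elim (use A that in \<open>auto intro!: radial_diff_le[OF g z]\<close>)
  qed simp
  have lim: "((\<lambda>r. g (of_real r * z)) \<longlongrightarrow> L) (at_left 1)"
  proof (rule tendstoI)
    fix e :: real assume "0 < e"
    then obtain a where a: "0 < a" "a < 1" "?T a < ennreal e" using small by blast
    have "eventually (\<lambda>r. r \<in> {a<..<1}) (at_left 1)" using a(2) by (rule eventually_at_left_real)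
    then show "eventually (\<lambda>r. dist (g (of_real r * z)) L < e) (at_left 1)"
    proof eventually_elim
      case (elim r)
      have "ennreal (norm (L - g (of_real r * z))) \<le> ?T r" by (rule b) (use elim a in auto)
      also have "\<dots> \<le> ?T a" using elim by (intro radial_tail_antimono) auto
      also have "\<dots> < ennreal e" by fact
      finally show ?case by (simp add: dist_norm norm_minus_commute ennreal_less_iff)
    qed
  qed
  then have eq: "boundary_function g z = L" by (rule boundary_functionI)
  show "((\<lambda>r. g (of_real r * z)) \<longlongrightarrow> boundary_function g z) (at_left 1)" using lim eq by simp
  show "\<And>\<rho>. 0 \<le> \<rho> \<Longrightarrow> \<rho> < 1 \<Longrightarrow> ennreal (norm (boundary_function g z - g (of_real \<rho> * z))) \<le> ?T \<rho>"
    using b eq by simp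
qed

text \<open>The weight is the growth rate \<open>(1 - r) powr (1/p - 1)\<close> itself. Its exponent
  exceeds -1, so it is integrable up to 1, with integral \<open>p * (1 - \<rho>) powr (1/p)\<close>
  from \<open>\<rho>\<close> on.\<close>

lemma radial_tail_growth:
  assumes p: "1 < p" and [measurable]: "d \<in> borel_measurable borel" and K: "0 \<le> K"
    and gr: "\<And>r. 0 \<le> r \<Longrightarrow> r < 1 \<Longrightarrow> Lpow p (\<lambda>z. d (of_real r * z)) \<le> ennreal (K * (1 - r) powr (1 - p))"
    and \<rho>: "0 \<le> \<rho>" "\<rho> < 1"
  shows "(\<integral>\<^sup>+z. ennreal (enn2real (radial_tail d \<rho> z) powr p) \<partial>circ) \<le> ennreal (K * p powr p * (1 - \<rho>))"
    and "AE z in circ. radial_tail d \<rho> z < \<infinity>"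
proof -
  let ?N = "restrict_space lborel {\<rho><..<1}"
  let ?w = "\<lambda>r::real. (1 - r) powr (1/p - 1)"
  have w: "?w \<in> borel_measurable ?N" by (rule measurable_restrict_space1) measurable
  have u: "(\<lambda>(z, r). norm (d (of_real r * z))) \<in> borel_measurable (circ \<Otimes>\<^sub>M ?N)"
    by (rule measurable_pair_restrict) measurable
  have pos: "0 < ?w r" if "r \<in> space ?N" for r using that by (auto simp: space_restrict_space)
  have B: "(\<integral>\<^sup>+z. ennreal (norm (d (of_real r * z)) powr p) \<partial>circ) \<le> ennreal (K * ?w r powr p)" if "r \<in> space ?N" for r
  proof -
    have r: "0 \<le> r" "r < 1" using that \<rho> by (auto simp: space_restrict_space)
    have "(1/p - 1) * p = 1 - p" using p by (simp add: field_simps)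
    then show ?thesis using gr[OF r] by (simp add: Lpow_def powr_powr)
  qed
  have A: "(\<integral>\<^sup>+r. ennreal (?w r) \<partial>?N) \<le> ennreal (p * (1 - \<rho>) powr (1/p))"
    using p \<rho> nn_integral_one_minus_powr[of "1/p" \<rho>]
    by (subst nn_integral_restrict_space) (auto simp: mult.commute)
  have A0: "0 < p * (1 - \<rho>) powr (1/p)" using p \<rho> by auto
  have tail: "radial_tail d \<rho> z = (\<integral>\<^sup>+r. ennreal (norm (d (of_real r * z))) \<partial>?N)" for z
    unfolding radial_tail_def by (subst nn_integral_restrict_space) auto
  have s: "sigma_finite_measure ?N" by (rule sigma_finite_restrict_lborel) simp
  have "(\<integral>\<^sup>+z. ennreal (enn2real (radial_tail d \<rho> z) powr p) \<partial>circ) \<le> ennreal (K * (p * (1 - \<rho>) powr (1/p)) powr p)"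
  proof (rule Minkowski_weight[OF sigma_finite_circ s p u w _ pos B K A A0])
    \<comment> \<open>At points where the tail is infinite \<open>enn2real\<close> returns 0, so the
      inequality holds there as well.\<close>
    show "AE z in circ. ennreal (enn2real (radial_tail d \<rho> z)) \<le> (\<integral>\<^sup>+r. ennreal (norm (d (of_real r * z))) \<partial>?N)"
      by (intro AE_I2) (simp add: tail[symmetric] ennreal_enn2real_if)
  qed auto
  also have "(p * (1 - \<rho>) powr (1/p)) powr p = p powr p * (1 - \<rho>)"
    using p \<rho> by (simp add: powr_mult powr_powr)
  finally show "(\<integral>\<^sup>+z. ennreal (enn2real (radial_tail d \<rho> z) powr p) \<partial>circ) \<le> ennreal (K * p powr p * (1 - \<rho>))"
    by (simp add: mult.assoc)
  show "AE z in circ. radial_tail d \<rho> z < \<infinity>"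
    unfolding tail by (rule Minkowski_weight_AE_finite[OF sigma_finite_circ s p u w _ pos B K A A0]) auto
qed

lemma le_enn2realI: "ennreal x \<le> y \<Longrightarrow> y < \<infinity> \<Longrightarrow> x \<le> enn2real y"
  by (cases y) (auto simp: ennreal_le_iff2)

lemma AE_circ_angle:
  assumes "AE z in circ. P z"
  shows "AE t in lborel. t \<in> {0..2*pi} \<longrightarrow> P (cis t)"
proof -
  have "AE t in uniform_measure lborel {0..2*pi}. P (cis t)"
    using assms unfolding circ_def by (rule AE_distrD[OF cis_uniform_measurable])
  then show ?thesis by (subst (asm) AE_uniform_measure) auto
qed

text \<open>A non-integrable \<open>\<phi>\<close> is covered by the default value 0 of the Lebesgue
  integral. This suits \<open>boundary_function\<close>, whose values are unspecified where no
  radial limit exists.\<close>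

lemma LINT_angle_le:
  assumes nn: "\<And>z. 0 \<le> \<phi> z" and [measurable]: "\<psi> \<in> borel_measurable borel"
    and le: "AE z in circ. ennreal (\<phi> z) \<le> \<psi> z" and B: "(\<integral>\<^sup>+z. \<psi> z \<partial>circ) \<le> ennreal B" "0 \<le> B"
  shows "1 / (2 * pi) * (LINT t:{0..2 * pi}|lebesgue. \<phi> (cis t)) \<le> B"
proof (cases "integrable lebesgue (\<lambda>t. indicator {0..2*pi} t *\<^sub>R \<phi> (cis t))")
  case True
  have "AE t in lborel. ennreal (indicator {0..2*pi} t *\<^sub>R \<phi> (cis t)) \<le> \<psi> (cis t) * indicator {0..2*pi} t"
    using AE_circ_angle[OF le] by eventually_elim (auto simp: indicator_def)
  then have ae: "AE t in lebesgue. ennreal (indicator {0..2*pi} t *\<^sub>R \<phi> (cis t)) \<le> \<psi> (cis t) * indicator {0..2*pi} t"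
    by (rule AE_completion)
  have "ennreal (LINT t:{0..2 * pi}|lebesgue. \<phi> (cis t)) = (\<integral>\<^sup>+t. ennreal (indicator {0..2*pi} t *\<^sub>R \<phi> (cis t)) \<partial>lebesgue)"
    unfolding set_lebesgue_integral_def by (rule nn_integral_eq_integral[symmetric, OF True]) (use nn in auto)
  also have "\<dots> \<le> (\<integral>\<^sup>+t. \<psi> (cis t) * indicator {0..2*pi} t \<partial>lebesgue)"
    by (rule nn_integral_mono_AE[OF ae])
  also have "\<dots> = (\<integral>\<^sup>+t. \<psi> (cis t) * indicator {0..2*pi} t \<partial>lborel)"
    by (rule nn_integral_completion) measurable
  also have "\<dots> = ennreal (2 * pi) * (\<integral>\<^sup>+z. \<psi> z \<partial>circ)"
  proof -
    have "x = ennreal (2 * pi) * (x / ennreal (2 * pi))" for x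
      using mult_divide_eq_ennreal[of "ennreal (2 * pi)" x] pi_gt_zero
      by (simp add: ennreal_times_divide mult.commute del: pi_gt_zero)
    then show ?thesis by (subst nn_integral_circ_angle) auto
  qed
  also have "\<dots> \<le> ennreal (2 * pi) * ennreal B" by (intro mult_left_mono B) auto
  also have "\<dots> = ennreal (2 * pi * B)" using B by (simp add: ennreal_mult)
  finally have "(LINT t:{0..2 * pi}|lebesgue. \<phi> (cis t)) \<le> 2 * pi * B" using B by (simp add: ennreal_le_iff)
  then show ?thesis by (simp add: field_simps)
next
  case False
  then show ?thesis using B by (simp add: set_lebesgue_integral_def not_integrable_integral_eq)
qed

lemma powr_add3_le:
  fixes a b c :: real
  assumes "0 \<le> a" "0 \<le> b" "0 \<le> c" "0 < p"
  shows "(a + b + c) powr p \<le> 3 powr p * (a powr p + b powr p + c powr p)"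
proof -
  have "(a + b + c) powr p \<le> (3 * max (max a b) c) powr p" using assms by (intro powr_mono2) auto
  also have "\<dots> = 3 powr p * (max (max a b) c) powr p" using assms by (simp add: powr_mult)
  also have "\<dots> \<le> 3 powr p * (a powr p + b powr p + c powr p)" by (intro mult_left_mono) (auto simp: max_def)
  finally show ?thesis .
qed

text \<open>The points of the arc are rotations of one another, so all slices have the same mean and
  the constant weight 1 is the right one.\<close>

lemma arc_growth:
  assumes p: "1 < p" and [measurable]: "d \<in> borel_measurable borel"
    and B: "Lpow p (\<lambda>z. d (of_real \<rho> * z)) \<le> ennreal B" "0 \<le> B" and h: "0 < h"
  defines "S \<equiv> \<lambda>z. \<integral>\<^sup>+x. ennreal (norm (d (of_real \<rho> * (cis x * z)))) * indicator {0..h} x \<partial>lborel"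
  shows "(\<integral>\<^sup>+z. ennreal (enn2real (S z) powr p) \<partial>circ) \<le> ennreal (B * h powr p)"
    and "AE z in circ. S z < \<infinity>"
proof -
  let ?N = "restrict_space lborel {0..h}"
  have u: "(\<lambda>(z, x). norm (d (of_real \<rho> * (cis x * z)))) \<in> borel_measurable (circ \<Otimes>\<^sub>M ?N)"
    by (rule measurable_pair_restrict) measurable
  have s: "sigma_finite_measure ?N" by (rule sigma_finite_restrict_lborel) simp
  have B': "(\<integral>\<^sup>+z. ennreal (norm (d (of_real \<rho> * (cis x * z))) powr p) \<partial>circ) \<le> ennreal (B * 1 powr p)" for x
    using B(1) Lpow_rotate[of "\<lambda>z. d (of_real \<rho> * z)" "cis x" p] by (simp add: Lpow_def)
  have A: "(\<integral>\<^sup>+r. ennreal 1 \<partial>?N) \<le> ennreal h"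
    using h by (subst nn_integral_restrict_space) auto
  have Seq: "S z = (\<integral>\<^sup>+x. ennreal (norm (d (of_real \<rho> * (cis x * z)))) \<partial>?N)" for z
    unfolding S_def by (subst nn_integral_restrict_space) auto
  show "(\<integral>\<^sup>+z. ennreal (enn2real (S z) powr p) \<partial>circ) \<le> ennreal (B * h powr p)"
  proof (rule Minkowski_weight[OF sigma_finite_circ s p u, where w = "\<lambda>_. 1"])
    show "AE z in circ. ennreal (enn2real (S z)) \<le> (\<integral>\<^sup>+x. ennreal (norm (d (of_real \<rho> * (cis x * z)))) \<partial>?N)"
      by (intro AE_I2) (simp add: Seq[symmetric] ennreal_enn2real_if)
  qed (use A B' B h in auto)
  show "AE z in circ. S z < \<infinity>" unfolding Seq
    by (rule Minkowski_weight_AE_finite[OF sigma_finite_circ s p u, where w = "\<lambda>_. 1"]) (use A B' B h in auto)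
qed

lemma arc_diff_le:
  assumes g: "g holomorphic_on ball 0 1" and z: "norm z = 1" and r: "0 \<le> \<rho>" "\<rho> < 1" and h: "0 \<le> h"
  shows "ennreal (norm (g (of_real \<rho> * (cis h * z)) - g (of_real \<rho> * z)))
    \<le> (\<integral>\<^sup>+x. ennreal (norm (disc_ext (deriv g) (of_real \<rho> * (cis x * z)))) * indicator {0..h} x \<partial>lborel)"
proof -
  have hd: "deriv g holomorphic_on ball 0 1" by (intro holomorphic_deriv g) auto
  have in1: "norm (of_real \<rho> * (cis x * z)) < 1" for x using r z by (simp add: norm_mult)
  have "ennreal (norm (g (of_real \<rho> * (cis h * z)) - g (of_real \<rho> * (cis 0 * z))))
      \<le> (\<integral>\<^sup>+x. ennreal (norm ((of_real \<rho> * (\<i> * cis x * z)) * deriv g (of_real \<rho> * (cis x * z)))) * indicator {0..h} x \<partial>lborel)"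
  proof (rule norm_diff_le_nn_integral[OF h])
    fix x assume "x \<in> {0..h}"
    have "(g has_field_derivative deriv g (of_real \<rho> * (cis x * z))) (at (of_real \<rho> * (cis x * z)))"
      by (rule holomorphic_derivI[OF g]) (use in1 in auto)
    moreover have "((\<lambda>x. of_real \<rho> * (cis x * z)) has_vector_derivative of_real \<rho> * (\<i> * cis x * z)) (at x within {0..h})"
      unfolding has_vector_derivative_def by (auto intro!: derivative_eq_intros simp: algebra_simps)
    ultimately show "((\<lambda>x. g (of_real \<rho> * (cis x * z))) has_vector_derivative
         (of_real \<rho> * (\<i> * cis x * z)) * deriv g (of_real \<rho> * (cis x * z))) (at x within {0..h})"
      using field_vector_diff_chain_within[of "\<lambda>x. of_real \<rho> * (cis x * z)" "of_real \<rho> * (\<i> * cis x * z)" x "{0..h}" g] 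
      by (auto simp: o_def intro: has_field_derivative_at_within)
  next
    show "continuous_on {0..h} (\<lambda>x. (of_real \<rho> * (\<i> * cis x * z)) * deriv g (of_real \<rho> * (cis x * z)))"
      by (intro continuous_intros continuous_on_compose2[OF holomorphic_on_imp_continuous_on[OF hd]])
         (use in1 in auto)
  qed
  also have "\<dots> \<le> (\<integral>\<^sup>+x. ennreal (norm (disc_ext (deriv g) (of_real \<rho> * (cis x * z)))) * indicator {0..h} x \<partial>lborel)"
  proof (intro nn_integral_mono mult_right_mono ennreal_leI)
    fix x
    have "norm ((of_real \<rho> * (\<i> * cis x * z)) * deriv g (of_real \<rho> * (cis x * z))) = \<rho> * norm (deriv g (of_real \<rho> * (cis x * z)))"
      using r z by (simp add: norm_mult)
    also have "\<dots> \<le> norm (deriv g (of_real \<rho> * (cis x * z)))" using r by (intro mult_left_le_one_le) auto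
    finally show "norm ((of_real \<rho> * (\<i> * cis x * z)) * deriv g (of_real \<rho> * (cis x * z))) \<le> norm (disc_ext (deriv g) (of_real \<rho> * (cis x * z)))"
      using disc_ext_eq[OF in1] by simp
  qed simp
  finally show ?thesis by simp
qed

text \<open>Each leg of the path contributes a p-th power mean of order \<open>h\<close>: the radial
  ones by \<open>radial_tail_growth\<close>, the arc because
  \<open>h powr (1 - p) * h powr p = h\<close>.\<close>

lemma mean_Lipschitz_if_derivative_growth:
  assumes p: "1 < p" and g: "g holomorphic_on ball 0 1" and gr: "derivative_growth p g"
  shows "g \<in> mean_Lipschitz p (1 / p)"
proof -
  from gr obtain K where K: "0 \<le> K" and gr0: "\<And>r. 0 \<le> r \<Longrightarrow> r < 1 \<Longrightarrow>
      Lpow p (\<lambda>z. deriv g (of_real r * z)) \<le> ennreal (K * (1 - r) powr (1 - p))"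
    unfolding derivative_growth_def by blast
  define d where "d = disc_ext (deriv g)"
  have dm[measurable]: "d \<in> borel_measurable borel" unfolding d_def
    by (intro disc_ext_measurable holomorphic_deriv g) auto
  have gr1: "Lpow p (\<lambda>z. d (of_real r * z)) \<le> ennreal (K * (1 - r) powr (1 - p))" if "0 \<le> r" "r < 1" for r
  proof -
    have "Lpow p (\<lambda>z. d (of_real r * z)) = Lpow p (\<lambda>z. deriv g (of_real r * z))"
      unfolding d_def using that by (intro Lpow_cong disc_ext_eq) (simp add: norm_mult)
    then show ?thesis using gr0[OF that] by simp
  qed
  let ?T = "radial_tail d"
  have T: "(\<integral>\<^sup>+z. ennreal (enn2real (?T \<rho> z) powr p) \<partial>circ) \<le> ennreal (K * p powr p * (1 - \<rho>))"
    "AE z in circ. ?T \<rho> z < \<infinity>" if "0 \<le> \<rho>" "\<rho> < 1" for \<rho>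
    using radial_tail_growth[OF p dm K _ that] gr1 by blast+
  have fin: "AE z in circ. norm z = 1 \<and> ?T 0 z < \<infinity>" using AE_circ T(2)[of 0] by auto
  have hardy: "g \<in> hardy_space p"
  proof -
    \<comment> \<open>Along the whole radius \<open>g\<close> differs from \<open>g 0\<close> by at
      most \<open>?T 0 z\<close>, so the tail bound at \<rho> = 0 already gives membership in the
      Hardy space.\<close>
    let ?B = "2 powr p * (norm (g 0) powr p + K * p powr p)"
    have "Lpow p (\<lambda>z. g (of_real r * z)) \<le> ennreal ((?B powr (1/p)) powr p)" if r: "0 < r" "r < 1" for r
    proof -
      have "Lpow p (\<lambda>z. g (of_real r * z)) \<le> (\<integral>\<^sup>+z. ennreal (2 powr p) * (ennreal (norm (g 0) powr p) + ennreal (enn2real (?T 0 z) powr p)) \<partial>circ)"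
        unfolding Lpow_def
      proof (rule nn_integral_mono_AE, use fin in eventually_elim)
        case (elim z)
        then have "ennreal (norm (g (of_real r * z) - g (of_real 0 * z))) \<le> ?T 0 z"
          unfolding d_def by (intro radial_diff_le[OF g]) (use r in auto)
        then have "norm (g (of_real r * z) - g 0) \<le> enn2real (?T 0 z)"
          using elim by (intro le_enn2realI) auto
        then have "norm (g (of_real r * z)) \<le> norm (g 0) + enn2real (?T 0 z)"
          using norm_triangle_sub[of "g (of_real r * z)" "g 0"] by linarith
        then have "norm (g (of_real r * z)) powr p \<le> (norm (g 0) + enn2real (?T 0 z)) powr p"
          using p by (intro powr_mono2) auto
        also have "\<dots> \<le> 2 powr p * (norm (g 0) powr p + enn2real (?T 0 z) powr p)" using p by (intro powr_add_le) auto
        finally show "ennreal (norm (g (of_real r * z)) powr p) \<le> ennreal (2 powr p) * (ennreal (norm (g 0) powr p) + ennreal (enn2real (?T 0 z) powr p))"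
          by (simp add: ennreal_mult[symmetric] ennreal_plus[symmetric] del: ennreal_plus)
      qed
      also have "\<dots> = ennreal (2 powr p) * (ennreal (norm (g 0) powr p) + (\<integral>\<^sup>+z. ennreal (enn2real (?T 0 z) powr p) \<partial>circ))"
        by (simp add: nn_integral_cmult nn_integral_add prob_space_circ)
      also have "\<dots> \<le> ennreal (2 powr p) * (ennreal (norm (g 0) powr p) + ennreal (K * p powr p))"
        using T(1)[of 0] by (intro mult_left_mono add_left_mono) auto
      also have "\<dots> = ennreal ?B" using K by (simp add: ennreal_mult[symmetric] ennreal_plus[symmetric] del: ennreal_plus)
      also have "?B = (?B powr (1/p)) powr p" using p K by (simp add: powr_powr)
      finally show ?thesis .
    qed
    then show ?thesis by (intro hardyI[OF g, of p "?B powr (1/p)"]) (use p in auto)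
  qed
  \<comment> \<open>Two radial legs and one arc; \<open>3 powr p\<close> comes from
    \<open>powr_add3_le\<close>.\<close>
  define C where "C = 3 powr p * (2 * K * p powr p + K)"
  have C: "0 \<le> C" using K by (simp add: C_def)
  define q where "q = (\<lambda>h. (1 / (2 * pi) * (LINT \<theta>:{0..2 * pi}|lebesgue.
           norm (boundary_function g (cis (\<theta> + h)) - boundary_function g (cis \<theta>)) powr p)) powr (1 / p))"
  have q: "q h \<le> C powr (1/p) * h powr (1/p)" if h: "0 < h" "h < 1" for h
  proof -
    \<comment> \<open>At depth \<open>h\<close> the radial legs and the arc are of the same
      order.\<close>
    define \<rho> where "\<rho> = 1 - h"
    have \<rho>: "0 \<le> \<rho>" "\<rho> < 1" using h by (auto simp: \<rho>_def)
    define S where "S = (\<lambda>z. \<integral>\<^sup>+x. ennreal (norm (d (of_real \<rho> * (cis x * z)))) * indicator {0..h} x \<partial>lborel)"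
    have [measurable]: "S \<in> borel_measurable borel" unfolding S_def by measurable
    have grr: "Lpow p (\<lambda>z. d (of_real \<rho> * z)) \<le> ennreal (K * h powr (1 - p))" using gr1[OF \<rho>] by (simp add: \<rho>_def)
    have Kh: "0 \<le> K * h powr (1 - p)" using K by simp
    have Sb: "(\<integral>\<^sup>+z. ennreal (enn2real (S z) powr p) \<partial>circ) \<le> ennreal (K * h powr (1 - p) * h powr p)"
      "AE z in circ. S z < \<infinity>"
      unfolding S_def by (rule arc_growth[OF p dm grr Kh h(1)])+
    have "h = 1 - \<rho>" by (simp add: \<rho>_def)
    then have Tb: "(\<integral>\<^sup>+z. ennreal (enn2real (?T \<rho> z) powr p) \<partial>circ) \<le> ennreal (K * p powr p * h)"
      using T(1)[OF \<rho>] by simp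
    define \<psi> where "\<psi> = (\<lambda>z. ennreal (3 powr p) * (ennreal (enn2real (?T \<rho> (cis h * z)) powr p) + ennreal (enn2real (S z) powr p) + ennreal (enn2real (?T \<rho> z) powr p)))"
    have [measurable]: "\<psi> \<in> borel_measurable borel" unfolding \<psi>_def by measurable
    have "(\<integral>\<^sup>+z. \<psi> z \<partial>circ) = ennreal (3 powr p) * ((\<integral>\<^sup>+z. ennreal (enn2real (?T \<rho> (cis h * z)) powr p) \<partial>circ) + (\<integral>\<^sup>+z. ennreal (enn2real (S z) powr p) \<partial>circ) + (\<integral>\<^sup>+z. ennreal (enn2real (?T \<rho> z) powr p) \<partial>circ))"
      unfolding \<psi>_def by (simp add: nn_integral_cmult nn_integral_add)
    also have "(\<integral>\<^sup>+z. ennreal (enn2real (?T \<rho> (cis h * z)) powr p) \<partial>circ) = (\<integral>\<^sup>+z. ennreal (enn2real (?T \<rho> z) powr p) \<partial>circ)"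
      by (rule nn_integral_circ_rotate) auto
    also have "ennreal (3 powr p) * ((\<integral>\<^sup>+z. ennreal (enn2real (?T \<rho> z) powr p) \<partial>circ) + (\<integral>\<^sup>+z. ennreal (enn2real (S z) powr p) \<partial>circ) + (\<integral>\<^sup>+z. ennreal (enn2real (?T \<rho> z) powr p) \<partial>circ))
      \<le> ennreal (3 powr p) * (ennreal (K * p powr p * h) + ennreal (K * h powr (1 - p) * h powr p) + ennreal (K * p powr p * h))"
      by (intro mult_left_mono add_mono Tb Sb(1)) auto
    also have "\<dots> = ennreal (C * h)"
      using K h by (simp add: C_def ennreal_mult[symmetric] ennreal_plus[symmetric] mult.assoc powr_add[symmetric] algebra_simps del: ennreal_plus)
    finally have \<psi>: "(\<integral>\<^sup>+z. \<psi> z \<partial>circ) \<le> ennreal (C * h)" .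
    \<comment> \<open>The end of the arc needs a radial limit too; invariance of the measure carries
      the exceptional null set along.\<close>
    have fin2: "AE z in circ. ?T 0 (cis h * z) < \<infinity>"
    proof -
      have "AE z in distr circ borel ((*) (cis h)). ?T 0 z < \<infinity>"
        using T(2)[of 0] by (subst distr_circ_rotate) auto
      then show ?thesis by (rule AE_distrD[rotated]) simp
    qed
    have le: "AE z in circ. ennreal (norm (boundary_function g (cis h * z) - boundary_function g z) powr p) \<le> \<psi> z"
      using fin fin2 Sb(2)
    proof eventually_elim
      case (elim z)
      then have z: "norm z = 1" "norm (cis h * z) = 1" by (auto simp: norm_mult)
      have f: "?T \<rho> z < \<infinity>" "?T \<rho> (cis h * z) < \<infinity>" "S z < \<infinity>"
        using elim K radial_tail_antimono[OF \<rho>(1), of d] by (auto intro: le_less_trans)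
      have 1: "norm (boundary_function g (cis h * z) - g (of_real \<rho> * (cis h * z))) \<le> enn2real (?T \<rho> (cis h * z))"
        by (rule le_enn2realI[OF _ f(2)], unfold d_def, rule radial_limit_of_tail(2)[OF g z(2) _ \<rho>]) (use elim in \<open>auto simp: d_def\<close>)
      have 2: "norm (boundary_function g z - g (of_real \<rho> * z)) \<le> enn2real (?T \<rho> z)"
        by (rule le_enn2realI[OF _ f(1)], unfold d_def, rule radial_limit_of_tail(2)[OF g z(1) _ \<rho>]) (use elim in \<open>auto simp: d_def\<close>)
      have 3: "norm (g (of_real \<rho> * (cis h * z)) - g (of_real \<rho> * z)) \<le> enn2real (S z)"
        by (rule le_enn2realI[OF _ f(3)], unfold S_def d_def, rule arc_diff_le[OF g z(1) \<rho>]) (use h in auto)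
      have "norm (boundary_function g (cis h * z) - boundary_function g z)
          = norm ((boundary_function g (cis h * z) - g (of_real \<rho> * (cis h * z))) + (g (of_real \<rho> * (cis h * z)) - g (of_real \<rho> * z)) + (g (of_real \<rho> * z) - boundary_function g z))"
        by simp
      also have "\<dots> \<le> norm (boundary_function g (cis h * z) - g (of_real \<rho> * (cis h * z))) + norm (g (of_real \<rho> * (cis h * z)) - g (of_real \<rho> * z)) + norm (g (of_real \<rho> * z) - boundary_function g z)"
        by (intro norm_triangle_mono order.refl)
      also have "\<dots> \<le> enn2real (?T \<rho> (cis h * z)) + enn2real (S z) + enn2real (?T \<rho> z)"
        using 1 2 3 by (simp add: norm_minus_commute)
      finally have "norm (boundary_function g (cis h * z) - boundary_function g z) powr p \<le> (enn2real (?T \<rho> (cis h * z)) + enn2real (S z) + enn2real (?T \<rho> z)) powr p"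
        using p by (intro powr_mono2) auto
      also have "\<dots> \<le> 3 powr p * (enn2real (?T \<rho> (cis h * z)) powr p + enn2real (S z) powr p + enn2real (?T \<rho> z) powr p)"
        using p by (intro powr_add3_le) auto
      finally show ?case unfolding \<psi>_def
        by (simp add: ennreal_mult[symmetric] ennreal_plus[symmetric] del: ennreal_plus)
    qed
    have "1 / (2 * pi) * (LINT \<theta>:{0..2 * pi}|lebesgue. norm (boundary_function g (cis h * cis \<theta>) - boundary_function g (cis \<theta>)) powr p) \<le> C * h"
      using LINT_angle_le[OF _ _ le \<psi>] C h by simp
    then have "q h \<le> (C * h) powr (1/p)"
      unfolding q_def using p
      by (intro powr_mono2) (auto simp: cis_mult add.commute set_lebesgue_integral_def intro!: Bochner_Integration.integral_nonneg)
    then show ?thesis by (simp add: powr_mult)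
  qed
  have "(\<lambda>t. integral_modulus_of_continuity p g t) \<in> O[at_right 0](\<lambda>t. t powr (1/p))"
  proof (rule bigoI)
    have "eventually (\<lambda>t::real. t \<in> {0<..<1}) (at_right 0)" by (rule eventually_at_right_real) simp
    then show "eventually (\<lambda>t. norm (integral_modulus_of_continuity p g t) \<le> C powr (1/p) * norm (t powr (1/p))) (at_right 0)"
    proof eventually_elim
      case (elim t)
      have qt: "q h \<le> C powr (1/p) * t powr (1/p)" if "h \<in> {0<..t}" for h
      proof -
        have "q h \<le> C powr (1/p) * h powr (1/p)" by (rule q) (use that elim in auto)
        also have "\<dots> \<le> C powr (1/p) * t powr (1/p)" using that p by (intro mult_left_mono powr_mono2) auto
        finally show ?thesis .
      qed
      have eq: "integral_modulus_of_continuity p g t = (SUP h\<in>{0<..t}. q h)"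
        by (simp add: integral_modulus_of_continuity_def q_def)
      have "0 \<le> q t" by (simp add: q_def)
      also have "q t \<le> (SUP h\<in>{0<..t}. q h)"
        using elim qt by (intro cSUP_upper bdd_aboveI[where M = "C powr (1/p) * t powr (1/p)"]) auto
      finally have "0 \<le> (SUP h\<in>{0<..t}. q h)" .
      moreover have "(SUP h\<in>{0<..t}. q h) \<le> C powr (1/p) * t powr (1/p)"
        using elim qt by (intro cSUP_least) auto
      ultimately show ?case by (simp add: eq)
    qed
  qed
  then show ?thesis using hardy by (simp add: mean_Lipschitz_def)
qed

section \<open>Boundary values of Hardy functions\<close>

text \<open>By the mean value theorem on the two halves, the increment over the right half is the
  larger one, because the derivative is strictly increasing.\<close>

lemma powr_midpoint_less:
  fixes x y :: real
  assumes p: "1 < p" and x: "0 \<le> x" "x < y"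
  shows "((x + y) / 2) powr p < (x powr p + y powr p) / 2"
proof -
  define m where "m = (x + y) / 2"
  have m: "x < m" "m < y" using x by (auto simp: m_def)
  have der: "((\<lambda>t. t powr p) has_real_derivative p * t powr (p - 1)) (at t)" if "0 < t" for t :: real
    using that by (auto intro!: derivative_eq_intros)
  have dif: "(\<lambda>t. t powr p) differentiable (at t)" if "0 < t" for t :: real
    using der[OF that] by (auto simp: real_differentiable_def)
  have cont: "continuous_on S (\<lambda>t. t powr p)" if "S \<subseteq> {0..}" for S :: "real set"
    using p that by (intro continuous_on_powr' continuous_intros) auto
  have "\<exists>l z. x < z \<and> z < m \<and> DERIV (\<lambda>t. t powr p) z :> l \<and> m powr p - x powr p = (m - x) * l"
    by (rule MVT[OF m(1) cont]) (use x m in \<open>auto intro!: dif\<close>)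
  then obtain l z where z: "x < z" "z < m" "DERIV (\<lambda>t. t powr p) z :> l" "m powr p - x powr p = (m - x) * l" by blast
  have "\<exists>l z. m < z \<and> z < y \<and> DERIV (\<lambda>t. t powr p) z :> l \<and> y powr p - m powr p = (y - m) * l"
    by (rule MVT[OF m(2) cont]) (use x m in \<open>auto intro!: dif\<close>)
  then obtain l' z' where z': "m < z'" "z' < y" "DERIV (\<lambda>t. t powr p) z' :> l'" "y powr p - m powr p = (y - m) * l'" by blast
  have l: "l = p * z powr (p - 1)" "l' = p * z' powr (p - 1)"
    using DERIV_unique[OF z(3) der] DERIV_unique[OF z'(3) der] z z' x m by auto
  have "z powr (p - 1) < z' powr (p - 1)" using z z' x p by (intro powr_less_mono2) auto
  then have "l < l'" using l p by simp
  moreover have mx: "m - x = y - m" by (simp add: m_def field_simps)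
  ultimately have "(m - x) * l < (y - m) * l'" using m by (simp only: mx mult_less_cancel_left_pos)
  then have "m powr p - x powr p < y powr p - m powr p"
    using z(4) z'(4) by simp
  then show ?thesis by (simp add: m_def[symmetric])
qed

lemma powr_midpoint_le:
  fixes x y :: real
  assumes "1 < p" "0 \<le> x" "0 \<le> y"
  shows "((x + y) / 2) powr p \<le> (x powr p + y powr p) / 2"
  using powr_midpoint_less[of p x y] powr_midpoint_less[of p y x] assms
  by (cases x y rule: linorder_cases) (auto simp: add.commute)

lemma norm_midpoint_powr_le:
  fixes a b :: complex
  assumes p: "1 < p"
  shows "norm ((a + b) / 2) powr p \<le> (norm a powr p + norm b powr p) / 2"
proof -
  have "norm ((a + b) / 2) \<le> (norm a + norm b) / 2" using norm_triangle_ineq[of a b] by simp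
  then have "norm ((a + b) / 2) powr p \<le> ((norm a + norm b) / 2) powr p" using p by (intro powr_mono2) auto
  also have "\<dots> \<le> (norm a powr p + norm b powr p) / 2" using p by (intro powr_midpoint_le) auto
  finally show ?thesis .
qed

text \<open>If the norms differ, strictness comes from the power function; if they agree, from the
  parallelogram law.\<close>

lemma norm_midpoint_powr_less:
  fixes a b :: complex
  assumes p: "1 < p" and ab: "a \<noteq> b"
  shows "norm ((a + b) / 2) powr p < (norm a powr p + norm b powr p) / 2"
proof (cases "norm a = norm b")
  case False
  have "norm ((a + b) / 2) \<le> (norm a + norm b) / 2" using norm_triangle_ineq[of a b] by simp
  then have "norm ((a + b) / 2) powr p \<le> ((norm a + norm b) / 2) powr p" using p by (intro powr_mono2) auto
  also have "\<dots> < (norm a powr p + norm b powr p) / 2"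
    using powr_midpoint_less[of p "norm a" "norm b"] powr_midpoint_less[of p "norm b" "norm a"] False p
    by (cases "norm a" "norm b" rule: linorder_cases) (auto simp: add.commute)
  finally show ?thesis .
next
  case True
  have "(norm (a + b))\<^sup>2 + (norm (a - b))\<^sup>2 = 2 * (norm a)\<^sup>2 + 2 * (norm b)\<^sup>2"
    by (simp add: cmod_power2) (simp add: power2_eq_square algebra_simps)
  moreover have "0 < (norm (a - b))\<^sup>2" using ab by simp
  ultimately have "(norm (a + b))\<^sup>2 < 4 * (norm a)\<^sup>2" unfolding True by linarith
  then have "(norm (a + b))\<^sup>2 < (2 * norm a)\<^sup>2" by (simp add: power_mult_distrib)
  then have "norm (a + b) < 2 * norm a" by (rule power2_less_imp_less) simp
  then have "norm ((a + b) / 2) < norm a" by simp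
  then have "norm ((a + b) / 2) powr p < norm a powr p" using p by (intro powr_less_mono2) auto
  then show ?thesis using True by simp
qed

text \<open>By homogeneity a pair can be scaled to maximal norm 1. On that compact set the convexity
  defect is positive, hence bounded below by some \<delta>; as the normalised average of the powers
  is at most 1, the additive gain \<delta> becomes the factor \<open>1 - \<delta>\<close>.\<close>

lemma uniform_convexity:
  assumes p: "1 < p" and e: "0 < e"
  obtains \<delta> where "0 < \<delta>" "\<And>a b :: complex. e * max (norm a) (norm b) \<le> norm (a - b) \<Longrightarrow>
      norm ((a + b) / 2) powr p \<le> (1 - \<delta>) * ((norm a powr p + norm b powr p) / 2)"
proof -
  define S where "S = {x :: complex \<times> complex. max (norm (fst x)) (norm (snd x)) = 1 \<and> e \<le> norm (fst x - snd x)}"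
  define \<phi> where "\<phi> = (\<lambda>x :: complex \<times> complex. (norm (fst x) powr p + norm (snd x) powr p) / 2 - norm ((fst x + snd x) / 2) powr p)"
  have cont: "continuous_on S \<phi>" unfolding \<phi>_def
    using p by (intro continuous_intros continuous_on_powr') auto
  have "closed S" unfolding S_def
    by (intro closed_Collect_conj closed_Collect_eq closed_Collect_le continuous_intros)
  moreover have "S \<subseteq> cball 0 1 \<times> cball 0 1" unfolding S_def by auto
  ultimately have comp: "compact S"
    using compact_Int_closed[OF compact_Times[OF compact_cball compact_cball], of S] by (metis Int_absorb1)
  have pos: "0 < \<phi> x" if "x \<in> S" for x
  proof -
    have "fst x \<noteq> snd x" using that e by (auto simp: S_def)
    then show ?thesis using norm_midpoint_powr_less[OF p, of "fst x" "snd x"] by (simp add: \<phi>_def)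
  qed
  obtain \<delta> where \<delta>: "0 < \<delta>" "\<And>x. x \<in> S \<Longrightarrow> \<delta> \<le> \<phi> x"
  \<comment> \<open>For \<open>e > 2\<close> no pair qualifies, and any positive value
    serves.\<close>
  proof (cases "S = {}")
    case False
    then obtain x where "x \<in> S" "\<And>y. y \<in> S \<Longrightarrow> \<phi> x \<le> \<phi> y"
      using continuous_attains_inf[OF comp _ cont] by blast
    then show ?thesis using that[of "\<phi> x"] pos by blast
  qed (use that[of 1] in auto)
  show ?thesis
  proof (rule that[OF \<delta>(1)])
    fix a b :: complex assume ab: "e * max (norm a) (norm b) \<le> norm (a - b)"
    define c where "c = max (norm a) (norm b)"
    show "norm ((a + b) / 2) powr p \<le> (1 - \<delta>) * ((norm a powr p + norm b powr p) / 2)"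
    proof (cases "c = 0")
      case True
      then have "a = 0" "b = 0" by (auto simp: c_def max_def split: if_splits)
      then show ?thesis by simp
    next
      case False
      then have c: "0 < c" by (auto simp: c_def max_def split: if_splits)
      let ?a = "a / of_real c" and ?b = "b / of_real c"
      have na: "norm ?a = norm a / c" "norm ?b = norm b / c" using c by (auto simp: norm_divide)
      have d: "norm (?a - ?b) = norm (a - b) / c" using c by (simp add: diff_divide_distrib[symmetric] norm_divide)
      have m: "norm ((?a + ?b) / 2) = norm ((a + b) / 2) / c" using c by (simp add: add_divide_distrib[symmetric] norm_divide)
      have "max (norm ?a) (norm ?b) = 1" unfolding na using c by (auto simp: c_def max_def field_simps)
      moreover have "e \<le> norm (?a - ?b)" unfolding d using ab c by (simp add: c_def field_simps)
      ultimately have "(?a, ?b) \<in> S" by (simp add: S_def)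
      from \<delta>(2)[OF this] have D: "\<delta> \<le> ((norm a / c) powr p + (norm b / c) powr p) / 2 - (norm ((a + b) / 2) / c) powr p"
        by (simp only: \<phi>_def fst_conv snd_conv na m)
      have "(norm a / c) powr p \<le> 1" "(norm b / c) powr p \<le> 1"
        using c p by (auto intro!: powr_le1 simp: c_def field_simps)
      then have "\<delta> * (((norm a / c) powr p + (norm b / c) powr p) / 2) \<le> \<delta> * 1"
        using \<delta>(1) by (intro mult_left_mono) auto
      with D have "(norm ((a + b) / 2) / c) powr p \<le> (1 - \<delta>) * (((norm a / c) powr p + (norm b / c) powr p) / 2)"
        by (simp add: algebra_simps)
      then have "norm ((a + b) / 2) powr p / c powr p \<le> (1 - \<delta>) * ((norm a powr p + norm b powr p) / 2) / c powr p"
        using c by (simp only: powr_divide add_divide_distrib[symmetric] divide_divide_eq_left times_divide_eq_right mult.commute[of "c powr p" 2])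
      moreover have "0 < c powr p" using c by simp
      ultimately show ?thesis by (rule divide_le_cancel[THEN iffD1, THEN conjunct1, THEN mp])
    qed
  qed
qed

text \<open>An additive form of uniform convexity that can be integrated over the circle without
  splitting it. For points relatively far apart the defect, multiplied by \<open>C\<close>, pays for
  their distance; otherwise the distance is itself small compared with their norms.\<close>

lemma convexity_defect:
  assumes p: "1 < p" and e: "0 < e"
  obtains C where "0 \<le> C" "\<And>a b :: complex. norm (a - b) powr p + 2 * C * norm ((a + b) / 2) powr p
     \<le> (e + C) * (norm a powr p + norm b powr p)"
proof -
  obtain \<delta> where \<delta>: "0 < \<delta>" "\<And>a b :: complex. e powr (1/p) * max (norm a) (norm b) \<le> norm (a - b) \<Longrightarrow>
      norm ((a + b) / 2) powr p \<le> (1 - \<delta>) * ((norm a powr p + norm b powr p) / 2)"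
    using uniform_convexity[OF p, of "e powr (1/p)"] e by auto
  \<comment> \<open>Then the crude bound \<open>2 powr p * ?s\<close> for the distance is exactly
    the gain \<open>C * \<delta> * ?s\<close>.\<close>
  define C where "C = 2 powr p / \<delta>"
  have C: "0 \<le> C" using \<delta> by (simp add: C_def)
  show ?thesis
  proof (rule that[OF C])
    fix a b :: complex
    let ?s = "norm a powr p + norm b powr p"
    show "norm (a - b) powr p + 2 * C * norm ((a + b) / 2) powr p \<le> (e + C) * ?s"
    proof (cases "e powr (1/p) * max (norm a) (norm b) \<le> norm (a - b)")
      case True
      have "norm (a - b) powr p \<le> (norm a + norm b) powr p"
        using p by (intro powr_mono2 norm_triangle_ineq4) auto
      also have "\<dots> \<le> 2 powr p * ?s" using p by (intro powr_add_le) auto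
      also have "2 powr p = C * \<delta>" using \<delta> by (simp add: C_def)
      finally have 1: "norm (a - b) powr p \<le> C * \<delta> * ?s" .
      have "2 * C * norm ((a + b) / 2) powr p \<le> 2 * C * ((1 - \<delta>) * (?s / 2))"
        using \<delta>(2)[OF True] C by (intro mult_left_mono) auto
      with 1 have "norm (a - b) powr p + 2 * C * norm ((a + b) / 2) powr p \<le> C * ?s" by (simp add: algebra_simps)
      also have "\<dots> \<le> (e + C) * ?s" using e by (intro mult_right_mono) auto
      finally show ?thesis .
    next
      case False
      then have "norm (a - b) powr p \<le> (e powr (1/p) * max (norm a) (norm b)) powr p"
        using p by (intro powr_mono2) auto
      also have "\<dots> = e * max (norm a) (norm b) powr p" using p e by (simp add: powr_mult powr_powr)
      also have "\<dots> \<le> e * ?s" using e by (intro mult_left_mono) (auto simp: max_def)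
      finally have 1: "norm (a - b) powr p \<le> e * ?s" .
      have "2 * C * norm ((a + b) / 2) powr p \<le> 2 * C * (?s / 2)"
        using norm_midpoint_powr_le[OF p] C by (intro mult_left_mono) auto
      with 1 show ?thesis by (simp add: algebra_simps)
    qed
  qed
qed

text \<open>
  Fix a radius \<open>s\<close> whose mean is close to the supremum. For \<open>x\<close>, \<open>y\<close> near 1 the midpoint of the dilates
  at \<open>x\<close> and \<open>y\<close>, dilated further by \<open>s\<close>, is uniformly close to the dilate at \<open>s\<close>. As dilation
  decreases the mean, the midpoint has almost maximal mean, and uniform convexity makes the dilates close.
\<close>

lemma Lpow_dilates_Cauchy:
  assumes p: "1 < p" and F: "F holomorphic_on ball 0 1" and B: "0 \<le> B"
    and le: "\<And>r. 0 < r \<Longrightarrow> r < 1 \<Longrightarrow> Lpow p (\<lambda>z. F (of_real r * z)) \<le> ennreal B" and e: "0 < e"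
  shows "\<exists>r0. 0 < r0 \<and> r0 < 1 \<and> (\<forall>x y. r0 < x \<longrightarrow> x < 1 \<longrightarrow> r0 < y \<longrightarrow> y < 1 \<longrightarrow>
      Lpow p (\<lambda>z. F (of_real x * z) - F (of_real y * z)) \<le> ennreal e)"
proof -
  have Fc: "continuous_on (ball 0 1) F" by (rule holomorphic_on_imp_continuous_on[OF F])
  have [measurable]: "disc_ext F \<in> borel_measurable borel" by (rule disc_ext_measurable[OF F])
  define I where "I = (\<lambda>r. enn2real (Lpow p (\<lambda>z. F (of_real r * z))))"
  have IL: "Lpow p (\<lambda>z. F (of_real r * z)) = ennreal (I r)" if "0 < r" "r < 1" for r
    unfolding I_def using le[OF that] by (subst ennreal_enn2real) (auto intro: le_less_trans)
  have I0: "0 \<le> I r" for r by (simp add: I_def)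
  have IB: "I r \<le> B" if "0 < r" "r < 1" for r using le[OF that] B by (simp add: IL[OF that] ennreal_le_iff)
  define S where "S = (SUP r\<in>{0<..<1}. I r)"
  have bdd: "bdd_above (I ` {0<..<1})" using IB by (auto intro!: bdd_aboveI[where M = B])
  have IS: "I r \<le> S" if "0 < r" "r < 1" for r unfolding S_def using that bdd by (intro cSUP_upper) auto
  have S0: "0 \<le> S" using I0[of "1/2"] IS[of "1/2"] by linarith
  \<comment> \<open>\<open>e1\<close>, and later \<open>\<eta>\<close>, are chosen so that the final
    errors \<open>2 * e1 * S\<close> and \<open>4 * C * \<eta>\<close> are each at most
    \<open>e / 2\<close>.\<close>
  define e1 where "e1 = e / (4 * (S + 1))"
  have e1: "0 < e1" using e S0 by (simp add: e1_def)
  obtain C where C: "0 \<le> C" "\<And>a b :: complex. norm (a - b) powr p + 2 * C * norm ((a + b) / 2) powr p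
     \<le> (e1 + C) * (norm a powr p + norm b powr p)" using convexity_defect[OF p e1] by blast
  define \<eta> where "\<eta> = e / (8 * (C + 1))"
  have \<eta>: "0 < \<eta>" using e C by (simp add: \<eta>_def)
  have "\<exists>s\<in>{0<..<1}. S - \<eta> < I s"
    by (subst less_cSUP_iff[symmetric, OF _ bdd]) (use \<eta> in \<open>simp_all add: S_def\<close>)
  then obtain s where s: "0 < s" "s < 1" "S - \<eta> < I s" by auto
  \<comment> \<open>The further dilation by \<open>s\<close> keeps all arguments in a compact part
    of the disc, so the endpoints \<open>x = 1\<close> and \<open>y = 1\<close> are admissible and
    uniform continuity is available.\<close>
  let ?\<phi> = "\<lambda>(x, y, z). norm ((F (of_real s * (of_real x * z)) + F (of_real s * (of_real y * z))) / 2) powr p"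
  let ?D = "{0..1} \<times> {0..1} \<times> sphere (0::complex) 1"
  have in1: "norm (of_real s * (of_real x * z)) < 1" if "x \<in> {0..1}" "norm z = 1" for x and z :: complex
    using that s by (auto simp: norm_mult intro!: le_less_trans[of "s * x" s] mult_left_le)
  have "uniformly_continuous_on ?D ?\<phi>"
  proof (rule compact_uniformly_continuous)
    show "continuous_on ?D ?\<phi>" unfolding split_beta
      using p in1 by (intro continuous_on_powr' continuous_intros continuous_on_compose2[OF Fc]) auto
  qed (intro compact_Times compact_Icc compact_sphere)
  then obtain d where d: "0 < d" "\<And>u v. u \<in> ?D \<Longrightarrow> v \<in> ?D \<Longrightarrow> dist v u < d \<Longrightarrow> dist (?\<phi> v) (?\<phi> u) < \<eta>"
    unfolding uniformly_continuous_on_def using \<eta> by blast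
  \<comment> \<open>Each of the two radii then moves by less than \<open>d / 2\<close> from 1; the
    bound 1/2 keeps both positive.\<close>
  define r0 where "r0 = max (1/2) (1 - d/2)"
  have r0: "0 < r0" "r0 < 1" using d(1) by (auto simp: r0_def)
  show ?thesis
  proof (intro exI[of _ r0] conjI r0 allI impI)
    fix x y assume x: "r0 < x" "x < 1" and y: "r0 < y" "y < 1"
    have xy: "0 < x" "0 < y" "1 - d/2 < x" "1 - d/2 < y" using x y r0 by (auto simp: r0_def)
    define a where "a = (\<lambda>z. disc_ext F (of_real x * z))"
    define b where "b = (\<lambda>z. disc_ext F (of_real y * z))"
    have [measurable]: "a \<in> borel_measurable borel" "b \<in> borel_measurable borel" unfolding a_def b_def by measurable
    define G where "G = (\<lambda>z. (a z + b z) / 2)"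
    have [measurable]: "G \<in> borel_measurable borel" unfolding G_def by measurable
    \<comment> \<open>Both dilates extend to this disc, beyond the closed unit disc, as
      \<open>Lpow_dilate_le\<close> demands of their midpoint.\<close>
    define R where "R = 1 / max x y"
    have R: "1 < R" using x y xy by (auto simp: R_def max_def)
    have hG: "G holomorphic_on ball 0 R"
    proof -
      have "a holomorphic_on ball 0 (1 / x)" "b holomorphic_on ball 0 (1 / y)"
        unfolding a_def b_def using xy by (auto intro!: dilate_holomorphic disc_ext_holomorphic F)
      moreover have "R \<le> 1 / x" "R \<le> 1 / y" using xy by (auto simp: R_def max_def field_simps)
      ultimately show ?thesis unfolding G_def
        by (intro holomorphic_intros) (auto intro: holomorphic_on_subset subset_ball)
    qed
    have La: "Lpow p a = ennreal (I x)" "Lpow p b = ennreal (I y)"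
      using x y xy by (auto simp: IL[symmetric] a_def b_def disc_ext_eq norm_mult intro!: Lpow_cong)
    have "ennreal (I s) \<le> Lpow p (\<lambda>z. G (of_real s * z)) + ennreal \<eta>"
    proof -
      have "ennreal (I s) = (\<integral>\<^sup>+z. ennreal (norm (F (of_real s * z)) powr p) \<partial>circ)"
        using IL[OF s(1,2)] by (simp add: Lpow_def)
      also have "\<dots> \<le> (\<integral>\<^sup>+z. ennreal (norm (G (of_real s * z)) powr p) + ennreal \<eta> \<partial>circ)"
      proof (rule nn_integral_circ_mono)
        fix z :: complex assume z: "norm z = 1"
        have "dist (x, y, z) (1, 1, z) < d"
        proof -
          have "dist (x, y, z) (1, 1, z) \<le> dist x 1 + dist (y, z) (1, z)"
            unfolding dist_Pair_Pair by (rule sqrt_sum_squares_le_sum) auto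
          also have "dist (y, z) (1, z) = dist y 1" by (simp add: dist_Pair_Pair)
          finally show ?thesis using xy x y by (simp add: dist_real_def)
        qed
        then have "dist (?\<phi> (x, y, z)) (?\<phi> (1, 1, z)) < \<eta>" using z x y xy by (intro d(2)) auto
        moreover have "?\<phi> (1, 1, z) = norm (F (of_real s * z)) powr p" by simp
        moreover have "?\<phi> (x, y, z) = norm (G (of_real s * z)) powr p"
          using in1[of x z] in1[of y z] x y xy z by (simp add: G_def a_def b_def disc_ext_eq mult.left_commute)
        ultimately have "norm (F (of_real s * z)) powr p \<le> norm (G (of_real s * z)) powr p + \<eta>"
          by (simp add: dist_real_def)
        then show "ennreal (norm (F (of_real s * z)) powr p) \<le> ennreal (norm (G (of_real s * z)) powr p) + ennreal \<eta>"
          using \<eta> by (simp add: ennreal_plus[symmetric] ennreal_leI del: ennreal_plus)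
      qed
      also have "\<dots> = Lpow p (\<lambda>z. G (of_real s * z)) + ennreal \<eta>"
        by (simp add: Lpow_def nn_integral_add prob_space_circ)
      finally show ?thesis .
    qed
    also have "\<dots> \<le> Lpow p G + ennreal \<eta>"
      by (intro add_right_mono Lpow_dilate_le[OF _ hG R]) (use s p in auto)
    finally have LG: "ennreal (I s) \<le> Lpow p G + ennreal \<eta>" .
    have "Lpow p (\<lambda>z. a z - b z) + ennreal (2 * C) * Lpow p G \<le> ennreal (e1 + C) * (Lpow p a + Lpow p b)"
    proof -
      have "Lpow p (\<lambda>z. a z - b z) + ennreal (2 * C) * Lpow p G = (\<integral>\<^sup>+z. ennreal (norm (a z - b z) powr p + 2 * C * norm (G z) powr p) \<partial>circ)"
        unfolding Lpow_def using C(1) by (simp add: nn_integral_add nn_integral_cmult[symmetric] ennreal_mult)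
      also have "\<dots> \<le> (\<integral>\<^sup>+z. ennreal (e1 + C) * (ennreal (norm (a z) powr p) + ennreal (norm (b z) powr p)) \<partial>circ)"
        using C(2) e1 C(1) unfolding G_def
        by (intro nn_integral_mono) (simp add: ennreal_mult[symmetric] ennreal_plus[symmetric] ennreal_leI del: ennreal_plus)
      also have "\<dots> = ennreal (e1 + C) * (Lpow p a + Lpow p b)"
        unfolding Lpow_def by (simp add: nn_integral_add nn_integral_cmult)
      finally show ?thesis .
    qed
    also have "\<dots> \<le> ennreal (e1 + C) * (ennreal S + ennreal S)"
      unfolding La using IS x y xy by (intro mult_left_mono add_mono ennreal_leI) auto
    also have "\<dots> = ennreal (2 * (e1 + C) * S)"
      using S0 e1 C(1) by (simp add: ennreal_mult[symmetric] ennreal_plus[symmetric] del: ennreal_plus)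
    finally have main: "Lpow p (\<lambda>z. a z - b z) + ennreal (2 * C) * Lpow p G \<le> ennreal (2 * (e1 + C) * S)" .
    then have "Lpow p (\<lambda>z. a z - b z) < \<infinity>"
      by (metis ennreal_less_top infinity_ennreal_def le_iff_add order.strict_trans1 add_increasing2 order.refl order.trans zero_le)
    then obtain X where X: "0 \<le> X" "Lpow p (\<lambda>z. a z - b z) = ennreal X" by (cases "Lpow p (\<lambda>z. a z - b z)") auto
    have "Lpow p G < \<infinity>"
    proof -
      have "Lpow p G \<le> (\<integral>\<^sup>+z. ennreal (norm (a z) powr p) + ennreal (norm (b z) powr p) \<partial>circ)"
        unfolding Lpow_def
      proof (intro nn_integral_mono)
        fix z
        have "norm (G z) powr p \<le> norm (a z) powr p + norm (b z) powr p"
          unfolding G_def by (rule order.trans[OF norm_midpoint_powr_le[OF p]]) simp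
        then show "ennreal (norm (G z) powr p) \<le> ennreal (norm (a z) powr p) + ennreal (norm (b z) powr p)"
          by (simp add: ennreal_plus[symmetric] ennreal_leI del: ennreal_plus)
      qed
      also have "\<dots> = Lpow p a + Lpow p b"
        unfolding Lpow_def by (simp add: nn_integral_add)
      also have "\<dots> < \<infinity>" unfolding La by simp
      finally show ?thesis .
    qed
    then obtain Y where Y: "0 \<le> Y" "Lpow p G = ennreal Y" by (cases "Lpow p G") auto
    have "I s \<le> Y + \<eta>" using LG Y \<eta> by (simp add: ennreal_plus[symmetric] ennreal_le_iff del: ennreal_plus)
    moreover have "X + 2 * C * Y \<le> 2 * (e1 + C) * S"
    proof -
      have "ennreal (X + 2 * C * Y) \<le> ennreal (2 * (e1 + C) * S)"
        using main X Y C(1) by (simp add: ennreal_mult[symmetric] ennreal_plus[symmetric] del: ennreal_plus)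
      then show ?thesis using S0 e1 C(1) by (subst (asm) ennreal_le_iff) auto
    qed
    \<comment> \<open>The midpoint has almost maximal mean:
      \<open>S - \<eta> < I s \<le> Y + \<eta>\<close>. The terms \<open>2 * C * S\<close> now
      cancel.\<close>
    moreover have "2 * C * (S - 2 * \<eta>) \<le> 2 * C * Y" using C(1) calculation(1) s(3) by (intro mult_left_mono) auto
    ultimately have "X \<le> 2 * e1 * S + 4 * C * \<eta>" by (simp add: algebra_simps)
    also have "2 * e1 * S \<le> e / 2" using e S0 by (simp add: e1_def field_simps)
    also have "4 * C * \<eta> \<le> e / 2" using e C(1) by (simp add: \<eta>_def field_simps)
    finally have "X \<le> e" by simp
    moreover have "Lpow p (\<lambda>z. F (of_real x * z) - F (of_real y * z)) = Lpow p (\<lambda>z. a z - b z)"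
      using x y xy by (intro Lpow_cong) (simp add: a_def b_def disc_ext_eq norm_mult)
    ultimately show "Lpow p (\<lambda>z. F (of_real x * z) - F (of_real y * z)) \<le> ennreal e"
      using X by (simp add: ennreal_leI)
  qed
qed

section \<open>The radial maximal function\<close>

lemma nn_integral_circ_sym:
  assumes [measurable]: "f \<in> borel_measurable borel"
  shows "(\<integral>\<^sup>+z. f z \<partial>circ) = (\<integral>\<^sup>+t. f (cis t) * indicator {-pi..pi} t \<partial>lborel) / ennreal (2 * pi)"
proof -
  have "(\<integral>\<^sup>+z. f z \<partial>circ) = (\<integral>\<^sup>+z. f ((-1) * z) \<partial>circ)"
    by (rule nn_integral_circ_rotate[symmetric]) auto
  also have "\<dots> = (\<integral>\<^sup>+t. f (- cis t) * indicator {0..2*pi} t \<partial>lborel) / ennreal (2 * pi)"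
    by (subst nn_integral_circ_angle) auto
  also have "(\<integral>\<^sup>+t. f (- cis t) * indicator {0..2*pi} t \<partial>lborel) = (\<integral>\<^sup>+t. f (- cis (pi + 1 * t)) * indicator {0..2*pi} (pi + 1 * t) \<partial>lborel)"
    by (subst nn_integral_real_affine[where c = 1 and t = pi]) auto
  also have "\<dots> = (\<integral>\<^sup>+t. f (cis t) * indicator {-pi..pi} t \<partial>lborel)"
    by (intro nn_integral_cong) (auto simp: indicator_def cis_mult[symmetric])
  finally show ?thesis .
qed

text \<open>The kernel is a superposition of the normalised indicators of the intervals \<open>[-y, y]\<close>.\<close>

lemma Poisson_type_average:
  fixes \<phi> :: "real \<Rightarrow> ennreal"
  assumes [measurable]: "\<phi> \<in> borel_measurable borel" and d: "0 < d" "d \<le> 1" and c: "0 \<le> c"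
    and avg: "\<And>x. 0 < x \<Longrightarrow> x \<le> pi \<Longrightarrow> (\<integral>\<^sup>+s. \<phi> s * indicator {-x..x} s \<partial>lborel) \<le> ennreal (2 * x * c)"
  shows "(\<integral>\<^sup>+s. \<phi> s * ennreal (if \<bar>s\<bar> \<le> d then 1 / d else d / s\<^sup>2) * indicator {-pi..pi} s \<partial>lborel) \<le> ennreal (5 * c)"
proof -
  let ?K = "\<lambda>s::real. if \<bar>s\<bar> \<le> d then 1 / d else d / s\<^sup>2"
  have dpi: "d < pi" using d pi_gt3 by linarith
  \<comment> \<open>The integral of \<open>2 * d / y ^ 3\<close> from
    \<open>max \<bar>s\<bar> d\<close> to \<open>pi\<close> is
    \<open>d / (max \<bar>s\<bar> d)\<^sup>2 - d / pi\<^sup>2\<close>. The constant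
    \<open>d / pi\<^sup>2\<close> restores the value of the kernel at the ends of the
    window.\<close>
  have K: "ennreal (?K s) = ennreal (d / pi\<^sup>2) + (\<integral>\<^sup>+y. ennreal (2 * d / y ^ 3) * indicator {d..pi} y * indicator {-y..y} s \<partial>lborel)"
    if s: "s \<in> {-pi..pi}" for s
  proof -
    define a where "a = max \<bar>s\<bar> d"
    have a: "0 < a" "a \<le> pi" using s d dpi by (auto simp: a_def)
    have "(\<integral>\<^sup>+y. ennreal (2 * d / y ^ 3) * indicator {d..pi} y * indicator {-y..y} s \<partial>lborel)
       = (\<integral>\<^sup>+y. ennreal (2 * d / y ^ 3) * indicator {a..pi} y \<partial>lborel)"
      by (intro nn_integral_cong) (auto simp: indicator_def a_def)
    also have "\<dots> = ennreal (- d / pi\<^sup>2 - (- d / a\<^sup>2))"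
    proof (rule nn_integral_FTC_Icc)
      fix y assume y: "y \<in> {a..pi}"
      then have "y \<noteq> 0" using a by auto
      then show "((\<lambda>y. - d / y\<^sup>2) has_real_derivative 2 * d / y ^ 3) (at y)"
        by (auto intro!: derivative_eq_intros simp: field_simps power2_eq_square power3_eq_cube)
      show "0 \<le> 2 * d / y ^ 3" using y a d by auto
    qed (use a in auto)
    finally have "ennreal (d / pi\<^sup>2) + (\<integral>\<^sup>+y. ennreal (2 * d / y ^ 3) * indicator {d..pi} y * indicator {-y..y} s \<partial>lborel)
       = ennreal (d / pi\<^sup>2) + ennreal (- d / pi\<^sup>2 - (- d / a\<^sup>2))" by simp
    also have "\<dots> = ennreal (d / pi\<^sup>2 + (- d / pi\<^sup>2 - (- d / a\<^sup>2)))"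
      using a d by (intro ennreal_plus[symmetric]) (auto simp: divide_left_mono power_mono)
    also have "d / pi\<^sup>2 + (- d / pi\<^sup>2 - (- d / a\<^sup>2)) = ?K s"
      using d by (auto simp: a_def max_def power2_eq_square)
    finally show ?thesis ..
  qed
  let ?D = "\<integral>\<^sup>+s. \<integral>\<^sup>+y. \<phi> s * indicator {-pi..pi} s * (ennreal (2 * d / y ^ 3) * indicator {d..pi} y * indicator {-y..y} s) \<partial>lborel \<partial>lborel"
  have "(\<integral>\<^sup>+s. \<phi> s * ennreal (?K s) * indicator {-pi..pi} s \<partial>lborel)
    = (\<integral>\<^sup>+s. ennreal (d / pi\<^sup>2) * (\<phi> s * indicator {-pi..pi} s)
        + (\<integral>\<^sup>+y. \<phi> s * indicator {-pi..pi} s * (ennreal (2 * d / y ^ 3) * indicator {d..pi} y * indicator {-y..y} s) \<partial>lborel) \<partial>lborel)"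
  proof (intro nn_integral_cong)
    fix s :: real
    show "\<phi> s * ennreal (?K s) * indicator {-pi..pi} s = ennreal (d / pi\<^sup>2) * (\<phi> s * indicator {-pi..pi} s)
        + (\<integral>\<^sup>+y. \<phi> s * indicator {-pi..pi} s * (ennreal (2 * d / y ^ 3) * indicator {d..pi} y * indicator {-y..y} s) \<partial>lborel)"
    proof (cases "s \<in> {-pi..pi}")
      case True
      have "(\<integral>\<^sup>+y. \<phi> s * indicator {-pi..pi} s * (ennreal (2 * d / y ^ 3) * indicator {d..pi} y * indicator {-y..y} s) \<partial>lborel)
        = \<phi> s * indicator {-pi..pi} s * (\<integral>\<^sup>+y. ennreal (2 * d / y ^ 3) * indicator {d..pi} y * indicator {-y..y} s \<partial>lborel)"
        by (rule nn_integral_cmult) (simp add: indicator_def if_distrib cong: if_cong)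
      then show ?thesis using True by (simp only: K[OF True]) (simp add: distrib_left mult.commute)
    qed simp
  qed
  also have "\<dots> = ennreal (d / pi\<^sup>2) * (\<integral>\<^sup>+s. \<phi> s * indicator {-pi..pi} s \<partial>lborel)
        + (\<integral>\<^sup>+s. \<integral>\<^sup>+y. \<phi> s * indicator {-pi..pi} s * (ennreal (2 * d / y ^ 3) * indicator {d..pi} y * indicator {-y..y} s) \<partial>lborel \<partial>lborel)"
    by (subst nn_integral_add) (auto simp: nn_integral_cmult indicator_def if_distrib cong: if_cong)
  finally have decomp: "(\<integral>\<^sup>+s. \<phi> s * ennreal (?K s) * indicator {-pi..pi} s \<partial>lborel) = ennreal (d / pi\<^sup>2) * (\<integral>\<^sup>+s. \<phi> s * indicator {-pi..pi} s \<partial>lborel) + ?D" .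
  have "?D
     = (\<integral>\<^sup>+y. \<integral>\<^sup>+s. \<phi> s * indicator {-pi..pi} s * (ennreal (2 * d / y ^ 3) * indicator {d..pi} y * indicator {-y..y} s) \<partial>lborel \<partial>lborel)"
    by (rule lborel_pair.Fubini'[symmetric]) (simp add: indicator_def if_distrib cong: if_cong)
  also have "\<dots> \<le> (\<integral>\<^sup>+y. ennreal (4 * d * c / y\<^sup>2) * indicator {d..pi} y \<partial>lborel)"
  proof (intro nn_integral_mono)
    fix y :: real
    show "(\<integral>\<^sup>+s. \<phi> s * indicator {-pi..pi} s * (ennreal (2 * d / y ^ 3) * indicator {d..pi} y * indicator {-y..y} s) \<partial>lborel)
      \<le> ennreal (4 * d * c / y\<^sup>2) * indicator {d..pi} y"
    proof (cases "y \<in> {d..pi}")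
      case True
      then have y: "0 < y" "y \<le> pi" using d by auto
      have "(\<integral>\<^sup>+s. \<phi> s * indicator {-pi..pi} s * (ennreal (2 * d / y ^ 3) * indicator {d..pi} y * indicator {-y..y} s) \<partial>lborel)
        = (\<integral>\<^sup>+s. ennreal (2 * d / y ^ 3) * (\<phi> s * indicator {-y..y} s) \<partial>lborel)"
        using True by (intro nn_integral_cong) (auto simp: indicator_def mult.commute)
      also have "\<dots> = ennreal (2 * d / y ^ 3) * (\<integral>\<^sup>+s. \<phi> s * indicator {-y..y} s \<partial>lborel)"
        by (rule nn_integral_cmult) auto
      also have "\<dots> \<le> ennreal (2 * d / y ^ 3) * ennreal (2 * y * c)"
        by (intro mult_left_mono avg y) auto
      also have "\<dots> = ennreal (2 * d / y ^ 3 * (2 * y * c))"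
        using y d c by (intro ennreal_mult[symmetric]) auto
      also have "2 * d / y ^ 3 * (2 * y * c) = 4 * d * c / y\<^sup>2"
        using y by (simp add: power2_eq_square power3_eq_cube)
      finally show ?thesis using True by simp
    next
      case False
      then have "indicator {d..pi} y = (0::ennreal)" by (simp add: indicator_def)
      then show ?thesis by simp
    qed
  qed
  also have "\<dots> = ennreal (- (4 * d * c) * inverse pi - (- (4 * d * c) * inverse d))"
  proof (rule nn_integral_FTC_Icc[where F = "\<lambda>y. - (4 * d * c) * inverse y"])
    fix y assume y: "y \<in> {d..pi}"
    then have y0: "y \<noteq> 0" using d by auto
    show "((\<lambda>y. - (4 * d * c) * inverse y) has_real_derivative 4 * d * c / y\<^sup>2) (at y)"
      by (rule DERIV_cong[OF DERIV_cmult[OF DERIV_inverse[OF y0]]]) (simp add: divide_inverse power_inverse numeral_2_eq_2)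
    show "0 \<le> 4 * d * c / y\<^sup>2" using y c d by auto
  qed (use dpi in auto)
  also have "\<dots> \<le> ennreal (4 * c)"
  proof (rule ennreal_leI)
    have "0 \<le> 4 * d * c * inverse pi" using d c by simp
    moreover have "4 * d * c * inverse d = 4 * c" using d by simp
    ultimately show "- (4 * d * c) * inverse pi - (- (4 * d * c) * inverse d) \<le> 4 * c"
      unfolding minus_mult_left[symmetric] by linarith
  qed
  finally have 2: "?D \<le> ennreal (4 * c)" .
  have "ennreal (d / pi\<^sup>2) * (\<integral>\<^sup>+s. \<phi> s * indicator {-pi..pi} s \<partial>lborel) \<le> ennreal (d / pi\<^sup>2) * ennreal (2 * pi * c)"
    by (intro mult_left_mono avg) auto
  also have "\<dots> = ennreal (d / pi\<^sup>2 * (2 * pi * c))" using d c by (intro ennreal_mult[symmetric]) auto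
  also have "\<dots> \<le> ennreal c"
  proof (rule ennreal_leI)
    have "d / pi\<^sup>2 * (2 * pi * c) = (2 * d / pi) * c" by (simp add: power2_eq_square)
    also have "\<dots> \<le> 1 * c" using d c pi_gt3 by (intro mult_right_mono) (auto simp: field_simps)
    finally show "d / pi\<^sup>2 * (2 * pi * c) \<le> c" by simp
  qed
  finally have 1: "ennreal (d / pi\<^sup>2) * (\<integral>\<^sup>+s. \<phi> s * indicator {-pi..pi} s \<partial>lborel) \<le> ennreal c" .
  \<comment> \<open>The superposition gives 4, from the integral of
    \<open>4 * d * c / y\<^sup>2\<close> above \<open>d\<close>; the constant part gives at most 1
    because \<open>2 * d \<le> pi\<close>.\<close>
  have "ennreal c + ennreal (4 * c) = ennreal (5 * c)" using c by (simp add: ennreal_plus[symmetric] del: ennreal_plus)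
  then show ?thesis unfolding decomp using add_mono[OF 1 2] by simp
qed

text \<open>The chord is \<open>2 * \<bar>sin (t/2)\<bar>\<close>, and concavity of
  \<open>sin\<close> gives Jordan's inequality.\<close>

lemma cis_dist_lower:
  assumes "\<bar>t\<bar> \<le> pi"
  shows "2 * \<bar>t\<bar> / pi \<le> norm (cis t - 1)"
proof -
  have jordan: "2 * x / pi \<le> sin x" if "0 \<le> x" "x \<le> pi / 2" for x
  proof -
    have "concave_on {0..pi/2} sin"
      by (rule f''_le0_imp_concave[where f' = cos and f'' = "\<lambda>x. - sin x"]) (auto intro!: derivative_eq_intros sin_ge_zero)
    then have "(1 - 2 * x / pi) * sin 0 + (2 * x / pi) * sin (pi/2) \<le> sin ((1 - 2 * x / pi) *\<^sub>R 0 + (2 * x / pi) *\<^sub>R (pi/2))"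
      using that by (intro concave_onD) (auto simp: field_simps)
    then show ?thesis by simp
  qed
  have "(norm (cis t - 1))\<^sup>2 = (cos t - 1)\<^sup>2 + (sin t)\<^sup>2" by (simp add: cmod_power2)
  also have "\<dots> = 2 * (1 - cos t)" using sin_cos_squared_add[of t] by (simp add: power2_eq_square algebra_simps)
  also have "cos t = 1 - 2 * (sin (t/2))\<^sup>2" using cos_double_sin[of "t/2"] by simp
  finally have "(norm (cis t - 1))\<^sup>2 = (2 * \<bar>sin (t/2)\<bar>)\<^sup>2" by (simp add: power_mult_distrib)
  then have n: "norm (cis t - 1) = 2 * \<bar>sin (t/2)\<bar>" by (rule power2_eq_imp_eq) auto
  have "2 * \<bar>t/2\<bar> / pi \<le> sin \<bar>t/2\<bar>" by (rule jordan) (use assms in auto)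
  also have "\<dots> \<le> \<bar>sin (t/2)\<bar>" by (auto simp: abs_if)
  finally show ?thesis using n by simp
qed

lemma cis_dist_radius:
  assumes "\<bar>t\<bar> \<le> pi" "0 \<le> r" "r \<le> 1"
  shows "\<bar>t\<bar> / pi \<le> norm (cis t - of_real r)" "1 - r \<le> norm (cis t - of_real r)" "norm (cis t - 1) \<le> 2 * norm (cis t - of_real r)"
proof -
  show 1: "1 - r \<le> norm (cis t - of_real r)"
    using norm_triangle_ineq2[of "cis t" "of_real r"] assms by simp
  have "norm (cis t - 1) \<le> norm (cis t - of_real r) + norm (of_real r - (1::complex))"
    using norm_triangle_ineq[of "cis t - of_real r" "of_real r - 1"] by simp
  also have "norm (of_real r - (1::complex)) = 1 - r"
    using assms by (metis abs_minus_commute abs_of_nonneg diff_ge_0_iff_ge norm_of_real of_real_1 of_real_diff)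
  finally show 2: "norm (cis t - 1) \<le> 2 * norm (cis t - of_real r)" using 1 by simp
  show "\<bar>t\<bar> / pi \<le> norm (cis t - of_real r)" using 2 cis_dist_lower[OF assms(1)] by simp
qed

text \<open>The Poisson kernel is at most \<open>2 * pi\<^sup>2\<close> times the kernel of
  \<open>Poisson_type_average\<close> with \<open>d = 1 - r\<close>; the normalisation by
  \<open>2 * pi\<close> then turns its constant 5 into \<open>5 * pi\<close>.\<close>

lemma radial_bound_of_averages:
  assumes [measurable]: "F \<in> borel_measurable borel" and hol: "F holomorphic_on ball 0 R" and R: "R > 1"
    and r: "0 \<le> r" "r < 1" and c: "0 \<le> c"
    and avg: "\<And>x. 0 < x \<Longrightarrow> x \<le> pi \<Longrightarrow> (\<integral>\<^sup>+s. ennreal (norm (F (cis s))) * indicator {t-x..t+x} s \<partial>lborel) \<le> ennreal (2 * x * c)"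
  shows "norm (F (of_real r * cis t)) \<le> 5 * pi * c"
proof -
  define d where "d = 1 - r"
  have d: "0 < d" "d \<le> 1" using r by (auto simp: d_def)
  let ?K = "\<lambda>s::real. if \<bar>s\<bar> \<le> d then 1 / d else d / s\<^sup>2"
  define \<phi> where "\<phi> = (\<lambda>s. ennreal (norm (F (cis (t + s)))))"
  have [measurable]: "\<phi> \<in> borel_measurable borel" unfolding \<phi>_def by measurable
  have avg': "(\<integral>\<^sup>+s. \<phi> s * indicator {-x..x} s \<partial>lborel) \<le> ennreal (2 * x * c)" if x: "0 < x" "x \<le> pi" for x
  proof -
    have "(\<integral>\<^sup>+s. ennreal (norm (F (cis s))) * indicator {t-x..t+x} s \<partial>lborel)
      = (\<integral>\<^sup>+s. ennreal (norm (F (cis (t + 1 * s)))) * indicator {t-x..t+x} (t + 1 * s) \<partial>lborel)"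
      by (subst nn_integral_real_affine[where c = 1 and t = t]) auto
    also have "\<dots> = (\<integral>\<^sup>+s. \<phi> s * indicator {-x..x} s \<partial>lborel)"
      by (intro nn_integral_cong) (auto simp: indicator_def \<phi>_def)
    finally show ?thesis using avg[OF x] by simp
  qed
  have ker: "(1 - r\<^sup>2) / (norm (cis s - of_real r))\<^sup>2 \<le> 2 * pi\<^sup>2 * ?K s" if s: "s \<in> {-pi..pi}" for s
  proof -
    have n: "\<bar>s\<bar> / pi \<le> norm (cis s - of_real r)" "d \<le> norm (cis s - of_real r)"
      using cis_dist_radius[of s r] s r by (auto simp: d_def)
    have "1 - r\<^sup>2 = d * (1 + r)" by (simp add: d_def power2_eq_square algebra_simps)
    then have num: "1 - r\<^sup>2 \<le> 2 * d" "0 \<le> 1 - r\<^sup>2" using r d by auto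
    show ?thesis
    proof (cases "\<bar>s\<bar> \<le> d")
      case True
      have "(1 - r\<^sup>2) / (norm (cis s - of_real r))\<^sup>2 \<le> 2 * d / d\<^sup>2"
        using num n d by (intro frac_le power_mono) auto
      also have "\<dots> = 2 * 1 * (1 / d)" using d by (simp add: power2_eq_square)
      also have "\<dots> \<le> 2 * pi\<^sup>2 * (1 / d)" using d pi_gt3 by (intro mult_right_mono mult_left_mono one_le_power) auto
      finally show ?thesis using True by simp
    next
      case False
      then have s0: "0 < \<bar>s\<bar>" using d by auto
      have "(1 - r\<^sup>2) / (norm (cis s - of_real r))\<^sup>2 \<le> 2 * d / (\<bar>s\<bar> / pi)\<^sup>2"
        using num n s0 by (intro frac_le power_mono) auto
      also have "\<dots> = 2 * pi\<^sup>2 * (d / s\<^sup>2)" by (simp add: power_divide)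
      finally show ?thesis using False by simp
    qed
  qed
  have "ennreal (norm (F (of_real r * cis t))) \<le> (\<integral>\<^sup>+e. ennreal (norm (F (cis t * e)) * ((1 - r\<^sup>2) / (norm (e - of_real r))\<^sup>2)) \<partial>circ)"
    by (rule Poisson_norm_bound[OF _ hol R r]) auto
  also have "\<dots> = (\<integral>\<^sup>+s. ennreal (norm (F (cis t * cis s)) * ((1 - r\<^sup>2) / (norm (cis s - of_real r))\<^sup>2)) * indicator {-pi..pi} s \<partial>lborel) / ennreal (2 * pi)"
    by (rule nn_integral_circ_sym) measurable
  also have "\<dots> \<le> (\<integral>\<^sup>+s. ennreal (2 * pi\<^sup>2) * (\<phi> s * ennreal (?K s) * indicator {-pi..pi} s) \<partial>lborel) / ennreal (2 * pi)"
  proof (intro divide_right_mono_ennreal nn_integral_mono)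
    fix s :: real
    show "ennreal (norm (F (cis t * cis s)) * ((1 - r\<^sup>2) / (norm (cis s - of_real r))\<^sup>2)) * indicator {-pi..pi} s
       \<le> ennreal (2 * pi\<^sup>2) * (\<phi> s * ennreal (?K s) * indicator {-pi..pi} s)"
    proof (cases "s \<in> {-pi..pi}")
      case True
      have K0: "0 \<le> ?K s" using d by auto
      have "norm (F (cis t * cis s)) * ((1 - r\<^sup>2) / (norm (cis s - of_real r))\<^sup>2) \<le> norm (F (cis t * cis s)) * (2 * pi\<^sup>2 * ?K s)"
        by (intro mult_left_mono ker True) auto
      also have "\<dots> = 2 * pi\<^sup>2 * (norm (F (cis (t + s))) * ?K s)" by (simp add: cis_mult)
      finally show ?thesis using True K0 unfolding \<phi>_def
        by (simp only: ennreal_mult[symmetric] norm_ge_zero indicator_simps mult_1_right) (auto intro!: ennreal_leI simp: ennreal_mult[symmetric])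
    qed simp
  qed
  also have "\<dots> = ennreal (2 * pi\<^sup>2) * (\<integral>\<^sup>+s. \<phi> s * ennreal (?K s) * indicator {-pi..pi} s \<partial>lborel) / ennreal (2 * pi)"
    by (subst nn_integral_cmult) measurable
  also have "\<dots> \<le> ennreal (2 * pi\<^sup>2) * ennreal (5 * c) / ennreal (2 * pi)"
    by (intro divide_right_mono_ennreal mult_left_mono Poisson_type_average d c avg') auto
  also have "\<dots> = ennreal (2 * pi\<^sup>2 * (5 * c) / (2 * pi))"
    using c by (simp add: ennreal_mult[symmetric] divide_ennreal)
  also have "2 * pi\<^sup>2 * (5 * c) / (2 * pi) = 5 * pi * c" by (simp add: power2_eq_square)
  finally show ?thesis using c by (simp add: ennreal_le_iff)
qed

lemma emeasure_periodic_window: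
  fixes \<phi> :: "real \<Rightarrow> ennreal"
  assumes [measurable]: "\<phi> \<in> borel_measurable borel" and per: "\<And>t. \<phi> (t + T) = \<phi> t"
  shows "(\<integral>\<^sup>+t. \<phi> t * indicator {-T..2*T} t \<partial>lborel) \<le> 3 * (\<integral>\<^sup>+t. \<phi> t * indicator {0..T} t \<partial>lborel)"
proof -
  let ?A = "\<integral>\<^sup>+t. \<phi> t * indicator {0..T} t \<partial>lborel"
  have per': "\<phi> (t - T) = \<phi> t" for t using per[of "t - T"] by simp
  have a: "(\<integral>\<^sup>+t. \<phi> t * indicator {-T..0} t \<partial>lborel) = ?A"
  proof -
    have "(\<integral>\<^sup>+t. \<phi> t * indicator {-T..0} t \<partial>lborel) = (\<integral>\<^sup>+t. \<phi> (-T + 1 * t) * indicator {-T..0} (-T + 1 * t) \<partial>lborel)"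
      by (subst nn_integral_real_affine[where c = 1 and t = "-T"]) auto
    also have "\<dots> = ?A" using per' by (intro nn_integral_cong) (auto simp: indicator_def)
    finally show ?thesis .
  qed
  have b: "(\<integral>\<^sup>+t. \<phi> t * indicator {T..2*T} t \<partial>lborel) = ?A"
  proof -
    have "(\<integral>\<^sup>+t. \<phi> t * indicator {T..2*T} t \<partial>lborel) = (\<integral>\<^sup>+t. \<phi> (T + 1 * t) * indicator {T..2*T} (T + 1 * t) \<partial>lborel)"
      by (subst nn_integral_real_affine[where c = 1 and t = "T"]) auto
    also have "\<dots> = ?A" using per by (intro nn_integral_cong) (auto simp: indicator_def add.commute)
    finally show ?thesis .
  qed
  have "(\<integral>\<^sup>+t. \<phi> t * indicator {-T..2*T} t \<partial>lborel) \<le> (\<integral>\<^sup>+t. \<phi> t * indicator {-T..0} t + \<phi> t * indicator {0..T} t + \<phi> t * indicator {T..2*T} t \<partial>lborel)"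
    by (intro nn_integral_mono) (auto simp: indicator_def)
  also have "\<dots> = (\<integral>\<^sup>+t. \<phi> t * indicator {-T..0} t \<partial>lborel) + ?A + (\<integral>\<^sup>+t. \<phi> t * indicator {T..2*T} t \<partial>lborel)"
    by (simp add: nn_integral_add)
  also have "\<dots> = (1 + 1 + 1) * ?A" unfolding a b by (simp only: distrib_right mult_1)
  also have "(1 + 1 + 1 :: ennreal) = 3" by simp
  finally show ?thesis .
qed

text \<open>By Vitali's lemma countably many of the intervals are disjoint while their fivefold
  enlargements cover \<open>E\<close>. An enlargement has length \<open>10 * \<rho> t\<close>, at
  most \<open>5 / c\<close> times the mass of its interval, and the masses of disjoint intervals add
  up inside \<open>W\<close>.\<close>

lemma covering_bound:
  fixes \<phi> :: "real \<Rightarrow> ennreal" and \<rho> :: "real \<Rightarrow> real"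
  assumes [measurable]: "\<phi> \<in> borel_measurable borel" "E \<in> sets borel"
    and r: "\<And>t. t \<in> E \<Longrightarrow> 0 < \<rho> t \<and> \<rho> t \<le> M" and sub: "\<And>t. t \<in> E \<Longrightarrow> {t - \<rho> t..t + \<rho> t} \<subseteq> W"
    and W[measurable]: "W \<in> sets borel" and c: "0 < c"
    and big: "\<And>t. t \<in> E \<Longrightarrow> ennreal (2 * \<rho> t * c) \<le> (\<integral>\<^sup>+s. \<phi> s * indicator {t - \<rho> t..t + \<rho> t} s \<partial>lborel)"
  shows "emeasure lborel E \<le> ennreal (5 / c) * (\<integral>\<^sup>+s. \<phi> s * indicator W s \<partial>lborel)"
proof -
  have "E \<subseteq> (\<Union>t\<in>E. cball t (\<rho> t))" using r by (fastforce simp: less_imp_le)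
  then obtain C where C: "countable C" "C \<subseteq> E"
     "pairwise (\<lambda>i j. disjnt (cball i (\<rho> i)) (cball j (\<rho> j))) C"
     "E \<subseteq> (\<Union>i\<in>C. cball i (5 * \<rho> i))"
    by (rule Vitali_covering_lemma_cballs[OF _ r])
  \<comment> \<open>The selected centres are indexed by the subset \<open>X\<close> of the naturals;
    empty sets fill the gaps, so that sums over all naturals apply.\<close>
  define X where "X = to_nat_on C ` C"
  define f where "f = from_nat_into C"
  have fto: "f (to_nat_on C t) = t" if "t \<in> C" for t
    unfolding f_def by (rule from_nat_into_to_nat_on[OF C(1) that])
  have fC: "f n \<in> C" if "n \<in> X" for n using that fto by (auto simp: X_def)
  have finj: "m = n" if "m \<in> X" "n \<in> X" "f m = f n" for m n
    using that fto by (auto simp: X_def)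
  have fsurj: "\<exists>n\<in>X. f n = t" if "t \<in> C" for t
    using that fto by (auto simp: X_def)
  define A where "A = (\<lambda>n. if n \<in> X then cball (f n) (\<rho> (f n)) else {})"
  define D where "D = (\<lambda>n. if n \<in> X then cball (f n) (5 * \<rho> (f n)) else {})"
  have disj: "disjoint_family A"
    unfolding disjoint_family_on_def
  proof (intro ballI impI)
    fix m n :: nat assume "m \<noteq> n"
    then show "A m \<inter> A n = {}"
      using C(3) fC[of m] fC[of n] finj[of m n] unfolding A_def pairwise_def disjnt_def by auto
  qed
  define \<nu> where "\<nu> = density lborel \<phi>"
  have nu: "emeasure \<nu> B = (\<integral>\<^sup>+s. \<phi> s * indicator B s \<partial>lborel)" if "B \<in> sets borel" for B
    unfolding \<nu>_def using that by (subst emeasure_density) auto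
  have "emeasure lborel E \<le> emeasure lborel (\<Union>n. D n)"
  proof (rule emeasure_mono)
    show "E \<subseteq> (\<Union>n. D n)"
    proof
      fix t assume "t \<in> E"
      then obtain i where i: "i \<in> C" "t \<in> cball i (5 * \<rho> i)" using C(4) by blast
      then obtain n where "n \<in> X" "f n = i" using fsurj by blast
      then show "t \<in> (\<Union>n. D n)" using i by (auto simp: D_def intro!: exI[of _ n])
    qed
  qed (auto simp: D_def)
  also have "\<dots> \<le> (\<Sum>n. emeasure lborel (D n))"
    by (rule emeasure_subadditive_countably) (auto simp: D_def)
  also have "\<dots> \<le> (\<Sum>n. ennreal (5 / c) * emeasure \<nu> (A n))"
  proof (intro suminf_le)
    fix n
    show "emeasure lborel (D n) \<le> ennreal (5 / c) * emeasure \<nu> (A n)"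
    proof (cases "n \<in> X")
      case True
      then have t: "f n \<in> E" using fC C(2) by blast
      have cb: "cball (f n) x = {f n - x..f n + x}" for x by (simp add: cball_eq_atLeastAtMost)
      have "emeasure lborel (D n) = ennreal (10 * \<rho> (f n))"
        using True r[OF t] by (simp add: D_def cb)
      also have "\<dots> = ennreal (5 / c) * ennreal (2 * \<rho> (f n) * c)"
        using r[OF t] c by (simp add: ennreal_mult[symmetric])
      also have "\<dots> \<le> ennreal (5 / c) * (\<integral>\<^sup>+s. \<phi> s * indicator {f n - \<rho> (f n)..f n + \<rho> (f n)} s \<partial>lborel)"
        by (intro mult_left_mono big t) simp
      also have "\<dots> = ennreal (5 / c) * emeasure \<nu> (A n)" using True by (simp add: nu A_def cb)
      finally show ?thesis .
    qed (simp add: D_def)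
  qed auto
  also have "\<dots> = ennreal (5 / c) * (\<Sum>n. emeasure \<nu> (A n))" by (rule ennreal_suminf_cmult)
  finally have 1: "emeasure lborel E \<le> ennreal (5 / c) * (\<Sum>n. emeasure \<nu> (A n))" .
  have "(\<Sum>n. emeasure \<nu> (A n)) = emeasure \<nu> (\<Union>n. A n)"
    by (rule suminf_emeasure[OF _ disj]) (auto simp: A_def \<nu>_def)
  also have "\<dots> \<le> emeasure \<nu> W"
  proof (rule emeasure_mono)
    show "(\<Union>n. A n) \<subseteq> W"
      using sub fC C(2) by (auto simp: A_def cball_eq_atLeastAtMost split: if_splits)
  qed (simp add: \<nu>_def)
  also have "emeasure \<nu> W = (\<integral>\<^sup>+s. \<phi> s * indicator W s \<partial>lborel)" by (rule nu[OF W])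
  finally show ?thesis by (intro order.trans[OF 1] mult_left_mono) auto
qed

text \<open>The union over \<open>r\<close> is uncountable, but it is the trace on the circle of a
  union of open sets once each condition is extended radially, by \<open>sgn\<close>, to the
  punctured plane.\<close>

lemma radial_level_set_measurable:
  assumes F: "F holomorphic_on ball 0 R" and R: "1 \<le> R" and Rs: "Rs \<subseteq> {0..<1}"
  shows "{z. norm z = 1 \<and> (\<exists>r\<in>Rs. l < norm (F (of_real r * z)))} \<in> sets borel"
proof -
  define U where "U = (\<Union>r\<in>Rs. {z \<in> - {0}. l < norm (F (of_real r * sgn z))})"
  have Fc: "continuous_on (ball 0 R) F" by (rule holomorphic_on_imp_continuous_on[OF F])
  have "open {z \<in> - {0}. l < norm (F (of_real r * sgn z))}" if r: "r \<in> Rs" for r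
  proof -
    have "0 \<le> r" "r < 1" using r Rs by auto
    then have "continuous_on (- {0}) (\<lambda>z::complex. norm (F (of_real r * sgn z)))"
      using R by (intro continuous_intros continuous_on_compose2[OF Fc]) (auto simp: norm_mult norm_sgn split: if_splits)
    then have "open ((- {0}) \<inter> (\<lambda>z::complex. norm (F (of_real r * sgn z))) -` {l<..})"
      by (rule continuous_open_preimage) auto
    then show ?thesis by (simp add: vimage_def Int_def)
  qed
  then have "open U" unfolding U_def by blast
  then have "sphere 0 1 \<inter> U \<in> sets borel" by simp
  also have "sphere 0 1 \<inter> U = {z. norm z = 1 \<and> (\<exists>r\<in>Rs. l < norm (F (of_real r * z)))}"
    unfolding U_def by (auto simp: sgn_div_norm)
  finally show ?thesis .
qed

text \<open>The constant 75 is 5 from the Vitali covering, 5 from the Poisson kernel and 3 from the periodic window.\<close>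

lemma radial_weak_type:
  assumes [measurable]: "F \<in> borel_measurable borel" and hol: "F holomorphic_on ball 0 R" and R: "R > 1" and l: "0 < l"
  shows "emeasure circ {z. norm z = 1 \<and> (\<exists>r\<in>{0..<1}. l < norm (F (of_real r * z)))}
     \<le> ennreal (75 * pi / l) * (\<integral>\<^sup>+z. ennreal (norm (F z)) \<partial>circ)"
proof -
  define E where "E = {z. norm z = 1 \<and> (\<exists>r\<in>{0..<1}. l < norm (F (of_real r * z)))}"
  have [measurable]: "E \<in> sets borel" unfolding E_def by (rule radial_level_set_measurable[OF hol]) (use R in auto)
  define E' where "E' = {t \<in> {0..2*pi}. cis t \<in> E}"
  have E'm: "E' \<in> sets borel"
  proof -
    have "cis -` E \<inter> space borel \<in> sets borel" by (rule measurable_sets[OF cis_borel_measurable]) simp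
    then have "{0..2*pi} \<inter> (cis -` E \<inter> space borel) \<in> sets borel" by (rule sets.Int[rotated]) simp
    then show ?thesis by (simp add: E'_def Int_def vimage_def)
  qed
  define \<phi> where "\<phi> = (\<lambda>s. ennreal (norm (F (cis s))))"
  have [measurable]: "\<phi> \<in> borel_measurable borel" unfolding \<phi>_def by measurable
  \<comment> \<open>If all averages around a point stayed below this \<open>c\<close>,
    \<open>radial_bound_of_averages\<close> would bound the function by \<open>l\<close> on the
    whole radius.\<close>
  define c where "c = l / (5 * pi)"
  have c: "0 < c" using l by (simp add: c_def)
  have "\<exists>x. 0 < x \<and> x \<le> pi \<and> ennreal (2 * x * c) \<le> (\<integral>\<^sup>+s. \<phi> s * indicator {t-x..t+x} s \<partial>lborel)" if t: "t \<in> E'" for t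
  proof (rule ccontr)
    assume "\<not> ?thesis"
    then have small: "(\<integral>\<^sup>+s. \<phi> s * indicator {t-x..t+x} s \<partial>lborel) \<le> ennreal (2 * x * c)" if "0 < x" "x \<le> pi" for x
      using that by (meson le_cases)
    obtain r where r: "0 \<le> r" "r < 1" "l < norm (F (of_real r * cis t))" using t by (auto simp: E'_def E_def)
    have "norm (F (of_real r * cis t)) \<le> 5 * pi * c"
      by (rule radial_bound_of_averages[OF _ hol R r(1,2)]) (use c small in \<open>auto simp: \<phi>_def\<close>)
    then show False using r(3) by (simp add: c_def)
  qed
  then obtain \<rho> where \<rho>: "\<And>t. t \<in> E' \<Longrightarrow> 0 < \<rho> t \<and> \<rho> t \<le> pi"
      "\<And>t. t \<in> E' \<Longrightarrow> ennreal (2 * \<rho> t * c) \<le> (\<integral>\<^sup>+s. \<phi> s * indicator {t - \<rho> t..t + \<rho> t} s \<partial>lborel)"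
    by metis
  \<comment> \<open>The centres lie in \<open>{0..2*pi}\<close> and the radii are at most
    \<open>pi\<close>, so three periods contain all intervals.\<close>
  have "emeasure lborel E' \<le> ennreal (5 / c) * (\<integral>\<^sup>+s. \<phi> s * indicator {-(2*pi)..2*(2*pi)} s \<partial>lborel)"
  proof (rule covering_bound[OF _ E'm \<rho>(1) _ _ c \<rho>(2)])
    fix t assume t: "t \<in> E'"
    then show "{t - \<rho> t..t + \<rho> t} \<subseteq> {-(2*pi)..2*(2*pi)}"
      using \<rho>(1)[OF t] by (auto simp: E'_def)
  qed auto
  also have "\<dots> \<le> ennreal (5 / c) * (3 * (\<integral>\<^sup>+s. \<phi> s * indicator {0..2*pi} s \<partial>lborel))"
    by (intro mult_left_mono emeasure_periodic_window) (auto simp: \<phi>_def cis_mult[symmetric])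
  finally have main: "emeasure lborel E' \<le> ennreal (5 / c) * (3 * (\<integral>\<^sup>+s. \<phi> s * indicator {0..2*pi} s \<partial>lborel))" .
  have "emeasure circ E = (\<integral>\<^sup>+z. indicator E z \<partial>circ)" by simp
  also have "\<dots> = (\<integral>\<^sup>+t. indicator E (cis t) * indicator {0..2*pi} t \<partial>lborel) / ennreal (2*pi)"
    by (rule nn_integral_circ_angle) simp
  also have "(\<integral>\<^sup>+t. indicator E (cis t) * indicator {0..2*pi} t \<partial>lborel) = (\<integral>\<^sup>+t. indicator E' t \<partial>lborel)"
    by (intro nn_integral_cong) (auto simp: indicator_def E'_def)
  also have "\<dots> = emeasure lborel E'" using E'm by simp
  also have "\<dots> / ennreal (2 * pi) \<le> ennreal (5 / c) * (3 * (\<integral>\<^sup>+s. \<phi> s * indicator {0..2*pi} s \<partial>lborel)) / ennreal (2 * pi)"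
    by (rule divide_right_mono_ennreal[OF main])
  also have "\<dots> = (ennreal (5 / c) * 3) * ((\<integral>\<^sup>+s. \<phi> s * indicator {0..2*pi} s \<partial>lborel) / ennreal (2 * pi))"
    by (simp only: ennreal_times_divide mult.assoc)
  also have "(\<integral>\<^sup>+s. \<phi> s * indicator {0..2*pi} s \<partial>lborel) / ennreal (2 * pi) = (\<integral>\<^sup>+z. ennreal (norm (F z)) \<partial>circ)"
    unfolding \<phi>_def by (rule nn_integral_circ_angle[symmetric]) measurable
  also have "ennreal (5 / c) * 3 = ennreal (75 * pi / l)"
  proof -
    have "ennreal (5 / c) * 3 = ennreal (5 / c) * ennreal 3" by simp
    also have "\<dots> = ennreal (5 / c * 3)" using c by (intro ennreal_mult[symmetric]) auto
    also have "5 / c * 3 = 75 * pi / l" by (simp add: c_def)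
    finally show ?thesis .
  qed
  finally show ?thesis by (simp add: E_def)
qed

section \<open>Existence of radial limits\<close>

lemma L1_le_Lpow:
  assumes p: "1 < p" and [measurable]: "u \<in> borel_measurable borel" and e: "Lpow p u \<le> ennreal e" "0 \<le> e"
  shows "(\<integral>\<^sup>+z. ennreal (norm (u z)) \<partial>circ) \<le> ennreal (e powr (1/p))"
  using nn_integral_Jensen_weight[OF p, of "\<lambda>z. norm (u z)" circ "\<lambda>_. 1" 1 e] e
  by (simp add: Lpow_def prob_space_circ)

lemma Cauchy_at_left_limit:
  fixes f :: "real \<Rightarrow> complex"
  assumes C: "\<And>e. 0 < e \<Longrightarrow> \<exists>a<1. \<forall>x\<in>{a<..<1}. \<forall>y\<in>{a<..<1}. dist (f x) (f y) < e"
  shows "\<exists>L. (f \<longlongrightarrow> L) (at_left 1)"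
proof -
  define A where "A = (\<lambda>n::nat. 1 - 1 / (real n + 2))"
  have limA: "A \<longlonglongrightarrow> 1" unfolding A_def by real_asymp
  have A1: "A n < 1" for n by (simp add: A_def)
  have ev: "eventually (\<lambda>n. A n \<in> {a<..<1}) sequentially" if "a < 1" for a
    using order_tendstoD(1)[OF limA that] by eventually_elim (use A1 in auto)
  have "Cauchy (\<lambda>n. f (A n))"
  proof (rule metric_CauchyI)
    fix e :: real assume "0 < e"
    then obtain a where a: "a < 1" "\<forall>x\<in>{a<..<1}. \<forall>y\<in>{a<..<1}. dist (f x) (f y) < e" using C by blast
    then show "\<exists>M. \<forall>m\<ge>M. \<forall>n\<ge>M. dist (f (A m)) (f (A n)) < e"
      using ev[OF a(1)] unfolding eventually_sequentially by blast
  qed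
  then obtain L where L: "(\<lambda>n. f (A n)) \<longlonglongrightarrow> L" using Cauchy_convergent convergent_def by blast
  have "(f \<longlongrightarrow> L) (at_left 1)"
  proof (rule tendstoI)
    fix e :: real assume e: "0 < e"
    then obtain a where a: "a < 1" "\<forall>x\<in>{a<..<1}. \<forall>y\<in>{a<..<1}. dist (f x) (f y) < e / 2" using C[of "e/2"] by auto
    have "eventually (\<lambda>n. dist (f (A n)) L < e / 2 \<and> A n \<in> {a<..<1}) sequentially"
      using tendstoD[OF L, of "e/2"] ev[OF a(1)] e by (auto intro: eventually_conj)
    then obtain n where n: "dist (f (A n)) L < e / 2" "A n \<in> {a<..<1}" by (auto simp: eventually_sequentially)
    have "eventually (\<lambda>x. x \<in> {a<..<1}) (at_left 1)" using a(1) by (rule eventually_at_left_real)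
    then show "eventually (\<lambda>x. dist (f x) L < e) (at_left 1)"
    proof eventually_elim
      case (elim x)
      have "dist (f x) L \<le> dist (f x) (f (A n)) + dist (f (A n)) L" by (rule dist_triangle)
      also have "\<dots> < e / 2 + e / 2" using a(2) elim n by (intro add_strict_mono) auto
      finally show ?case by simp
    qed
  qed
  then show ?thesis by blast
qed

text \<open>For \<rho> near 1 the difference \<open>G\<close> of the function and its dilate is
  small in the mean, so the weak-type bound makes its radial maximal function small off a small set.
  That bound needs holomorphy beyond the circle; it is applied to dilates of \<open>G\<close> whose
  radii increase to 1.\<close>

lemma oscillation_small:
  assumes p: "1 < p" and F: "F holomorphic_on ball 0 1" and B: "0 \<le> B"
    and le: "\<And>r. 0 < r \<Longrightarrow> r < 1 \<Longrightarrow> Lpow p (\<lambda>z. F (of_real r * z)) \<le> ennreal B" and l: "0 < l" and \<eta>: "0 < \<eta>"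
  obtains \<rho> where "0 < \<rho>" "\<rho> < 1"
    "{z. norm z = 1 \<and> (\<exists>r\<in>{0..<1}. l < norm (F (of_real r * z) - F (of_real \<rho> * (of_real r * z))))} \<in> sets borel"
    "emeasure circ {z. norm z = 1 \<and> (\<exists>r\<in>{0..<1}. l < norm (F (of_real r * z) - F (of_real \<rho> * (of_real r * z))))} \<le> ennreal (75 * pi / l * \<eta>)"
proof -
  have \<eta>p: "0 < \<eta> powr p" using \<eta> by simp
  \<comment> \<open>The tolerance \<open>\<eta> powr p\<close> becomes \<open>\<eta>\<close> in the
    first-power mean.\<close>
  obtain r0 where r0: "0 < r0" "r0 < 1" "\<And>x y. r0 < x \<Longrightarrow> x < 1 \<Longrightarrow> r0 < y \<Longrightarrow> y < 1 \<Longrightarrow>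
      Lpow p (\<lambda>z. F (of_real x * z) - F (of_real y * z)) \<le> ennreal (\<eta> powr p)"
    using Lpow_dilates_Cauchy[OF p F B _ \<eta>p] le by blast
  define \<rho> where "\<rho> = (r0 + 1) / 2"
  have \<rho>: "r0 < \<rho>" "\<rho> < 1" "0 < \<rho>" using r0 by (auto simp: \<rho>_def)
  have [measurable]: "disc_ext F \<in> borel_measurable borel" by (rule disc_ext_measurable[OF F])
  define G where "G = (\<lambda>z. F z - F (of_real \<rho> * z))"
  have hG: "G holomorphic_on ball 0 1"
  proof -
    have "(\<lambda>z. F (of_real \<rho> * z)) holomorphic_on ball 0 1"
      by (rule holomorphic_on_subset[OF dilate_holomorphic[OF F \<rho>(3)] subset_ball]) (use \<rho> in simp)
    then show ?thesis unfolding G_def by (intro holomorphic_intros F)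
  qed
  \<comment> \<open>Radii \<open>A n\<close> above \<open>q\<close> keep \<open>\<rho> * A n\<close>
    above \<open>r0\<close>, so both dilates are within reach of the Cauchy estimate.\<close>
  define q where "q = r0 / \<rho>"
  have q: "0 < q" "q < 1" using r0 \<rho> by (auto simp: q_def)
  define A where "A = (\<lambda>n::nat. 1 - (1 - q) / (real n + 2))"
  have A: "q < A n" "A n < 1" for n
  proof -
    have "(1 - q) / (real n + 2) < (1 - q) / 1" using q by (intro divide_strict_left_mono) auto
    then show "q < A n" by (simp add: A_def)
  qed (use q in \<open>auto simp: A_def\<close>)
  have A0: "0 < A n" for n using A(1)[of n] q by linarith
  have limA: "A \<longlonglongrightarrow> 1" unfolding A_def using q by real_asymp
  have mA: "A m \<le> A n" if "m \<le> n" for m n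
    unfolding A_def using that q by (intro diff_left_mono divide_left_mono) auto
  \<comment> \<open>Radii below \<open>A n\<close> for \<open>G\<close> correspond to radii below 1
    for its dilate by \<open>A n\<close>; the sets increase to the one in question.\<close>
  define E where "E = (\<lambda>n. {z. norm z = 1 \<and> (\<exists>r\<in>{0..<A n}. l < norm (G (of_real r * z)))})"
  have Em: "E n \<in> sets borel" for n unfolding E_def
    by (rule radial_level_set_measurable[OF hG]) (use A(2)[of n] in auto)
  have Eb: "emeasure circ (E n) \<le> ennreal (75 * pi / l * \<eta>)" for n
  proof -
    define H where "H = (\<lambda>z. disc_ext G (of_real (A n) * z))"
    have "disc_ext G \<in> borel_measurable borel" by (rule disc_ext_measurable[OF hG])
    then have [measurable]: "H \<in> borel_measurable borel" unfolding H_def by measurable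
    have hH: "H holomorphic_on ball 0 (1 / A n)"
      unfolding H_def by (rule dilate_holomorphic[OF disc_ext_holomorphic[OF hG] A0])
    have RH: "1 < 1 / A n" using A(2)[of n] A0[of n] by simp
    have "E n = {z. norm z = 1 \<and> (\<exists>r\<in>{0..<1}. l < norm (H (of_real r * z)))}"
      unfolding E_def
    proof (rule Collect_cong, rule conj_cong[OF refl], rule iffI)
      fix z :: complex assume z: "norm z = 1"
      show "\<exists>r\<in>{0..<1}. l < norm (H (of_real r * z))" if ex: "\<exists>r\<in>{0..<A n}. l < norm (G (of_real r * z))"
      proof -
        from ex obtain r where r: "0 \<le> r" "r < A n" "l < norm (G (of_real r * z))" by auto
        have "H (of_real (r / A n) * z) = G (of_real r * z)"
          using A0[of n] r A(2)[of n] z by (simp add: H_def disc_ext_eq norm_mult)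
        then show ?thesis using r A0[of n] by (intro bexI[of _ "r / A n"]) auto
      qed
      show "\<exists>r\<in>{0..<A n}. l < norm (G (of_real r * z))" if ex: "\<exists>r\<in>{0..<1}. l < norm (H (of_real r * z))"
      proof -
        from ex obtain r where r: "0 \<le> r" "r < 1" "l < norm (H (of_real r * z))" by auto
        have "A n * r < A n * 1" using r A0[of n] by (intro mult_strict_left_mono)
        then have Ar: "A n * r < A n" by simp
        have "A n * r < 1" using Ar A(2)[of n] by (rule less_trans)
        then have "norm (of_real (A n * r) * z) < 1" using A0[of n] r z by (simp add: norm_mult)
        then have "H (of_real r * z) = G (of_real (A n * r) * z)"
          unfolding H_def mult.assoc[symmetric] of_real_mult[symmetric] by (rule disc_ext_eq)
        then show ?thesis using r A0[of n] Ar by (intro bexI[of _ "A n * r"]) auto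
      qed
    qed
    then have "emeasure circ (E n) \<le> ennreal (75 * pi / l) * (\<integral>\<^sup>+z. ennreal (norm (H z)) \<partial>circ)"
      using radial_weak_type[OF _ hH RH l] by simp
    also have "(\<integral>\<^sup>+z. ennreal (norm (H z)) \<partial>circ) \<le> ennreal ((\<eta> powr p) powr (1/p))"
    proof (rule L1_le_Lpow[OF p])
      have "Lpow p H = Lpow p (\<lambda>z. F (of_real (A n) * z) - F (of_real (\<rho> * A n) * z))"
        using A0[of n] A(2)[of n] by (intro Lpow_cong) (simp add: H_def disc_ext_eq norm_mult G_def mult.assoc)
      also have "\<dots> \<le> ennreal (\<eta> powr p)"
      proof (rule r0(3))
        have "q < A n" by (rule A)
        then show "r0 < \<rho> * A n" using \<rho> by (simp add: q_def field_simps)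
        also have "\<rho> * A n \<le> 1 * A n" using \<rho> A0[of n] by (intro mult_right_mono) auto
        finally show "r0 < A n" by simp
        have "\<rho> * A n < 1 * 1" using \<rho> A0[of n] A(2)[of n] by (intro mult_strict_mono) auto
        then show "\<rho> * A n < 1" by simp
      qed (rule A)
      finally show "Lpow p H \<le> ennreal (\<eta> powr p)" .
    qed auto
    also have "(\<eta> powr p) powr (1/p) = \<eta>" using p \<eta> by (simp add: powr_powr)
    finally show ?thesis using l \<eta> by (simp add: ennreal_mult[symmetric] mult_left_mono)
  qed
  have EU: "{z. norm z = 1 \<and> (\<exists>r\<in>{0..<1}. l < norm (G (of_real r * z)))} = (\<Union>n. E n)"
  proof (intro set_eqI iffI)
    fix z assume "z \<in> {z. norm z = 1 \<and> (\<exists>r\<in>{0..<1}. l < norm (G (of_real r * z)))}"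
    then obtain r where r: "norm z = 1" "0 \<le> r" "r < 1" "l < norm (G (of_real r * z))" by auto
    have "eventually (\<lambda>n. r < A n) sequentially" using limA r(3) by (rule order_tendstoD(1))
    then obtain n where "r < A n" by (auto simp: eventually_sequentially)
    then show "z \<in> (\<Union>n. E n)" using r by (auto simp: E_def intro!: exI[of _ n])
  next
    fix z assume "z \<in> (\<Union>n. E n)"
    then obtain n r where "norm z = 1" "0 \<le> r" "r < A n" "l < norm (G (of_real r * z))" by (auto simp: E_def)
    then show "z \<in> {z. norm z = 1 \<and> (\<exists>r\<in>{0..<1}. l < norm (G (of_real r * z)))}"
      using A(2)[of n] by force
  qed
  have "incseq E"
  proof (rule monoI)
    fix m n :: nat assume "m \<le> n"
    then show "E m \<subseteq> E n" using mA[of m n] by (fastforce simp: E_def)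
  qed
  then have "emeasure circ (\<Union>n. E n) = (SUP n. emeasure circ (E n))"
    using Em by (intro SUP_emeasure_incseq[symmetric]) auto
  also have "\<dots> \<le> ennreal (75 * pi / l * \<eta>)" by (rule SUP_least) (rule Eb)
  finally have "emeasure circ (\<Union>n. E n) \<le> ennreal (75 * pi / l * \<eta>)" .
  moreover have "(\<Union>n. E n) \<in> sets borel" using Em by auto
  ultimately show ?thesis
    using that[OF \<rho>(3,2)] unfolding EU[symmetric] G_def by blast
qed

text \<open>A dilate of \<open>F\<close> is continuous across the circle, so its radial limits
  exist. By \<open>oscillation_small\<close> some dilate is uniformly close to \<open>F\<close>
  along the whole radius, except on a set of arbitrarily small measure.\<close>

lemma radial_limit_AE:
  assumes p: "1 < p" and F: "F holomorphic_on ball 0 1" and B: "0 \<le> B"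
    and le: "\<And>r. 0 < r \<Longrightarrow> r < 1 \<Longrightarrow> Lpow p (\<lambda>z. F (of_real r * z)) \<le> ennreal B"
  shows "AE z in circ. \<exists>L. ((\<lambda>r. F (of_real r * z)) \<longlongrightarrow> L) (at_left 1)"
proof -
  define E where "E = (\<lambda>l \<rho>. {z. norm z = 1 \<and> (\<exists>r\<in>{0..<1}. l < norm (F (of_real r * z) - F (of_real \<rho> * (of_real r * z))))})"
  have "\<exists>\<rho>. 0 < \<rho> \<and> \<rho> < 1 \<and> E (1 / (real k + 1)) \<rho> \<in> sets borel \<and>
      emeasure circ (E (1 / (real k + 1)) \<rho>) \<le> ennreal (75 * pi / (1 / (real k + 1)) * (1 / (real j + 1)))" for k j :: nat
  proof -
    have 1: "0 < 1 / (real k + 1)" "0 < 1 / (real j + 1)" by auto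
    show ?thesis unfolding E_def by (rule oscillation_small[OF p F B le 1]) blast+
  qed
  then obtain \<rho> where \<rho>: "\<And>k j :: nat. 0 < \<rho> k j \<and> \<rho> k j < 1 \<and> E (1 / (real k + 1)) (\<rho> k j) \<in> sets borel \<and>
      emeasure circ (E (1 / (real k + 1)) (\<rho> k j)) \<le> ennreal (75 * pi / (1 / (real k + 1)) * (1 / (real j + 1)))"
    by metis
  \<comment> \<open>Outside \<open>N k\<close> some dilate stays within
    \<open>1 / (real k + 1)\<close> of \<open>F\<close> on the whole radius; letting
    \<open>j\<close> grow shows that \<open>N k\<close> is null.\<close>
  define N where "N = (\<lambda>k. \<Inter>j. E (1 / (real k + 1)) (\<rho> k j))"
  have Nm: "N k \<in> sets circ" for k unfolding N_def using \<rho> by auto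
  have "emeasure circ (N k) = 0" for k
  proof -
    have "emeasure circ (N k) \<le> 0"
    proof (rule tendsto_lowerbound)
      have "(\<lambda>j::nat. 75 * pi / (1 / (real k + 1)) * (1 / (real j + 1))) \<longlonglongrightarrow> 0" by real_asymp
      then show "(\<lambda>j::nat. ennreal (75 * pi / (1 / (real k + 1)) * (1 / (real j + 1)))) \<longlonglongrightarrow> 0"
        using tendsto_ennrealI by fastforce
      show "eventually (\<lambda>j. emeasure circ (N k) \<le> ennreal (75 * pi / (1 / (real k + 1)) * (1 / (real j + 1)))) sequentially"
      proof (intro always_eventually allI)
        fix j
        have "emeasure circ (N k) \<le> emeasure circ (E (1 / (real k + 1)) (\<rho> k j))"
          by (rule emeasure_mono) (use \<rho> in \<open>auto simp: N_def\<close>)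
        then show "emeasure circ (N k) \<le> ennreal (75 * pi / (1 / (real k + 1)) * (1 / (real j + 1)))"
          using \<rho>[of k j] by auto
      qed
    qed simp
    then show ?thesis by simp
  qed
  then have "N k \<in> null_sets circ" for k using Nm by auto
  then have "(\<Union>k. N k) \<in> null_sets circ" by (rule null_sets_UN)
  then have "AE z in circ. z \<notin> (\<Union>k. N k)" by (rule AE_not_in)
  then show ?thesis using AE_circ
  proof eventually_elim
    case (elim z)
    show ?case
    proof (rule Cauchy_at_left_limit)
      fix e :: real assume e: "0 < e"
      obtain k :: nat where k: "1 / (real k + 1) < e / 4"
        using reals_Archimedean[of "e / 4"] e by (auto simp: inverse_eq_divide add.commute)
      obtain j where j: "z \<notin> E (1 / (real k + 1)) (\<rho> k j)" using elim(1) by (auto simp: N_def)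
      let ?\<rho> = "\<rho> k j"
      have b: "norm (F (of_real r * z) - F (of_real ?\<rho> * (of_real r * z))) \<le> 1 / (real k + 1)" if "0 \<le> r" "r < 1" for r
        using j that elim(2) by (auto simp: E_def not_less)
      have \<rho>01: "0 < ?\<rho>" "?\<rho> < 1" using \<rho> by auto
      have c: "isCont F (of_real ?\<rho> * z)"
        using holomorphic_on_imp_continuous_on[OF F] \<rho>01 elim(2) by (auto simp: continuous_on_eq_continuous_at norm_mult)
      have "((\<lambda>r. of_real ?\<rho> * (of_real r * z)) \<longlongrightarrow> of_real ?\<rho> * (of_real 1 * z)) (at_left 1)"
        by (intro tendsto_intros)
      then have "((\<lambda>r. F (of_real ?\<rho> * (of_real r * z))) \<longlongrightarrow> F (of_real ?\<rho> * z)) (at_left 1)"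
        by (intro isCont_tendsto_compose[OF c]) simp
      then have "eventually (\<lambda>r. dist (F (of_real ?\<rho> * (of_real r * z))) (F (of_real ?\<rho> * z)) < e / 4) (at_left 1)"
        using e by (intro tendstoD) auto
      then obtain a where a: "a < 1" "\<And>r. a < r \<Longrightarrow> r < 1 \<Longrightarrow> dist (F (of_real ?\<rho> * (of_real r * z))) (F (of_real ?\<rho> * z)) < e / 4"
        unfolding eventually_at_left_field by auto
      \<comment> \<open>One quarter of \<open>e\<close> goes to the distance between
        \<open>F\<close> and the dilate, one to the continuity of the dilate at
        \<open>z\<close>.\<close>
      have near: "dist (F (of_real r * z)) (F (of_real ?\<rho> * z)) < e / 2" if r: "max a 0 < r" "r < 1" for r
      proof -
        have "dist (F (of_real r * z)) (F (of_real ?\<rho> * z)) \<le> dist (F (of_real r * z)) (F (of_real ?\<rho> * (of_real r * z))) + dist (F (of_real ?\<rho> * (of_real r * z))) (F (of_real ?\<rho> * z))"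
          by (rule dist_triangle)
        also have "\<dots> < e / 4 + e / 4"
          using b[of r] k r a(2)[of r] by (intro add_strict_mono) (auto simp: dist_norm)
        finally show ?thesis by simp
      qed
      show "\<exists>a<1. \<forall>x\<in>{a<..<1}. \<forall>y\<in>{a<..<1}. dist (F (of_real x * z)) (F (of_real y * z)) < e"
      proof (intro exI[of _ "max a 0"] conjI ballI)
        fix x y assume "x \<in> {max a 0<..<1}" "y \<in> {max a 0<..<1}"
        then show "dist (F (of_real x * z)) (F (of_real y * z)) < e"
          using dist_triangle_half_l[OF near near, of x y] by simp
      qed (use a in auto)
    qed
  qed
qed

lemma Lpow_liminf:
  assumes [measurable]: "\<And>n. u n \<in> borel_measurable borel" and p: "0 < p"
    and lim: "AE z in circ. (\<lambda>n. u n z) \<longlonglongrightarrow> v z" and le: "eventually (\<lambda>n. Lpow p (u n) \<le> c) sequentially"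
  shows "Lpow p v \<le> c"
proof -
  have "Lpow p v = (\<integral>\<^sup>+z. liminf (\<lambda>n. ennreal (norm (u n z) powr p)) \<partial>circ)"
    unfolding Lpow_def
  proof (rule nn_integral_cong_AE, use lim in eventually_elim)
    case (elim z)
    have "(\<lambda>n. ennreal (norm (u n z) powr p)) \<longlonglongrightarrow> ennreal (norm (v z) powr p)"
      using p elim by (intro tendsto_ennrealI tendsto_powr' tendsto_intros) auto
    from lim_imp_Liminf[OF _ this] show ?case by simp
  qed
  also have "\<dots> \<le> liminf (\<lambda>n. Lpow p (u n))"
    unfolding Lpow_def by (rule nn_integral_liminf) measurable
  also have "\<dots> \<le> limsup (\<lambda>n. Lpow p (u n))" by (rule Liminf_le_Limsup) simp
  also have "\<dots> \<le> c" by (rule Limsup_bounded[OF le])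
  finally show ?thesis .
qed

text \<open>By Fatou's lemma the Cauchy property of the dilates passes to their boundary limit
  \<open>b\<close>, so the dilate at a radius \<rho> near 1 is close to \<open>b\<close> in the
  mean. It dominates all dilates of smaller radius, and the triangle inequality for p-th powers
  costs \<open>2 powr p\<close>.\<close>

lemma hardy_boundary_values:
  assumes p: "1 < p" and F: "F holomorphic_on ball 0 1" and B: "0 \<le> B"
    and le: "\<And>r. 0 < r \<Longrightarrow> r < 1 \<Longrightarrow> Lpow p (\<lambda>z. F (of_real r * z)) \<le> ennreal B"
  shows "\<exists>b. b \<in> borel_measurable borel \<and> (AE z in circ. ((\<lambda>r. F (of_real r * z)) \<longlongrightarrow> b z) (at_left 1)) \<and>
    Lpow p b \<le> ennreal B \<and> (\<forall>s. 0 \<le> s \<longrightarrow> s < 1 \<longrightarrow> Lpow p (\<lambda>z. F (of_real s * z)) \<le> ennreal (2 powr p) * Lpow p b)"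
proof -
  have [measurable]: "disc_ext F \<in> borel_measurable borel" by (rule disc_ext_measurable[OF F])
  define A where "A = (\<lambda>n::nat. 1 - 1 / (real n + 2))"
  have A: "0 < A n" "A n < 1" for n by (auto simp: A_def field_simps)
  have limA: "A \<longlonglongrightarrow> 1" unfolding A_def by real_asymp
  have limAf: "filterlim A (at_left 1) sequentially"
    unfolding filterlim_at using limA A by (auto simp: less_imp_neq)
  define u where "u = (\<lambda>n z. disc_ext F (of_real (A n) * z))"
  have [measurable]: "u n \<in> borel_measurable borel" for n unfolding u_def by measurable
  \<comment> \<open>A limit along one sequence is Borel everywhere, in contrast to the radial limit;
    where the latter exists, the two agree.\<close>
  define b where "b = (\<lambda>z. lim (\<lambda>n. u n z))"
  have bm[measurable]: "b \<in> borel_measurable borel" unfolding b_def by measurable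
  have uF: "u n z = F (of_real (A n) * z)" if "norm z = 1" for n z
    using that A[of n] by (simp add: u_def disc_ext_eq norm_mult)
  have rl: "AE z in circ. \<exists>L. ((\<lambda>r. F (of_real r * z)) \<longlongrightarrow> L) (at_left 1)"
    by (rule radial_limit_AE[OF p F B le])
  have both: "AE z in circ. ((\<lambda>r. F (of_real r * z)) \<longlongrightarrow> b z) (at_left 1) \<and> (\<lambda>n. u n z) \<longlonglongrightarrow> b z"
    using rl AE_circ
  proof eventually_elim
    case (elim z)
    then obtain L where L: "((\<lambda>r. F (of_real r * z)) \<longlongrightarrow> L) (at_left 1)" by blast
    have "(\<lambda>n. F (of_real (A n) * z)) \<longlonglongrightarrow> L" by (rule filterlim_compose[OF L limAf])
    then have "(\<lambda>n. u n z) \<longlonglongrightarrow> L" using uF[OF elim(2)] by simp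
    moreover from this have "b z = L" unfolding b_def by (rule limI)
    ultimately show ?case using L by simp
  qed
  have lim1: "AE z in circ. ((\<lambda>r. F (of_real r * z)) \<longlongrightarrow> b z) (at_left 1)" using both by eventually_elim auto
  have lim2: "AE z in circ. (\<lambda>n. u n z) \<longlonglongrightarrow> b z" using both by eventually_elim auto
  have Lu: "Lpow p (u n) = Lpow p (\<lambda>z. F (of_real (A n) * z))" for n by (rule Lpow_cong) (rule uF)
  have Lb: "Lpow p b \<le> ennreal B"
    by (rule Lpow_liminf[OF _ _ lim2]) (use p le A Lu in auto)
  have main: "Lpow p (\<lambda>z. F (of_real s * z)) \<le> ennreal (2 powr p) * Lpow p b" if s: "0 \<le> s" "s < 1" for s
  proof (rule ennreal_le_epsilon)
    fix e :: real assume e: "0 < e"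
    define e' where "e' = e / 2 powr p"
    have e': "0 < e'" using e by (simp add: e'_def)
    obtain r0 where r0: "0 < r0" "r0 < 1" "\<And>x y. r0 < x \<Longrightarrow> x < 1 \<Longrightarrow> r0 < y \<Longrightarrow> y < 1 \<Longrightarrow>
        Lpow p (\<lambda>z. F (of_real x * z) - F (of_real y * z)) \<le> ennreal e'"
      using Lpow_dilates_Cauchy[OF p F B _ e'] le by blast
    define \<rho> where "\<rho> = (max r0 s + 1) / 2"
    have \<rho>: "r0 < \<rho>" "s < \<rho>" "\<rho> < 1" "0 < \<rho>" using r0 s by (auto simp: \<rho>_def)
    define v where "v = (\<lambda>z. disc_ext F (of_real \<rho> * z))"
    have [measurable]: "v \<in> borel_measurable borel" unfolding v_def by measurable
    have vF: "v z = F (of_real \<rho> * z)" if "norm z = 1" for z using that \<rho> by (simp add: v_def disc_ext_eq norm_mult)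
    have diff: "Lpow p (\<lambda>z. v z - b z) \<le> ennreal e'"
    proof (rule Lpow_liminf[where u = "\<lambda>n z. v z - u n z"])
      show "AE z in circ. (\<lambda>n. v z - u n z) \<longlonglongrightarrow> v z - b z"
        using lim2 by eventually_elim (intro tendsto_intros)
      have "eventually (\<lambda>n. r0 < A n) sequentially" using limA r0(2) by (rule order_tendstoD(1))
      then show "eventually (\<lambda>n. Lpow p (\<lambda>z. v z - u n z) \<le> ennreal e') sequentially"
      proof eventually_elim
        case (elim n)
        have "Lpow p (\<lambda>z. v z - u n z) = Lpow p (\<lambda>z. F (of_real \<rho> * z) - F (of_real (A n) * z))"
          by (rule Lpow_cong) (simp add: vF uF)
        also have "\<dots> \<le> ennreal e'" using elim A \<rho> by (intro r0(3)) auto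
        finally show ?case .
      qed
    qed (use p in auto)
    have "Lpow p (\<lambda>z. F (of_real s * z)) \<le> Lpow p (\<lambda>z. F (of_real \<rho> * z))"
      by (rule Lpow_mono_radius[OF F]) (use s \<rho> p in auto)
    also have "\<dots> = Lpow p (\<lambda>z. b z + (v z - b z))" by (rule Lpow_cong) (simp add: vF)
    also have "\<dots> \<le> ennreal (2 powr p) * (Lpow p b + Lpow p (\<lambda>z. v z - b z))"
      by (rule Lpow_add_le) (use p in auto)
    also have "\<dots> \<le> ennreal (2 powr p) * (Lpow p b + ennreal e')"
      by (intro mult_left_mono add_left_mono diff) auto
    also have "\<dots> = ennreal (2 powr p) * Lpow p b + ennreal e"
      using e' by (simp add: distrib_left ennreal_mult[symmetric] e'_def)
    finally show "Lpow p (\<lambda>z. F (of_real s * z)) \<le> ennreal (2 powr p) * Lpow p b + ennreal e" .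
  qed
  show ?thesis using bm lim1 Lb main by blast
qed

section \<open>From the Lipschitz condition to derivative growth\<close>

text \<open>Radii below \<open>r0\<close> are handled by monotonicity of the means; the right-hand
  side is at least its constant because \<open>(1 - r) powr (1 - p) \<ge> 1\<close>.\<close>

lemma derivative_growthI:
  assumes p: "1 < p" and g: "g holomorphic_on ball 0 1" and r0: "0 \<le> r0" "r0 < 1" and K: "0 \<le> K"
    and le: "\<And>r. r0 \<le> r \<Longrightarrow> r < 1 \<Longrightarrow> Lpow p (\<lambda>z. deriv g (of_real r * z)) \<le> ennreal (K * (1 - r) powr (1 - p))"
  shows "derivative_growth p g"
  unfolding derivative_growth_def
proof (intro exI conjI allI impI)
  let ?c = "(1 - r0) powr (1 - p)"
  have ge1: "1 \<le> (1 - r) powr (1 - p)" if "0 \<le> r" "r < 1" for r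
    using powr_mono2'[of "1 - p" "1 - r" 1] p that by simp
  show "0 \<le> K * ?c" using K by simp
  fix r :: real assume r: "0 \<le> r" "r < 1"
  show "Lpow p (\<lambda>z. deriv g (of_real r * z)) \<le> ennreal (K * ?c * (1 - r) powr (1 - p))"
  proof (cases "r0 \<le> r")
    case True
    have "K * (1 - r) powr (1 - p) * 1 \<le> K * (1 - r) powr (1 - p) * ?c"
      using K ge1[OF r0] by (intro mult_left_mono) auto
    then have "ennreal (K * (1 - r) powr (1 - p)) \<le> ennreal (K * ?c * (1 - r) powr (1 - p))"
      by (intro ennreal_leI) (simp add: mult_ac)
    with le[OF True r(2)] show ?thesis by (rule order.trans)
  next
    case False
    have "Lpow p (\<lambda>z. deriv g (of_real r * z)) \<le> Lpow p (\<lambda>z. deriv g (of_real r0 * z))"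
      by (rule Lpow_mono_radius) (use False p g r r0 in \<open>auto intro: holomorphic_deriv\<close>)
    also have "\<dots> \<le> ennreal (K * ?c)" by (rule le) (use r0 in auto)
    also have "K * ?c * 1 \<le> K * ?c * (1 - r) powr (1 - p)"
      using K ge1[OF r] by (intro mult_left_mono) auto
    then have "ennreal (K * ?c) \<le> ennreal (K * ?c * (1 - r) powr (1 - p))"
      by (intro ennreal_leI) simp
    finally show ?thesis .
  qed
qed

text \<open>The distance from \<open>cis t\<close> to \<open>r\<close> is at least
  \<open>1 - r\<close> and at least \<open>\<bar>t\<bar> / pi\<close>. The first bound is used for
  \<open>\<bar>t\<bar> \<le> 1 - r\<close>, the second beyond, where \<alpha> < 1 makes the lower
  limit of integration dominate. Both parts are of order
  \<open>(1 - r) powr (\<alpha> - 1)\<close>.\<close>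

lemma circ_kernel_powr:
  assumes a: "0 < \<alpha>" "\<alpha> < 1" and r: "0 \<le> r" "r < 1"
  shows "(\<integral>\<^sup>+e. ennreal (norm (e - of_real r) powr (\<alpha> - 2)) \<partial>circ)
     \<le> ennreal ((1 + pi powr (2 - \<alpha>) / (1 - \<alpha>)) * (1 - r) powr (\<alpha> - 1))"
proof -
  define d where "d = 1 - r"
  have d: "0 < d" "d \<le> 1" "d < pi" using r pi_gt3 by (auto simp: d_def)
  define c where "c = pi powr (2 - \<alpha>)"
  have c: "0 < c" by (simp add: c_def)
  let ?I = "\<integral>\<^sup>+t. ennreal (t powr (\<alpha> - 2)) * indicator {d..pi} t \<partial>lborel"
  have I: "?I \<le> ennreal (d powr (\<alpha> - 1) / (1 - \<alpha>))"
  proof -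
    have "?I = ennreal (- (pi powr (\<alpha> - 1)) / (1 - \<alpha>) - (- (d powr (\<alpha> - 1)) / (1 - \<alpha>)))"
    proof (rule nn_integral_FTC_Icc[where F = "\<lambda>t. - (t powr (\<alpha> - 1)) / (1 - \<alpha>)"])
      fix t assume t: "t \<in> {d..pi}"
      then have "0 < t" using d by auto
      then have "((\<lambda>t. t powr (\<alpha> - 1)) has_real_derivative (\<alpha> - 1) * t powr (\<alpha> - 2)) (at t)"
        using has_real_derivative_powr[of t "\<alpha> - 1"] by simp
      from DERIV_cdivide[OF DERIV_minus[OF this], of "1 - \<alpha>"]
      show "((\<lambda>t. - (t powr (\<alpha> - 1)) / (1 - \<alpha>)) has_real_derivative t powr (\<alpha> - 2)) (at t)"
        by (rule DERIV_cong) (use a in \<open>simp add: field_simps\<close>)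
    qed (use d in auto)
    also have "\<dots> \<le> ennreal (d powr (\<alpha> - 1) / (1 - \<alpha>))" using a by (intro ennreal_leI) simp
    finally show ?thesis .
  qed
  have I': "(\<integral>\<^sup>+t. ennreal (\<bar>t\<bar> powr (\<alpha> - 2)) * indicator {-pi..-d} t \<partial>lborel) = ?I"
  proof -
    have "(\<integral>\<^sup>+t. ennreal (\<bar>t\<bar> powr (\<alpha> - 2)) * indicator {-pi..-d} t \<partial>lborel)
       = (\<integral>\<^sup>+t. ennreal (\<bar>0 + (-1) * t\<bar> powr (\<alpha> - 2)) * indicator {-pi..-d} (0 + (-1) * t) \<partial>lborel)"
      by (subst nn_integral_real_affine[where c = "-1" and t = 0]) auto
    also have "\<dots> = ?I" using d by (intro nn_integral_cong) (auto simp: indicator_def)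
    finally show ?thesis .
  qed
  have pw: "ennreal (norm (cis t - of_real r) powr (\<alpha> - 2)) * indicator {-pi..pi} t
     \<le> ennreal (d powr (\<alpha> - 2)) * indicator {-d..d} t
       + (ennreal c * (ennreal (\<bar>t\<bar> powr (\<alpha> - 2)) * indicator {-pi..-d} t) + ennreal c * (ennreal (t powr (\<alpha> - 2)) * indicator {d..pi} t))" for t
  proof (cases "t \<in> {-pi..pi}")
    case True
    then have t: "\<bar>t\<bar> \<le> pi" by auto
    have n: "\<bar>t\<bar> / pi \<le> norm (cis t - of_real r)" "d \<le> norm (cis t - of_real r)"
      using cis_dist_radius[OF t, of r] r by (auto simp: d_def)
    show ?thesis
    proof (cases "t \<in> {-d..d}")
      case tt: True
      have "norm (cis t - of_real r) powr (\<alpha> - 2) \<le> d powr (\<alpha> - 2)" using n d a by (intro powr_mono2') auto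
      then have "ennreal (norm (cis t - of_real r) powr (\<alpha> - 2)) \<le> ennreal (d powr (\<alpha> - 2))" by (rule ennreal_leI)
      then show ?thesis using True tt by (simp add: add_increasing2)
    next
      case False
      then have t0: "d < \<bar>t\<bar>" by auto
      have "norm (cis t - of_real r) powr (\<alpha> - 2) \<le> (\<bar>t\<bar> / pi) powr (\<alpha> - 2)" using n t0 d a by (intro powr_mono2') auto
      also have "\<dots> = c * \<bar>t\<bar> powr (\<alpha> - 2)"
      proof -
        have "pi powr (\<alpha> - 2) * pi powr (2 - \<alpha>) = 1" by (simp add: powr_add[symmetric])
        then have "1 / pi powr (\<alpha> - 2) = c" by (simp add: c_def field_simps)
        moreover have "(\<bar>t\<bar> / pi) powr (\<alpha> - 2) = (1 / pi powr (\<alpha> - 2)) * \<bar>t\<bar> powr (\<alpha> - 2)" by (simp add: powr_divide)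
        ultimately show ?thesis by (simp only:)
      qed
      finally have le: "ennreal (norm (cis t - of_real r) powr (\<alpha> - 2)) \<le> ennreal c * ennreal (\<bar>t\<bar> powr (\<alpha> - 2))"
        using c by (simp add: ennreal_mult[symmetric] ennreal_leI)
      show ?thesis
      proof (cases "0 \<le> t")
        case tp: True
        then have "t \<in> {d..pi}" "t \<notin> {-pi..-d}" "t \<notin> {-d..d}" using t0 t d by auto
        then show ?thesis using le tp True by simp
      next
        case tn: False
        then have "t \<notin> {d..pi}" "t \<in> {-pi..-d}" "t \<notin> {-d..d}" using t0 t d by auto
        then show ?thesis using le True by simp
      qed
    qed
  qed simp
  have "(\<integral>\<^sup>+t. ennreal (norm (cis t - of_real r) powr (\<alpha> - 2)) * indicator {-pi..pi} t \<partial>lborel)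
    \<le> (\<integral>\<^sup>+t. ennreal (d powr (\<alpha> - 2)) * indicator {-d..d} t
       + (ennreal c * (ennreal (\<bar>t\<bar> powr (\<alpha> - 2)) * indicator {-pi..-d} t) + ennreal c * (ennreal (t powr (\<alpha> - 2)) * indicator {d..pi} t)) \<partial>lborel)"
    by (intro nn_integral_mono pw)
  also have "\<dots> = ennreal (d powr (\<alpha> - 2)) * ennreal (2 * d) + (ennreal c * ?I + ennreal c * ?I)"
    using d by (simp add: nn_integral_add nn_integral_cmult I' nn_integral_cmult_indicator)
  also have "\<dots> \<le> ennreal (d powr (\<alpha> - 2)) * ennreal (2 * d) + (ennreal c * ennreal (d powr (\<alpha> - 1) / (1 - \<alpha>)) + ennreal c * ennreal (d powr (\<alpha> - 1) / (1 - \<alpha>)))"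
    by (intro add_mono mult_left_mono I order.refl) auto
  also have "\<dots> = ennreal (d powr (\<alpha> - 2) * (2 * d) + (c * (d powr (\<alpha> - 1) / (1 - \<alpha>)) + c * (d powr (\<alpha> - 1) / (1 - \<alpha>))))"
    using c d a by (simp add: ennreal_mult[symmetric] ennreal_plus[symmetric] del: ennreal_plus)
  also have "d powr (\<alpha> - 2) * (2 * d) + (c * (d powr (\<alpha> - 1) / (1 - \<alpha>)) + c * (d powr (\<alpha> - 1) / (1 - \<alpha>))) = 2 * ((1 + c / (1 - \<alpha>)) * d powr (\<alpha> - 1))"
  proof -
    have "d powr (\<alpha> - 2) * d = d powr (\<alpha> - 1)"
      using d powr_add[of d "\<alpha> - 2" 1] by simp
    then have "d powr (\<alpha> - 2) * (2 * d) = 2 * d powr (\<alpha> - 1)" by (simp add: mult_ac)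
    then show ?thesis by (simp add: algebra_simps)
  qed
  finally have main: "(\<integral>\<^sup>+t. ennreal (norm (cis t - of_real r) powr (\<alpha> - 2)) * indicator {-pi..pi} t \<partial>lborel)
     \<le> ennreal (2 * ((1 + c / (1 - \<alpha>)) * d powr (\<alpha> - 1)))" .
  have "(\<integral>\<^sup>+e. ennreal (norm (e - of_real r) powr (\<alpha> - 2)) \<partial>circ)
     = (\<integral>\<^sup>+t. ennreal (norm (cis t - of_real r) powr (\<alpha> - 2)) * indicator {-pi..pi} t \<partial>lborel) / ennreal (2 * pi)"
    by (rule nn_integral_circ_sym) measurable
  also have "\<dots> \<le> ennreal (2 * ((1 + c / (1 - \<alpha>)) * d powr (\<alpha> - 1))) / ennreal (2 * pi)"
    by (rule divide_right_mono_ennreal[OF main])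
  also have "\<dots> = ennreal (2 * ((1 + c / (1 - \<alpha>)) * d powr (\<alpha> - 1)) / (2 * pi))"
    using c a by (intro divide_ennreal) auto
  also have "\<dots> \<le> ennreal ((1 + c / (1 - \<alpha>)) * d powr (\<alpha> - 1))"
  proof (rule ennreal_leI)
    have half: "2 * X / (2 * pi) \<le> X" if "0 \<le> X" for X :: real
      using mult_left_mono[of 1 pi X] that pi_gt3 by (simp add: field_simps)
    show "2 * ((1 + c / (1 - \<alpha>)) * d powr (\<alpha> - 1)) / (2 * pi) \<le> (1 + c / (1 - \<alpha>)) * d powr (\<alpha> - 1)"
      by (rule half) (use c a in auto)
  qed
  finally show ?thesis by (simp add: c_def d_def)
qed

text \<open>In Cauchy's formula for the derivative the slice at \<open>e\<close> has p-th power mean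
  at most \<open>2 * D * norm (e - r) powr (1 - 2 * p)\<close>, as
  \<open>norm (e - 1) \<le> 2 * norm (e - r)\<close>. This is the p-th power of the weight
  \<open>norm (e - r) powr (1/p - 2)\<close>, whose mass is of order
  \<open>(1 - r) powr (1/p - 1)\<close>.\<close>

lemma Lpow_deriv_of_Lipschitz:
  assumes p: "1 < p" and [measurable]: "G \<in> borel_measurable borel" and hol: "G holomorphic_on ball 0 R" and R: "R > 1"
    and D: "0 \<le> D" and lip: "\<And>e. norm e = 1 \<Longrightarrow> Lpow p (\<lambda>z. G (z * e) - G z) \<le> ennreal (D * norm (e - 1))"
    and r: "0 \<le> r" "r < 1"
  shows "Lpow p (\<lambda>z. deriv G (of_real r * z))
     \<le> ennreal (2 * D * (1 + pi powr (2 - 1/p) / (1 - 1/p)) powr p * (1 - r) powr (1 - p))"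
proof -
  define w where "w = (\<lambda>e::complex. if norm e = 1 then norm (e - of_real r) powr (1/p - 2) else 1)"
  define u where "u = (\<lambda>z e::complex. if norm e = 1 then norm (G (z * e) - G z) * (1 / (norm (e - of_real r))\<^sup>2) else 0)"
  have wm[measurable]: "w \<in> borel_measurable circ" unfolding w_def by measurable
  have um[measurable]: "(\<lambda>(z, e). u z e) \<in> borel_measurable (circ \<Otimes>\<^sub>M circ)" unfolding u_def by measurable
  have ner: "0 < norm (e - of_real r)" if "norm e = 1" for e :: complex using that r by auto
  let ?C = "1 + pi powr (2 - 1/p) / (1 - 1/p)"
  have C: "0 < ?C" using p by (intro add_pos_nonneg) auto
  have "(\<integral>\<^sup>+z. ennreal (norm (deriv G (of_real r * z)) powr p) \<partial>circ) \<le> ennreal (2 * D * (?C * (1 - r) powr (1/p - 1)) powr p)"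
  proof (rule Minkowski_weight[OF sigma_finite_circ sigma_finite_circ p um wm])
    show "0 \<le> u z e" for z e by (simp add: u_def)
    show "0 < w e" for e using ner[of e] by (auto simp: w_def)
    show "0 \<le> 2 * D" using D by simp
    show "0 < ?C * (1 - r) powr (1/p - 1)" using C r by auto
    show "(\<integral>\<^sup>+e. ennreal (w e) \<partial>circ) \<le> ennreal (?C * (1 - r) powr (1/p - 1))"
    proof -
      have "(\<integral>\<^sup>+e. ennreal (w e) \<partial>circ) = (\<integral>\<^sup>+e. ennreal (norm (e - of_real r) powr (1/p - 2)) \<partial>circ)"
        by (rule nn_integral_circ_cong) (simp add: w_def)
      also have "\<dots> \<le> ennreal (?C * (1 - r) powr (1/p - 1))" by (rule circ_kernel_powr) (use p r in auto)
      finally show ?thesis .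
    qed
    show "AE z in circ. ennreal (norm (deriv G (of_real r * z))) \<le> (\<integral>\<^sup>+e. ennreal (u z e) \<partial>circ)"
      using AE_circ
    proof eventually_elim
      case (elim z)
      \<comment> \<open>Subtracting the constant \<open>G z\<close> leaves the derivative unchanged
        and brings the difference of \<open>G\<close> under the integral.\<close>
      define H where "H = (\<lambda>v. G v - G z)"
      have Hm: "H \<in> borel_measurable borel" unfolding H_def by measurable
      have hH: "H holomorphic_on ball 0 R" unfolding H_def by (intro holomorphic_intros hol)
      have inR: "of_real r * z \<in> ball 0 R" using elim r R by (simp add: norm_mult)
      have "(G has_field_derivative deriv G (of_real r * z)) (at (of_real r * z))"
        by (rule holomorphic_derivI[OF hol open_ball inR])
      then have "(H has_field_derivative deriv G (of_real r * z) - 0) (at (of_real r * z))"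
        unfolding H_def by (intro DERIV_diff DERIV_const)
      then have "deriv H (of_real r * z) = deriv G (of_real r * z)" by (simp add: DERIV_imp_deriv)
      then have "ennreal (norm (deriv G (of_real r * z))) \<le> (\<integral>\<^sup>+e. ennreal (norm (H (z * e)) * (1 / (norm (e - of_real r))\<^sup>2)) \<partial>circ)"
        using Cauchy_deriv_norm_bound[OF Hm hH R r elim] by simp
      also have "\<dots> = (\<integral>\<^sup>+e. ennreal (u z e) \<partial>circ)" by (rule nn_integral_circ_cong) (simp add: u_def H_def)
      finally show ?case .
    qed
    show "(\<integral>\<^sup>+z. ennreal (u z e powr p) \<partial>circ) \<le> ennreal (2 * D * w e powr p)" for e
    proof (cases "norm e = 1")
      case True
      let ?n = "norm (e - of_real r)"
      have n: "0 < ?n" using ner[OF True] .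
      have tri: "norm (e - 1) \<le> 2 * ?n"
      proof -
        have "1 - r \<le> ?n" using norm_triangle_ineq2[of e "of_real r"] True r by simp
        moreover have "norm (of_real r - (1::complex)) = 1 - r"
          using r by (metis abs_minus_commute abs_of_nonneg diff_ge_0_iff_ge less_imp_le norm_of_real of_real_1 of_real_diff)
        moreover have "norm (e - 1) \<le> ?n + norm (of_real r - (1::complex))"
          using norm_triangle_ineq[of "e - of_real r" "of_real r - 1"] by simp
        ultimately show ?thesis by linarith
      qed
      have "(\<integral>\<^sup>+z. ennreal (u z e powr p) \<partial>circ) = (\<integral>\<^sup>+z. ennreal ((1 / ?n\<^sup>2) powr p) * ennreal (norm (G (z * e) - G z) powr p) \<partial>circ)"
        using True by (intro nn_integral_cong) (simp add: u_def powr_mult ennreal_mult[symmetric] powr_divide)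
      also have "\<dots> = ennreal ((1 / ?n\<^sup>2) powr p) * Lpow p (\<lambda>z. G (z * e) - G z)"
        unfolding Lpow_def by (rule nn_integral_cmult) measurable
      also have "\<dots> \<le> ennreal ((1 / ?n\<^sup>2) powr p) * ennreal (D * (2 * ?n))"
        using D tri by (intro mult_left_mono order.trans[OF lip[OF True]] ennreal_leI) auto
      also have "\<dots> = ennreal ((1 / ?n\<^sup>2) powr p * (D * (2 * ?n)))" using D by (simp add: ennreal_mult[symmetric])
      also have "(1 / ?n\<^sup>2) powr p * (D * (2 * ?n)) = 2 * D * w e powr p"
      proof -
        have "(1 / ?n\<^sup>2) = ?n powr (-2)" using n by (simp add: powr_minus divide_inverse)
        then have "(1 / ?n\<^sup>2) powr p * ?n = ?n powr (-2 * p) * ?n powr 1" using n by (simp add: powr_powr)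
        also have "\<dots> = ?n powr (1 - 2 * p)" by (simp only: powr_add[symmetric]) simp
        also have "1 - 2 * p = (1/p - 2) * p" using p by (simp add: field_simps)
        also have "?n powr ((1/p - 2) * p) = w e powr p" using True by (simp add: w_def powr_powr)
        finally show ?thesis by (simp add: mult_ac)
      qed
      finally show ?thesis .
    qed (use D in \<open>simp add: u_def\<close>)
  qed auto
  also have "(?C * (1 - r) powr (1/p - 1)) powr p = ?C powr p * (1 - r) powr (1 - p)"
  proof -
    have "(1/p - 1) * p = 1 - p" using p by (simp add: field_simps)
    then show ?thesis by (simp add: powr_mult powr_powr)
  qed
  finally show ?thesis by (simp add: Lpow_def mult.assoc)
qed

lemma Lpow_cong_AE:
  assumes "AE z in circ. u z = v z"
  shows "Lpow p u = Lpow p v"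
  unfolding Lpow_def by (rule nn_integral_cong_AE) (use assms in eventually_elim, simp)

lemma AE_circ_rotate:
  assumes "AE z in circ. P z" "norm a = 1"
  shows "AE z in circ. P (a * z)"
proof -
  have "AE z in distr circ borel ((*) a). P z" using assms(1) by (simp only: distr_circ_rotate[OF assms(2)])
  then show ?thesis by (rule AE_distrD[rotated]) simp
qed

text \<open>The boundary function agrees with the Borel function \<open>b\<close> only almost
  everywhere, also after rotation. Finiteness ensures that the Lebesgue integral on the right is not
  the default value 0.\<close>

lemma Lpow_boundary_difference:
  assumes p: "0 < p" and [measurable]: "b \<in> borel_measurable borel"
    and bf: "AE z in circ. boundary_function g z = b z" and fin: "Lpow p (\<lambda>z. b (cis h * z) - b z) < \<infinity>"
  shows "Lpow p (\<lambda>z. b (cis h * z) - b z) = ennreal (1 / (2 * pi) * (LINT \<theta>:{0..2 * pi}|lebesgue.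
           norm (boundary_function g (cis (\<theta> + h)) - boundary_function g (cis \<theta>)) powr p))"
proof -
  let ?\<phi> = "\<lambda>z. norm (b (cis h * z) - b z) powr p"
  have si: "set_integrable lborel {0..2*pi} (\<lambda>t. ?\<phi> (cis t))"
    unfolding set_integrable_def
  proof (rule integrableI_nonneg)
    have X: "(\<integral>\<^sup>+t. ennreal (?\<phi> (cis t)) * indicator {0..2*pi} t \<partial>lborel) / ennreal (2 * pi) < \<infinity>"
      using fin unfolding Lpow_def by (subst (asm) nn_integral_circ_angle) auto
    have "(\<integral>\<^sup>+t. ennreal (?\<phi> (cis t)) * indicator {0..2*pi} t \<partial>lborel) < \<infinity>"
    proof (rule ccontr)
      assume "\<not> ?thesis"
      then have "(\<integral>\<^sup>+t. ennreal (?\<phi> (cis t)) * indicator {0..2*pi} t \<partial>lborel) = \<infinity>"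
        by (metis infinity_ennreal_def top.not_eq_extremum)
      then show False using X by (simp add: ennreal_top_divide)
    qed
    also have "(\<integral>\<^sup>+t. ennreal (?\<phi> (cis t)) * indicator {0..2*pi} t \<partial>lborel) = (\<integral>\<^sup>+t. ennreal (indicator {0..2*pi} t *\<^sub>R ?\<phi> (cis t)) \<partial>lborel)"
      by (intro nn_integral_cong) (auto simp: indicator_def)
    finally show "(\<integral>\<^sup>+t. ennreal (indicator {0..2*pi} t *\<^sub>R ?\<phi> (cis t)) \<partial>lborel) < \<infinity>" .
  qed auto
  have 1: "Lpow p (\<lambda>z. b (cis h * z) - b z) = ennreal (1 / (2 * pi) * (LINT t:{0..2 * pi}|lebesgue. ?\<phi> (cis t)))"
    unfolding Lpow_def by (rule nn_integral_circ_eq_LINT[OF si]) auto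
  have "AE z in circ. boundary_function g (cis h * z) = b (cis h * z) \<and> boundary_function g z = b z"
    using AE_circ_rotate[OF bf, of "cis h"] bf by auto
  then have ae: "AE t in lebesgue. t \<in> {0..2*pi} \<longrightarrow> boundary_function g (cis h * cis t) = b (cis h * cis t) \<and> boundary_function g (cis t) = b (cis t)"
    by (intro AE_completion AE_circ_angle)
  let ?f = "\<lambda>t. indicator {0..2*pi} t *\<^sub>R ?\<phi> (cis t)"
  let ?g = "\<lambda>t. indicator {0..2*pi} t *\<^sub>R (norm (boundary_function g (cis (t + h)) - boundary_function g (cis t)) powr p)"
  have fg: "AE t in lebesgue. ?f t = ?g t"
    using ae by eventually_elim (auto simp: indicator_def cis_mult add.commute)
  have fm: "?f \<in> borel_measurable lebesgue" by (rule measurable_completion) measurable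
  have gm: "?g \<in> borel_measurable lebesgue" by (rule borel_measurable_AE[OF fm fg])
  have "(LINT t|lebesgue. ?f t) = (LINT t|lebesgue. ?g t)" by (rule integral_cong_AE[OF fm gm fg])
  then show ?thesis using 1 by (simp add: set_lebesgue_integral_def)
qed

text \<open>The difference of \<open>g\<close> and its rotation is again a Hardy function, with
  boundary values \<open>\<Delta> h\<close>. Hence \<open>hardy_boundary_values\<close> carries the
  modulus of continuity from the circle to all smaller radii, where
  \<open>Lpow_deriv_of_Lipschitz\<close> applies.\<close>

lemma derivative_growth_if_mean_Lipschitz:
  assumes p: "1 < p" and gL: "g \<in> mean_Lipschitz p (1 / p)"
  shows "derivative_growth p g"
proof -
  have gH: "g \<in> hardy_space p" and bigo: "(\<lambda>t. integral_modulus_of_continuity p g t) \<in> O[at_right 0](\<lambda>t. t powr (1/p))"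
    using gL by (auto simp: mean_Lipschitz_def)
  have g: "g holomorphic_on ball 0 1" using gH by (simp add: hardy_space_def)
  have [measurable]: "disc_ext g \<in> borel_measurable borel" by (rule disc_ext_measurable[OF g])
  define B where "B = hardy_norm p g powr p"
  have B: "0 \<le> B" by (simp add: B_def)
  have gle: "Lpow p (\<lambda>z. g (of_real r * z)) \<le> ennreal B" if "0 < r" "r < 1" for r
    unfolding B_def by (rule Lpow_hardy[OF gH that]) (use p in auto)
  obtain b where b: "b \<in> borel_measurable borel" "AE z in circ. ((\<lambda>r. g (of_real r * z)) \<longlongrightarrow> b z) (at_left 1)" "Lpow p b \<le> ennreal B"
    using hardy_boundary_values[OF p g B gle] by blast
  note b(1)[measurable]
  have bf: "AE z in circ. boundary_function g z = b z"
    using b(2) by eventually_elim (rule boundary_functionI)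
  define \<Delta> where "\<Delta> = (\<lambda>h z. b (cis h * z) - b z)"
  define B2 where "B2 = 2 powr p * (B + B)"
  have B2: "0 \<le> B2" using B by (simp add: B2_def)
  have sumle: "Lpow p (\<lambda>z. u z - v z) \<le> ennreal B2" if "u \<in> borel_measurable borel" "v \<in> borel_measurable borel" "Lpow p u \<le> ennreal B" "Lpow p v \<le> ennreal B" for u v
  proof -
    have "Lpow p (\<lambda>z. u z + - v z) \<le> ennreal (2 powr p) * (Lpow p u + Lpow p (\<lambda>z. - v z))"
      using that p by (intro Lpow_add_le) auto
    also have "Lpow p (\<lambda>z. - v z) = Lpow p v" by (simp add: Lpow_def)
    also have "ennreal (2 powr p) * (Lpow p u + Lpow p v) \<le> ennreal (2 powr p) * (ennreal B + ennreal B)"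
      using that by (intro mult_left_mono add_mono) auto
    also have "\<dots> = ennreal B2" using B by (simp add: B2_def ennreal_mult[symmetric] ennreal_plus[symmetric] del: ennreal_plus)
    finally show ?thesis by simp
  qed
  have \<Delta>B: "Lpow p (\<Delta> h) \<le> ennreal B2" for h
    unfolding \<Delta>_def
  proof (rule sumle)
    show "Lpow p (\<lambda>z. b (cis h * z)) \<le> ennreal B" using b(3) by (simp add: Lpow_rotate)
  qed (use b(3) in auto)
  define q where "q = (\<lambda>h. 1 / (2 * pi) * (LINT \<theta>:{0..2 * pi}|lebesgue.
           norm (boundary_function g (cis (\<theta> + h)) - boundary_function g (cis \<theta>)) powr p))"
  have q0: "0 \<le> q h" for h unfolding q_def set_lebesgue_integral_def
    by (intro mult_nonneg_nonneg Bochner_Integration.integral_nonneg) auto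
  have q: "Lpow p (\<Delta> h) = ennreal (q h)" for h
    unfolding \<Delta>_def q_def
    by (rule Lpow_boundary_difference[OF _ _ bf]) (use p \<Delta>B[of h] in \<open>auto simp: \<Delta>_def intro: le_less_trans\<close>)
  have qB: "q h \<le> B2" for h using \<Delta>B[of h] B2 by (simp add: q ennreal_le_iff)
  obtain c where c: "0 < c" "eventually (\<lambda>t. norm (integral_modulus_of_continuity p g t) \<le> c * norm (t powr (1/p))) (at_right 0)"
    using bigo by (elim landau_o.bigE) auto
  then obtain t0 where t0: "0 < t0" "\<And>t. 0 < t \<Longrightarrow> t < t0 \<Longrightarrow> norm (integral_modulus_of_continuity p g t) \<le> c * norm (t powr (1/p))"
    unfolding eventually_at_right_field by auto
  \<comment> \<open>\<open>c powr p\<close> serves the steps below \<open>t0\<close>, where the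
    hypothesis speaks; for larger steps the trivial bound \<open>B2\<close> is at most
    \<open>B2 / t0\<close> times the step.\<close>
  define D0 where "D0 = c powr p + B2 / t0"
  have D0: "0 \<le> D0" using t0 B2 by (simp add: D0_def)
  have qD: "q h \<le> D0 * h" if h: "0 < h" for h
  proof (cases "h < t0")
    case True
    \<comment> \<open>A real supremum dominates its members only for a bounded set; the trivial
      bound \<open>B2\<close> provides this.\<close>
    have "q h powr (1/p) \<le> (SUP h'\<in>{0<..h}. q h' powr (1/p))"
    proof (rule cSUP_upper)
      show "bdd_above ((\<lambda>h'. q h' powr (1/p)) ` {0<..h})"
        using qB q0 p by (intro bdd_aboveI[where M = "B2 powr (1/p)"]) (auto intro!: powr_mono2)
    qed (use h in simp)
    also have "\<dots> = integral_modulus_of_continuity p g h"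
      by (simp add: integral_modulus_of_continuity_def q_def)
    also have "\<dots> \<le> c * h powr (1/p)" using t0(2)[OF h True] by simp
    finally have "(q h powr (1/p)) powr p \<le> (c * h powr (1/p)) powr p" using p by (intro powr_mono2) auto
    then have "q h \<le> c powr p * h" using p q0[of h] h by (simp add: powr_powr powr_mult)
    also have "\<dots> \<le> D0 * h" using h t0 B2 by (intro mult_right_mono) (auto simp: D0_def)
    finally show ?thesis .
  next
    case False
    have "q h \<le> B2 / t0 * t0" using qB t0 by simp
    also have "\<dots> \<le> B2 / t0 * h" using False B2 t0 by (intro mult_left_mono) auto
    also have "\<dots> \<le> D0 * h" using h by (intro mult_right_mono) (auto simp: D0_def)
    finally show ?thesis .
  qed
  \<comment> \<open>\<open>2 powr p\<close> comes from the comparison with boundary values,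
    \<open>pi / 2\<close> from replacing the arc \<open>h\<close> by its chord.\<close>
  define D where "D = 2 powr p * D0 * (pi / 2)"
  have D: "0 \<le> D" using D0 by (simp add: D_def)
  have arc: "Lpow p (\<lambda>z. g (of_real s * (cis h * z)) - g (of_real s * z)) \<le> ennreal (D * norm (cis h - 1))"
    if s: "0 \<le> s" "s < 1" and h: "0 < h" "h \<le> pi" for s h
  proof -
    define F where "F = (\<lambda>z. g (cis h * z) - g z)"
    have hF: "F holomorphic_on ball 0 1"
    proof -
      have "(g \<circ> (\<lambda>z. cis h * z)) holomorphic_on ball 0 1"
        by (rule holomorphic_on_compose_gen[OF _ g]) (auto intro!: holomorphic_intros simp: norm_mult)
      then show ?thesis unfolding F_def by (intro holomorphic_intros g) (simp add: o_def)
    qed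
    have Fle: "Lpow p (\<lambda>z. F (of_real r * z)) \<le> ennreal B2" if r: "0 < r" "r < 1" for r
    proof -
      define v where "v = (\<lambda>z. disc_ext g (of_real r * z))"
      have [measurable]: "v \<in> borel_measurable borel" unfolding v_def by measurable
      have vg: "v z = g (of_real r * z)" if "norm z = 1" for z using that r by (simp add: v_def disc_ext_eq norm_mult)
      have Lv: "Lpow p v \<le> ennreal B" using gle[OF r] Lpow_cong[of v "\<lambda>z. g (of_real r * z)" p] vg by simp
      have "Lpow p (\<lambda>z. F (of_real r * z)) = Lpow p (\<lambda>z. v (cis h * z) - v z)"
        by (rule Lpow_cong) (simp add: F_def vg norm_mult mult.left_commute)
      also have "\<dots> \<le> ennreal B2" by (rule sumle) (use Lv in \<open>auto simp: Lpow_rotate\<close>)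
      finally show ?thesis .
    qed
    obtain b' where b': "b' \<in> borel_measurable borel" "AE z in circ. ((\<lambda>r. F (of_real r * z)) \<longlongrightarrow> b' z) (at_left 1)"
        "\<And>s. 0 \<le> s \<Longrightarrow> s < 1 \<Longrightarrow> Lpow p (\<lambda>z. F (of_real s * z)) \<le> ennreal (2 powr p) * Lpow p b'"
      using hardy_boundary_values[OF p hF B2 Fle] by blast
    have "AE z in circ. b' z = \<Delta> h z"
      using b'(2) b(2) AE_circ_rotate[OF b(2), of "cis h", simplified]
    proof eventually_elim
      case (elim z)
      have "((\<lambda>r. g (of_real r * (cis h * z)) - g (of_real r * z)) \<longlongrightarrow> \<Delta> h z) (at_left 1)"
        unfolding \<Delta>_def by (intro tendsto_intros elim)
      then have "((\<lambda>r. F (of_real r * z)) \<longlongrightarrow> \<Delta> h z) (at_left 1)" by (simp add: F_def mult.left_commute)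
      from tendsto_unique[OF _ elim(1) this] show ?case by simp
    qed
    then have Lb': "Lpow p b' = ennreal (q h)" using Lpow_cong_AE[of b' "\<Delta> h" p] q[of h] by simp
    have "Lpow p (\<lambda>z. g (of_real s * (cis h * z)) - g (of_real s * z)) = Lpow p (\<lambda>z. F (of_real s * z))"
      by (rule Lpow_cong) (simp add: F_def mult.left_commute)
    also have "\<dots> \<le> ennreal (2 powr p) * ennreal (q h)" using b'(3)[OF s] Lb' by simp
    also have "\<dots> = ennreal (2 powr p * q h)" using q0 by (simp add: ennreal_mult)
    also have "\<dots> \<le> ennreal (D * norm (cis h - 1))"
    proof (rule ennreal_leI)
      have "2 * h / pi \<le> norm (cis h - 1)" using cis_dist_lower[of h] h by simp
      then have "h \<le> pi / 2 * norm (cis h - 1)" using pi_gt_zero by (simp add: field_simps)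
      then have "D0 * h \<le> D0 * (pi / 2 * norm (cis h - 1))" using D0 by (rule mult_left_mono)
      with qD[OF h(1)] have "2 powr p * q h \<le> 2 powr p * (D0 * (pi / 2 * norm (cis h - 1)))"
        by (intro mult_left_mono) auto
      then show "2 powr p * q h \<le> D * norm (cis h - 1)" by (simp add: D_def mult.assoc)
    qed
    finally show ?thesis .
  qed
  have lip: "Lpow p (\<lambda>z. disc_ext g (of_real s * (z * e)) - disc_ext g (of_real s * z)) \<le> ennreal (D * norm (e - 1))"
    if s: "0 \<le> s" "s < 1" and e: "norm e = 1" for s e
  proof -
    define h where "h = Arg e"
    have he: "e = cis h" using e cis_Arg[of e] by (force simp: h_def sgn_div_norm)
    have h: "- pi < h" "h \<le> pi" using Arg_bounded[of e] by (auto simp: h_def)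
    have eq: "Lpow p (\<lambda>z. disc_ext g (of_real s * (z * e)) - disc_ext g (of_real s * z)) = Lpow p (\<lambda>z. g (of_real s * (cis h * z)) - g (of_real s * z))"
      using s by (intro Lpow_cong) (simp add: he disc_ext_eq norm_mult mult.commute)
    consider "h = 0" | "0 < h" | "h < 0" by linarith
    then show ?thesis
    proof cases
      case 1
      then show ?thesis using he by (simp add: Lpow_def)
    next
      case 2
      then show ?thesis unfolding eq using arc[OF s 2 h(2)] he by simp
    next
      \<comment> \<open>Rotation by \<open>- h\<close> exchanges the two points of the difference,
        so that \<open>arc\<close> applies with the positive step \<open>- h\<close>.\<close>
      case 3
      define v where "v = (\<lambda>z. disc_ext g (of_real s * z))"
      have [measurable]: "v \<in> borel_measurable borel" unfolding v_def by measurable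
      have vg: "v z = g (of_real s * z)" if "norm z = 1" for z using that s by (simp add: v_def disc_ext_eq norm_mult)
      have "Lpow p (\<lambda>z. g (of_real s * (cis h * z)) - g (of_real s * z)) = Lpow p (\<lambda>z. v (cis h * z) - v z)"
        by (rule Lpow_cong) (simp add: vg norm_mult)
      also have "\<dots> = Lpow p (\<lambda>z. v (cis h * (cis (- h) * z)) - v (cis (- h) * z))"
        by (rule Lpow_rotate[symmetric]) auto
      also have "\<dots> = Lpow p (\<lambda>z. g (of_real s * (cis (- h) * z)) - g (of_real s * z))"
        unfolding Lpow_def by (rule nn_integral_circ_cong) (simp add: vg norm_mult mult.assoc[symmetric] cis_mult norm_minus_commute)
      also have "\<dots> \<le> ennreal (D * norm (cis (- h) - 1))" by (rule arc[OF s]) (use 3 h in auto)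
      also have "norm (cis (- h) - 1) = norm (cis h - 1)"
        by (metis cis_cnj complex_cnj_diff complex_cnj_one complex_mod_cnj)
      finally show ?thesis unfolding eq using he by simp
    qed
  qed
  define C where "C = 2 * D * (1 + pi powr (2 - 1/p) / (1 - 1/p)) powr p"
  have C: "0 \<le> C" using D by (simp add: C_def)
  show ?thesis
  proof (rule derivative_growthI[OF p g, of "1/4" "2 powr p * (C * 2 powr (p - 1))"])
    fix x :: real assume x: "1/4 \<le> x" "x < 1"
    \<comment> \<open>The radius \<open>x\<close> is the product of two factors \<open>s\<close>:
      one makes the dilate \<open>G\<close> holomorphic beyond the circle, the other is the radius
      at which its derivative is taken. The bound \<open>x \<ge> 1/4\<close> keeps
      \<open>1 / s\<close> at most 2.\<close>
    define s where "s = sqrt x"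
    have s2: "s * s = x" using x by (simp add: s_def)
    have s: "1/2 \<le> s" "s < 1" using x real_le_rsqrt[of "1/2" x] by (auto simp: s_def power2_eq_square)
    define G where "G = (\<lambda>z. disc_ext g (of_real s * z))"
    have [measurable]: "G \<in> borel_measurable borel" unfolding G_def by measurable
    have hG: "G holomorphic_on ball 0 (1 / s)"
      unfolding G_def by (rule dilate_holomorphic[OF disc_ext_holomorphic[OF g]]) (use s in auto)
    have main: "Lpow p (\<lambda>z. deriv G (of_real s * z)) \<le> ennreal (C * (1 - s) powr (1 - p))"
      unfolding C_def
    proof (rule Lpow_deriv_of_Lipschitz[OF p _ hG _ D])
      show "Lpow p (\<lambda>z. G (z * e) - G z) \<le> ennreal (D * norm (e - 1))" if "norm e = 1" for e
        unfolding G_def by (rule lip) (use s that in auto)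
    qed (use s in auto)
    have dG: "deriv g (of_real x * z) = of_real (1 / s) * deriv G (of_real s * z)" if z: "norm z = 1" for z
    proof -
      have e: "of_real s * (of_real s * z) = of_real x * z" by (simp add: s2[symmetric])
      have "norm (of_real s * (of_real s * z)) < 1" unfolding e using x z by (simp add: norm_mult)
      then have "deriv G (of_real s * z) = of_real s * deriv g (of_real x * z)"
        unfolding G_def by (subst deriv_dilate[OF g]) (simp_all add: e)
      then show ?thesis using s by simp
    qed
    have "Lpow p (\<lambda>z. deriv g (of_real x * z)) \<le> ennreal (2 powr p) * Lpow p (\<lambda>z. deriv G (of_real s * z))"
    proof -
      have "Lpow p (\<lambda>z. deriv g (of_real x * z)) \<le> (\<integral>\<^sup>+z. ennreal (2 powr p) * ennreal (norm (disc_ext (deriv G) (of_real s * z)) powr p) \<partial>circ)"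
        unfolding Lpow_def
      proof (rule nn_integral_circ_mono)
        fix z :: complex assume z: "norm z = 1"
        have "norm (deriv g (of_real x * z)) = 1 / s * norm (deriv G (of_real s * z))"
          using dG[OF z] s by (simp add: norm_mult norm_divide)
        also have "\<dots> \<le> 2 * norm (deriv G (of_real s * z))"
          using s by (intro mult_right_mono) (auto simp: field_simps)
        finally have "norm (deriv g (of_real x * z)) powr p \<le> (2 * norm (deriv G (of_real s * z))) powr p"
          using p by (intro powr_mono2) auto
        also have "\<dots> = 2 powr p * norm (disc_ext (deriv G) (of_real s * z)) powr p"
          using s z by (simp add: powr_mult disc_ext_eq norm_mult)
        finally show "ennreal (norm (deriv g (of_real x * z)) powr p) \<le> ennreal (2 powr p) * ennreal (norm (disc_ext (deriv G) (of_real s * z)) powr p)"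
          by (simp add: ennreal_mult[symmetric] ennreal_leI)
      qed
      also have "\<dots> = ennreal (2 powr p) * (\<integral>\<^sup>+z. ennreal (norm (disc_ext (deriv G) (of_real s * z)) powr p) \<partial>circ)"
      proof (rule nn_integral_cmult)
        have "deriv G holomorphic_on ball 0 1"
          by (rule holomorphic_on_subset[OF holomorphic_deriv[OF hG open_ball] subset_ball]) (use s in simp)
        then have [measurable]: "disc_ext (deriv G) \<in> borel_measurable borel" by (rule disc_ext_measurable)
        show "(\<lambda>z. ennreal (norm (disc_ext (deriv G) (of_real s * z)) powr p)) \<in> borel_measurable circ" by measurable
      qed
      also have "(\<integral>\<^sup>+z. ennreal (norm (disc_ext (deriv G) (of_real s * z)) powr p) \<partial>circ) = Lpow p (\<lambda>z. deriv G (of_real s * z))"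
        unfolding Lpow_def by (rule nn_integral_circ_cong) (use s in \<open>simp add: disc_ext_eq norm_mult\<close>)
      finally show ?thesis .
    qed
    also have "\<dots> \<le> ennreal (2 powr p) * ennreal (C * (1 - s) powr (1 - p))" by (intro mult_left_mono main) simp
    also have "\<dots> \<le> ennreal (2 powr p) * ennreal (C * (2 powr (p - 1) * (1 - x) powr (1 - p)))"
    proof (intro mult_left_mono ennreal_leI)
      have "1 - x = (1 - s) * (1 + s)" by (simp add: s2[symmetric] algebra_simps)
      also have "\<dots> \<le> (1 - s) * 2" using s by (intro mult_left_mono) auto
      finally have "(1 - x) / 2 \<le> 1 - s" by simp
      then have "(1 - s) powr (1 - p) \<le> ((1 - x) / 2) powr (1 - p)" using p x by (intro powr_mono2') auto
      also have "\<dots> = 2 powr (p - 1) * (1 - x) powr (1 - p)"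
        by (simp add: powr_divide powr_diff field_simps)
      finally show "(1 - s) powr (1 - p) \<le> 2 powr (p - 1) * (1 - x) powr (1 - p)" .
    qed (use C in auto)
    also have "\<dots> = ennreal (2 powr p * (C * 2 powr (p - 1)) * (1 - x) powr (1 - p))"
      using C by (simp add: ennreal_mult[symmetric] mult.assoc)
    finally show "Lpow p (\<lambda>z. deriv g (of_real x * z)) \<le> ennreal (2 powr p * (C * 2 powr (p - 1)) * (1 - x) powr (1 - p))" .
  qed (use C in auto)
qed

section \<open>A Littlewood--Paley bound by interpolation\<close>

text \<open>Open, so that both \<open>x\<close> and \<open>1 - x\<close> are positive on the whole
  space.\<close>

definition unit_interval :: "real measure" where
  "unit_interval = restrict_space lborel {0<..<1}"

lemma space_unit_interval [simp]: "space unit_interval = {0<..<1}"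
  by (simp add: unit_interval_def space_restrict_space)

lemma sigma_finite_unit_interval: "sigma_finite_measure unit_interval"
  unfolding unit_interval_def by (rule sigma_finite_restrict_lborel) simp

lemma measurable_unit_interval: "f \<in> measurable borel N \<Longrightarrow> f \<in> measurable unit_interval N"
  unfolding unit_interval_def by (rule measurable_restrict_space1) simp

lemma measurable_pair_unit_interval:
  "f \<in> measurable (M \<Otimes>\<^sub>M lborel) L \<Longrightarrow> f \<in> measurable (M \<Otimes>\<^sub>M unit_interval) L"
  unfolding unit_interval_def by (rule measurable_pair_restrict)

lemma nn_integral_unit_interval:
  "(\<integral>\<^sup>+x. f x \<partial>unit_interval) = (\<integral>\<^sup>+x. f x * indicator {0<..<1} x \<partial>lborel)"
  unfolding unit_interval_def by (subst nn_integral_restrict_space) auto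

lemma circ_power_orthonormal:
  "(LINT s|circ. s ^ m * cnj s ^ n) = (if m = n then 1 else 0)"
proof -
  have le: "(LINT s|circ. s ^ m * cnj s ^ n) = (if m = n then 1 else 0)" if "n \<le> m" for m n
  proof -
    have "(LINT s|circ. s ^ m * cnj s ^ n) = (LINT s|circ. s ^ (m - n) / (1 - 0 * cnj s))"
    proof (rule integral_circ_cong)
      fix s :: complex assume s: "norm s = 1"
      have ss: "s * cnj s = 1" using s by (simp add: complex_norm_square[symmetric])
      have "s ^ m * cnj s ^ n = s ^ (m - n) * (s ^ n * cnj s ^ n)"
        using that by (simp add: mult.assoc[symmetric] power_add[symmetric])
      also have "s ^ n * cnj s ^ n = 1" by (simp add: power_mult_distrib[symmetric] ss)
      finally show "s ^ m * cnj s ^ n = s ^ (m - n) / (1 - 0 * cnj s)" by simp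
    qed auto
    also have "\<dots> = 0 ^ (m - n)"
      by (rule Cauchy_circ[where R = 2 and F = "\<lambda>s. s ^ (m - n)"]) (auto intro!: holomorphic_intros)
    finally show ?thesis using that by auto
  qed
  show ?thesis
  proof (cases "n \<le> m")
    case False
    have "(LINT s|circ. s ^ m * cnj s ^ n) = (LINT s|circ. cnj (s ^ n * cnj s ^ m))"
      by (simp add: mult.commute)
    also have "\<dots> = cnj (LINT s|circ. s ^ n * cnj s ^ m)" by (rule Bochner_Integration.integral_cnj)
    also have "\<dots> = (if m = n then 1 else 0)" using le[of m n] False by simp
    finally show ?thesis .
  qed (rule le)
qed

lemma circ_polynomial_L2:
  fixes a :: "nat \<Rightarrow> complex"
  shows "integrable circ (\<lambda>s. (norm (\<Sum>n<N. a n * s ^ n))\<^sup>2)"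
    and "(LINT s|circ. (norm (\<Sum>n<N. a n * s ^ n))\<^sup>2) = (\<Sum>n<N. (norm (a n))\<^sup>2)"
proof -
  let ?P = "\<lambda>s. \<Sum>n<N. a n * s ^ n"
  show "integrable circ (\<lambda>s. (norm (?P s))\<^sup>2)"
    by (rule integrable_circ_continuous) (auto intro!: continuous_intros)
  have i: "integrable circ (\<lambda>s. a m * cnj (a n) * (s ^ m * cnj s ^ n))" for m n
    by (rule integrable_circ_continuous) (auto intro!: continuous_intros)
  have "complex_of_real (LINT s|circ. (norm (?P s))\<^sup>2) = (LINT s|circ. complex_of_real ((norm (?P s))\<^sup>2))"
    by (rule integral_complex_of_real[symmetric])
  also have "\<dots> = (LINT s|circ. (\<Sum>m<N. \<Sum>n<N. a m * cnj (a n) * (s ^ m * cnj s ^ n)))"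
  proof (intro Bochner_Integration.integral_cong refl)
    fix s
    have "complex_of_real ((norm (?P s))\<^sup>2) = ?P s * cnj (?P s)" by (rule complex_norm_square)
    also have "cnj (?P s) = (\<Sum>n<N. cnj (a n) * cnj s ^ n)" by simp
    finally show "complex_of_real ((norm (?P s))\<^sup>2) = (\<Sum>m<N. \<Sum>n<N. a m * cnj (a n) * (s ^ m * cnj s ^ n))"
      by (simp add: sum_product mult_ac)
  qed
  also have "\<dots> = (\<Sum>m<N. \<Sum>n<N. a m * cnj (a n) * (if m = n then 1 else 0))"
    using i by (simp add: Bochner_Integration.integral_sum circ_power_orthonormal)
  also have "\<dots> = (\<Sum>m<N. complex_of_real ((norm (a m))\<^sup>2))"
    by (simp add: if_distrib sum.delta complex_norm_square cong: if_cong del: of_real_power)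
  finally have "complex_of_real (LINT s|circ. (norm (?P s))\<^sup>2) = complex_of_real (\<Sum>m<N. (norm (a m))\<^sup>2)" by simp
  then show "(LINT s|circ. (norm (?P s))\<^sup>2) = (\<Sum>n<N. (norm (a n))\<^sup>2)" by (simp only: of_real_eq_iff)
qed

text \<open>Bessel's inequality, obtained by expanding the mean of
  \<open>(norm (cnj (h e) - e * S e))\<^sup>2\<close>. The powers start at 1 because these are the
  ones in the expansion of \<open>kernel_deriv\<close>.\<close>

lemma circ_Bessel:
  assumes [measurable]: "h \<in> borel_measurable borel" and m: "\<And>e. norm e = 1 \<Longrightarrow> norm (h e) \<le> m"
  shows "(\<Sum>n<N. (norm (LINT e|circ. h e * e ^ Suc n))\<^sup>2) \<le> (LINT e|circ. (norm (h e))\<^sup>2)"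
proof -
  define b where "b = (\<lambda>n. LINT e|circ. h e * e ^ Suc n)"
  define S where "S = (\<lambda>e. \<Sum>n<N. cnj (b n) * e ^ n)"
  have [measurable]: "S \<in> borel_measurable borel" unfolding S_def by measurable
  have Sc: "continuous_on A S" for A unfolding S_def by (intro continuous_intros)
  have L2: "integrable circ (\<lambda>e. (norm (S e))\<^sup>2)" "(LINT e|circ. (norm (S e))\<^sup>2) = (\<Sum>n<N. (norm (b n))\<^sup>2)"
    using circ_polynomial_L2[of "\<lambda>n. cnj (b n)" N] by (simp_all add: S_def)
  have m0: "0 \<le> m" by (rule order.trans[OF norm_ge_zero m[of 1]]) simp
  obtain MS where MS: "\<And>e. norm e = 1 \<Longrightarrow> norm (S e) \<le> MS"
  proof -
    have "compact (S ` sphere 0 1)" by (intro compact_continuous_image Sc compact_sphere)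
    then obtain B where "\<forall>x\<in>S ` sphere 0 1. norm x \<le> B" using compact_imp_bounded bounded_iff by blast
    then show ?thesis using that[of B] by auto
  qed
  have ih: "integrable circ (\<lambda>e. (norm (h e))\<^sup>2)"
    by (rule integrable_circ_bounded[where B = "m\<^sup>2"]) (use m m0 in \<open>auto intro!: power_mono\<close>)
  have ihe: "integrable circ (\<lambda>e. h e * e ^ Suc n)" for n
    by (rule integrable_circ_bounded[where B = m]) (use m in \<open>auto simp: norm_mult norm_power\<close>)
  have ihS: "integrable circ (\<lambda>e. h e * (e * S e))"
    by (rule integrable_circ_bounded[where B = "m * MS"]) (use m m0 MS in \<open>auto simp: norm_mult intro!: mult_mono\<close>)
  have "(LINT e|circ. h e * (e * S e)) = (LINT e|circ. (\<Sum>n<N. cnj (b n) * (h e * e ^ Suc n)))"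
    by (intro Bochner_Integration.integral_cong refl) (simp add: S_def sum_distrib_left mult_ac)
  also have "\<dots> = (\<Sum>n<N. cnj (b n) * b n)"
    using ihe by (subst Bochner_Integration.integral_sum) (auto simp: b_def)
  also have "\<dots> = complex_of_real (\<Sum>n<N. (norm (b n))\<^sup>2)"
    by (simp add: complex_norm_square mult.commute del: of_real_power)
  finally have "Re (LINT e|circ. h e * (e * S e)) = (\<Sum>n<N. (norm (b n))\<^sup>2)" by simp
  then have cross: "(LINT e|circ. Re (h e * (e * S e))) = (\<Sum>n<N. (norm (b n))\<^sup>2)"
    using integral_Re[OF ihS] by simp
  have iR: "integrable circ (\<lambda>e. Re (h e * (e * S e)))" by (rule integrable_Re[OF ihS])
  have lin: "(LINT e|circ. A e - 2 * B e + C e) = (LINT e|circ. A e) - 2 * (LINT e|circ. B e) + (LINT e|circ. C e)"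
    if "integrable circ A" "integrable circ B" "integrable circ C" for A B C :: "complex \<Rightarrow> real"
    using that by simp
  have "0 \<le> (LINT e|circ. (norm (h e))\<^sup>2 - 2 * Re (h e * (e * S e)) + (norm (S e))\<^sup>2)"
  proof (rule integral_nonneg_AE, use AE_circ in eventually_elim)
    case (elim e)
    have "(norm (cnj (h e) - e * S e))\<^sup>2 = (norm (h e))\<^sup>2 - 2 * Re (h e * (e * S e)) + (norm (e * S e))\<^sup>2"
      unfolding cmod_power2 by (simp add: power2_eq_square algebra_simps)
    moreover have "norm (e * S e) = norm (S e)" using elim by (simp add: norm_mult)
    ultimately show ?case by (metis zero_le_power2)
  qed
  also have "\<dots> = (LINT e|circ. (norm (h e))\<^sup>2) - 2 * (\<Sum>n<N. (norm (b n))\<^sup>2) + (\<Sum>n<N. (norm (b n))\<^sup>2)"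
    unfolding lin[OF ih iR L2(1)] L2(2) cross ..
  finally show ?thesis by (simp add: b_def)
qed

text \<open>Up to the unimodular factor \<open>s\<close>, this is the \<open>x\<close>-derivative of the mean of \<open>h e / (1 - x * e * cnj s)\<close> over \<open>e\<close>.\<close>

definition kernel_deriv :: "(complex \<Rightarrow> complex) \<Rightarrow> real \<Rightarrow> complex \<Rightarrow> complex" where
  "kernel_deriv h x s = (LINT e|circ. h e * e / (1 - of_real x * e * cnj s)\<^sup>2)"

section \<open>Endpoint estimates for the derivative kernel\<close>

lemma kernel_deriv_measurable:
  assumes [measurable]: "h \<in> borel_measurable borel"
  shows "(\<lambda>(s, x). kernel_deriv h x s) \<in> borel_measurable (circ \<Otimes>\<^sub>M lborel)"
proof -
  interpret sigma_finite_measure circ by (rule sigma_finite_circ)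
  show ?thesis unfolding kernel_deriv_def split_beta by measurable
qed

lemma norm_one_minus_real_mult:
  assumes "norm (z::complex) = 1"
  shows "norm (1 - of_real x * z) = norm (z - of_real x)"
proof -
  have "norm (1 - of_real x * z) = norm (cnj z - of_real x)"
    using norm_one_minus_cnj[of "cnj z" "of_real x"] assms by simp
  also have "\<dots> = norm (cnj (z - of_real x))" by simp
  finally show ?thesis by (simp only: complex_mod_cnj)
qed

lemma kernel_denominator:
  assumes "norm (e::complex) = 1" "norm s = 1" "0 \<le> x" "x < 1"
  shows "1 - x \<le> norm (1 - of_real x * e * cnj s)" "1 - of_real x * e * cnj s \<noteq> 0"
proof -
  show 1: "1 - x \<le> norm (1 - of_real x * e * cnj s)"
    using norm_triangle_ineq2[of 1 "of_real x * e * cnj s"] assms by (simp add: norm_mult)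
  show "1 - of_real x * e * cnj s \<noteq> 0" using 1 assms by auto
qed

lemma kernel_deriv_integrable:
  assumes [measurable]: "h \<in> borel_measurable borel" and m: "\<And>e. norm e = 1 \<Longrightarrow> norm (h e) \<le> m"
    and s: "norm s = 1" and x: "0 \<le> x" "x < 1"
  shows "integrable circ (\<lambda>e. h e * e / (1 - of_real x * e * cnj s)\<^sup>2)"
proof (rule integrable_circ_bounded[where B = "m / (1 - x)\<^sup>2"])
  fix e :: complex assume e: "norm e = 1"
  have "0 \<le> m" by (rule order.trans[OF norm_ge_zero m[OF e]])
  then show "norm (h e * e / (1 - of_real x * e * cnj s)\<^sup>2) \<le> m / (1 - x)\<^sup>2"
    using m[OF e] e kernel_denominator(1)[OF e s x] x
    by (simp add: norm_divide norm_mult norm_power) (intro frac_le power_mono, auto)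
qed measurable

text \<open>The supremum endpoint of the interpolation: after rotation by \<open>s\<close> the
  kernel has mass at most \<open>1 / (1 - x)\<close>.\<close>

lemma kernel_deriv_bound:
  assumes [measurable]: "h \<in> borel_measurable borel" and m: "\<And>e. norm e = 1 \<Longrightarrow> norm (h e) \<le> m"
    and s: "norm s = 1" and x: "0 \<le> x" "x < 1"
  shows "norm (kernel_deriv h x s) \<le> m / (1 - x)"
proof -
  have m0: "0 \<le> m" by (rule order.trans[OF norm_ge_zero m[of 1]]) simp
  have "ennreal (norm (kernel_deriv h x s)) \<le> (\<integral>\<^sup>+e. norm (h e * e / (1 - of_real x * e * cnj s)\<^sup>2) \<partial>circ)"
    unfolding kernel_deriv_def by (rule integral_norm_bound_ennreal[OF kernel_deriv_integrable[OF assms]])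
  also have "\<dots> = (\<integral>\<^sup>+e. norm (h (s * e) * (s * e) / (1 - of_real x * (s * e) * cnj s)\<^sup>2) \<partial>circ)"
    by (rule nn_integral_circ_rotate[symmetric, OF _ s]) measurable
  also have "\<dots> \<le> (\<integral>\<^sup>+e. ennreal m * ennreal (1 / (norm (e - of_real x))\<^sup>2) \<partial>circ)"
  proof (rule nn_integral_circ_mono)
    fix e :: complex assume e: "norm e = 1"
    have ss: "s * cnj s = 1" using s by (simp add: complex_norm_square[symmetric])
    have "of_real x * (s * e) * cnj s = of_real x * e * (s * cnj s)" by (simp only: mult_ac)
    then have "norm (1 - of_real x * (s * e) * cnj s) = norm (e - of_real x)"
      using norm_one_minus_real_mult[OF e, of x] by (simp only: ss mult_1_right)
    then have "norm (h (s * e) * (s * e) / (1 - of_real x * (s * e) * cnj s)\<^sup>2) = norm (h (s * e)) * (1 / (norm (e - of_real x))\<^sup>2)"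
      using s e by (simp add: norm_divide norm_mult norm_power)
    also have "\<dots> \<le> m * (1 / (norm (e - of_real x))\<^sup>2)"
      using m[of "s * e"] s e by (intro mult_right_mono) (auto simp: norm_mult)
    finally show "ennreal (norm (h (s * e) * (s * e) / (1 - of_real x * (s * e) * cnj s)\<^sup>2)) \<le> ennreal m * ennreal (1 / (norm (e - of_real x))\<^sup>2)"
      using m0 by (simp add: ennreal_mult[symmetric] ennreal_leI)
  qed
  also have "\<dots> = ennreal m * (\<integral>\<^sup>+e. ennreal (1 / (norm (e - of_real x))\<^sup>2) \<partial>circ)"
    by (rule nn_integral_cmult) measurable
  also have "\<dots> \<le> ennreal m * ennreal (1 / (1 - x))"
    by (intro mult_left_mono circ_kernel_mass x) auto
  also have "\<dots> = ennreal (m / (1 - x))" using m0 x by (simp add: ennreal_mult[symmetric])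
  finally show ?thesis using m0 x by (simp add: ennreal_le_iff)
qed

text \<open>The expansion \<open>1 / (1 - w)\<^sup>2 = \<Sum>n. (n + 1) * w ^ n\<close> gives
  \<open>kernel_deriv\<close> the coefficients \<open>(n + 1) * x ^ n * b n\<close>. Orthogonality
  reduces the claim to the integral of \<open>(1 - x) * x ^ (2 * n)\<close>, which is
  \<open>1 / ((2 * n + 1) * (2 * n + 2))\<close> and cancels \<open>(n + 1)\<^sup>2\<close>;
  Bessel's inequality finishes. Partial sums and Fatou's lemma handle the infinite series.\<close>

lemma kernel_deriv_L2:
  assumes [measurable]: "h \<in> borel_measurable borel" and m: "\<And>e. norm e = 1 \<Longrightarrow> norm (h e) \<le> m"
  shows "(\<integral>\<^sup>+(s, x). ennreal ((1 - x) * (norm (kernel_deriv h x s))\<^sup>2) \<partial>(circ \<Otimes>\<^sub>M unit_interval))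
     \<le> (\<integral>\<^sup>+e. ennreal ((norm (h e))\<^sup>2) \<partial>circ)"
proof -
  interpret C: sigma_finite_measure circ by (rule sigma_finite_circ)
  interpret U: sigma_finite_measure unit_interval by (rule sigma_finite_unit_interval)
  interpret CU: pair_sigma_finite circ unit_interval ..
  define b where "b = (\<lambda>n. LINT e|circ. h e * e ^ Suc n)"
  define T where "T = (\<lambda>N s (x::real). \<Sum>n<N. of_nat (Suc n) * of_real x ^ n * cnj s ^ n * b n)"
  have m0: "0 \<le> m" by (rule order.trans[OF norm_ge_zero m[of 1]]) simp
  have ihe: "integrable circ (\<lambda>e. h e * e ^ Suc n)" for n
    by (rule integrable_circ_bounded[where B = m]) (use m in \<open>auto simp: norm_mult norm_power\<close>)
  have lim: "(\<lambda>N. T N s x) \<longlonglongrightarrow> kernel_deriv h x s" if s: "norm s = 1" and x: "0 < x" "x < 1" for s x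
  proof -
    let ?w = "\<lambda>e. of_real x * e * cnj s"
    \<comment> \<open>On the circle the partial sums are dominated by the same series at the real
      point \<open>x\<close>, which gives the constant majorant.\<close>
    have "(\<lambda>N. LINT e|circ. h e * e * (\<Sum>n<N. of_nat (Suc n) * ?w e ^ n)) \<longlonglongrightarrow> (LINT e|circ. h e * e * (1 / (1 - ?w e)\<^sup>2))"
    proof (rule integral_dominated_convergence[where w = "\<lambda>_. m * (1 / (1 - x)\<^sup>2)"])
      have nw: "norm (?w e) = x" if "norm e = 1" for e using that s x by (simp add: norm_mult)
      show "AE e in circ. (\<lambda>N. h e * e * (\<Sum>n<N. of_nat (Suc n) * ?w e ^ n)) \<longlonglongrightarrow> h e * e * (1 / (1 - ?w e)\<^sup>2)"
        using AE_circ
      proof eventually_elim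
        case (elim e)
        have "norm (?w e) < 1" using nw[OF elim] x by simp
        then have "(\<lambda>n. of_nat (Suc n) * ?w e ^ n) sums (1 / (1 - ?w e)\<^sup>2)" by (rule geometric_deriv_sums)
        then show ?case unfolding sums_def by (intro tendsto_intros)
      qed
      show "AE e in circ. norm (h e * e * (\<Sum>n<N. of_nat (Suc n) * ?w e ^ n)) \<le> m * (1 / (1 - x)\<^sup>2)" for N
        using AE_circ
      proof eventually_elim
        case (elim e)
        have "norm (\<Sum>n<N. of_nat (Suc n) * ?w e ^ n) \<le> (\<Sum>n<N. norm (of_nat (Suc n) * ?w e ^ n))" by (rule norm_sum)
        also have "\<dots> = (\<Sum>n<N. real (Suc n) * x ^ n)"
          by (intro sum.cong refl) (simp only: norm_mult[of "of_nat _"] norm_power nw[OF elim] norm_of_nat)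
        also have "\<dots> \<le> 1 / (1 - x)\<^sup>2"
        proof -
          have g: "(\<lambda>n. of_nat (Suc n) * x ^ n) sums (1 / (1 - x)\<^sup>2)" by (rule geometric_deriv_sums) (use x in simp)
          have "(\<Sum>n<N. of_nat (Suc n) * x ^ n) \<le> (\<Sum>n. of_nat (Suc n) * x ^ n)"
            by (rule sum_le_suminf[OF sums_summable[OF g]]) (use x in auto)
          then show ?thesis using sums_unique[OF g] by simp
        qed
        finally have "norm (\<Sum>n<N. of_nat (Suc n) * ?w e ^ n) \<le> 1 / (1 - x)\<^sup>2" .
        then show ?case using m[OF elim] m0 elim unfolding norm_mult by (simp only: elim mult_1_right) (intro mult_mono, auto)
      qed
      show "integrable circ (\<lambda>_. m * (1 / (1 - x)\<^sup>2))" by (rule integrable_circ_bounded[where B = "\<bar>m * (1 / (1 - x)\<^sup>2)\<bar>"]) auto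
    qed measurable
    moreover have "(LINT e|circ. h e * e * (\<Sum>n<N. of_nat (Suc n) * ?w e ^ n)) = T N s x" for N
    proof -
      have "(LINT e|circ. h e * e * (\<Sum>n<N. of_nat (Suc n) * ?w e ^ n)) = (LINT e|circ. (\<Sum>n<N. (of_nat (Suc n) * of_real x ^ n * cnj s ^ n) * (h e * e ^ Suc n)))"
        by (intro Bochner_Integration.integral_cong refl) (simp add: sum_distrib_left power_mult_distrib mult_ac)
      also have "\<dots> = T N s x"
        using ihe by (subst Bochner_Integration.integral_sum) (auto simp: T_def b_def)
      finally show ?thesis .
    qed
    ultimately show ?thesis by (simp add: kernel_deriv_def)
  qed
  have Tm: "(\<lambda>(s, x). ennreal ((1 - x) * (norm (T N s x))\<^sup>2)) \<in> borel_measurable (circ \<Otimes>\<^sub>M unit_interval)" for N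
    unfolding T_def by (rule measurable_pair_unit_interval) measurable
  have TN: "(\<integral>\<^sup>+(s, x). ennreal ((1 - x) * (norm (T N s x))\<^sup>2) \<partial>(circ \<Otimes>\<^sub>M unit_interval)) \<le> (\<integral>\<^sup>+e. ennreal ((norm (h e))\<^sup>2) \<partial>circ)" for N
  proof -
    have "(\<integral>\<^sup>+(s, x). ennreal ((1 - x) * (norm (T N s x))\<^sup>2) \<partial>(circ \<Otimes>\<^sub>M unit_interval))
      = (\<integral>\<^sup>+x. \<integral>\<^sup>+s. ennreal ((1 - x) * (norm (T N s x))\<^sup>2) \<partial>circ \<partial>unit_interval)"
      using CU.nn_integral_snd[OF Tm[of N]] by (simp add: split_beta)
    also have "\<dots> = (\<integral>\<^sup>+x. (\<Sum>n<N. ennreal ((norm (b n))\<^sup>2 * (real (Suc n))\<^sup>2) * ennreal ((1 - x) * x ^ (2 * n))) \<partial>unit_interval)"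
    proof (intro nn_integral_cong)
      fix x assume "x \<in> space unit_interval"
      then have x: "0 < x" "x < 1" by auto
      define a where "a = (\<lambda>n. cnj (of_nat (Suc n) * of_real x ^ n * b n))"
      have nT: "norm (T N s x) = norm (\<Sum>n<N. a n * s ^ n)" for s
      proof -
        have "T N s x = cnj (\<Sum>n<N. a n * s ^ n)" by (simp add: T_def a_def mult_ac)
        then show ?thesis by (simp only: complex_mod_cnj)
      qed
      have "(\<integral>\<^sup>+s. ennreal ((1 - x) * (norm (T N s x))\<^sup>2) \<partial>circ) = ennreal (LINT s|circ. (1 - x) * (norm (\<Sum>n<N. a n * s ^ n))\<^sup>2)"
        unfolding nT using x circ_polynomial_L2(1)[of a N] by (intro nn_integral_eq_integral) auto
      also have "(LINT s|circ. (1 - x) * (norm (\<Sum>n<N. a n * s ^ n))\<^sup>2) = (1 - x) * (\<Sum>n<N. (norm (a n))\<^sup>2)"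
        by (simp add: circ_polynomial_L2(2))
      also have "\<dots> = (\<Sum>n<N. (norm (b n))\<^sup>2 * (real (Suc n))\<^sup>2 * ((1 - x) * x ^ (2 * n)))"
        unfolding sum_distrib_left
      proof (intro sum.cong refl)
        fix n
        have "norm (a n) = real (Suc n) * x ^ n * norm (b n)"
          using x unfolding a_def complex_mod_cnj norm_mult norm_power norm_of_nat by simp
        then show "(1 - x) * (norm (a n))\<^sup>2 = (norm (b n))\<^sup>2 * (real (Suc n))\<^sup>2 * ((1 - x) * x ^ (2 * n))"
          by (simp only: power_mult_distrib power_mult[symmetric] mult_ac)
      qed
      also have "ennreal \<dots> = (\<Sum>n<N. ennreal ((norm (b n))\<^sup>2 * (real (Suc n))\<^sup>2 * ((1 - x) * x ^ (2 * n))))"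
        using x by (intro sum_ennreal[symmetric]) auto
      also have "\<dots> = (\<Sum>n<N. ennreal ((norm (b n))\<^sup>2 * (real (Suc n))\<^sup>2) * ennreal ((1 - x) * x ^ (2 * n)))"
        using x by (intro sum.cong refl ennreal_mult) auto
      finally show "(\<integral>\<^sup>+s. ennreal ((1 - x) * (norm (T N s x))\<^sup>2) \<partial>circ) = (\<Sum>n<N. ennreal ((norm (b n))\<^sup>2 * (real (Suc n))\<^sup>2) * ennreal ((1 - x) * x ^ (2 * n)))" .
    qed
    also have "\<dots> = (\<Sum>n<N. ennreal ((norm (b n))\<^sup>2 * (real (Suc n))\<^sup>2) * (\<integral>\<^sup>+x. ennreal ((1 - x) * x ^ (2 * n)) \<partial>unit_interval))"
    proof -
      have [measurable]: "(\<lambda>x. ennreal ((1 - x) * x ^ (2 * n))) \<in> borel_measurable unit_interval" for n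
        by (rule measurable_unit_interval) measurable
      show ?thesis by (subst nn_integral_sum) (auto simp: nn_integral_cmult)
    qed
    also have "\<dots> \<le> (\<Sum>n<N. ennreal ((norm (b n))\<^sup>2))"
    proof (intro sum_mono)
      fix n
      have "(\<integral>\<^sup>+x. ennreal ((1 - x) * x ^ (2 * n)) \<partial>unit_interval) \<le> (\<integral>\<^sup>+x. ennreal ((1 - x) * x ^ (2 * n)) * indicator {0..1} x \<partial>lborel)"
        unfolding nn_integral_unit_interval by (intro nn_integral_mono) (auto simp: indicator_def)
      also have "\<dots> = ennreal ((1 ^ (2 * n + 1) / (2 * n + 1) - 1 ^ (2 * n + 2) / (2 * n + 2)) - (0 ^ (2 * n + 1) / (2 * n + 1) - 0 ^ (2 * n + 2) / (2 * n + 2)))"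
      proof (rule nn_integral_FTC_Icc[where F = "\<lambda>x. x ^ (2 * n + 1) / (2 * n + 1) - x ^ (2 * n + 2) / (2 * n + 2)"])
        fix x :: real assume x: "x \<in> {0..1}"
        have 1: "((\<lambda>x. x ^ (2 * n + 1) / real (2 * n + 1)) has_real_derivative x ^ (2 * n)) (at x)"
          by (rule DERIV_cong[OF DERIV_cdivide[OF DERIV_pow]]) (simp del: of_nat_Suc of_nat_add of_nat_mult)
        have 2: "((\<lambda>x. x ^ (2 * n + 2) / real (2 * n + 2)) has_real_derivative x ^ (2 * n + 1)) (at x)"
          by (rule DERIV_cong[OF DERIV_cdivide[OF DERIV_pow]]) (simp del: of_nat_Suc of_nat_add of_nat_mult)
        have "((\<lambda>x. x ^ (2 * n + 1) / real (2 * n + 1) - x ^ (2 * n + 2) / real (2 * n + 2)) has_real_derivative x ^ (2 * n) - x ^ (2 * n + 1)) (at x)"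
          by (rule DERIV_diff[OF 1 2])
        moreover have "x ^ (2 * n) - x ^ (2 * n + 1) = (1 - x) * x ^ (2 * n)" by (simp add: algebra_simps)
        ultimately show "((\<lambda>x. x ^ (2 * n + 1) / (2 * n + 1) - x ^ (2 * n + 2) / (2 * n + 2)) has_real_derivative (1 - x) * x ^ (2 * n)) (at x)"
          by simp
        show "0 \<le> (1 - x) * x ^ (2 * n)" using x by auto
      qed auto
      also have "\<dots> \<le> ennreal (1 / (real (Suc n))\<^sup>2)"
      proof (rule ennreal_leI)
        define k where "k = real n"
        have k: "0 \<le> k" by (simp add: k_def)
        have e: "1 / (2 * k + 1) - 1 / (2 * k + 2) = 1 / ((2 * k + 1) * (2 * k + 2))"
          using k by (simp add: field_simps)
        have "(k + 1)\<^sup>2 \<le> (2 * k + 1) * (2 * k + 2)" using k by (simp add: power2_eq_square algebra_simps)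
        then have "1 / ((2 * k + 1) * (2 * k + 2)) \<le> 1 / (k + 1)\<^sup>2" using k by (intro divide_left_mono) auto
        then show "(1 ^ (2 * n + 1) / (2 * n + 1) - 1 ^ (2 * n + 2) / (2 * n + 2)) - (0 ^ (2 * n + 1) / (2 * n + 1) - 0 ^ (2 * n + 2) / (2 * n + 2)) \<le> 1 / (real (Suc n))\<^sup>2"
          using e by (simp add: k_def add.commute)
      qed
      finally have "ennreal ((norm (b n))\<^sup>2 * (real (Suc n))\<^sup>2) * (\<integral>\<^sup>+x. ennreal ((1 - x) * x ^ (2 * n)) \<partial>unit_interval)
        \<le> ennreal ((norm (b n))\<^sup>2 * (real (Suc n))\<^sup>2) * ennreal (1 / (real (Suc n))\<^sup>2)" by (rule mult_left_mono) simp
      also have "\<dots> = ennreal ((norm (b n))\<^sup>2 * (real (Suc n))\<^sup>2 * (1 / (real (Suc n))\<^sup>2))"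
        by (intro ennreal_mult[symmetric]) auto
      also have "(norm (b n))\<^sup>2 * (real (Suc n))\<^sup>2 * (1 / (real (Suc n))\<^sup>2) = (norm (b n))\<^sup>2" by (simp del: of_nat_Suc)
      finally show "ennreal ((norm (b n))\<^sup>2 * (real (Suc n))\<^sup>2) * (\<integral>\<^sup>+x. ennreal ((1 - x) * x ^ (2 * n)) \<partial>unit_interval) \<le> ennreal ((norm (b n))\<^sup>2)" .
    qed
    also have "\<dots> = ennreal (\<Sum>n<N. (norm (b n))\<^sup>2)" by (rule sum_ennreal) auto
    also have "\<dots> \<le> ennreal (LINT e|circ. (norm (h e))\<^sup>2)" unfolding b_def by (intro ennreal_leI circ_Bessel[OF assms])
    also have "\<dots> = (\<integral>\<^sup>+e. ennreal ((norm (h e))\<^sup>2) \<partial>circ)"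
    proof (rule nn_integral_eq_integral[symmetric])
      show "integrable circ (\<lambda>e. (norm (h e))\<^sup>2)"
        by (rule integrable_circ_bounded[where B = "m\<^sup>2"]) (use m m0 in \<open>auto intro!: power_mono\<close>)
    qed auto
    finally show ?thesis .
  qed
  have ae: "AE y in circ \<Otimes>\<^sub>M unit_interval. norm (fst y) = 1"
  proof (rule CU.AE_pair_measure)
    show "AE s in circ. AE x in unit_interval. norm (fst (s, x)) = 1" using AE_circ by eventually_elim auto
  qed measurable
  have "(\<integral>\<^sup>+(s, x). ennreal ((1 - x) * (norm (kernel_deriv h x s))\<^sup>2) \<partial>(circ \<Otimes>\<^sub>M unit_interval))
     = (\<integral>\<^sup>+y. liminf (\<lambda>N. ennreal ((1 - snd y) * (norm (T N (fst y) (snd y)))\<^sup>2)) \<partial>(circ \<Otimes>\<^sub>M unit_interval))"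
  proof (rule nn_integral_cong_AE, use ae AE_space in eventually_elim)
    case (elim y)
    then have "0 < snd y" "snd y < 1" by (auto simp: space_pair_measure)
    from lim[OF elim(1) this] have "(\<lambda>N. ennreal ((1 - snd y) * (norm (T N (fst y) (snd y)))\<^sup>2)) \<longlonglongrightarrow> ennreal ((1 - snd y) * (norm (kernel_deriv h (snd y) (fst y)))\<^sup>2)"
      by (intro tendsto_ennrealI tendsto_intros)
    from lim_imp_Liminf[OF _ this] show ?case by (simp add: split_beta)
  qed
  also have "\<dots> \<le> liminf (\<lambda>N. \<integral>\<^sup>+y. ennreal ((1 - snd y) * (norm (T N (fst y) (snd y)))\<^sup>2) \<partial>(circ \<Otimes>\<^sub>M unit_interval))"
    by (rule nn_integral_liminf) (use Tm in \<open>simp add: split_beta\<close>)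
  also have "\<dots> \<le> limsup (\<lambda>N. \<integral>\<^sup>+y. ennreal ((1 - snd y) * (norm (T N (fst y) (snd y)))\<^sup>2) \<partial>(circ \<Otimes>\<^sub>M unit_interval))"
    by (rule Liminf_le_Limsup) simp
  also have "\<dots> \<le> (\<integral>\<^sup>+e. ennreal ((norm (h e))\<^sup>2) \<partial>circ)"
    by (rule Limsup_bounded, rule always_eventually, rule allI, rule TN[unfolded split_beta])
  finally show ?thesis .
qed

text \<open>Interpolates between the \<open>L\<^sup>2\<close> bound and the trivial bound \<open>(1 - x) * norm (kernel_deriv h x s) \<le> m\<close>.\<close>

lemma kernel_deriv_Lq:
  assumes q: "2 \<le> q"
  shows "\<exists>C\<ge>0. \<forall>h m. h \<in> borel_measurable borel \<longrightarrow> (\<forall>e. norm e = 1 \<longrightarrow> norm (h e) \<le> m) \<longrightarrow>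
    (\<integral>\<^sup>+(s, x). ennreal ((1 - x) powr (q - 1) * norm (kernel_deriv h x s) powr q) \<partial>(circ \<Otimes>\<^sub>M unit_interval))
     \<le> ennreal C * (\<integral>\<^sup>+e. ennreal (norm (h e) powr q) \<partial>circ)"
proof -
  interpret C: sigma_finite_measure circ by (rule sigma_finite_circ)
  interpret U: sigma_finite_measure unit_interval by (rule sigma_finite_unit_interval)
  interpret CU: pair_sigma_finite circ unit_interval ..
  let ?P = "circ \<Otimes>\<^sub>M unit_interval"
  have sp: "0 < snd y \<and> snd y < 1" if "y \<in> space ?P" for y
    using that by (auto simp: space_pair_measure)
  have kdm: "(\<lambda>y. kernel_deriv h (snd y) (fst y)) \<in> borel_measurable ?P" if "h \<in> borel_measurable borel" for h :: "complex \<Rightarrow> complex"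
    using measurable_pair_unit_interval[OF kernel_deriv_measurable[OF that]] by (simp add: split_beta)
  have ae: "AE y in ?P. norm (fst y) = 1"
  proof (rule CU.AE_pair_measure)
    show "AE s in circ. AE x in unit_interval. norm (fst (s, x)) = 1" using AE_circ by eventually_elim auto
  qed measurable
  show ?thesis
  \<comment> \<open>At \<open>q = 2\<close> the endpoint estimate is the claim; interpolation
    requires strictly larger exponents.\<close>
  proof (cases "q = 2")
    case True
    show ?thesis
    proof (intro exI[of _ 1] conjI allI impI)
      fix h :: "complex \<Rightarrow> complex" and m assume h: "h \<in> borel_measurable borel" "\<forall>e. norm e = 1 \<longrightarrow> norm (h e) \<le> m"
      have "(\<integral>\<^sup>+(s, x). ennreal ((1 - x) powr (q - 1) * norm (kernel_deriv h x s) powr q) \<partial>?P)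
        = (\<integral>\<^sup>+(s, x). ennreal ((1 - x) * (norm (kernel_deriv h x s))\<^sup>2) \<partial>?P)"
      proof (intro nn_integral_cong)
        fix y assume "y \<in> space ?P"
        then show "(case y of (s, x) \<Rightarrow> ennreal ((1 - x) powr (q - 1) * norm (kernel_deriv h x s) powr q))
          = (case y of (s, x) \<Rightarrow> ennreal ((1 - x) * (norm (kernel_deriv h x s))\<^sup>2))"
          using sp[of y] True by (auto simp: split_beta powr_numeral)
      qed
      also have "\<dots> \<le> (\<integral>\<^sup>+e. ennreal ((norm (h e))\<^sup>2) \<partial>circ)"
        by (rule kernel_deriv_L2[where m = m]) (use h in auto)
      finally show "(\<integral>\<^sup>+(s, x). ennreal ((1 - x) powr (q - 1) * norm (kernel_deriv h x s) powr q) \<partial>?P)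
        \<le> ennreal 1 * (\<integral>\<^sup>+e. ennreal (norm (h e) powr q) \<partial>circ)"
        using True by (simp add: powr_numeral)
    qed simp
  next
    case False
    then have q2: "2 < q" using q by simp
    \<comment> \<open>The constant of \<open>Marcinkiewicz\<close> for \<open>C = 4\<close>,
      \<open>c = 2\<close> and \<open>r = 2\<close>.\<close>
    let ?C = "4 * q * 2 powr (q - 2) / (q - 2)"
    show ?thesis
    proof (intro exI[of _ ?C] conjI allI impI)
      fix h :: "complex \<Rightarrow> complex" and m assume hm: "h \<in> borel_measurable borel" "\<forall>e. norm e = 1 \<longrightarrow> norm (h e) \<le> m"
      note hm(1)[measurable]
      \<comment> \<open>With respect to the weight \<open>1 / (1 - x)\<close> the factor in
        \<open>T\<close> makes the quadratic estimate read as a bound from exponent 2 to exponent 2.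
        The absolute values make \<open>T\<close> nonnegative everywhere, as interpolation
        demands.\<close>
      define W where "W = (\<lambda>y::complex \<times> real. ennreal (1 / \<bar>1 - snd y\<bar>))"
      define T where "T = (\<lambda>y. \<bar>1 - snd y\<bar> * norm (kernel_deriv h (snd y) (fst y)))"
      have [measurable]: "W \<in> borel_measurable ?P" unfolding W_def
        by (rule measurable_pair_unit_interval) measurable
      have im: "(\<lambda>y. \<bar>1 - snd y\<bar> :: real) \<in> borel_measurable ?P"
        by (rule measurable_pair_unit_interval) measurable
      note im[measurable] kdm[OF hm(1), measurable]
      have [measurable]: "T \<in> borel_measurable ?P" unfolding T_def by measurable
      define M where "M = density ?P W"
      have sM: "sigma_finite_measure M"
        unfolding M_def by (subst CU.sigma_finite_iff_density_finite) (auto simp: W_def)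
      have "(\<integral>\<^sup>+y. ennreal (T y powr q) \<partial>M) \<le> ennreal ?C * (\<integral>\<^sup>+e. ennreal (norm (h e) powr q) \<partial>circ)"
      proof (rule Marcinkiewicz[OF sM sigma_finite_circ, where r = 2])
        show "T \<in> borel_measurable M" unfolding M_def by simp
        show "(\<lambda>e. norm (h e)) \<in> borel_measurable circ" by measurable
        fix l :: real assume l: "0 < l"
        \<comment> \<open>The remainder \<open>h1\<close> is at most \<open>l / 2\<close>, so it
          contributes at most \<open>l / 2\<close> to \<open>T\<close>; where \<open>T\<close>
          exceeds \<open>l\<close>, the large part \<open>h2\<close> must contribute more than
          \<open>l / 2\<close>.\<close>
        define h2 where "h2 = (\<lambda>e. if l < 2 * norm (h e) then h e else 0)"
        define h1 where "h1 = (\<lambda>e. h e - h2 e)"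
        have h2m[measurable]: "h2 \<in> borel_measurable borel" unfolding h2_def by measurable
        have h1m[measurable]: "h1 \<in> borel_measurable borel" unfolding h1_def by measurable
        have h1b: "norm (h1 e) \<le> l / 2" for e using l by (auto simp: h1_def h2_def)
        have m0: "0 \<le> m" using hm(2) by (metis norm_ge_zero norm_one order.trans)
        have h2b: "norm (h2 e) \<le> m" if "norm e = 1" for e using hm(2) that m0 by (auto simp: h2_def)
        have split: "ennreal (indicator {y \<in> space ?P. l < T y} y) \<le> ennreal (4 / l\<^sup>2) * ennreal ((1 - snd y)\<^sup>2 * (norm (kernel_deriv h2 (snd y) (fst y)))\<^sup>2)"
          if y: "y \<in> space ?P" "norm (fst y) = 1" for y
        proof (cases "l < T y")
          case True
          have x: "0 \<le> snd y" "snd y < 1" using sp[OF y(1)] by auto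
          have "kernel_deriv h (snd y) (fst y) = kernel_deriv h1 (snd y) (fst y) + kernel_deriv h2 (snd y) (fst y)"
          proof -
            let ?D = "\<lambda>e. (1 - of_real (snd y) * e * cnj (fst y))\<^sup>2"
            have "(LINT e|circ. h1 e * e / ?D e + h2 e * e / ?D e) = (LINT e|circ. h1 e * e / ?D e) + (LINT e|circ. h2 e * e / ?D e)"
              by (rule Bochner_Integration.integral_add[OF kernel_deriv_integrable[OF h1m h1b y(2) x] kernel_deriv_integrable[OF h2m h2b y(2) x]])
            moreover have "h e * e / ?D e = h1 e * e / ?D e + h2 e * e / ?D e" for e
              by (simp add: h1_def add_divide_distrib[symmetric] distrib_right[symmetric])
            ultimately show ?thesis unfolding kernel_deriv_def by (simp only:)
          qed
          then have "T y \<le> (1 - snd y) * (norm (kernel_deriv h1 (snd y) (fst y)) + norm (kernel_deriv h2 (snd y) (fst y)))"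
            using x unfolding T_def by (intro mult_mono) (auto intro: norm_triangle_ineq)
          also have "\<dots> = (1 - snd y) * norm (kernel_deriv h1 (snd y) (fst y)) + (1 - snd y) * norm (kernel_deriv h2 (snd y) (fst y))"
            by (simp add: algebra_simps)
          finally have 1: "T y \<le> (1 - snd y) * norm (kernel_deriv h1 (snd y) (fst y)) + (1 - snd y) * norm (kernel_deriv h2 (snd y) (fst y))" .
          have "norm (kernel_deriv h1 (snd y) (fst y)) \<le> l / 2 / (1 - snd y)"
            by (rule kernel_deriv_bound[OF h1m h1b y(2) x])
          then have "norm (kernel_deriv h1 (snd y) (fst y)) * (1 - snd y) \<le> l / 2"
            by (subst (asm) pos_le_divide_eq) (use x in auto)
          then have "(1 - snd y) * norm (kernel_deriv h1 (snd y) (fst y)) \<le> l / 2"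
            by (simp only: mult.commute)
          with 1 True have "l / 2 < (1 - snd y) * norm (kernel_deriv h2 (snd y) (fst y))" by linarith
          then have "(l / 2)\<^sup>2 \<le> ((1 - snd y) * norm (kernel_deriv h2 (snd y) (fst y)))\<^sup>2" using l by (intro power_mono) auto
          then have "4 / l\<^sup>2 * (l / 2)\<^sup>2 \<le> 4 / l\<^sup>2 * ((1 - snd y) * norm (kernel_deriv h2 (snd y) (fst y)))\<^sup>2"
            by (rule mult_left_mono) simp
          moreover have "4 / l\<^sup>2 * (l / 2)\<^sup>2 = 1" using l by (simp add: power_divide)
          ultimately have "1 \<le> 4 / l\<^sup>2 * ((1 - snd y)\<^sup>2 * (norm (kernel_deriv h2 (snd y) (fst y)))\<^sup>2)"
            by (simp only: power_mult_distrib)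
          then have "ennreal 1 \<le> ennreal (4 / l\<^sup>2 * ((1 - snd y)\<^sup>2 * (norm (kernel_deriv h2 (snd y) (fst y)))\<^sup>2))" by (rule ennreal_leI)
          also have "\<dots> = ennreal (4 / l\<^sup>2) * ennreal ((1 - snd y)\<^sup>2 * (norm (kernel_deriv h2 (snd y) (fst y)))\<^sup>2)"
            by (rule ennreal_mult) auto
          finally show ?thesis using True y(1) by (simp only: indicator_def mem_Collect_eq simp_thms of_bool_eq)
        qed (simp add: indicator_def)
        have "emeasure M {y \<in> space M. l < T y} = (\<integral>\<^sup>+y. W y * indicator {y \<in> space ?P. l < T y} y \<partial>?P)"
        proof -
          have "{y \<in> space ?P. l < T y} \<in> sets ?P" by measurable
          then show ?thesis unfolding M_def space_density by (intro emeasure_density) auto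
        qed
        also have "\<dots> \<le> (\<integral>\<^sup>+y. ennreal (4 / l\<^sup>2) * ennreal ((1 - snd y) * (norm (kernel_deriv h2 (snd y) (fst y)))\<^sup>2) \<partial>?P)"
        proof (rule nn_integral_mono_AE, use ae AE_space in eventually_elim)
          case (elim y)
          have x: "0 < 1 - snd y" using sp[OF elim(2)] by auto
          have "W y * indicator {y \<in> space ?P. l < T y} y = W y * ennreal (indicator {y \<in> space ?P. l < T y} y)"
            by (simp add: indicator_def)
          also have "\<dots> \<le> W y * (ennreal (4 / l\<^sup>2) * ennreal ((1 - snd y)\<^sup>2 * (norm (kernel_deriv h2 (snd y) (fst y)))\<^sup>2))"
            by (intro mult_left_mono split elim) auto
          also have "\<dots> = ennreal (1 / (1 - snd y) * (4 / l\<^sup>2 * ((1 - snd y)\<^sup>2 * (norm (kernel_deriv h2 (snd y) (fst y)))\<^sup>2)))"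
            using x by (simp add: W_def ennreal_mult[symmetric])
          also have "1 / (1 - snd y) * (4 / l\<^sup>2 * ((1 - snd y)\<^sup>2 * (norm (kernel_deriv h2 (snd y) (fst y)))\<^sup>2)) = 4 / l\<^sup>2 * ((1 - snd y) * (norm (kernel_deriv h2 (snd y) (fst y)))\<^sup>2)"
            using x by (simp add: power2_eq_square)
          also have "ennreal (4 / l\<^sup>2 * ((1 - snd y) * (norm (kernel_deriv h2 (snd y) (fst y)))\<^sup>2)) = ennreal (4 / l\<^sup>2) * ennreal ((1 - snd y) * (norm (kernel_deriv h2 (snd y) (fst y)))\<^sup>2)"
            using x by (intro ennreal_mult) auto
          finally show ?case .
        qed
        also have "\<dots> = ennreal (4 / l\<^sup>2) * (\<integral>\<^sup>+(s, x). ennreal ((1 - x) * (norm (kernel_deriv h2 x s))\<^sup>2) \<partial>?P)"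
        proof -
          have [measurable]: "(\<lambda>y. 1 - snd y :: real) \<in> borel_measurable ?P"
            by (rule measurable_pair_unit_interval) measurable
          note kdm[OF h2m, measurable]
          show ?thesis by (subst nn_integral_cmult) (auto simp: case_prod_unfold)
        qed
        also have "\<dots> \<le> ennreal (4 / l\<^sup>2) * (\<integral>\<^sup>+e. ennreal ((norm (h2 e))\<^sup>2) \<partial>circ)"
          by (intro mult_left_mono kernel_deriv_L2[OF h2m h2b]) auto
        also have "\<dots> = ennreal (4 * l powr (- 2)) * (\<integral>\<^sup>+e. ennreal (norm (h e) powr 2) * indicator {e. l < 2 * norm (h e)} e \<partial>circ)"
          using l by (intro arg_cong2[where f = "(*)"] arg_cong[where f = ennreal] nn_integral_cong)
             (auto simp: h2_def indicator_def powr_minus powr_numeral divide_inverse)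
        finally show "emeasure M {y \<in> space M. l < T y}
          \<le> ennreal (4 * l powr (- 2)) * (\<integral>\<^sup>+e. ennreal (norm (h e) powr 2) * indicator {e. l < 2 * norm (h e)} e \<partial>circ)" .
      qed (use q2 in \<open>auto simp: T_def\<close>)
      also have "(\<integral>\<^sup>+y. ennreal (T y powr q) \<partial>M) = (\<integral>\<^sup>+y. W y * ennreal (T y powr q) \<partial>?P)"
        unfolding M_def by (rule nn_integral_density) measurable
      also have "\<dots> = (\<integral>\<^sup>+(s, x). ennreal ((1 - x) powr (q - 1) * norm (kernel_deriv h x s) powr q) \<partial>?P)"
      proof (intro nn_integral_cong)
        fix y assume y: "y \<in> space ?P"
        have x: "0 < 1 - snd y" using sp[OF y] by auto
        have "1 / (1 - snd y) * (1 - snd y) powr q = (1 - snd y) powr (q - 1)"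
          using x by (simp add: powr_diff)
        then have "1 / (1 - snd y) * T y powr q = (1 - snd y) powr (q - 1) * norm (kernel_deriv h (snd y) (fst y)) powr q"
          using x by (simp add: T_def powr_mult mult.assoc[symmetric])
        moreover have "W y * ennreal (T y powr q) = ennreal (1 / (1 - snd y) * T y powr q)"
          using x unfolding W_def by (subst ennreal_mult) auto
        ultimately show "W y * ennreal (T y powr q) = (case y of (s, x) \<Rightarrow> ennreal ((1 - x) powr (q - 1) * norm (kernel_deriv h x s) powr q))"
          by (simp add: split_beta)
      qed
      finally show "(\<integral>\<^sup>+(s, x). ennreal ((1 - x) powr (q - 1) * norm (kernel_deriv h x s) powr q) \<partial>?P)
        \<le> ennreal ?C * (\<integral>\<^sup>+e. ennreal (norm (h e) powr q) \<partial>circ)" .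
    qed (use q2 in auto)
  qed
qed

section \<open>Hardy and Fejer--Riesz inequalities\<close>

text \<open>Jensen's inequality with the weight \<open>w\<close> on \<open>{0<..<y}\<close>, then
  Tonelli's theorem. The powers of \<open>1 - x\<close> from the weight and from the outer integral
  combine to exactly \<open>q\<close>, whatever \<open>a\<close> is.\<close>

lemma Hardy_inequality:
  fixes v V :: "real \<Rightarrow> real"
  assumes q: "1 < q" and [measurable]: "v \<in> borel_measurable borel" and nn: "\<And>x. 0 \<le> v x" "\<And>y. 0 \<le> V y"
    and le: "\<And>y. 0 < y \<Longrightarrow> y < 1 \<Longrightarrow> ennreal (V y) \<le> (\<integral>\<^sup>+x. ennreal (v x) * indicator {0<..<y} x \<partial>lborel)"
  shows "(\<integral>\<^sup>+y. ennreal (V y powr q) \<partial>unit_interval)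
    \<le> ennreal (2 * (2 * (q - 1)) powr (q - 1)) * (\<integral>\<^sup>+x. ennreal (v x powr q * (1 - x) powr q) \<partial>unit_interval)"
proof -
  \<comment> \<open>The outer integral of \<open>(1 - y) powr (- a * (q - 1))\<close> up to 1
    converges when \<open>a * (q - 1) < 1\<close>; the value 1/2 is the simplest choice and produces
    the factor 2.\<close>
  define a where "a = 1 / (2 * (q - 1))"
  have a: "0 < a" "a * (q - 1) = 1 / 2" using q by (auto simp: a_def)
  define w where "w = (\<lambda>x::real. (1 - x) powr (- a - 1))"
  have [measurable]: "w \<in> borel_measurable borel" unfolding w_def by measurable
  let ?c = "a powr (1 - q)"
  have c: "?c = (2 * (q - 1)) powr (q - 1)"
    using q by (simp add: a_def powr_divide powr_diff powr_minus field_simps)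
  have pw: "ennreal (V y powr q) \<le> ennreal (?c * (1 - y) powr (- (1/2))) * (\<integral>\<^sup>+x. ennreal (v x powr q * w x powr (1 - q)) * indicator {0<..<y} x \<partial>lborel)"
    if y: "0 < y" "y < 1" for y
  proof -
    let ?N = "restrict_space lborel {0<..<y}"
    have sN: "space ?N = {0<..<y}" by (simp add: space_restrict_space)
    have N: "(\<integral>\<^sup>+x. f x \<partial>?N) = (\<integral>\<^sup>+x. f x * indicator {0<..<y} x \<partial>lborel)" for f :: "real \<Rightarrow> ennreal"
      by (subst nn_integral_restrict_space) auto
    have A: "(\<integral>\<^sup>+x. ennreal (w x) \<partial>?N) \<le> ennreal ((1 - y) powr (- a) / a)"
    proof -
      have "(\<integral>\<^sup>+x. ennreal (w x) \<partial>?N) \<le> (\<integral>\<^sup>+x. ennreal (w x) * indicator {0..y} x \<partial>lborel)"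
        unfolding N by (intro nn_integral_mono) (auto simp: indicator_def)
      also have "\<dots> = ennreal ((1 - y) powr (- a) / a - (1 - 0) powr (- a) / a)"
      proof (rule nn_integral_FTC_Icc[where F = "\<lambda>x. (1 - x) powr (- a) / a"])
        fix x assume x: "x \<in> {0..y}"
        then have x1: "0 < 1 - x" using y by auto
        have "((\<lambda>x. 1 - x) has_real_derivative - 1) (at x)" by (auto intro!: derivative_eq_intros)
        from DERIV_cdivide[OF DERIV_fun_powr[OF this x1, of "- a"], of a]
        show "((\<lambda>x. (1 - x) powr (- a) / a) has_real_derivative w x) (at x)"
          by (rule DERIV_cong) (use a in \<open>simp add: w_def\<close>)
        show "0 \<le> w x" by (simp add: w_def)
      qed (use y in auto)
      also have "\<dots> \<le> ennreal ((1 - y) powr (- a) / a)" using a by (intro ennreal_leI) auto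
      finally show ?thesis .
    qed
    have "ennreal (V y powr q) \<le> ennreal (((1 - y) powr (- a) / a) powr (q - 1)) * (\<integral>\<^sup>+x. ennreal (v x powr q * w x powr (1 - q)) \<partial>?N)"
    proof (rule nn_integral_Jensen_powr[OF q _ _ _ _ A])
      show "v \<in> borel_measurable ?N" "w \<in> borel_measurable ?N" by (rule measurable_restrict_space1, simp)+
      show "0 < w x" if "x \<in> space ?N" for x using that y by (auto simp: sN w_def)
      show "ennreal (V y) \<le> (\<integral>\<^sup>+x. ennreal (v x) \<partial>?N)" using le[OF y] by (simp add: N)
    qed (use a y nn in auto)
    also have "((1 - y) powr (- a) / a) powr (q - 1) = ?c * (1 - y) powr (- (1/2))"
    proof -
      have "((1 - y) powr (- a) / a) powr (q - 1) = (1 - y) powr (- (a * (q - 1))) / a powr (q - 1)"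
        by (simp add: powr_divide powr_powr)
      also have "\<dots> = (1 - y) powr (- (1/2)) * a powr (- (q - 1))" by (simp only: a(2) powr_minus divide_inverse)
      also have "- (q - 1) = 1 - q" by simp
      finally show ?thesis by (simp only: mult.commute)
    qed
    finally show ?thesis by (simp only: N)
  qed
  have "(\<integral>\<^sup>+y. ennreal (V y powr q) \<partial>unit_interval)
    \<le> (\<integral>\<^sup>+y. \<integral>\<^sup>+x. ennreal (?c * (1 - y) powr (- (1/2))) * (ennreal (v x powr q * w x powr (1 - q)) * indicator {0<..<y} x) * indicator {0<..<1} y \<partial>lborel \<partial>lborel)"
    unfolding nn_integral_unit_interval
  proof (intro nn_integral_mono)
    fix y :: real
    show "ennreal (V y powr q) * indicator {0<..<1} y \<le> (\<integral>\<^sup>+x. ennreal (?c * (1 - y) powr (- (1/2))) * (ennreal (v x powr q * w x powr (1 - q)) * indicator {0<..<y} x) * indicator {0<..<1} y \<partial>lborel)"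
    proof (cases "0 < y \<and> y < 1")
      case True
      then show ?thesis using pw[of y] by (simp add: nn_integral_cmult)
    qed (auto simp: indicator_def)
  qed
  also have "\<dots> = (\<integral>\<^sup>+x. \<integral>\<^sup>+y. ennreal (?c * (1 - y) powr (- (1/2))) * (ennreal (v x powr q * w x powr (1 - q)) * indicator {0<..<y} x) * indicator {0<..<1} y \<partial>lborel \<partial>lborel)"
    by (rule lborel_pair.Fubini') (simp add: indicator_def if_distrib cong: if_cong)
  also have "\<dots> \<le> (\<integral>\<^sup>+x. ennreal (2 * ?c) * (ennreal (v x powr q * (1 - x) powr q) * indicator {0<..<1} x) \<partial>lborel)"
  proof (intro nn_integral_mono)
    fix x :: real
    show "(\<integral>\<^sup>+y. ennreal (?c * (1 - y) powr (- (1/2))) * (ennreal (v x powr q * w x powr (1 - q)) * indicator {0<..<y} x) * indicator {0<..<1} y \<partial>lborel)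
      \<le> ennreal (2 * ?c) * (ennreal (v x powr q * (1 - x) powr q) * indicator {0<..<1} x)"
    proof (cases "0 < x \<and> x < 1")
      case True
      let ?z = "v x powr q * w x powr (1 - q)"
      have "(\<integral>\<^sup>+y. ennreal (?c * (1 - y) powr (- (1/2))) * (ennreal ?z * indicator {0<..<y} x) * indicator {0<..<1} y \<partial>lborel)
        = (\<integral>\<^sup>+y. ennreal (?c * ?z) * (ennreal ((1 - y) powr (1/2 - 1)) * indicator {x<..<1} y) \<partial>lborel)"
        using True by (intro nn_integral_cong) (auto simp: indicator_def ennreal_mult mult_ac)
      also have "\<dots> = ennreal (?c * ?z) * ennreal ((1 - x) powr (1/2) / (1/2))"
        using True nn_integral_one_minus_powr[of "1/2" x] by (subst nn_integral_cmult) auto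
      also have "\<dots> = ennreal (?c * ?z * ((1 - x) powr (1/2) / (1/2)))" by (intro ennreal_mult[symmetric]) auto
      also have "?c * ?z * ((1 - x) powr (1/2) / (1/2)) = 2 * ?c * (v x powr q * (1 - x) powr q)"
      proof -
        have "w x powr (1 - q) = (1 - x) powr ((q - 1) + a * (q - 1))"
          by (simp add: w_def powr_powr algebra_simps)
        then have "w x powr (1 - q) * (1 - x) powr (1/2) = (1 - x) powr q"
          unfolding a(2) by (simp add: powr_add[symmetric])
        then show ?thesis by (simp add: mult_ac)
      qed
      finally show ?thesis using True by (simp add: ennreal_mult)
    next
      case False
      then have "(\<integral>\<^sup>+y. ennreal (?c * (1 - y) powr (- (1/2))) * (ennreal (v x powr q * w x powr (1 - q)) * indicator {0<..<y} x) * indicator {0<..<1} y \<partial>lborel)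
        = (\<integral>\<^sup>+y. 0 \<partial>(lborel :: real measure))"
        by (intro nn_integral_cong) (auto simp: indicator_def)
      then show ?thesis by simp
    qed
  qed
  also have "\<dots> = ennreal (2 * ?c) * (\<integral>\<^sup>+x. ennreal (v x powr q * (1 - x) powr q) \<partial>unit_interval)"
    unfolding nn_integral_unit_interval by (rule nn_integral_cmult) measurable
  finally show ?thesis by (simp only: c)
qed

text \<open>Interpolation of a weak-type bound for the restriction to the radius. In Poisson's
  formula at \<open>t\<close> the part of \<open>F\<close> of size at most \<open>l / 2\<close>
  contributes at most \<open>l / 2\<close>, the rest at most \<open>2 / (1 - t) * J\<close>, where
  \<open>J\<close> is the mass of the large values. Hence a value above \<open>l\<close> forces
  \<open>1 - t \<le> 4 * J / l\<close>.\<close>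

lemma Fejer_Riesz_aux:
  assumes p: "1 < p" and [measurable]: "F \<in> borel_measurable borel" and hol: "F holomorphic_on ball 0 R" and R: "R > 1"
  shows "(\<integral>\<^sup>+t. ennreal (norm (F (of_real t)) powr p) \<partial>unit_interval) \<le> ennreal (4 * p * 2 powr (p - 1) / (p - 1)) * Lpow p F"
  unfolding Lpow_def
proof (rule Marcinkiewicz[OF sigma_finite_unit_interval sigma_finite_circ, where r = 1])
  show "(\<lambda>t. norm (F (of_real t))) \<in> borel_measurable unit_interval"
    by (rule measurable_unit_interval) measurable
  show "(\<lambda>e. norm (F e)) \<in> borel_measurable circ" by measurable
  fix l :: real assume l: "0 < l"
  let ?J = "\<integral>\<^sup>+e. ennreal (norm (F e)) * indicator {e. l < 2 * norm (F e)} e \<partial>circ"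
  show "emeasure unit_interval {t \<in> space unit_interval. l < norm (F (of_real t))}
      \<le> ennreal (4 * l powr (- 1)) * (\<integral>\<^sup>+e. ennreal (norm (F e) powr 1) * indicator {e. l < 2 * norm (F e)} e \<partial>circ)"
  proof (cases "?J = \<infinity>")
    case True
    then show ?thesis using l by (simp add: ennreal_mult_top)
  next
    case False
    then obtain J where J: "0 \<le> J" "?J = ennreal J" by (auto simp: less_top[symmetric] elim!: ennreal_cases[of ?J])
    have key: "1 - 4 * J / l \<le> t" if t: "0 < t" "t < 1" "l < norm (F (of_real t))" for t
    proof -
      have t2: "0 \<le> 1 - t\<^sup>2" using t by (simp add: power_le_one)
      let ?P = "\<lambda>e. (1 - t\<^sup>2) / (norm (e - of_real t))\<^sup>2"
      have P1: "(\<integral>\<^sup>+e. ennreal (?P e) \<partial>circ) = 1"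
        using nn_integral_Poisson_kernel[of "of_real t"] t by simp
      have "ennreal (norm (F (of_real t * 1))) \<le> (\<integral>\<^sup>+e. ennreal (norm (F (1 * e)) * ?P e) \<partial>circ)"
        by (rule Poisson_norm_bound[OF _ hol R]) (use t in auto)
      also have "\<dots> \<le> (\<integral>\<^sup>+e. ennreal (l / 2) * ennreal (?P e) + ennreal (2 / (1 - t)) * (ennreal (norm (F e)) * indicator {e. l < 2 * norm (F e)} e) \<partial>circ)"
      proof (rule nn_integral_circ_mono)
        fix e :: complex assume e: "norm e = 1"
        show "ennreal (norm (F (1 * e)) * ?P e) \<le> ennreal (l / 2) * ennreal (?P e) + ennreal (2 / (1 - t)) * (ennreal (norm (F e)) * indicator {e. l < 2 * norm (F e)} e)"
        proof (cases "l < 2 * norm (F e)")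
          case True
          have n: "1 - t \<le> norm (e - of_real t)" using norm_triangle_ineq2[of e "of_real t"] e t by simp
          have "?P e \<le> (2 * (1 - t)) / (1 - t)\<^sup>2"
          proof (rule frac_le)
            have "1 - t\<^sup>2 = (1 + t) * (1 - t)" by (simp add: power2_eq_square algebra_simps)
            also have "\<dots> \<le> 2 * (1 - t)" using t by (intro mult_right_mono) auto
            finally show "1 - t\<^sup>2 \<le> 2 * (1 - t)" .
            show "(1 - t)\<^sup>2 \<le> (norm (e - of_real t))\<^sup>2" using n t by (intro power_mono) auto
          qed (use t in auto)
          also have "\<dots> = 2 / (1 - t)"
            unfolding power2_eq_square by (rule nonzero_mult_divide_mult_cancel_right) (use t in simp)
          finally have "norm (F e) * ?P e \<le> norm (F e) * (2 / (1 - t))" by (intro mult_left_mono) auto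
          then have "ennreal (norm (F e) * ?P e) \<le> ennreal (2 / (1 - t)) * ennreal (norm (F e))"
            using t by (simp add: ennreal_mult[symmetric] ennreal_leI mult.commute)
          then show ?thesis using True by (simp add: add_increasing)
        next
          case False
          then have "norm (F e) * ?P e \<le> l / 2 * ?P e" using t2 by (intro mult_right_mono) auto
          then have "ennreal (norm (F e) * ?P e) \<le> ennreal (l / 2) * ennreal (?P e)"
            using l t2 by (simp add: ennreal_mult[symmetric] ennreal_leI)
          then show ?thesis using False by simp
        qed
      qed
      also have "\<dots> = ennreal (l / 2) * (\<integral>\<^sup>+e. ennreal (?P e) \<partial>circ) + ennreal (2 / (1 - t)) * ?J"
        by (simp add: nn_integral_add nn_integral_cmult)
      also have "\<dots> = ennreal (l / 2 + 2 / (1 - t) * J)"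
        using J l t unfolding P1 J(2) by (simp add: ennreal_mult[symmetric] ennreal_plus[symmetric] del: ennreal_plus)
      finally have le: "ennreal (norm (F (of_real t * 1))) \<le> ennreal (l / 2 + 2 / (1 - t) * J)" .
      have "0 \<le> l / 2 + 2 / (1 - t) * J" using J l t by simp
      with le have "norm (F (of_real t)) \<le> l / 2 + 2 / (1 - t) * J" by (simp only: ennreal_le_iff mult_1_right)
      then have "l / 2 < 2 / (1 - t) * J" using t by simp
      then have "l * (1 - t) < 4 * J" using t by (simp add: field_simps)
      then show ?thesis using l by (simp add: field_simps)
    qed
    have "emeasure unit_interval {t \<in> space unit_interval. l < norm (F (of_real t))} = emeasure lborel {t \<in> {0<..<1}. l < norm (F (of_real t))}"
      unfolding unit_interval_def by (subst emeasure_restrict_space) (auto simp: space_restrict_space)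
    \<comment> \<open>The superlevel set lies in one interval ending at 1, so no covering argument
      is involved.\<close>
    also have "\<dots> \<le> emeasure lborel {1 - 4 * J / l..1}"
      by (rule emeasure_mono) (use key in auto)
    also have "\<dots> = ennreal (4 * J / l)" using J l by simp
    also have "\<dots> = ennreal (4 * l powr (- 1)) * ennreal J"
      using J l by (simp add: ennreal_mult[symmetric] powr_minus divide_inverse mult_ac)
    finally show ?thesis using J by simp
  qed
qed (use p in auto)

text \<open>The preceding bound concerns functions holomorphic beyond the closed disc; it is applied
  to dilates, and Fatou's lemma gives the limit.\<close>

lemma Fejer_Riesz:
  assumes p: "1 < p" and F: "F holomorphic_on ball 0 1"
    and le: "\<And>r. 0 < r \<Longrightarrow> r < 1 \<Longrightarrow> Lpow p (\<lambda>z. F (of_real r * z)) \<le> ennreal B"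
  shows "(\<integral>\<^sup>+t. ennreal (norm (disc_ext F (of_real t)) powr p) \<partial>unit_interval) \<le> ennreal (4 * p * 2 powr (p - 1) / (p - 1)) * ennreal B"
proof -
  have cm[measurable]: "disc_ext F \<in> borel_measurable borel" by (rule disc_ext_measurable[OF F])
  define A where "A = (\<lambda>n::nat. 1 - 1 / (real n + 2))"
  have A: "0 < A n" "A n < 1" for n by (auto simp: A_def field_simps)
  have limA: "A \<longlonglongrightarrow> 1" unfolding A_def by real_asymp
  define u where "u = (\<lambda>n t. ennreal (norm (disc_ext F (of_real (A n) * of_real t)) powr p))"
  have "(\<integral>\<^sup>+t. ennreal (norm (disc_ext F (of_real t)) powr p) \<partial>unit_interval) = (\<integral>\<^sup>+t. liminf (\<lambda>n. u n t) \<partial>unit_interval)"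
  proof (intro nn_integral_cong)
    fix t assume "t \<in> space unit_interval"
    then have t: "0 < t" "t < 1" by auto
    have c: "isCont (disc_ext F) (of_real t)"
      using holomorphic_on_imp_continuous_on[OF disc_ext_holomorphic[OF F]] t by (auto simp: continuous_on_eq_continuous_at)
    have "(\<lambda>n. of_real (A n) * of_real t) \<longlonglongrightarrow> of_real 1 * complex_of_real t" by (intro tendsto_intros limA)
    then have "(\<lambda>n. disc_ext F (of_real (A n) * of_real t)) \<longlonglongrightarrow> disc_ext F (of_real t)"
      by (intro isCont_tendsto_compose[OF c]) simp
    then have "(\<lambda>n. u n t) \<longlonglongrightarrow> ennreal (norm (disc_ext F (of_real t)) powr p)"
      unfolding u_def using p by (intro tendsto_ennrealI tendsto_powr' tendsto_intros) auto
    from lim_imp_Liminf[OF _ this] show "ennreal (norm (disc_ext F (of_real t)) powr p) = liminf (\<lambda>n. u n t)" by simp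
  qed
  also have "\<dots> \<le> liminf (\<lambda>n. \<integral>\<^sup>+t. u n t \<partial>unit_interval)"
    by (rule nn_integral_liminf, rule measurable_unit_interval) (unfold u_def, measurable)
  also have "\<dots> \<le> limsup (\<lambda>n. \<integral>\<^sup>+t. u n t \<partial>unit_interval)" by (rule Liminf_le_Limsup) simp
  also have "\<dots> \<le> ennreal (4 * p * 2 powr (p - 1) / (p - 1)) * ennreal B"
  proof (rule Limsup_bounded, rule always_eventually, rule allI)
    fix n
    define G where "G = (\<lambda>z. disc_ext F (of_real (A n) * z))"
    have Gm: "G \<in> borel_measurable borel" unfolding G_def by measurable
    have hG: "G holomorphic_on ball 0 (1 / A n)"
      unfolding G_def by (rule dilate_holomorphic[OF disc_ext_holomorphic[OF F] A(1)])
    have R: "1 < 1 / A n" using A[of n] by simp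
    have "(\<integral>\<^sup>+t. u n t \<partial>unit_interval) \<le> ennreal (4 * p * 2 powr (p - 1) / (p - 1)) * Lpow p G"
      using Fejer_Riesz_aux[OF p Gm hG R] by (simp add: G_def u_def)
    also have "Lpow p G = Lpow p (\<lambda>z. F (of_real (A n) * z))"
      using A[of n] by (intro Lpow_cong) (simp add: G_def disc_ext_eq norm_mult)
    also have "ennreal (4 * p * 2 powr (p - 1) / (p - 1)) * \<dots> \<le> ennreal (4 * p * 2 powr (p - 1) / (p - 1)) * ennreal B"
      by (intro mult_left_mono le A) auto
    finally show "(\<integral>\<^sup>+t. u n t \<partial>unit_interval) \<le> ennreal (4 * p * 2 powr (p - 1) / (p - 1)) * ennreal B" .
  qed
  finally show ?thesis .
qed

section \<open>Sufficiency: duality\<close>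

lemma generalized_Hilbert_eq_unit_interval:
  assumes f: "f holomorphic_on ball 0 1" and g: "g holomorphic_on ball 0 1" and z: "norm z < 1"
  shows "generalized_Hilbert g f z = (LINT t|unit_interval. disc_ext f (of_real t) * disc_ext (deriv g) (of_real t * z))"
proof -
  have [measurable]: "disc_ext f \<in> borel_measurable borel" "disc_ext (deriv g) \<in> borel_measurable borel"
    by (intro disc_ext_measurable f g holomorphic_deriv open_ball)+
  let ?k = "\<lambda>t. disc_ext f (of_real t) * disc_ext (deriv g) (of_real t * z)"
  have "generalized_Hilbert g f z = (LINT t|lebesgue. indicator {0..<1} t *\<^sub>R ?k t)"
    unfolding generalized_Hilbert_def set_lebesgue_integral_def
  proof (intro Bochner_Integration.integral_cong refl)
    fix t :: real
    show "indicator {0..<1} t *\<^sub>R (f (of_real t) * deriv g (of_real t * z)) = indicator {0..<1} t *\<^sub>R ?k t"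
    proof (cases "t \<in> {0..<1}")
      case True
      have "norm (of_real t * z) < 1" by (rule norm_of_real_mult_less) (use True z in auto)
      then show ?thesis using True by (simp add: disc_ext_eq)
    qed simp
  qed
  also have "\<dots> = (LINT t|lborel. indicator {0..<1} t *\<^sub>R ?k t)"
    by (rule integral_completion) measurable
  also have "\<dots> = (LINT t|lborel. indicator {0<..<1} t *\<^sub>R ?k t)"
    by (rule integral_cong_AE, measurable) (rule AE_mp[OF AE_lborel_singleton[of 0]], auto simp: indicator_def)
  also have "\<dots> = (LINT t|unit_interval. ?k t)"
    unfolding unit_interval_def by (subst integral_restrict_space) auto
  finally show ?thesis .
qed

lemma integrable_unit_interval_of_powr:
  assumes p: "1 < p" and [measurable]: "\<phi> \<in> borel_measurable borel"
    and fin: "(\<integral>\<^sup>+t. ennreal (norm (\<phi> t) powr p) \<partial>unit_interval) < \<infinity>"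
  shows "integrable unit_interval (\<phi> :: real \<Rightarrow> complex)"
proof (rule integrableI_bounded)
  show "\<phi> \<in> borel_measurable unit_interval" by (rule measurable_unit_interval) measurable
  have [measurable]: "(\<lambda>t. norm (\<phi> t) powr p) \<in> borel_measurable unit_interval"
    by (rule measurable_unit_interval) measurable
  have "(\<integral>\<^sup>+t. ennreal (norm (\<phi> t)) \<partial>unit_interval) \<le> (\<integral>\<^sup>+t. 1 + ennreal (norm (\<phi> t) powr p) \<partial>unit_interval)"
  proof (intro nn_integral_mono)
    fix t
    have "norm (\<phi> t) \<le> 1 + norm (\<phi> t) powr p"
    proof (cases "norm (\<phi> t) \<le> 1")
      case False
      then have "norm (\<phi> t) powr 1 \<le> norm (\<phi> t) powr p" using p by (intro powr_mono) auto
      then show ?thesis using False by simp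
    qed (simp add: add_increasing2)
    then have "ennreal (norm (\<phi> t)) \<le> ennreal (1 + norm (\<phi> t) powr p)" by (rule ennreal_leI)
    then show "ennreal (norm (\<phi> t)) \<le> 1 + ennreal (norm (\<phi> t) powr p)" by simp
  qed
  also have "\<dots> = emeasure unit_interval (space unit_interval) + (\<integral>\<^sup>+t. ennreal (norm (\<phi> t) powr p) \<partial>unit_interval)"
    by (subst nn_integral_add) auto
  also have "\<dots> < \<infinity>"
    using fin unfolding unit_interval_def by (simp add: emeasure_restrict_space space_restrict_space)
  finally show "(\<integral>\<^sup>+t. ennreal (norm (\<phi> t)) \<partial>unit_interval) < \<infinity>" .
qed

text \<open>Termwise integration of the Taylor series of \<open>deriv g\<close> yields a power
  series whose coefficients are those of \<open>deriv g\<close> times the moments of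
  \<open>f\<close>; integrability of \<open>f\<close> on the radius bounds the moments.\<close>

lemma generalized_Hilbert_holomorphic:
  assumes f: "f holomorphic_on ball 0 1" and g: "g holomorphic_on ball 0 1"
    and int: "integrable unit_interval (\<lambda>t. disc_ext f (of_real t))"
  shows "generalized_Hilbert g f holomorphic_on ball 0 1"
proof -
  let ?\<phi> = "\<lambda>t. disc_ext f (of_real t)"
  have d: "deriv g holomorphic_on ball 0 1" by (intro holomorphic_deriv g open_ball)
  define c where "c = (\<lambda>n. (deriv ^^ n) (deriv g) 0 / fact n)"
  have ser: "(\<lambda>n. c n * w ^ n) sums deriv g w" if "norm w < 1" for w
    using holomorphic_power_series[OF d, of w] that by (simp add: c_def)
  have "(\<lambda>n. (c n * (LINT t|unit_interval. ?\<phi> t * of_real t ^ n)) * (z - 0) ^ n) sums generalized_Hilbert g f z"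
    if z: "z \<in> ball 0 1" for z
  proof -
    have z1: "norm z < 1" using z by simp
    \<comment> \<open>A point of the disc of larger norm than \<open>z\<close>: convergence there
      implies absolute convergence at \<open>z\<close>.\<close>
    define x where "x = complex_of_real ((1 + norm z) / 2)"
    have "norm x = (1 + norm z) / 2" unfolding x_def norm_of_real by simp
    then have x: "norm z < norm x" "norm x < 1" using z1 by auto
    have abs: "summable (\<lambda>n. norm (c n * z ^ n))"
      by (rule powser_insidea[OF sums_summable[OF ser[OF x(2)]] x(1)])
    let ?u = "\<lambda>n t. ?\<phi> t * (c n * (of_real t * z) ^ n)"
    have ubound: "norm (?u n t) \<le> norm (?\<phi> t) * norm (c n * z ^ n)" if "t \<in> {0<..<1}" for n t
    proof -
      have "norm ((of_real t * z) ^ n) = t ^ n * norm (z ^ n)" using that by (simp add: norm_mult norm_power power_mult_distrib)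
      also have "\<dots> \<le> 1 * norm (z ^ n)" using that by (intro mult_right_mono power_le_one) auto
      finally show ?thesis by (simp add: norm_mult mult_left_mono)
    qed
    have um: "(\<lambda>t. c n * (of_real t * z) ^ n) \<in> borel_measurable unit_interval" for n
      by (rule measurable_unit_interval) measurable
    have ui: "integrable unit_interval (?u n)" for n
    proof (rule Bochner_Integration.integrable_bound)
      show "integrable unit_interval (\<lambda>t. norm (?\<phi> t) * norm (c n * z ^ n))"
        using int by (intro integrable_mult_left integrable_norm)
      show "?u n \<in> borel_measurable unit_interval"
        by (intro borel_measurable_times borel_measurable_integrable[OF int] um)
      show "AE t in unit_interval. norm (?u n t) \<le> norm (norm (?\<phi> t) * norm (c n * z ^ n))"
        by (rule AE_I2) (use ubound in auto)
    qed
    have "(\<lambda>n. LINT t|unit_interval. ?u n t) sums (LINT t|unit_interval. (\<Sum>n. ?u n t))"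
    proof (rule sums_integral[OF ui])
      show "AE t in unit_interval. summable (\<lambda>n. norm (?u n t))"
      proof (rule AE_I2)
        fix t assume "t \<in> space unit_interval"
        then show "summable (\<lambda>n. norm (?u n t))"
          using ubound[of t] by (intro summable_comparison_test'[OF summable_mult[OF abs, of "norm (?\<phi> t)"]]) auto
      qed
      show "summable (\<lambda>n. LINT t|unit_interval. norm (?u n t))"
      proof (rule summable_comparison_test'[OF summable_mult[OF abs, of "LINT t|unit_interval. norm (?\<phi> t)"]])
        fix n
        have "(LINT t|unit_interval. norm (?u n t)) \<le> (LINT t|unit_interval. norm (?\<phi> t) * norm (c n * z ^ n))"
          using ubound int ui by (intro integral_mono integrable_norm integrable_mult_left) auto
        then show "norm (LINT t|unit_interval. norm (?u n t)) \<le> (LINT t|unit_interval. norm (?\<phi> t)) * norm (c n * z ^ n)"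
          by (simp add: Bochner_Integration.integral_nonneg)
      qed
    qed
    moreover have "(LINT t|unit_interval. ?u n t) = (c n * (LINT t|unit_interval. ?\<phi> t * of_real t ^ n)) * (z - 0) ^ n" for n
    proof -
      have "(LINT t|unit_interval. ?u n t) = (LINT t|unit_interval. (c n * z ^ n) * (?\<phi> t * of_real t ^ n))"
        by (intro Bochner_Integration.integral_cong refl) (simp add: power_mult_distrib mult_ac)
      then show ?thesis by (simp add: mult_ac)
    qed
    moreover have "(LINT t|unit_interval. (\<Sum>n. ?u n t)) = generalized_Hilbert g f z"
      unfolding generalized_Hilbert_eq_unit_interval[OF f g z1]
    proof (intro Bochner_Integration.integral_cong refl)
      fix t assume "t \<in> space unit_interval"
      then have tz: "norm (of_real t * z) < 1" using z1 by (intro norm_of_real_mult_less) auto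
      show "(\<Sum>n. ?u n t) = ?\<phi> t * disc_ext (deriv g) (of_real t * z)"
        unfolding disc_ext_eq[OF tz] by (rule sums_unique[symmetric], rule sums_mult, rule ser[OF tz])
    qed
    ultimately show ?thesis by simp
  qed
  then show ?thesis by (rule power_series_holomorphic)
qed

section \<open>The pairing of a holomorphic function with a function on the circle\<close>

lemma continuous_on_sphere_dilate:
  assumes "F holomorphic_on ball 0 1" "norm w < 1"
  shows "continuous_on (sphere 0 1) (\<lambda>e. disc_ext F (w * e))"
proof -
  have "continuous_on (ball 0 1) (disc_ext F)"
    by (rule holomorphic_on_imp_continuous_on[OF disc_ext_holomorphic[OF assms(1)]])
  then show ?thesis
    by (rule continuous_on_compose2) (use assms(2) in \<open>auto intro!: continuous_intros simp: norm_mult\<close>)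
qed

lemma circle_pairing_derivative:
  fixes w :: complex
  assumes d: "d holomorphic_on ball 0 1" and [measurable]: "h \<in> borel_measurable borel" and hc: "continuous_on (sphere 0 1) h"
    and \<rho>: "0 < \<rho>" "\<rho> < 1" and w: "norm w < 1"
  shows "((\<lambda>w. LINT e|circ. disc_ext d (w * of_real \<rho> * e) * h e) has_field_derivative
     (LINT e|circ. of_real \<rho> * e * disc_ext (deriv d) (w * of_real \<rho> * e) * h e)) (at w)"
proof -
  have d2: "deriv d holomorphic_on ball 0 1" by (intro holomorphic_deriv d open_ball)
  have [measurable]: "disc_ext d \<in> borel_measurable borel" "disc_ext (deriv d) \<in> borel_measurable borel"
    by (intro disc_ext_measurable d d2)+
  have in1: "norm (w * of_real \<rho> * cis t) < 1" if "norm w < 1" for w t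
  proof -
    have "norm w * \<rho> < 1 * 1" using that \<rho> by (intro mult_strict_mono) auto
    then show ?thesis using \<rho> by (simp add: norm_mult)
  qed
  have in2: "norm (w * of_real \<rho>) < 1" if "norm w < 1" for w :: complex using in1[OF that, of 0] by simp
  have hcis: "continuous_on A (\<lambda>t. h (cis t))" for A
    by (rule continuous_on_compose2[OF hc]) (auto intro!: continuous_intros)
  let ?F = "\<lambda>w t. d (w * of_real \<rho> * cis t) * h (cis t)"
  let ?F' = "\<lambda>w t. of_real \<rho> * cis t * deriv d (w * of_real \<rho> * cis t) * h (cis t)"
  have eqF: "integral (cbox 0 (2*pi)) (?F w) = of_real (2 * pi) * (LINT e|circ. disc_ext d (w * of_real \<rho> * e) * h e)" if "norm w < 1" for w
  proof -
    have "((\<lambda>t. disc_ext d (w * of_real \<rho> * cis t) * h (cis t)) has_integral of_real (2 * pi) * (LINT e|circ. disc_ext d (w * of_real \<rho> * e) * h e)) {0..2*pi}"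
      by (rule has_integral_circ) (measurable, intro continuous_intros hc continuous_on_sphere_dilate[OF d in2[OF that]])
    then show ?thesis using in1[OF that] by (simp add: disc_ext_eq integral_unique)
  qed
  have eqF': "integral (cbox 0 (2*pi)) (?F' w) = of_real (2 * pi) * (LINT e|circ. of_real \<rho> * e * disc_ext (deriv d) (w * of_real \<rho> * e) * h e)"
  proof -
    have "((\<lambda>t. of_real \<rho> * cis t * disc_ext (deriv d) (w * of_real \<rho> * cis t) * h (cis t)) has_integral of_real (2 * pi) * (LINT e|circ. of_real \<rho> * e * disc_ext (deriv d) (w * of_real \<rho> * e) * h e)) {0..2*pi}"
      by (rule has_integral_circ) (measurable, intro continuous_intros hc continuous_on_sphere_dilate[OF d2 in2[OF w]])
    then show ?thesis using in1[OF w] by (simp add: disc_ext_eq integral_unique)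
  qed
  have "((\<lambda>w. integral (cbox 0 (2*pi)) (?F w)) has_field_derivative integral (cbox 0 (2*pi)) (?F' w)) (at w within ball 0 1)"
  proof (rule leibniz_rule_field_derivative)
    fix x :: complex and t :: real assume x: "x \<in> ball 0 1"
    have "(d has_field_derivative deriv d (x * of_real \<rho> * cis t)) (at (x * of_real \<rho> * cis t))"
      using in1[of x t] x by (intro holomorphic_derivI[OF d]) auto
    moreover have "((\<lambda>x. x * of_real \<rho> * cis t) has_field_derivative of_real \<rho> * cis t) (at x within ball 0 1)"
      by (auto intro!: derivative_eq_intros)
    ultimately have "((\<lambda>x. d (x * of_real \<rho> * cis t)) has_field_derivative deriv d (x * of_real \<rho> * cis t) * (of_real \<rho> * cis t)) (at x within ball 0 1)"
      by (rule DERIV_chain2)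
    from DERIV_cmult_right[OF this, of "h (cis t)"]
    show "((\<lambda>x. ?F x t) has_field_derivative ?F' x t) (at x within ball 0 1)"
      by (rule DERIV_cong) (simp only: mult_ac)
  next
    fix x :: complex assume x: "x \<in> ball 0 1"
    have "continuous_on (cbox 0 (2*pi)) (?F x)"
      by (intro continuous_intros hcis continuous_on_compose2[OF holomorphic_on_imp_continuous_on[OF d]])
         (use in1[of x] x in auto)
    then show "?F x integrable_on cbox 0 (2*pi)" by (rule integrable_continuous)
  next
    show "continuous_on (ball 0 1 \<times> cbox 0 (2*pi)) (\<lambda>(x, t). ?F' x t)"
      unfolding split_beta
      by (intro continuous_intros continuous_on_compose2[OF hcis[of UNIV]] continuous_on_compose2[OF holomorphic_on_imp_continuous_on[OF d2]])
         (use in1 in auto)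
  qed (use w in auto)
  then have D: "((\<lambda>w. integral (cbox 0 (2*pi)) (?F w)) has_field_derivative integral (cbox 0 (2*pi)) (?F' w)) (at w)"
    using at_within_open[of w "ball 0 1"] w by (simp only: mem_ball dist_0_norm open_ball)
  have "((\<lambda>w. (1 / of_real (2 * pi)) * integral (cbox 0 (2*pi)) (?F w)) has_field_derivative (1 / of_real (2 * pi)) * integral (cbox 0 (2*pi)) (?F' w)) (at w)"
    by (rule DERIV_cmult[OF D])
  then have D': "((\<lambda>w. (1 / of_real (2 * pi)) * integral (cbox 0 (2*pi)) (?F w)) has_field_derivative
      (LINT e|circ. of_real \<rho> * e * disc_ext (deriv d) (w * of_real \<rho> * e) * h e)) (at w)"
    unfolding eqF' by simp
  have w': "w \<in> ball 0 1" using w by simp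
  show ?thesis
  proof (rule has_field_derivative_transform_within_open[OF D' open_ball w'])
    fix x :: complex assume "x \<in> ball 0 1"
    then show "(1 / of_real (2 * pi)) * integral (cbox 0 (2*pi)) (?F x) = (LINT e|circ. disc_ext d (x * of_real \<rho> * e) * h e)"
      by (subst eqF) auto
  qed
qed

lemma integrable_circ_pair_bounded:
  fixes f :: "complex \<times> complex \<Rightarrow> complex"
  assumes [measurable]: "f \<in> borel_measurable (circ \<Otimes>\<^sub>M circ)"
    and B: "\<And>e s. norm e = 1 \<Longrightarrow> norm s = 1 \<Longrightarrow> norm (f (e, s)) \<le> B"
  shows "integrable (circ \<Otimes>\<^sub>M circ) f"
proof -
  interpret C: sigma_finite_measure circ by (rule sigma_finite_circ)
  interpret CC: pair_sigma_finite circ circ ..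
  have "AE e in circ. AE s in circ. norm (f (e, s)) \<le> B"
    using AE_circ
  proof eventually_elim
    case (elim e)
    show ?case using AE_circ by eventually_elim (rule B[OF elim])
  qed
  then have ae: "AE y in circ \<Otimes>\<^sub>M circ. norm (f y) \<le> B"
    by (intro CC.AE_pair_measure) measurable
  have "emeasure (circ \<Otimes>\<^sub>M circ) (space circ \<times> space circ) = emeasure circ (space circ) * emeasure circ (space circ)"
    by (rule C.emeasure_pair_measure_Times) auto
  then have "finite_measure (circ \<Otimes>\<^sub>M circ)"
    by (intro finite_measureI) (simp add: space_pair_measure prob_space_circ)
  then show ?thesis by (rule finite_measure.integrable_const_bound[OF _ ae]) measurable
qed

text \<open>The dilation \<open>x\<^sup>2\<close> is split evenly between \<open>d\<close> and the kernel, so that both factors are evaluated at radius about \<open>x\<close> and the Hoelder inequality applies.\<close>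

lemma circle_pairing_kernel:
  assumes d: "d holomorphic_on ball 0 1" and [measurable]: "h \<in> borel_measurable borel" and m: "\<And>e. norm e = 1 \<Longrightarrow> norm (h e) \<le> m"
    and \<rho>: "0 < \<rho>" "\<rho> < 1" and x: "0 < x" "x < 1"
  shows "of_real x * (LINT e|circ. of_real \<rho> * e * disc_ext (deriv d) (of_real (x\<^sup>2) * of_real \<rho> * e) * h e)
    = (LINT s|circ. disc_ext d (of_real (\<rho> * x) * s) * cnj s * kernel_deriv h x s)"
proof -
  interpret C: sigma_finite_measure circ by (rule sigma_finite_circ)
  interpret CC: pair_sigma_finite circ circ ..
  have d2: "deriv d holomorphic_on ball 0 1" by (intro holomorphic_deriv d open_ball)
  have [measurable]: "disc_ext d \<in> borel_measurable borel" "disc_ext (deriv d) \<in> borel_measurable borel"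
    by (intro disc_ext_measurable d d2)+
  have rx: "0 < \<rho> * x" "\<rho> * x < 1" using \<rho> x mult_strict_mono[of \<rho> 1 x 1] by auto
  define k where "k = (\<lambda>z. disc_ext d (of_real (\<rho> * x) * z))"
  have km[measurable]: "k \<in> borel_measurable borel" unfolding k_def by measurable
  have hk: "k holomorphic_on ball 0 (1 / (\<rho> * x))"
    unfolding k_def by (rule dilate_holomorphic[OF disc_ext_holomorphic[OF d] rx(1)])
  have R: "1 < 1 / (\<rho> * x)" using rx by simp
  have kc: "continuous_on (sphere 0 1) k"
    unfolding k_def by (rule continuous_on_sphere_dilate[OF d], simp only: norm_of_real) (use rx in simp)
  obtain Mk where Mk: "\<And>s. norm s = 1 \<Longrightarrow> norm (k s) \<le> Mk"
  proof -
    have "compact (k ` sphere 0 1)" by (intro compact_continuous_image kc compact_sphere)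
    then obtain B where "\<forall>x\<in>k ` sphere 0 1. norm x \<le> B" using compact_imp_bounded bounded_iff by blast
    then show ?thesis using that[of B] by auto
  qed
  have m0: "0 \<le> m" by (rule order.trans[OF norm_ge_zero m[of 1]]) simp
  have Mk0: "0 \<le> Mk" by (rule order.trans[OF norm_ge_zero Mk[of 1]]) simp
  let ?H = "\<lambda>e s. (k s * cnj s) * (h e * e / (1 - of_real x * e * cnj s)\<^sup>2)"
  have int: "integrable (circ \<Otimes>\<^sub>M circ) (\<lambda>(e, s). ?H e s)"
  proof (rule integrable_circ_pair_bounded[where B = "Mk * (m / (1 - x)\<^sup>2)"])
    fix e s :: complex assume e: "norm e = 1" and s: "norm s = 1"
    have "norm (h e * e / (1 - of_real x * e * cnj s)\<^sup>2) \<le> m / (1 - x)\<^sup>2"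
      using m[OF e] m0 e kernel_denominator(1)[OF e s, of x] x
      by (simp add: norm_divide norm_mult norm_power) (intro frac_le power_mono, auto)
    then have "norm (k s * cnj s) * norm (h e * e / (1 - of_real x * e * cnj s)\<^sup>2) \<le> Mk * (m / (1 - x)\<^sup>2)"
      using Mk[OF s] s Mk0 by (intro mult_mono) (auto simp: norm_mult)
    then show "norm (case (e, s) of (e, s) \<Rightarrow> ?H e s) \<le> Mk * (m / (1 - x)\<^sup>2)" by (simp only: prod.case norm_mult)
  qed measurable
  \<comment> \<open>Cauchy's formula for the derivative of \<open>k\<close> at
    \<open>of_real x * e\<close>. The chain rule for the dilate \<open>k\<close> gives the factor
    \<open>\<rho> * x\<close>, whence the factor \<open>x\<close> on the left of the claim.\<close>
  have inner: "of_real (\<rho> * x) * disc_ext (deriv d) (of_real (x\<^sup>2) * of_real \<rho> * e) = (LINT s|circ. k s * cnj s / (1 - of_real x * e * cnj s)\<^sup>2)"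
    if e: "norm e = 1" for e
  proof -
    have xe: "norm (of_real x * e) < 1" using e x by (simp add: norm_mult)
    have arg: "of_real (\<rho> * x) * (of_real x * e) = of_real (x\<^sup>2) * of_real \<rho> * e" by (simp add: power2_eq_square mult_ac)
    have "norm (of_real (\<rho> * x) * (of_real x * e)) = (\<rho> * x) * x" using \<rho> x e by (simp add: norm_mult)
    also have "\<dots> < 1 * 1" using rx x by (intro mult_strict_mono) auto
    finally have n: "norm (of_real (\<rho> * x) * (of_real x * e)) < 1" by simp
    have "(LINT s|circ. k s * cnj s / (1 - of_real x * e * cnj s)\<^sup>2) = deriv k (of_real x * e)"
      by (rule Cauchy_deriv_circ[OF km hk R xe])
    also have "\<dots> = of_real (\<rho> * x) * deriv d (of_real (\<rho> * x) * (of_real x * e))"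
      unfolding k_def by (rule deriv_dilate[OF d n])
    also have "deriv d (of_real (\<rho> * x) * (of_real x * e)) = disc_ext (deriv d) (of_real (x\<^sup>2) * of_real \<rho> * e)"
      using n unfolding arg by (simp add: disc_ext_eq)
    finally show ?thesis ..
  qed
  have "of_real x * (LINT e|circ. of_real \<rho> * e * disc_ext (deriv d) (of_real (x\<^sup>2) * of_real \<rho> * e) * h e)
    = (LINT e|circ. (h e * e) * (of_real (\<rho> * x) * disc_ext (deriv d) (of_real (x\<^sup>2) * of_real \<rho> * e)))"
    by (subst integral_mult_right_zero[symmetric]) (simp add: mult_ac)
  also have "\<dots> = (LINT e|circ. (LINT s|circ. ?H e s))"
  proof (rule integral_circ_cong)
    fix e :: complex assume e: "norm e = 1"
    have "(h e * e) * (LINT s|circ. k s * cnj s / (1 - of_real x * e * cnj s)\<^sup>2) = (LINT s|circ. ?H e s)"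
      by (subst integral_mult_right_zero[symmetric]) (simp add: mult_ac)
    then show "(h e * e) * (of_real (\<rho> * x) * disc_ext (deriv d) (of_real (x\<^sup>2) * of_real \<rho> * e)) = (LINT s|circ. ?H e s)"
      using inner[OF e] by simp
  qed measurable
  also have "\<dots> = (LINT s|circ. (LINT e|circ. ?H e s))"
    by (rule CC.Fubini_integral[OF int, symmetric])
  also have "\<dots> = (LINT s|circ. disc_ext d (of_real (\<rho> * x) * s) * cnj s * kernel_deriv h x s)"
    unfolding kernel_deriv_def k_def by (intro Bochner_Integration.integral_cong refl integral_mult_right_zero)
  finally show ?thesis .
qed

text \<open>The substitution \<open>t = y\<^sup>2\<close> has Jacobian \<open>2 * y \<le> 2\<close>.
  It returns from the parametrisation by \<open>x\<^sup>2\<close> in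
  \<open>circle_pairing_kernel\<close> to the original radius.\<close>

lemma nn_integral_unit_interval_square:
  assumes [measurable]: "f \<in> borel_measurable borel" and nn: "\<And>t. 0 \<le> f t"
  shows "(\<integral>\<^sup>+t. ennreal (f t) \<partial>unit_interval) \<le> 2 * (\<integral>\<^sup>+y. ennreal (f (y\<^sup>2)) \<partial>unit_interval)"
proof -
  have Icc: "(\<integral>\<^sup>+t. g t * indicator {0..1} t \<partial>lborel) = (\<integral>\<^sup>+t. g t * indicator {0<..<1} t \<partial>lborel)" for g :: "real \<Rightarrow> ennreal"
  proof (rule nn_integral_cong_AE)
    have "AE x in lborel. x \<noteq> (0::real) \<and> x \<noteq> 1"
      using AE_lborel_singleton[of 0] AE_lborel_singleton[of 1] by eventually_elim auto
    then show "AE t in lborel. g t * indicator {0..1} t = g t * indicator {0<..<1} t"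
      by eventually_elim (auto simp: indicator_def)
  qed
  have "(\<integral>\<^sup>+t. ennreal (f t) \<partial>unit_interval) = (\<integral>\<^sup>+t. ennreal (f t) * indicator {0\<^sup>2..1\<^sup>2} t \<partial>lborel)"
    unfolding nn_integral_unit_interval by (simp add: Icc)
  also have "\<dots> = (\<integral>\<^sup>+t. ennreal (f t * indicator {0\<^sup>2..1\<^sup>2} t) \<partial>lborel)"
    by (intro nn_integral_cong) (auto simp: indicator_def)
  also have "\<dots> = (\<integral>\<^sup>+y. ennreal (f (y\<^sup>2) * (2 * y) * indicator {0..1} y) \<partial>lborel)"
    by (rule nn_integral_substitution[where g = "\<lambda>y. y\<^sup>2"])
       (auto intro!: derivative_eq_intros continuous_intros simp: set_borel_measurable_def)
  also have "\<dots> \<le> (\<integral>\<^sup>+y. 2 * (ennreal (f (y\<^sup>2)) * indicator {0..1} y) \<partial>lborel)"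
  proof (intro nn_integral_mono)
    fix y :: real
    show "ennreal (f (y\<^sup>2) * (2 * y) * indicator {0..1} y) \<le> 2 * (ennreal (f (y\<^sup>2)) * indicator {0..1} y)"
    proof (cases "y \<in> {0..1}")
      case True
      have "f (y\<^sup>2) * (2 * y) \<le> f (y\<^sup>2) * 2" using True nn by (intro mult_left_mono) auto
      then have "ennreal (f (y\<^sup>2) * (2 * y)) \<le> ennreal (2 * f (y\<^sup>2))" by (intro ennreal_leI) simp
      also have "\<dots> = ennreal 2 * ennreal (f (y\<^sup>2))" using nn by (intro ennreal_mult) auto
      finally show ?thesis using True by simp
    qed simp
  qed
  also have "\<dots> = 2 * (\<integral>\<^sup>+y. ennreal (f (y\<^sup>2)) * indicator {0..1} y \<partial>lborel)"
    by (rule nn_integral_cmult) measurable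
  finally show ?thesis unfolding nn_integral_unit_interval Icc .
qed

text \<open>Hoelder's inequality in \<open>circle_pairing_kernel\<close>: one factor is controlled
  by the growth of \<open>d\<close> at radius \<open>\<rho> * x \<le> x\<close>, the other by
  \<open>A\<close>.\<close>

lemma circle_pairing_derivative_bound:
  assumes pq: "1 < p" "1 < q" "1/p + 1/q = 1" and d: "d holomorphic_on ball 0 1" and K: "0 \<le> K"
    and gr: "\<And>r. 0 \<le> r \<Longrightarrow> r < 1 \<Longrightarrow> Lpow p (\<lambda>z. d (of_real r * z)) \<le> ennreal (K * (1 - r) powr (1 - p))"
    and hm[measurable]: "h \<in> borel_measurable borel" and m: "\<And>e. norm e = 1 \<Longrightarrow> norm (h e) \<le> m"
    and \<rho>: "0 < \<rho>" "\<rho> < 1" and x: "0 < x" "x < 1"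
    and A: "(\<integral>\<^sup>+s. ennreal (norm (kernel_deriv h x s) powr q) \<partial>circ) \<le> ennreal A" "0 \<le> A"
  shows "x * norm (LINT e|circ. of_real \<rho> * e * disc_ext (deriv d) (of_real (x\<^sup>2) * of_real \<rho> * e) * h e)
    \<le> (K * (1 - x) powr (1 - p)) powr (1/p) * A powr (1/q)"
proof -
  interpret C: sigma_finite_measure circ by (rule sigma_finite_circ)
  have dm[measurable]: "disc_ext d \<in> borel_measurable borel" by (rule disc_ext_measurable[OF d])
  have km[measurable]: "(\<lambda>s. kernel_deriv h x s) \<in> borel_measurable borel"
    unfolding kernel_deriv_def by measurable
  have rx: "0 < \<rho> * x" "\<rho> * x < 1" "\<rho> * x \<le> x" using \<rho> x mult_strict_mono[of \<rho> 1 x 1] by auto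
  let ?k = "\<lambda>s. disc_ext d (of_real (\<rho> * x) * s)"
  have kc: "continuous_on (sphere 0 1) ?k"
    by (rule continuous_on_sphere_dilate[OF d], simp only: norm_of_real) (use rx in simp)
  obtain Mk where Mk: "\<And>s. norm s = 1 \<Longrightarrow> norm (?k s) \<le> Mk"
  proof -
    have "compact (?k ` sphere 0 1)" by (intro compact_continuous_image kc compact_sphere)
    then obtain B where "\<forall>x\<in>?k ` sphere 0 1. norm x \<le> B" using compact_imp_bounded bounded_iff by blast
    then show ?thesis using that[of B] by auto
  qed
  have Mk0: "0 \<le> Mk" by (rule order.trans[OF norm_ge_zero Mk[of 1]]) simp
  have int: "integrable circ (\<lambda>s. ?k s * cnj s * kernel_deriv h x s)"
  proof (rule integrable_circ_bounded[where B = "Mk * (m / (1 - x))"])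
    fix s :: complex assume s: "norm s = 1"
    have "norm (kernel_deriv h x s) \<le> m / (1 - x)" by (rule kernel_deriv_bound[OF hm m s]) (use x in auto)
    then have "norm (?k s) * norm (kernel_deriv h x s) \<le> Mk * (m / (1 - x))"
      using Mk[OF s] Mk0 by (intro mult_mono) auto
    then show "norm (?k s * cnj s * kernel_deriv h x s) \<le> Mk * (m / (1 - x))" using s by (simp add: norm_mult)
  qed measurable
  have "ennreal (x * norm (LINT e|circ. of_real \<rho> * e * disc_ext (deriv d) (of_real (x\<^sup>2) * of_real \<rho> * e) * h e))
    = ennreal (norm (of_real x * (LINT e|circ. of_real \<rho> * e * disc_ext (deriv d) (of_real (x\<^sup>2) * of_real \<rho> * e) * h e)))"
    using x by (simp add: norm_mult)
  also have "\<dots> = ennreal (norm (LINT s|circ. ?k s * cnj s * kernel_deriv h x s))"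
    by (simp only: circle_pairing_kernel[OF d hm m \<rho> x])
  also have "\<dots> \<le> (\<integral>\<^sup>+s. norm (?k s * cnj s * kernel_deriv h x s) \<partial>circ)" by (rule integral_norm_bound_ennreal[OF int])
  also have "\<dots> = (\<integral>\<^sup>+s. ennreal (norm (?k s) * norm (kernel_deriv h x s)) \<partial>circ)"
    by (rule nn_integral_circ_cong) (simp add: norm_mult)
  also have "\<dots> \<le> ennreal ((K * (1 - x) powr (1 - p)) powr (1/p) * A powr (1/q))"
  proof (rule nn_integral_Holder[OF pq _ _ _ _ _ _ A])
    have n: "norm (complex_of_real (\<rho> * x) * s) < 1" if "norm s = 1" for s
      by (simp only: norm_mult norm_of_real that) (use rx in simp)
    have "(\<integral>\<^sup>+s. ennreal (norm (?k s) powr p) \<partial>circ) = Lpow p (\<lambda>s. d (of_real (\<rho> * x) * s))"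
      unfolding Lpow_def by (intro nn_integral_circ_cong) (simp only: disc_ext_eq[OF n])
    also have "\<dots> \<le> ennreal (K * (1 - \<rho> * x) powr (1 - p))" by (rule gr) (use rx in auto)
    also have "\<dots> \<le> ennreal (K * (1 - x) powr (1 - p))"
      using K rx x pq by (intro ennreal_leI mult_left_mono powr_mono2') auto
    finally show "(\<integral>\<^sup>+s. ennreal (norm (?k s) powr p) \<partial>circ) \<le> ennreal (K * (1 - x) powr (1 - p))" .
  qed (use K in auto)
  finally show ?thesis by (subst (asm) ennreal_le_iff) auto
qed

text \<open>Hardy's inequality is applied to the derivative of the pairing along
  \<open>x\<^sup>2\<close>. In the constant, 2 comes from the substitution of squares,
  \<open>2 powr q\<close> from separating the value at 0, the summand 1 from that value, and the
  inner \<open>2 powr q\<close> from the factor 2 in \<open>v\<close>.\<close>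

lemma circle_pairing_Lq:
  assumes pq: "1 < p" "1 < q" "1/p + 1/q = 1" and d: "d holomorphic_on ball 0 1" and K: "0 \<le> K"
    and gr: "\<And>r. 0 \<le> r \<Longrightarrow> r < 1 \<Longrightarrow> Lpow p (\<lambda>z. d (of_real r * z)) \<le> ennreal (K * (1 - r) powr (1 - p))"
    and hm[measurable]: "h \<in> borel_measurable borel" and hc: "continuous_on (sphere 0 1) h"
    and \<rho>: "0 < \<rho>" "\<rho> < 1"
    and C: "0 \<le> C" "(\<integral>\<^sup>+(s, x). ennreal ((1 - x) powr (q - 1) * norm (kernel_deriv h x s) powr q) \<partial>(circ \<Otimes>\<^sub>M unit_interval))
     \<le> ennreal C * Lpow q h"
    and H: "Lpow q h = ennreal H" "0 \<le> H"
  shows "(\<integral>\<^sup>+t. ennreal (norm (LINT e|circ. disc_ext d (of_real t * of_real \<rho> * e) * h e) powr q) \<partial>unit_interval)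
    \<le> ennreal (2 * 2 powr q * K powr (q/p) * (1 + 2 * (2 * (q - 1)) powr (q - 1) * 2 powr q * C) * H)"
proof -
  interpret Ci: sigma_finite_measure circ by (rule sigma_finite_circ)
  interpret U: sigma_finite_measure unit_interval by (rule sigma_finite_unit_interval)
  interpret CU: pair_sigma_finite circ unit_interval ..
  have dm[measurable]: "disc_ext d \<in> borel_measurable borel" by (rule disc_ext_measurable[OF d])
  obtain m where m: "\<And>e. norm e = 1 \<Longrightarrow> norm (h e) \<le> m"
  proof -
    have "compact (h ` sphere 0 1)" by (intro compact_continuous_image hc compact_sphere)
    then obtain B where "\<forall>x\<in>h ` sphere 0 1. norm x \<le> B" using compact_imp_bounded bounded_iff by blast
    then show ?thesis using that[of B] by auto
  qed
  \<comment> \<open>The reason why the exponents fit: the growth of \<open>d\<close> contributes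
    \<open>(1 - x) powr (- 1)\<close> to the q-th power, and the factor
    \<open>(1 - x) powr q\<close> of Hardy's inequality turns it into the weight
    \<open>(1 - x) powr (q - 1)\<close> of the Littlewood--Paley bound.\<close>
  have qp: "(1 - p) * (q / p) = - 1"
  proof -
    have *: "1 - 1/q = 1/p" using pq(3) by linarith
    have "q / p = q * (1 - 1/q)" unfolding * by simp
    also have "\<dots> = q - 1" using pq by (simp add: field_simps)
    finally have *: "q / p = q - 1" .
    have "q + p = p * q" using pq by (simp add: field_simps)
    then show ?thesis unfolding * by (simp add: algebra_simps)
  qed
  define G where "G = (\<lambda>w. LINT e|circ. disc_ext d (w * of_real \<rho> * e) * h e)"
  define D where "D = (\<lambda>w. LINT e|circ. of_real \<rho> * e * disc_ext (deriv d) (w * of_real \<rho> * e) * h e)"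
  have der: "(G has_field_derivative D w) (at w)" if "norm w < 1" for w
    unfolding G_def D_def by (rule circle_pairing_derivative[OF d hm hc \<rho> that])
  have G: "G holomorphic_on ball 0 1"
    unfolding holomorphic_on_open[OF open_ball] using der by (metis mem_ball_0)
  \<comment> \<open>\<open>D\<close> is the derivative of the holomorphic function \<open>G\<close>,
    which gives its continuity at once.\<close>
  have Dc: "continuous_on (ball 0 1) D"
  proof -
    have "deriv G holomorphic_on ball 0 1" by (intro holomorphic_deriv G open_ball)
    then have "continuous_on (ball 0 1) (deriv G)" by (rule holomorphic_on_imp_continuous_on)
    then show ?thesis by (rule continuous_on_eq) (use der in \<open>auto intro!: DERIV_imp_deriv\<close>)
  qed
  define J where "J = (\<lambda>x. \<integral>\<^sup>+s. ennreal (norm (kernel_deriv h x s) powr q) \<partial>circ)"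
  have Jm[measurable]: "J \<in> borel_measurable borel" unfolding J_def kernel_deriv_def by measurable
  have Jfin: "J x < \<infinity>" if x: "0 < x" "x < 1" for x
  proof -
    have "J x \<le> (\<integral>\<^sup>+s. ennreal ((m / (1 - x)) powr q) \<partial>circ)"
      unfolding J_def
    proof (rule nn_integral_circ_mono)
      fix s :: complex assume s: "norm s = 1"
      have "norm (kernel_deriv h x s) \<le> m / (1 - x)" by (rule kernel_deriv_bound[OF hm m s]) (use x in auto)
      then show "ennreal (norm (kernel_deriv h x s) powr q) \<le> ennreal ((m / (1 - x)) powr q)"
        using pq by (intro ennreal_leI powr_mono2) auto
    qed
    also have "\<dots> < \<infinity>" by (simp add: prob_space_circ)
    finally show ?thesis .
  qed
  define A where "A = (\<lambda>x. enn2real (J x))"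
  have Am[measurable]: "A \<in> borel_measurable borel" unfolding A_def by measurable
  have A0: "0 \<le> A x" for x by (simp add: A_def)
  have AJ: "ennreal (A x) = J x" if "0 < x" "x < 1" for x
    unfolding A_def using Jfin[OF that] by (simp add: less_top)
  \<comment> \<open>The factor 2 belongs to the derivative \<open>2 * x\<close> of
    \<open>x\<^sup>2\<close>; its \<open>x\<close> is the one in
    \<open>circle_pairing_derivative_bound\<close>.\<close>
  define v where "v = (\<lambda>x. if 0 < x \<and> x < 1 then 2 * ((K * (1 - x) powr (1 - p)) powr (1/p) * A x powr (1/q)) else 0)"
  have vm: "v \<in> borel_measurable borel" unfolding v_def by measurable
  have Db: "norm (of_real (2 * x) * D (of_real (x\<^sup>2))) \<le> v x" if x: "0 < x" "x < 1" for x
  proof -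
    have "x * norm (D (of_real (x\<^sup>2))) \<le> (K * (1 - x) powr (1 - p)) powr (1/p) * A x powr (1/q)"
      unfolding D_def by (rule circle_pairing_derivative_bound[OF pq d K gr hm m \<rho> x _ A0]) (simp_all add: AJ[OF x] J_def)
    then show ?thesis using x by (simp add: v_def norm_mult)
  qed
  \<comment> \<open>Hardy's inequality controls only the increment from 0; the value at 0 is treated
    separately in \<open>G0\<close>.\<close>
  define V where "V = (\<lambda>y. if 0 < y \<and> y < 1 then norm (G (of_real (y\<^sup>2)) - G 0) else 0)"
  have sq: "norm (complex_of_real (x\<^sup>2)) < 1" if "0 \<le> x" "x < 1" for x
    using that unfolding norm_of_real by (simp add: power_less_one_iff)
  have Vle: "ennreal (V y) \<le> (\<integral>\<^sup>+x. ennreal (v x) * indicator {0<..<y} x \<partial>lborel)" if y: "0 < y" "y < 1" for y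
  proof -
    have "ennreal (norm (G (of_real (y\<^sup>2)) - G (of_real (0\<^sup>2)))) \<le> (\<integral>\<^sup>+x. ennreal (norm (of_real (2 * x) * D (of_real (x\<^sup>2)))) * indicator {0..y} x \<partial>lborel)"
    proof (rule norm_diff_le_nn_integral[where F = "\<lambda>x. G (of_real (x\<^sup>2))" and F' = "\<lambda>x. of_real (2 * x) * D (of_real (x\<^sup>2))"])
      fix x assume x: "x \<in> {0..y}"
      have "(G has_field_derivative D ((of_real x)\<^sup>2)) (at ((of_real x)\<^sup>2))"
        using der sq[of x] x y by simp
      moreover have "((\<lambda>z::complex. z\<^sup>2) has_field_derivative of_real (2 * x)) (at (of_real x))"
        by (auto intro!: derivative_eq_intros)
      ultimately have "((\<lambda>z. G (z\<^sup>2)) has_field_derivative D ((of_real x)\<^sup>2) * of_real (2 * x)) (at (of_real x))"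
        by (rule DERIV_chain2)
      then have "((\<lambda>x. G ((of_real x)\<^sup>2)) has_vector_derivative D ((of_real x)\<^sup>2) * of_real (2 * x)) (at x within {0..y})"
        by (rule has_vector_derivative_real_field[THEN has_vector_derivative_at_within])
      then show "((\<lambda>x. G (of_real (x\<^sup>2))) has_vector_derivative of_real (2 * x) * D (of_real (x\<^sup>2))) (at x within {0..y})"
        by (simp add: mult.commute)
    next
      show "continuous_on {0..y} (\<lambda>x. of_real (2 * x) * D (of_real (x\<^sup>2)))"
        by (intro continuous_intros continuous_on_compose2[OF Dc]) (use sq y in auto)
    qed (use y in auto)
    also have "\<dots> \<le> (\<integral>\<^sup>+x. ennreal (v x) * indicator {0<..<y} x \<partial>lborel)"
    proof (rule nn_integral_mono_AE)
      have "AE x in lborel. x \<noteq> 0 \<and> x \<noteq> y"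
        using AE_lborel_singleton[of 0] AE_lborel_singleton[of y] by eventually_elim auto
      then show "AE x in lborel. ennreal (norm (of_real (2 * x) * D (of_real (x\<^sup>2)))) * indicator {0..y} x \<le> ennreal (v x) * indicator {0<..<y} x"
      proof eventually_elim
        case (elim x)
        show ?case
        proof (cases "0 < x \<and> x < y")
          case True
          then show ?thesis using Db[of x] y by (simp add: ennreal_leI)
        qed (use elim in \<open>auto simp: indicator_def\<close>)
      qed
    qed
    finally show ?thesis using y by (simp add: V_def)
  qed
  have Hardy: "(\<integral>\<^sup>+y. ennreal (V y powr q) \<partial>unit_interval)
    \<le> ennreal (2 * (2 * (q - 1)) powr (q - 1)) * (\<integral>\<^sup>+x. ennreal (v x powr q * (1 - x) powr q) \<partial>unit_interval)"
    by (rule Hardy_inequality[OF pq(2) vm _ _ Vle]) (auto simp: v_def V_def)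
  have vint: "(\<integral>\<^sup>+x. ennreal (v x powr q * (1 - x) powr q) \<partial>unit_interval) \<le> ennreal (2 powr q * K powr (q/p) * (C * H))"
  proof -
    have "(\<integral>\<^sup>+x. ennreal (v x powr q * (1 - x) powr q) \<partial>unit_interval)
      = (\<integral>\<^sup>+x. ennreal (2 powr q * K powr (q/p)) * (\<integral>\<^sup>+s. ennreal ((1 - x) powr (q - 1) * norm (kernel_deriv h x s) powr q) \<partial>circ) \<partial>unit_interval)"
    proof (intro nn_integral_cong)
      fix x assume "x \<in> space unit_interval"
      then have x: "0 < x" "x < 1" by auto
      have "v x powr q = 2 powr q * (K powr (q/p) * (1 - x) powr (- 1) * A x)"
        using x pq A0 K by (simp add: v_def powr_mult powr_powr qp[symmetric])
      then have "v x powr q * (1 - x) powr q = 2 powr q * K powr (q/p) * (((1 - x) powr (- 1) * (1 - x) powr q) * A x)"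
        by (simp only: mult_ac)
      also have "(1 - x) powr (- 1) * (1 - x) powr q = (1 - x) powr (q - 1)"
        by (simp only: powr_add[symmetric]) simp
      finally have "ennreal (v x powr q * (1 - x) powr q) = ennreal (2 powr q * K powr (q/p)) * ennreal ((1 - x) powr (q - 1) * A x)"
        using A0 by (simp only: ennreal_mult[symmetric] mult_nonneg_nonneg powr_ge_zero)
      also have "ennreal ((1 - x) powr (q - 1) * A x) = ennreal ((1 - x) powr (q - 1)) * J x"
        using A0 AJ[OF x] by (simp add: ennreal_mult)
      also have "\<dots> = (\<integral>\<^sup>+s. ennreal ((1 - x) powr (q - 1)) * ennreal (norm (kernel_deriv h x s) powr q) \<partial>circ)"
        unfolding J_def kernel_deriv_def by (rule nn_integral_cmult[symmetric]) measurable
      also have "\<dots> = (\<integral>\<^sup>+s. ennreal ((1 - x) powr (q - 1) * norm (kernel_deriv h x s) powr q) \<partial>circ)"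
        by (simp add: ennreal_mult)
      finally show "ennreal (v x powr q * (1 - x) powr q) = ennreal (2 powr q * K powr (q/p)) * (\<integral>\<^sup>+s. ennreal ((1 - x) powr (q - 1) * norm (kernel_deriv h x s) powr q) \<partial>circ)" .
    qed
    also have "\<dots> = ennreal (2 powr q * K powr (q/p)) * (\<integral>\<^sup>+x. \<integral>\<^sup>+s. ennreal ((1 - x) powr (q - 1) * norm (kernel_deriv h x s) powr q) \<partial>circ \<partial>unit_interval)"
      by (rule nn_integral_cmult, rule measurable_unit_interval) (unfold kernel_deriv_def, measurable)
    also have "(\<integral>\<^sup>+x. \<integral>\<^sup>+s. ennreal ((1 - x) powr (q - 1) * norm (kernel_deriv h x s) powr q) \<partial>circ \<partial>unit_interval)
      = (\<integral>\<^sup>+(s, x). ennreal ((1 - x) powr (q - 1) * norm (kernel_deriv h x s) powr q) \<partial>(circ \<Otimes>\<^sub>M unit_interval))"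
    proof -
      have "(\<lambda>(s, x). ennreal ((1 - x) powr (q - 1) * norm (kernel_deriv h x s) powr q)) \<in> borel_measurable (circ \<Otimes>\<^sub>M unit_interval)"
        by (rule measurable_pair_unit_interval) (unfold kernel_deriv_def split_beta, measurable)
      from CU.nn_integral_snd[OF this] show ?thesis by simp
    qed
    also have "ennreal (2 powr q * K powr (q/p)) * \<dots> \<le> ennreal (2 powr q * K powr (q/p)) * (ennreal C * ennreal H)"
      using C(2) unfolding H(1) by (rule mult_left_mono) simp
    also have "\<dots> = ennreal (2 powr q * K powr (q/p) * (C * H))"
      using C H by (simp only: ennreal_mult[symmetric] mult_nonneg_nonneg powr_ge_zero)
    finally show ?thesis .
  qed
  \<comment> \<open>At 0 the pairing factors into \<open>d 0\<close> and the mean of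
    \<open>h\<close>, bounded by the growth at radius 0 and by Jensen's inequality.\<close>
  have G0: "norm (G 0) powr q \<le> K powr (q/p) * H"
  proof -
    have "ennreal (norm (d 0) powr p) = Lpow p (\<lambda>z. d (of_real 0 * z))" by (simp add: Lpow_def prob_space_circ)
    also have "\<dots> \<le> ennreal (K * (1 - 0) powr (1 - p))" by (rule gr) auto
    finally have "norm (d 0) powr p \<le> K" using K by (simp add: ennreal_le_iff)
    then have "(norm (d 0) powr p) powr (q/p) \<le> K powr (q/p)" using pq by (intro powr_mono2) auto
    then have d0: "norm (d 0) powr q \<le> K powr (q/p)" using pq by (simp add: powr_powr)
    have ih: "integrable circ h" by (rule integrable_circ_bounded[OF hm m])
    have "ennreal (norm (LINT e|circ. h e)) \<le> (\<integral>\<^sup>+e. norm (h e) \<partial>circ)" by (rule integral_norm_bound_ennreal[OF ih])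
    also have "\<dots> \<le> ennreal (H powr (1/q))" by (rule L1_le_Lpow[OF pq(2) hm]) (use H in auto)
    finally have "norm (LINT e|circ. h e) \<le> H powr (1/q)" by (simp add: ennreal_le_iff)
    then have "norm (LINT e|circ. h e) powr q \<le> (H powr (1/q)) powr q" using pq by (intro powr_mono2) auto
    then have h0: "norm (LINT e|circ. h e) powr q \<le> H" using pq H by (simp add: powr_powr)
    have "G 0 = d 0 * (LINT e|circ. h e)" by (simp add: G_def disc_ext_def)
    then have "norm (G 0) powr q = norm (d 0) powr q * norm (LINT e|circ. h e) powr q" by (simp add: norm_mult powr_mult)
    also have "\<dots> \<le> K powr (q/p) * H" using d0 h0 by (intro mult_mono) auto
    finally show ?thesis .
  qed
  have Gm[measurable]: "(\<lambda>t. G (of_real t)) \<in> borel_measurable borel" unfolding G_def by measurable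
  have Vm: "(\<lambda>y. V y powr q) \<in> borel_measurable borel"
  proof -
    have "(\<lambda>y. G (of_real (y\<^sup>2))) \<in> borel_measurable borel" unfolding G_def by measurable
    then show ?thesis unfolding V_def by measurable
  qed
  have "(\<integral>\<^sup>+t. ennreal (norm (G (of_real t)) powr q) \<partial>unit_interval) \<le> 2 * (\<integral>\<^sup>+y. ennreal (norm (G (of_real (y\<^sup>2))) powr q) \<partial>unit_interval)"
    by (rule nn_integral_unit_interval_square) auto
  also have "\<dots> \<le> 2 * (\<integral>\<^sup>+y. ennreal (2 powr q) * (ennreal (norm (G 0) powr q) + ennreal (V y powr q)) \<partial>unit_interval)"
  proof (intro mult_left_mono nn_integral_mono)
    fix y assume "y \<in> space unit_interval"
    then have y: "0 < y" "y < 1" by auto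
    have "norm (G (of_real (y\<^sup>2))) \<le> norm (G 0) + V y"
      using norm_triangle_sub[of "G (of_real (y\<^sup>2))" "G 0"] y by (simp add: V_def)
    then have "norm (G (of_real (y\<^sup>2))) powr q \<le> (norm (G 0) + V y) powr q" using pq by (intro powr_mono2) auto
    also have "\<dots> \<le> 2 powr q * (norm (G 0) powr q + V y powr q)" using pq by (intro powr_add_le) (auto simp: V_def)
    finally show "ennreal (norm (G (of_real (y\<^sup>2))) powr q) \<le> ennreal (2 powr q) * (ennreal (norm (G 0) powr q) + ennreal (V y powr q))"
      by (simp add: ennreal_mult[symmetric] ennreal_plus[symmetric] ennreal_leI del: ennreal_plus)
  qed simp
  also have "(\<integral>\<^sup>+y. ennreal (2 powr q) * (ennreal (norm (G 0) powr q) + ennreal (V y powr q)) \<partial>unit_interval)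
    = ennreal (2 powr q) * (ennreal (norm (G 0) powr q) + (\<integral>\<^sup>+y. ennreal (V y powr q) \<partial>unit_interval))"
  proof -
    note measurable_unit_interval[OF Vm, measurable]
    have "emeasure unit_interval {0<..<1} = 1"
      unfolding unit_interval_def by (subst emeasure_restrict_space) auto
    then show ?thesis by (subst nn_integral_cmult, measurable, subst nn_integral_add) auto
  qed
  finally have fin: "(\<integral>\<^sup>+t. ennreal (norm (G (of_real t)) powr q) \<partial>unit_interval)
    \<le> 2 * (ennreal (2 powr q) * (ennreal (norm (G 0) powr q) + (\<integral>\<^sup>+y. ennreal (V y powr q) \<partial>unit_interval)))" .
  let ?c = "2 * (2 * (q - 1)) powr (q - 1)"
  have "(\<integral>\<^sup>+y. ennreal (V y powr q) \<partial>unit_interval) \<le> ennreal ?c * ennreal (2 powr q * K powr (q/p) * (C * H))"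
    by (rule order.trans[OF Hardy]) (intro mult_left_mono vint, simp)
  also have "\<dots> = ennreal (?c * (2 powr q * K powr (q/p) * (C * H)))"
    using C H by (intro ennreal_mult[symmetric]) auto
  finally have "ennreal (norm (G 0) powr q) + (\<integral>\<^sup>+y. ennreal (V y powr q) \<partial>unit_interval)
    \<le> ennreal (K powr (q/p) * H) + ennreal (?c * (2 powr q * K powr (q/p) * (C * H)))"
    by (intro add_mono ennreal_leI G0)
  also have "\<dots> = ennreal (K powr (q/p) * H + ?c * (2 powr q * K powr (q/p) * (C * H)))"
    using C H by (intro ennreal_plus[symmetric]) auto
  finally have "2 * (ennreal (2 powr q) * (ennreal (norm (G 0) powr q) + (\<integral>\<^sup>+y. ennreal (V y powr q) \<partial>unit_interval)))
    \<le> ennreal 2 * (ennreal (2 powr q) * ennreal (K powr (q/p) * H + ?c * (2 powr q * K powr (q/p) * (C * H))))"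
    by (intro mult_mono) auto
  also have "\<dots> = ennreal (2 * (2 powr q * (K powr (q/p) * H + ?c * (2 powr q * K powr (q/p) * (C * H)))))"
    using C H by (simp only: ennreal_mult[symmetric] mult_nonneg_nonneg add_nonneg_nonneg powr_ge_zero zero_le_numeral)
  also have "2 * (2 powr q * (K powr (q/p) * H + ?c * (2 powr q * K powr (q/p) * (C * H))))
    = 2 * 2 powr q * K powr (q/p) * (1 + ?c * 2 powr q * C) * H" by (simp only: algebra_simps)
  finally show ?thesis using order.trans[OF fin] by (simp only: G_def)
qed

text \<open>The extremal element for Hoelder's inequality at \<open>w\<close>: the product with
  \<open>w\<close> is \<open>norm w powr p\<close>, and for conjugate \<open>q\<close> the q-th
  power of its norm is \<open>norm w powr p\<close> again.\<close>

definition dual_value :: "real \<Rightarrow> complex \<Rightarrow> complex" where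
  "dual_value p w = cnj w * of_real (norm w powr (p - 2))"

lemma norm_dual_value: "norm (dual_value p w) = norm w powr (p - 1)"
proof (cases "w = 0")
  case False
  then have "norm w * norm w powr (p - 2) = norm w powr (1 + (p - 2))"
    by (simp only: powr_add powr_one norm_ge_zero)
  then show ?thesis by (simp add: dual_value_def norm_mult)
qed (simp add: dual_value_def)

lemma mult_dual_value: "w * dual_value p w = of_real (norm w powr p)"
proof (cases "w = 0")
  case False
  have "(norm w)\<^sup>2 * norm w powr (p - 2) = norm w powr 2 * norm w powr (p - 2)"
    using False by (simp add: powr_numeral)
  also have "\<dots> = norm w powr p" by (simp only: powr_add[symmetric]) simp
  finally have "(norm w)\<^sup>2 * norm w powr (p - 2) = norm w powr p" .
  moreover have "w * dual_value p w = of_real ((norm w)\<^sup>2 * norm w powr (p - 2))"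
    unfolding dual_value_def of_real_mult by (subst complex_norm_square) (simp only: mult.assoc)
  ultimately show ?thesis by simp
qed (simp add: dual_value_def)

text \<open>For \<open>p < 2\<close> the real factor blows up at 0, but the norm is
  \<open>norm w powr (p - 1)\<close>, which tends to 0 because \<open>p > 1\<close>.\<close>

lemma continuous_on_dual_value:
  assumes p: "1 < p"
  shows "continuous_on UNIV (dual_value p)"
proof (rule continuous_at_imp_continuous_on, rule ballI)
  fix w :: complex
  show "isCont (dual_value p) w"
  proof (cases "w = 0")
    case True
    have "((\<lambda>w::complex. norm w powr (p - 1)) \<longlongrightarrow> norm (0::complex) powr (p - 1)) (at 0)"
      using p by (intro tendsto_powr' tendsto_intros) auto
    then have "((\<lambda>w. norm (dual_value p w)) \<longlongrightarrow> 0) (at 0)" by (simp add: norm_dual_value)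
    then have "((\<lambda>w. dual_value p w) \<longlongrightarrow> 0) (at 0)" by (rule tendsto_norm_zero_cancel)
    moreover have "dual_value p 0 = 0" by (simp add: dual_value_def)
    ultimately show ?thesis using True by (simp add: isCont_def)
  next
    case False
    then show ?thesis unfolding dual_value_def by (intro continuous_intros) auto
  qed
qed

text \<open>The test function \<open>h\<close> is built from the image itself on the circle of
  radius \<rho>, so the pairing reproduces the p-th power mean \<open>A\<close> of the image. The
  estimate then bounds \<open>A\<close> by a multiple of \<open>A powr (1/q)\<close>, which can be
  cancelled since \<open>A\<close> is finite for \<rho> < 1.\<close>

lemma bounded_if_derivative_growth:
  assumes p: "1 < p" "p \<le> 2" and g: "g holomorphic_on ball 0 1" and gr: "derivative_growth p g"
  shows "bounded_on_hardy_space p (generalized_Hilbert g)"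
proof -
  interpret Ci: sigma_finite_measure circ by (rule sigma_finite_circ)
  interpret U: sigma_finite_measure unit_interval by (rule sigma_finite_unit_interval)
  interpret CU: pair_sigma_finite circ unit_interval ..
  define q where "q = p / (p - 1)"
  have pq: "1 < p" "1 < q" "1/p + 1/q = 1" using p by (auto simp: q_def field_simps)
  \<comment> \<open>The hypothesis \<open>p \<le> 2\<close> is spent here, to make the
    Littlewood--Paley bound available.\<close>
  have q2: "2 \<le> q" using p by (simp add: q_def field_simps)
  have pm1: "(p - 1) * q = p" using p by (simp add: q_def)
  from gr obtain K where K: "0 \<le> K" and Kg: "\<And>r. 0 \<le> r \<Longrightarrow> r < 1 \<Longrightarrow>
      Lpow p (\<lambda>z. deriv g (of_real r * z)) \<le> ennreal (K * (1 - r) powr (1 - p))"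
    unfolding derivative_growth_def by blast
  from kernel_deriv_Lq[OF q2] obtain C where C: "0 \<le> C" and CK: "\<And>h m. h \<in> borel_measurable borel \<Longrightarrow> (\<forall>e. norm e = 1 \<longrightarrow> norm (h e) \<le> m) \<Longrightarrow>
    (\<integral>\<^sup>+(s, x). ennreal ((1 - x) powr (q - 1) * norm (kernel_deriv h x s) powr q) \<partial>(circ \<Otimes>\<^sub>M unit_interval))
     \<le> ennreal C * (\<integral>\<^sup>+e. ennreal (norm (h e) powr q) \<partial>circ)" by blast
  define C1 where "C1 = 2 * 2 powr q * K powr (q/p) * (1 + 2 * (2 * (q - 1)) powr (q - 1) * 2 powr q * C)"
  have C1: "0 \<le> C1" using C by (simp add: C1_def)
  define C2 where "C2 = 4 * p * 2 powr (p - 1) / (p - 1)"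
  have C2: "0 \<le> C2" using p by (simp add: C2_def)
  have d: "deriv g holomorphic_on ball 0 1" by (intro holomorphic_deriv g open_ball)
  have dm[measurable]: "disc_ext (deriv g) \<in> borel_measurable borel" by (rule disc_ext_measurable[OF d])
  \<comment> \<open>The final bound is \<open>A \<le> C2 * B * C1 powr (p/q)\<close>, where
    \<open>B\<close> is the p-th power of the norm of \<open>f\<close>; \<open>L\<close> is the p-th
    root of the constant.\<close>
  define L where "L = (C2 * C1 powr (p/q)) powr (1/p)"
  show ?thesis unfolding bounded_on_hardy_space_def
  proof (intro exI[of _ L] ballI)
    fix f assume f: "f \<in> hardy_space p"
    have hf: "f holomorphic_on ball 0 1" using f by (simp add: hardy_space_def)
    have fm[measurable]: "disc_ext f \<in> borel_measurable borel" by (rule disc_ext_measurable[OF hf])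
    define B where "B = hardy_norm p f powr p"
    have B: "0 \<le> B" by (simp add: B_def)
    have fle: "Lpow p (\<lambda>z. f (of_real r * z)) \<le> ennreal B" if "0 < r" "r < 1" for r
      unfolding B_def by (rule Lpow_hardy[OF f that]) (use p in auto)
    let ?\<phi> = "\<lambda>t. disc_ext f (of_real t)"
    have "(\<integral>\<^sup>+t. ennreal (norm (?\<phi> t) powr p) \<partial>unit_interval) \<le> ennreal C2 * ennreal B"
      unfolding C2_def by (rule Fejer_Riesz[OF p(1) hf fle])
    also have "\<dots> = ennreal (C2 * B)" using C2 B by (rule ennreal_mult[symmetric])
    finally have FR: "(\<integral>\<^sup>+t. ennreal (norm (?\<phi> t) powr p) \<partial>unit_interval) \<le> ennreal (C2 * B)" .
    have \<phi>m: "?\<phi> \<in> borel_measurable borel" by measurable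
    have "(\<integral>\<^sup>+t. ennreal (norm (?\<phi> t) powr p) \<partial>unit_interval) < \<infinity>" using FR by (rule le_less_trans) simp
    then have \<phi>i: "integrable unit_interval ?\<phi>"
      by (rule integrable_unit_interval_of_powr[OF p(1) \<phi>m])
    let ?F = "generalized_Hilbert g f"
    have hF: "?F holomorphic_on ball 0 1" by (rule generalized_Hilbert_holomorphic[OF hf g \<phi>i])
    have Fm[measurable]: "disc_ext ?F \<in> borel_measurable borel" by (rule disc_ext_measurable[OF hF])
    have main: "Lpow p (\<lambda>z. ?F (of_real \<rho> * z)) \<le> ennreal ((L * hardy_norm p f) powr p)" if \<rho>: "0 < \<rho>" "\<rho> < 1" for \<rho>
    proof -
      have \<rho>n: "norm (complex_of_real \<rho>) < 1" using \<rho> by simp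
      define F1 where "F1 = (\<lambda>e. disc_ext ?F (of_real \<rho> * e))"
      have F1m[measurable]: "F1 \<in> borel_measurable borel" unfolding F1_def by measurable
      have F1c: "continuous_on (sphere 0 1) F1" unfolding F1_def by (rule continuous_on_sphere_dilate[OF hF \<rho>n])
      have F1F: "F1 e = ?F (of_real \<rho> * e)" if "norm e = 1" for e using that \<rho> by (simp add: F1_def disc_ext_eq norm_mult)
      define h where "h = (\<lambda>e. dual_value p (F1 e))"
      have dvm: "dual_value p \<in> borel_measurable borel"
        by (rule borel_measurable_continuous_onI[OF continuous_on_dual_value[OF p(1)]])
      have hm[measurable]: "h \<in> borel_measurable borel"
        unfolding h_def by (rule measurable_compose[OF F1m dvm])
      have hc: "continuous_on (sphere 0 1) h"
        unfolding h_def by (rule continuous_on_compose2[OF continuous_on_dual_value[OF p(1)] F1c]) auto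
      have hn: "norm (h e) powr q = norm (F1 e) powr p" for e
        by (simp add: h_def norm_dual_value powr_powr pm1)
      obtain m where m: "\<And>e. norm e = 1 \<Longrightarrow> norm (h e) \<le> m"
      proof -
        have "compact (h ` sphere 0 1)" by (intro compact_continuous_image hc compact_sphere)
        then obtain B where "\<forall>x\<in>h ` sphere 0 1. norm x \<le> B" using compact_imp_bounded bounded_iff by blast
        then show ?thesis using that[of B] by auto
      qed
      have m0: "0 \<le> m" by (rule order.trans[OF norm_ge_zero m[of 1]]) simp
      define A where "A = (LINT e|circ. norm (F1 e) powr p)"
      have Ai: "integrable circ (\<lambda>e. norm (F1 e) powr p)"
      proof (rule integrable_circ_continuous)
        show "continuous_on (sphere 0 1) (\<lambda>e. norm (F1 e) powr p)"
          using p by (intro continuous_on_powr' continuous_intros F1c) auto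
      qed measurable
      have A0: "0 \<le> A" unfolding A_def by (rule Bochner_Integration.integral_nonneg) simp
      have AL: "Lpow p F1 = ennreal A"
        unfolding Lpow_def A_def by (rule nn_integral_eq_integral[OF Ai]) simp
      have hq: "Lpow q h = ennreal A" using AL by (simp add: Lpow_def hn)
      define G where "G = (\<lambda>t::real. LINT e|circ. disc_ext (deriv g) (of_real t * of_real \<rho> * e) * h e)"
      have Gm: "G \<in> borel_measurable borel" unfolding G_def by measurable
      have Gq: "(\<integral>\<^sup>+t. ennreal (norm (G t) powr q) \<partial>unit_interval) \<le> ennreal (C1 * A)"
        unfolding G_def C1_def
        by (rule circle_pairing_Lq[OF pq d K Kg hm hc \<rho> C _ hq A0])
           (use CK[OF hm, of m] m in \<open>auto simp: Lpow_def\<close>)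
      obtain Md where Md: "\<And>z. norm z \<le> \<rho> \<Longrightarrow> norm (disc_ext (deriv g) z) \<le> Md"
      proof -
        have "continuous_on (cball 0 \<rho>) (disc_ext (deriv g))"
          by (rule continuous_on_subset[OF holomorphic_on_imp_continuous_on[OF disc_ext_holomorphic[OF d]]]) (use \<rho> in auto)
        then have "compact (disc_ext (deriv g) ` cball 0 \<rho>)" by (rule compact_continuous_image[OF _ compact_cball])
        then obtain B where "\<forall>x\<in>disc_ext (deriv g) ` cball 0 \<rho>. norm x \<le> B" using compact_imp_bounded bounded_iff by blast
        then show ?thesis using that[of B] by auto
      qed
      have Md0: "0 \<le> Md" by (rule order.trans[OF norm_ge_zero Md[of 0]]) (use \<rho> in simp)
      \<comment> \<open>On the disc of radius \<rho> the factor \<open>deriv g\<close> is bounded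
        and so is \<open>h\<close> on the circle; the integrability of \<open>f\<close> on the
        radius therefore suffices for Fubini's theorem.\<close>
      let ?H = "\<lambda>e t. ?\<phi> t * disc_ext (deriv g) (of_real t * of_real \<rho> * e) * h e"
      have Hm: "(\<lambda>y. ?H (fst y) (snd y)) \<in> borel_measurable (circ \<Otimes>\<^sub>M unit_interval)"
        by (rule measurable_pair_unit_interval) measurable
      have Hi: "integrable (circ \<Otimes>\<^sub>M unit_interval) (\<lambda>(e, t). ?H e t)"
      proof (rule integrableI_bounded)
        show "(\<lambda>(e, t). ?H e t) \<in> borel_measurable (circ \<Otimes>\<^sub>M unit_interval)" using Hm by (simp add: case_prod_unfold)
        have [measurable]: "(\<lambda>t. norm (?\<phi> t)) \<in> borel_measurable unit_interval" by (rule measurable_unit_interval) measurable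
        have "(\<integral>\<^sup>+y. ennreal (norm (case y of (e, t) \<Rightarrow> ?H e t)) \<partial>(circ \<Otimes>\<^sub>M unit_interval))
          = (\<integral>\<^sup>+e. \<integral>\<^sup>+t. ennreal (norm (?H e t)) \<partial>unit_interval \<partial>circ)"
          using Hm by (subst U.nn_integral_fst[symmetric]) (auto simp: case_prod_unfold)
        also have "\<dots> \<le> (\<integral>\<^sup>+e. \<integral>\<^sup>+t. ennreal (Md * m) * ennreal (norm (?\<phi> t)) \<partial>unit_interval \<partial>circ)"
        proof (rule nn_integral_circ_mono, rule nn_integral_mono)
          fix e :: complex and t assume e: "norm e = 1" and "t \<in> space unit_interval"
          then have t: "0 < t" "t < 1" by auto
          have "norm (of_real t * of_real \<rho> * e) \<le> \<rho>" using t \<rho> e by (simp add: norm_mult mult_left_le_one_le)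
          then have "norm (disc_ext (deriv g) (of_real t * of_real \<rho> * e)) * norm (h e) \<le> Md * m"
            using Md m[OF e] Md0 by (intro mult_mono) auto
          then have "norm (?\<phi> t) * (norm (disc_ext (deriv g) (of_real t * of_real \<rho> * e)) * norm (h e)) \<le> norm (?\<phi> t) * (Md * m)"
            by (intro mult_left_mono) auto
          then have "norm (?H e t) \<le> Md * m * norm (?\<phi> t)" by (simp only: norm_mult mult_ac)
          then show "ennreal (norm (?H e t)) \<le> ennreal (Md * m) * ennreal (norm (?\<phi> t))"
            using Md0 m0 by (simp add: ennreal_mult[symmetric] ennreal_leI)
        qed
        also have "\<dots> = ennreal (Md * m) * (\<integral>\<^sup>+t. ennreal (norm (?\<phi> t)) \<partial>unit_interval)"
          by (subst nn_integral_cmult) (auto simp: prob_space_circ)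
        also have "\<dots> < \<infinity>" using \<phi>i by (simp add: integrable_iff_bounded ennreal_mult_less_top)
        finally show "(\<integral>\<^sup>+y. ennreal (norm (case y of (e, t) \<Rightarrow> ?H e t)) \<partial>(circ \<Otimes>\<^sub>M unit_interval)) < \<infinity>" .
      qed
      have "complex_of_real A = (LINT e|circ. complex_of_real (norm (F1 e) powr p))"
        unfolding A_def by (rule integral_complex_of_real[symmetric])
      also have "\<dots> = (LINT e|circ. (LINT t|unit_interval. ?H e t))"
      proof (rule integral_circ_cong)
        fix e :: complex assume e: "norm e = 1"
        have n: "norm (of_real \<rho> * e) < 1" using e \<rho> by (simp add: norm_mult)
        have F1i: "F1 e = (LINT t|unit_interval. ?\<phi> t * disc_ext (deriv g) (of_real t * (of_real \<rho> * e)))"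
          unfolding F1F[OF e] by (rule generalized_Hilbert_eq_unit_interval[OF hf g n])
        have Fh: "complex_of_real (norm (F1 e) powr p) = F1 e * h e" unfolding h_def by (rule mult_dual_value[symmetric])
        have "F1 e * h e = (LINT t|unit_interval. ?\<phi> t * disc_ext (deriv g) (of_real t * (of_real \<rho> * e))) * h e"
          by (rule arg_cong[OF F1i, where f = "\<lambda>a. a * h e"])
        also have "\<dots> = (LINT t|unit_interval. ?\<phi> t * disc_ext (deriv g) (of_real t * (of_real \<rho> * e)) * h e)"
          by (rule integral_mult_left_zero[symmetric])
        finally show "complex_of_real (norm (F1 e) powr p) = (LINT t|unit_interval. ?H e t)"
          unfolding Fh by (simp only: mult.assoc)
      next
        show "(\<lambda>e. LINT t|unit_interval. ?H e t) \<in> borel_measurable borel"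
          using U.borel_measurable_lebesgue_integral[of "\<lambda>e t. ?H e t" circ] Hm by (simp add: case_prod_unfold)
      qed measurable
      also have "\<dots> = (LINT t|unit_interval. (LINT e|circ. ?H e t))"
        by (rule CU.Fubini_integral[OF Hi, symmetric])
      also have "\<dots> = (LINT t|unit_interval. ?\<phi> t * G t)"
        unfolding G_def mult.assoc[of "?\<phi> _" "disc_ext (deriv g) _" "h _"]
        by (intro Bochner_Integration.integral_cong refl integral_mult_right_zero)
      finally have AG: "complex_of_real A = (LINT t|unit_interval. ?\<phi> t * G t)" .
      have "ennreal A = ennreal (norm (complex_of_real A))" using A0 by simp
      also have "\<dots> \<le> (\<integral>\<^sup>+t. ennreal (norm (?\<phi> t) * norm (G t)) \<partial>unit_interval)"
      \<comment> \<open>If the product were not integrable, its integral would be the default value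
        0, hence \<open>A = 0\<close>, and the bound would be trivial.\<close>
      proof (cases "integrable unit_interval (\<lambda>t. ?\<phi> t * G t)")
        case True
        from integral_norm_bound_ennreal[OF True] show ?thesis unfolding AG by (simp add: norm_mult)
      qed (simp add: AG not_integrable_integral_eq)
      also have "\<dots> \<le> ennreal ((C2 * B) powr (1/p) * (C1 * A) powr (1/q))"
      proof (rule nn_integral_Holder[OF pq _ _ _ _ FR _ Gq])
        show "(\<lambda>t. norm (?\<phi> t)) \<in> borel_measurable unit_interval" by (rule measurable_unit_interval) measurable
        show "(\<lambda>t. norm (G t)) \<in> borel_measurable unit_interval" using Gm by (intro measurable_unit_interval) measurable
      qed (use B C1 C2 A0 in auto)
      finally have Ale: "A \<le> (C2 * B) powr (1/p) * (C1 * A) powr (1/q)" by (subst (asm) ennreal_le_iff) auto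
      have "A \<le> C2 * B * C1 powr (p/q)"
      proof (cases "A = 0")
        case True
        then show ?thesis using C2 B by simp
      next
        case False
        then have Ap: "0 < A" using A0 by simp
        \<comment> \<open>Writing \<open>A\<close> in this way lets the common factor
          \<open>A powr (1/q)\<close> be cancelled.\<close>
        have "A powr (1/p) * A powr (1/q) = A" using pq(3) Ap by (simp add: powr_add[symmetric])
        with Ale have "A powr (1/p) * A powr (1/q) \<le> ((C2 * B) powr (1/p) * C1 powr (1/q)) * A powr (1/q)"
          by (simp add: powr_mult mult.assoc)
        then have "A powr (1/p) \<le> (C2 * B) powr (1/p) * C1 powr (1/q)"
          by (rule mult_right_le_imp_le) (use Ap in simp)
        then have "(A powr (1/p)) powr p \<le> ((C2 * B) powr (1/p) * C1 powr (1/q)) powr p" using p by (intro powr_mono2) auto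
        then show ?thesis using p Ap C2 B by (simp add: powr_powr powr_mult)
      qed
      also have "C2 * B * C1 powr (p/q) = (L * hardy_norm p f) powr p"
        using p C2 by (simp add: L_def B_def powr_mult powr_powr mult_ac)
      finally have "A \<le> (L * hardy_norm p f) powr p" .
      moreover have "Lpow p (\<lambda>z. ?F (of_real \<rho> * z)) = Lpow p F1" by (rule Lpow_cong) (simp add: F1F)
      ultimately show ?thesis using AL by (simp add: ennreal_leI)
    qed
    have L0: "0 \<le> L * hardy_norm p f" using hardy_norm_nonneg[OF f] by (simp add: L_def)
    show "?F \<in> hardy_space p \<and> hardy_norm p ?F \<le> L * hardy_norm p f"
      using hardyI[OF hF _ L0 main] p by auto
  qed
qed

theorem theorem1:
  fixes p :: real and g :: "complex \<Rightarrow> complex"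
  assumes "1 < p" and "p \<le> 2" and "g holomorphic_on ball 0 1"
  shows "bounded_on_hardy_space p (generalized_Hilbert g) \<longleftrightarrow> g \<in> mean_Lipschitz p (1 / p)"
  using assms derivative_growth_if_bounded bounded_if_derivative_growth
    derivative_growth_if_mean_Lipschitz mean_Lipschitz_if_derivative_growth
  by blast

end
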